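(* Let $(M^4,J_1)$ be a complex surface with a holomorphic $(2,0)$-form $\omega_2+i\omega_3$ (with $\omega_2,\omega_3$ real and $\omega_2(\cdot,\cdot)=\omega_3(J_1\cdot,\cdot)$). Let $A\neq 0$ be an integer, $c\in\mathbb{R}$, and let $I_s^+\subset\mathbb{R}^+$ be an open interval with $(s+c)/A>0$ for all $s\in I_s^+$. Let $\tilde\omega_1=\tilde\omega_1(s)$, $s\in I^+_s$, be a smooth $1$-parameter family of Kähler forms on $(M^4,J_1)$ and $u=u(s)$, $s\in I_s^+$, a smooth $1$-parameter family of positive functions on $M^4$, such that for all $s\in I_s^+$ $$\tfrac12 u\,(\omega_2+i\omega_3)\wedge(\omega_2-i\omega_3)=A^{-1}s(s+c)\,\tilde\omega_1\wedge\tilde\omega_1,\qquad d_Md_M^cu=A^2\frac{\partial^2}{\partial s^2}(\tilde\omega_1).$$ Let $N^8$ be the total space of the $\mathbb{T}^3$-bundle over $M^4\times I_s^+$ with connection $1$-forms $(\alpha,\xi,\eta)$ whose curvatures (assumed to define integral classes) are $$d\xi=-\omega_2,\qquad d\eta=-A\,\omega_3,\qquad d\alpha=-A^{-1}d_M^cu\wedge ds+A\frac{\partial}{\partial s}(\tilde\omega_1),$$ and let $L^7$ be the total space of the $\mathbb{T}^2$-bundle over $M^4\times I_s^+$ with connection forms $(\alpha,\xi)$. Then $$\varphi=\xi\wedge\Big(\tilde\omega_1+\frac1A\,ds\wedge\alpha\Big)+\Big(\frac{s+c}{A}\Big)\omega_2\wedge\alpha+\frac{u(s+c)}{A^2}\,\omega_3\wedge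 ds$$ is a closed $G_2$-structure on $L^7$, and the $4$-form $$\Phi=\eta\wedge\varphi+s^{4/3}*_\varphi\varphi$$ defines a torsion free $Spin(7)$-structure on $N^8$, whose induced metric is $$g_\Phi=s^{-2}\eta^2+\frac{A^2}{(s+c)^2}\xi^2+\frac{s(s+c)}{A\,u}\alpha^2+\frac{s(s+c)u}{A^3}ds^2+\frac{s(s+c)}{A}g_{\tilde\omega_1}.$$
   Context: Conventions. For an (almost) complex structure $J$ and a $1$-form $\beta$, $J\beta(\cdot):=\beta(J\cdot)$. $d_M$ is the exterior differential on $M^4$ and $d_M^c:=J_1\circ d_M$. The metric of a Kähler form $\tilde\omega_1$ is $g_{\tilde\omega_1}(\cdot,\cdot)=\tilde\omega_1(\cdot,J_1\cdot)$. A $Spin(7)$-structure on an 8-manifold is a $4$-form $\Phi$ pointwise linearly equivalent to $\Phi_0=dx_{0123}+dx_{0145}+dx_{0167}+dx_{0246}-dx_{0257}-dx_{0347}-dx_{0356}+dx_{2345}+dx_{2367}+dx_{4567}-dx_{1247}-dx_{1256}-dx_{1346}+dx_{1357}$ on $\mathbb{R}^8$; it induces a metric $g_\Phi$ and is torsion free iff $d\Phi=0$. A $G_2$-structure on a 7-manifold is a $3$-form $\varphi$ pointwise linearly equivalent to $\varphi_0=\partial_{x_0}\lrcorner\,\Phi_0$ on $\mathbb{R}^7$; it induces a metric $g_\varphi$, an orientation and a Hodge star $*_\varphi$. It is called closed (calibrated) if $d\varphi=0$. Integrality convention: "a closed $2$-form $F$ defines an integral class" means (ignoring factors of $2\pi$)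 that there is a principal circle bundle carrying a connection $1$-form (normalised to take value $1$ on the generator of the circle action) with curvature $F$; this is always so locally. Forms on the base are identified with their pullbacks. *)

theory Defs
  imports "HOL-Analysis.Analysis" "HOL-Library.Function_Algebras"
begin

instantiation "fun" :: (type, real_vector) real_vector
begin

definition scaleR_fun :: "real \<Rightarrow> ('a \<Rightarrow> 'b) \<Rightarrow> 'a \<Rightarrow> 'b" where
  "scaleR_fun r f = (\<lambda>x. r *\<^sub>R f x)"

instance
  by standard (simp_all add: scaleR_fun_def fun_eq_iff scaleR_add_right scaleR_add_left)

end

lemma scaleR_fun_apply [simp]: "(r *\<^sub>R f) x = r *\<^sub>R f x"
  by (simp add: scaleR_fun_def)


section \<open>Smooth manifolds\<close>

primrec Ck_on :: "nat \<Rightarrow> 'a::real_normed_vector set \<Rightarrow> ('a \<Rightarrow> 'b::real_normed_vector) \<Rightarrow> bool" where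
  "Ck_on 0 S f \<longleftrightarrow> continuous_on S f"
| "Ck_on (Suc k) S f \<longleftrightarrow> (\<forall>x\<in>S. f differentiable (at x)) \<and>
     (\<forall>w. Ck_on k S (\<lambda>x. frechet_derivative f (at x) w))"

text \<open>Intended for open sets \<open>S\<close> only.\<close>
definition smooth_on :: "'a::real_normed_vector set \<Rightarrow> ('a \<Rightarrow> 'b::real_normed_vector) \<Rightarrow> bool" where
  "smooth_on S f \<longleftrightarrow> (\<forall>k. Ck_on k S f)"

type_synonym ('a, 'e) chart = "'a set \<times> ('a \<Rightarrow> 'e)"

abbreviation chart_inv :: "('a, 'e) chart \<Rightarrow> 'e \<Rightarrow> 'a" where
  "chart_inv c \<equiv> inv_into (fst c) (snd c)"

definition points :: "('a, 'e) chart set \<Rightarrow> 'a set" where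
  "points A = (\<Union>c\<in>A. fst c)"

definition charts_at :: "('a, 'e) chart set \<Rightarrow> 'a \<Rightarrow> ('a, 'e) chart set" where
  "charts_at A p = {c \<in> A. p \<in> fst c}"

definition transition :: "('a, 'e) chart \<Rightarrow> ('a, 'e) chart \<Rightarrow> 'e \<Rightarrow> 'e" where
  "transition c c' = snd c' \<circ> chart_inv c"

text \<open>A smooth manifold of dimension \<open>DIM('e)\<close> is given by an atlas on an open subset \<open>points A\<close>
  of a topological space; the Hausdorff and second countability axioms are the class constraints
  on the type of points.\<close>
definition smooth_atlas ::
    "('a::{t2_space,second_countable_topology}, 'e::euclidean_space) chart set \<Rightarrow> bool" where
  "smooth_atlas A \<longleftrightarrow>
     (\<forall>c\<in>A. open (fst c) \<and> open (snd c ` fst c) \<and>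
        (\<exists>g. homeomorphism (fst c) (snd c ` fst c) (snd c) g)) \<and>
     (\<forall>c\<in>A. \<forall>c'\<in>A. smooth_on (snd c ` (fst c \<inter> fst c')) (transition c c'))"

definition open_atlas :: "'e set \<Rightarrow> ('e, 'e) chart set" where
  "open_atlas S = {(S, \<lambda>x. x)}"

definition prod_atlas ::
    "('a, 'e) chart set \<Rightarrow> ('b, 'f) chart set \<Rightarrow> ('a \<times> 'b, 'e \<times> 'f) chart set" where
  "prod_atlas A B = {(fst c \<times> fst d, map_prod (snd c) (snd d)) | c d. c \<in> A \<and> d \<in> B}"

definition restrict_atlas :: "'a set \<Rightarrow> ('a, 'e) chart set \<Rightarrow> ('a, 'e) chart set" where
  "restrict_atlas W A = (\<lambda>c. (fst c \<inter> W, snd c)) ` A"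

definition smooth_map ::
    "('a::topological_space, 'e::real_normed_vector) chart set \<Rightarrow>
     ('b::topological_space, 'f::real_normed_vector) chart set \<Rightarrow> ('a \<Rightarrow> 'b) \<Rightarrow> bool" where
  "smooth_map A B f \<longleftrightarrow> f ` points A \<subseteq> points B \<and> continuous_on (points A) f \<and>
     (\<forall>c\<in>A. \<forall>d\<in>B. smooth_on (snd c ` (fst c \<inter> f -` fst d)) (snd d \<circ> f \<circ> chart_inv c))"


section \<open>Tangent vectors\<close>

text \<open>A tangent vector at \<open>p\<close> is the family of its components in all charts around \<open>p\<close>, related by
  the derivatives of the transition maps, and extended by 0 to the other charts.\<close>
type_synonym ('a, 'e) tangent = "('a, 'e) chart \<Rightarrow> 'e"

definition tangent_space ::
    "('a, 'e::real_normed_vector) chart set \<Rightarrow> 'a \<Rightarrow> ('a, 'e) tangent set" where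
  "tangent_space A p = {v.
     (\<forall>c. c \<notin> charts_at A p \<longrightarrow> v c = 0) \<and>
     (\<forall>c\<in>charts_at A p. \<forall>c'\<in>charts_at A p.
        v c' = frechet_derivative (transition c c') (at (snd c p)) (v c))}"

text \<open>The tangent vector at \<open>p\<close> with component \<open>w\<close> in the chart \<open>c\<close>.\<close>
definition tangent_of ::
    "('a, 'e::real_normed_vector) chart set \<Rightarrow> ('a, 'e) chart \<Rightarrow> 'a \<Rightarrow> 'e \<Rightarrow> ('a, 'e) tangent" where
  "tangent_of A c p w =
     (\<lambda>c'. if c' \<in> charts_at A p then frechet_derivative (transition c c') (at (snd c p)) w else 0)"

definition some_chart :: "('a, 'e) chart set \<Rightarrow> 'a \<Rightarrow> ('a, 'e) chart" where
  "some_chart A p = (SOME c. c \<in> charts_at A p)"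

text \<open>Differential at \<open>p\<close> of a smooth map; by the chain rule it does not depend on the chart used.\<close>
definition dmap ::
    "('a, 'e::real_normed_vector) chart set \<Rightarrow> ('b, 'f::real_normed_vector) chart set \<Rightarrow>
     ('a \<Rightarrow> 'b) \<Rightarrow> 'a \<Rightarrow> ('a, 'e) tangent \<Rightarrow> ('b, 'f) tangent" where
  "dmap A B f p v = (let c = some_chart A p in
     (\<lambda>d. if d \<in> charts_at B (f p)
          then frechet_derivative (snd d \<circ> f \<circ> chart_inv c) (at (snd c p)) (v c) else 0))"

definition velocity ::
    "('a, 'e::real_normed_vector) chart set \<Rightarrow> (real \<Rightarrow> 'a) \<Rightarrow> real \<Rightarrow> ('a, 'e) tangent" where
  "velocity A \<gamma> t =
     (\<lambda>c. if c \<in> charts_at A (\<gamma> t) then vector_derivative (snd c \<circ> \<gamma>) (at t) else 0)"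


section \<open>Differential forms\<close>

text \<open>Alternating \<open>k\<close>-linear maps take a sequence of vectors, of which only the first \<open>k\<close> matter.\<close>
definition alternating_form :: "'t::real_vector set \<Rightarrow> nat \<Rightarrow> ((nat \<Rightarrow> 't) \<Rightarrow> real) \<Rightarrow> bool" where
  "alternating_form T k a \<longleftrightarrow>
     (\<forall>v v'. (\<forall>i<k. v i = v' i) \<longrightarrow> a v = a v') \<and>
     (\<forall>v x y. (\<forall>i. v i \<in> T) \<longrightarrow> x \<in> T \<longrightarrow> y \<in> T \<longrightarrow>
        (\<forall>i<k. a (v(i := x + y)) = a (v(i := x)) + a (v(i := y)))) \<and>
     (\<forall>v x r. (\<forall>i. v i \<in> T) \<longrightarrow> x \<in> T \<longrightarrow> (\<forall>i<k. a (v(i := r *\<^sub>R x)) = r * a (v(i := x)))) \<and>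
     (\<forall>v. (\<forall>i. v i \<in> T) \<longrightarrow> (\<forall>i<k. \<forall>j<k. i \<noteq> j \<longrightarrow> v i = v j \<longrightarrow> a v = 0))"

text \<open>Normalisation: \<open>(\<alpha> \<and> \<beta>)(v, w) = \<alpha>(v) \<beta>(w) - \<alpha>(w) \<beta>(v)\<close> for 1-forms.\<close>
definition alt_wedge ::
    "nat \<Rightarrow> nat \<Rightarrow> ((nat \<Rightarrow> 't) \<Rightarrow> 'v::real_normed_field) \<Rightarrow> ((nat \<Rightarrow> 't) \<Rightarrow> 'v) \<Rightarrow> (nat \<Rightarrow> 't) \<Rightarrow> 'v" where
  "alt_wedge k l a b v =
     (\<Sum>\<sigma> | \<sigma> permutes {..<k + l}. of_int (sign \<sigma>) * a (\<lambda>j. v (\<sigma> j)) * b (\<lambda>j. v (\<sigma> (k + j))))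
       / (fact k * fact l)"

type_synonym ('a, 'e, 'v) form = "'a \<Rightarrow> (nat \<Rightarrow> ('a, 'e) tangent) \<Rightarrow> 'v"

definition wedge ::
    "('a, 'e, 'v::real_normed_field) form \<Rightarrow> nat \<Rightarrow> nat \<Rightarrow> ('a, 'e, 'v) form \<Rightarrow> ('a, 'e, 'v) form"
    ("(_ \<and>\<^bsub>_,_\<^esub> _)" [75, 0, 0, 76] 75) where
  "\<alpha> \<and>\<^bsub>k,l\<^esub> \<beta> = (\<lambda>p. alt_wedge k l (\<alpha> p) (\<beta> p))"

definition fmult :: "('a \<Rightarrow> real) \<Rightarrow> ('a, 'e, 'v::real_vector) form \<Rightarrow> ('a, 'e, 'v) form"
    (infixr "\<cdot>" 77) where
  "f \<cdot> \<omega> = (\<lambda>p v. f p *\<^sub>R \<omega> p v)"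

definition complex_form :: "('a, 'e, real) form \<Rightarrow> ('a, 'e, real) form \<Rightarrow> ('a, 'e, complex) form" where
  "complex_form \<alpha> \<beta> = (\<lambda>p v. Complex (\<alpha> p v) (\<beta> p v))"

definition form_eq ::
    "('a, 'e::real_normed_vector) chart set \<Rightarrow> ('a, 'e, 'v) form \<Rightarrow> ('a, 'e, 'v) form \<Rightarrow> bool" where
  "form_eq A \<alpha> \<beta> \<longleftrightarrow>
     (\<forall>p\<in>points A. \<forall>v. (\<forall>i. v i \<in> tangent_space A p) \<longrightarrow> \<alpha> p v = \<beta> p v)"

definition smooth_form ::
    "('a, 'e::real_normed_vector) chart set \<Rightarrow> nat \<Rightarrow> ('a, 'e, real) form \<Rightarrow> bool" where
  "smooth_form A k \<omega> \<longleftrightarrow>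
     (\<forall>p\<in>points A. alternating_form (tangent_space A p) k (\<omega> p)) \<and>
     (\<forall>c\<in>A. \<forall>w. smooth_on (snd c ` fst c)
        (\<lambda>x. \<omega> (chart_inv c x) (\<lambda>i. tangent_of A c (chart_inv c x) (w i))))"

definition pullback ::
    "('a, 'e::real_normed_vector) chart set \<Rightarrow> ('b, 'f::real_normed_vector) chart set \<Rightarrow>
     ('a \<Rightarrow> 'b) \<Rightarrow> ('b, 'f, 'v) form \<Rightarrow> ('a, 'e, 'v) form" where
  "pullback A B f \<omega> = (\<lambda>p v. \<omega> (f p) (\<lambda>i. dmap A B f p (v i)))"

text \<open>Exterior derivative of a \<open>k\<close>-form: in a chart,
  \<open>d\<omega>(v\<^sub>0,\<dots>,v\<^sub>k) = (\<Sum>i\<le>k. (-1)^i D(\<omega>(v\<^sub>0,\<dots>,v\<^sub>k without v\<^sub>i))(v\<^sub>i))\<close>, where the \<open>v\<^sub>j\<close>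
  are extended to vector fields with constant components.\<close>
definition ext_d ::
    "('a, 'e::real_normed_vector) chart set \<Rightarrow> nat \<Rightarrow> ('a, 'e, real) form \<Rightarrow> ('a, 'e, real) form" where
  "ext_d A k \<omega> = (\<lambda>p v. let c = some_chart A p in
     \<Sum>i\<le>k. (-1) ^ i *
       frechet_derivative
         (\<lambda>x. \<omega> (chart_inv c x)
            (\<lambda>j. tangent_of A c (chart_inv c x) (v (if j < i then j else Suc j) c)))
         (at (snd c p)) (v i c))"

definition closed_form ::
    "('a, 'e::real_normed_vector) chart set \<Rightarrow> nat \<Rightarrow> ('a, 'e, real) form \<Rightarrow> bool" where
  "closed_form A k \<omega> \<longleftrightarrow> form_eq A (ext_d A k \<omega>) 0"

definition fun_form :: "('a \<Rightarrow> real) \<Rightarrow> ('a, 'e, real) form" where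
  "fun_form f = (\<lambda>p _. f p)"

definition vec2 :: "'t \<Rightarrow> 't \<Rightarrow> nat \<Rightarrow> 't" where
  "vec2 v w = (\<lambda>i. if i = 0 then v else w)"


section \<open>Complex surfaces\<close>

definition holomorphic_fun :: "(complex ^ 2) set \<Rightarrow> (complex ^ 2 \<Rightarrow> complex) \<Rightarrow> bool" where
  "holomorphic_fun S h \<longleftrightarrow>
     (\<forall>z\<in>S. \<exists>D. (h has_derivative D) (at z) \<and> (\<forall>w. D (\<i> *s w) = \<i> * D w))"

definition holomorphic_map :: "(complex ^ 2) set \<Rightarrow> (complex ^ 2 \<Rightarrow> complex ^ 2) \<Rightarrow> bool" where
  "holomorphic_map S h \<longleftrightarrow>
     (\<forall>z\<in>S. \<exists>D. (h has_derivative D) (at z) \<and> (\<forall>w. D (\<i> *s w) = \<i> *s D w))"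

definition complex_surface ::
    "('a::{t2_space,second_countable_topology}, complex ^ 2) chart set \<Rightarrow> bool" where
  "complex_surface M \<longleftrightarrow> smooth_atlas M \<and>
     (\<forall>c\<in>M. \<forall>c'\<in>M. holomorphic_map (snd c ` (fst c \<inter> fst c')) (transition c c'))"

text \<open>The complex structure: multiplication by \<open>\<i>\<close> in every holomorphic chart.\<close>
definition J :: "('a, complex ^ 2) tangent \<Rightarrow> ('a, complex ^ 2) tangent" where
  "J v = (\<lambda>c. \<i> *s v c)"

definition J_form :: "('a, complex ^ 2, real) form \<Rightarrow> ('a, complex ^ 2, real) form" where
  "J_form \<beta> = (\<lambda>p v. \<beta> p (\<lambda>i. J (v i)))"

definition dc :: "('a, complex ^ 2) chart set \<Rightarrow> ('a \<Rightarrow> real) \<Rightarrow> ('a, complex ^ 2, real) form" where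
  "dc M f = J_form (ext_d M 0 (fun_form f))"

text \<open>\<open>\<Omega> = h dz\<^sub>1 \<and> dz\<^sub>2\<close> with \<open>h\<close> holomorphic in every holomorphic chart.\<close>
definition holomorphic_2_0_form ::
    "('a, complex ^ 2) chart set \<Rightarrow> ('a, complex ^ 2, complex) form \<Rightarrow> bool" where
  "holomorphic_2_0_form M \<Omega> \<longleftrightarrow>
     (\<forall>c\<in>M. \<exists>h. holomorphic_fun (snd c ` fst c) h \<and>
        (\<forall>z\<in>snd c ` fst c. \<forall>w. \<Omega> (chart_inv c z) (\<lambda>i. tangent_of M c (chart_inv c z) (w i)) =
           h z * (w 0 $ 1 * w 1 $ 2 - w 0 $ 2 * w 1 $ 1)))"

definition kaehler_form ::
    "('a, complex ^ 2) chart set \<Rightarrow> ('a, complex ^ 2, real) form \<Rightarrow> bool" where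
  "kaehler_form M \<omega> \<longleftrightarrow> smooth_form M 2 \<omega> \<and> closed_form M 2 \<omega> \<and>
     (\<forall>p\<in>points M. \<forall>v\<in>tangent_space M p. \<forall>w\<in>tangent_space M p.
        \<omega> p (vec2 (J v) (J w)) = \<omega> p (vec2 v w)) \<and>
     (\<forall>p\<in>points M. \<forall>v\<in>tangent_space M p. v \<noteq> 0 \<longrightarrow> \<omega> p (vec2 v (J v)) > 0)"

definition kaehler_metric ::
    "('a, complex ^ 2, real) form \<Rightarrow> 'a \<Rightarrow> ('a, complex ^ 2) tangent \<Rightarrow> ('a, complex ^ 2) tangent \<Rightarrow> real" where
  "kaehler_metric \<omega> p v w = \<omega> p (vec2 v (J w))"


section \<open>One-parameter families\<close>

text \<open>A family \<open>\<omega>(s)\<close>, \<open>s \<in> I\<close>, of forms on \<open>M\<close> regarded as a form on \<open>M \<times> I\<close>; the family is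
  smooth iff this form is.\<close>
definition family_form ::
    "('a, 'e::real_normed_vector) chart set \<Rightarrow> real set \<Rightarrow> (real \<Rightarrow> ('a, 'e, 'v) form) \<Rightarrow>
     ('a \<times> real, 'e \<times> real, 'v) form" where
  "family_form M I \<omega> =
     (\<lambda>x v. \<omega> (snd x) (fst x) (\<lambda>i. dmap (prod_atlas M (open_atlas I)) M fst x (v i)))"

definition family_deriv :: "(real \<Rightarrow> ('a, 'e, real) form) \<Rightarrow> real \<Rightarrow> ('a, 'e, real) form" where
  "family_deriv \<omega> = (\<lambda>s p v. deriv (\<lambda>t. \<omega> t p v) s)"


section \<open>Principal torus bundles\<close>

text \<open>An action of the torus \<open>\<real>\<^sup>k / (2 \<pi> \<int>)\<^sup>k\<close> is written as an action of \<open>\<real>\<^sup>k\<close>. The third condition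
  says that it is a torus action and free, the fourth that the fibres are the orbits. The local
  sections in the last one are equivalent to local trivialisations
  \<open>W \<times> \<real>\<^sup>k / (2 \<pi> \<int>)\<^sup>k \<rightarrow> \<pi>\<^sup>-\<^sup>1(W)\<close>, \<open>(x, t) \<mapsto> \<rho>\<^sub>t(\<sigma> x)\<close>.\<close>
definition principal_torus_bundle ::
    "('n::{t2_space,second_countable_topology}, 'e::euclidean_space) chart set \<Rightarrow>
     ('b::{t2_space,second_countable_topology}, 'f::euclidean_space) chart set \<Rightarrow>
     ('n \<Rightarrow> 'b) \<Rightarrow> (real ^ 'k \<Rightarrow> 'n \<Rightarrow> 'n) \<Rightarrow> bool" where
  "principal_torus_bundle N B \<pi> \<rho> \<longleftrightarrow>
     smooth_atlas N \<and> DIM('e) = DIM('f) + CARD('k) \<and> smooth_map N B \<pi> \<and>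
     smooth_map (prod_atlas (open_atlas UNIV) N) N (\<lambda>(t, p). \<rho> t p) \<and>
     (\<forall>p\<in>points N. \<rho> 0 p = p \<and> (\<forall>t t'. \<rho> (t + t') p = \<rho> t (\<rho> t' p))) \<and>
     (\<forall>p\<in>points N. \<forall>t. \<rho> t p = p \<longleftrightarrow> (\<forall>i. \<exists>m::int. t $ i = 2 * pi * of_int m)) \<and>
     (\<forall>p\<in>points N. \<forall>q\<in>points N. \<pi> p = \<pi> q \<longleftrightarrow> (\<exists>t. q = \<rho> t p)) \<and>
     (\<forall>b\<in>points B. \<exists>W \<sigma>. open W \<and> b \<in> W \<and> W \<subseteq> points B \<and>
        smooth_map (restrict_atlas W B) N \<sigma> \<and> (\<forall>x\<in>W. \<pi> (\<sigma> x) = x))"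

definition generator ::
    "('n, 'e::real_normed_vector) chart set \<Rightarrow> (real ^ 'k \<Rightarrow> 'n \<Rightarrow> 'n) \<Rightarrow> 'k \<Rightarrow> 'n \<Rightarrow> ('n, 'e) tangent" where
  "generator N \<rho> j p = velocity N (\<lambda>t. \<rho> (t *\<^sub>R axis j 1) p) 0"

text \<open>\<open>\<theta>\<close> is the \<open>i\<close>-th component of a connection form with values in the Lie algebra \<open>\<real>\<^sup>k\<close>.\<close>
definition connection_form ::
    "('n, 'e::real_normed_vector) chart set \<Rightarrow> (real ^ 'k \<Rightarrow> 'n \<Rightarrow> 'n) \<Rightarrow> 'k \<Rightarrow> ('n, 'e, real) form \<Rightarrow> bool" where
  "connection_form N \<rho> i \<theta> \<longleftrightarrow> smooth_form N 1 \<theta> \<and>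
     (\<forall>t. form_eq N (pullback N N (\<rho> t) \<theta>) \<theta>) \<and>
     (\<forall>p\<in>points N. \<forall>j. \<theta> p (\<lambda>_. generator N \<rho> j p) = (if j = i then 1 else 0))"


section \<open>\<open>Spin(7)\<close>- and \<open>G\<^sub>2\<close>-structures\<close>

text \<open>The coordinates on \<open>\<real>\<^sup>8\<close> are \<open>x\<^sub>0,\<dots>,x\<^sub>7\<close>, indexed by the type \<open>8\<close>. For a list of
  indices, \<open>dx [i\<^sub>1,\<dots>,i\<^sub>k] = dx\<^bsub>i\<^sub>1\<^esub> \<and> \<dots> \<and> dx\<^bsub>i\<^sub>k\<^esub>\<close> is given by the determinant formula.\<close>
definition dx :: "8 list \<Rightarrow> (nat \<Rightarrow> real ^ 8) \<Rightarrow> real" where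
  "dx is v = (\<Sum>\<sigma> | \<sigma> permutes {..<length is}.
     of_int (sign \<sigma>) * (\<Prod>j<length is. v (\<sigma> j) $ (is ! j)))"

definition Phi0 :: "(nat \<Rightarrow> real ^ 8) \<Rightarrow> real" where
  "Phi0 = dx [0,1,2,3] + dx [0,1,4,5] + dx [0,1,6,7] + dx [0,2,4,6] - dx [0,2,5,7]
        - dx [0,3,4,7] - dx [0,3,5,6] + dx [2,3,4,5] + dx [2,3,6,7] + dx [4,5,6,7]
        - dx [1,2,4,7] - dx [1,2,5,6] - dx [1,3,4,6] + dx [1,3,5,7]"

definition interior :: "'t \<Rightarrow> ((nat \<Rightarrow> 't) \<Rightarrow> 'v) \<Rightarrow> (nat \<Rightarrow> 't) \<Rightarrow> 'v" where
  "interior x a v = a (\<lambda>j. case j of 0 \<Rightarrow> x | Suc i \<Rightarrow> v i)"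

text \<open>\<open>\<real>\<^sup>7\<close>, with coordinates \<open>x\<^sub>1,\<dots>,x\<^sub>7\<close>, is the hyperplane \<open>x\<^sub>0 = 0\<close>.\<close>
definition R7 :: "(real ^ 8) set" where
  "R7 = {x. x $ 0 = 0}"

definition phi0 :: "(nat \<Rightarrow> real ^ 8) \<Rightarrow> real" where
  "phi0 = interior (axis 0 1) Phi0"

definition vol7 :: "(nat \<Rightarrow> real ^ 8) \<Rightarrow> real" where
  "vol7 = dx [1,2,3,4,5,6,7]"

text \<open>Linear isomorphisms from the tangent space \<open>T\<close> to the model space are represented by linear maps
  on the ambient vector space; every linear map on \<open>T\<close> has such an extension.\<close>
definition g2_frame :: "'t::real_vector set \<Rightarrow> ((nat \<Rightarrow> 't) \<Rightarrow> real) \<Rightarrow> ('t \<Rightarrow> real ^ 8) \<Rightarrow> bool" where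
  "g2_frame T \<phi> f \<longleftrightarrow> linear f \<and> bij_betw f T R7 \<and>
     (\<forall>v. (\<forall>i. v i \<in> T) \<longrightarrow> \<phi> v = phi0 (f \<circ> v))"

definition spin7_frame :: "'t::real_vector set \<Rightarrow> ((nat \<Rightarrow> 't) \<Rightarrow> real) \<Rightarrow> ('t \<Rightarrow> real ^ 8) \<Rightarrow> bool" where
  "spin7_frame T \<Phi> f \<longleftrightarrow> linear f \<and> bij_betw f T UNIV \<and>
     (\<forall>v. (\<forall>i. v i \<in> T) \<longrightarrow> \<Phi> v = Phi0 (f \<circ> v))"

text \<open>Hodge star of a \<open>k\<close>-form in terms of an orthonormal basis \<open>(e i)\<close>, \<open>i \<in> S\<close>, and the volume
  form:
  \<open>(\<star>\<beta>)(v) = 1/k! (\<Sum>i\<^sub>1,\<dots>,i\<^sub>k\<in>S. \<beta>(e i\<^sub>1,\<dots>,e i\<^sub>k) vol(e i\<^sub>1,\<dots>,e i\<^sub>k,v\<^sub>0,v\<^sub>1,\<dots>))\<close>, which satisfies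
  \<open>\<gamma> \<and> \<star>\<beta> = \<langle>\<gamma>, \<beta>\<rangle> vol\<close>.\<close>
definition hodge_star ::
    "'i set \<Rightarrow> ('i \<Rightarrow> 't::zero) \<Rightarrow> ((nat \<Rightarrow> 't) \<Rightarrow> real) \<Rightarrow> nat \<Rightarrow> ((nat \<Rightarrow> 't) \<Rightarrow> real) \<Rightarrow> (nat \<Rightarrow> 't) \<Rightarrow> real" where
  "hodge_star S e vol k \<beta> v =
     (\<Sum>i\<in>{..<k} \<rightarrow>\<^sub>E S. \<beta> (\<lambda>j. if j < k then e (i j) else 0) *
        vol (\<lambda>j. if j < k then e (i j) else v (j - k))) / fact k"

text \<open>The metric, orientation and Hodge star induced by a \<open>G\<^sub>2\<close>-form (the metric induced by a
  \<open>Spin(7)\<close>-form) are those of the model, transported by any adapted frame. The choice of the frame is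
  irrelevant since the stabilisers of \<open>phi0\<close> and \<open>Phi0\<close> are contained in \<open>SO(7)\<close> and \<open>SO(8)\<close>.\<close>
definition g2_star ::
    "'t::real_vector set \<Rightarrow> ((nat \<Rightarrow> 't) \<Rightarrow> real) \<Rightarrow> nat \<Rightarrow> ((nat \<Rightarrow> 't) \<Rightarrow> real) \<Rightarrow> (nat \<Rightarrow> 't) \<Rightarrow> real" where
  "g2_star T \<phi> k \<beta> = (let f = (SOME f. g2_frame T \<phi> f) in
     hodge_star (UNIV - {0}) (\<lambda>i. inv_into T f (axis i 1)) (\<lambda>v. vol7 (f \<circ> v)) k \<beta>)"

definition spin7_metric ::
    "'t::real_vector set \<Rightarrow> ((nat \<Rightarrow> 't) \<Rightarrow> real) \<Rightarrow> 't \<Rightarrow> 't \<Rightarrow> real" where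
  "spin7_metric T \<Phi> v w = (let f = (SOME f. spin7_frame T \<Phi> f) in f v \<bullet> f w)"

definition g2_structure ::
    "('a, 'e::real_normed_vector) chart set \<Rightarrow> ('a, 'e, real) form \<Rightarrow> bool" where
  "g2_structure L \<phi> \<longleftrightarrow> smooth_form L 3 \<phi> \<and>
     (\<forall>p\<in>points L. \<exists>f. g2_frame (tangent_space L p) (\<phi> p) f)"

definition spin7_structure ::
    "('a, 'e::real_normed_vector) chart set \<Rightarrow> ('a, 'e, real) form \<Rightarrow> bool" where
  "spin7_structure N \<Phi> \<longleftrightarrow> smooth_form N 4 \<Phi> \<and>
     (\<forall>p\<in>points N. \<exists>f. spin7_frame (tangent_space N p) (\<Phi> p) f)"

definition closed_g2_structure ::
    "('a, 'e::real_normed_vector) chart set \<Rightarrow> ('a, 'e, real) form \<Rightarrow> bool" where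
  "closed_g2_structure L \<phi> \<longleftrightarrow> g2_structure L \<phi> \<and> closed_form L 3 \<phi>"

definition torsion_free_spin7_structure ::
    "('a, 'e::real_normed_vector) chart set \<Rightarrow> ('a, 'e, real) form \<Rightarrow> bool" where
  "torsion_free_spin7_structure N \<Phi> \<longleftrightarrow> spin7_structure N \<Phi> \<and> closed_form N 4 \<Phi>"

definition g2_hodge ::
    "('a, 'e::real_normed_vector) chart set \<Rightarrow> ('a, 'e, real) form \<Rightarrow> nat \<Rightarrow> ('a, 'e, real) form \<Rightarrow>
     ('a, 'e, real) form" where
  "g2_hodge L \<phi> k \<beta> = (\<lambda>p. g2_star (tangent_space L p) (\<phi> p) k (\<beta> p))"

end

theory Submission imports Defs
begin

text \<open>In a chart of the bundle, differential forms become smooth fields with values in the exterior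
  algebra \<open>grass\<close> of the chart space, and exterior differentiation becomes the operator \<open>dd\<close>. With
  \<open>r = s (s + c) / A\<close>, \<open>\<mu>\<^sup>2 = r u\<close> and \<open>\<nu>\<^sup>2 = r a\<close>, where \<open>a\<close> is the coefficient of \<open>dx\<^sub>1 \<and> dy\<^sub>1\<close> in \<open>\<omega>\<^sub>1\<close> and
  \<open>\<omega>\<^sub>2 + i \<omega>\<^sub>3 = h dz\<^sub>1 dz\<^sub>2\<close>, the complex Monge-Ampere equation says that \<open>r \<omega>\<^sub>1\<close> and
  \<open>- i \<mu> h dz\<^sub>1 dz\<^sub>2\<close> are the Kaehler form and the complex volume form of an \<open>SU(2)\<close>-structure. Together
  with \<open>A \<xi> / (s + c)\<close>, \<open>\<mu> ds / A\<close>, \<open>r \<alpha> / \<mu>\<close> and \<open>\<eta> / s\<close> a unitary coframe of it puts \<open>s \<phi>\<close> and \<open>\<Phi>\<close>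
  into standard form. Closedness is then a computation in the exterior algebra that only uses the
  curvatures, the type of the forms, and the Monge-Ampere equation.\<close>

section \<open>The signed shuffle algebra\<close>

text \<open>Elements of \<open>grass\<close> satisfy neither a degree nor an alternation condition,
  so they form a plain associative algebra in which products, contractions and \<open>dd\<close>
  obey their rules by induction on the argument list; alternation matters when a product is compared
  with the permutation sum \<open>alt_wedge\<close>. The main obstacle is that the induced metric
  and the Hodge star are read off from a frame picked by choice. They can be computed once any two
  frames of the same form are known to differ by an isometry, so the stabilisers of
  \<open>Phi0\<close> and \<open>phi0\<close> are shown to be orthogonal, by means of the triple
  cross product determined by \<open>Phi0\<close>. The exponent 4/3 comes from scaling: s phi is in
  standard position for the coframe, hence a frame of phi is that coframe times s^(-1/3), and the
  dual 4-form acquires s^(-4/3). Finally Phi mixes two total spaces, the star living on L and eta on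
  N. The same coframe formula is used on both, and dq carries one coframe to the other because q
  covers the base and pulls back alpha and xi.\<close>

typedef 'a grass = "UNIV :: ('a list \<Rightarrow> real) set" morphisms ev Grass
  by simp

lemma ev_Grass [simp]: "ev (Grass f) = f"
  by (simp add: Grass_inverse)

lemma grass_eqI: "(\<And>vs. ev a vs = ev b vs) \<Longrightarrow> a = b"
  by (metis ext ev_inject)

text \<open>The first vector is handed either to \<open>a\<close> or to \<open>b\<close>, so the
  value is a sum over all shuffles of the arguments. If \<open>b\<close> receives it, the vector
  passes the arguments that \<open>a\<close> is still to get, which is the sign put on
  \<open>a\<close>. On alternating forms this is the wedge product with the normalisation of
  \<open>alt_wedge\<close>.\<close>

primrec shuffle :: "'a list \<Rightarrow> ('a list \<Rightarrow> real) \<Rightarrow> ('a list \<Rightarrow> real) \<Rightarrow> real" where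
  "shuffle [] a b = a [] * b []"
| "shuffle (v # vs) a b = shuffle vs (\<lambda>ws. a (v # ws)) b
     + shuffle vs (\<lambda>ws. (-1) ^ length ws * a ws) (\<lambda>ws. b (v # ws))"

definition iota :: "'a \<Rightarrow> 'a grass \<Rightarrow> 'a grass" where
  "iota v a = Grass (\<lambda>vs. ev a (v # vs))"

text \<open>The grading involution. It supplies the signs of graded rules without assuming that the
  factors are homogeneous.\<close>

definition sg :: "'a grass \<Rightarrow> 'a grass" where
  "sg a = Grass (\<lambda>vs. (-1) ^ length vs * ev a vs)"

lemma shuffle_add_left: "shuffle vs (\<lambda>ws. a ws + a' ws) b = shuffle vs a b + shuffle vs a' b"
  by (induction vs arbitrary: a a' b) (simp_all add: algebra_simps)

lemma shuffle_add_right: "shuffle vs a (\<lambda>ws. b ws + b' ws) = shuffle vs a b + shuffle vs a b'"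
  by (induction vs arbitrary: a b b') (simp_all add: algebra_simps)

lemma shuffle_scale_left: "shuffle vs (\<lambda>ws. r * a ws) b = r * shuffle vs a b"
proof (induction vs arbitrary: a b)
  case (Cons v vs)
  have "shuffle vs (\<lambda>ws. (-1) ^ length ws * (r * a ws)) (\<lambda>ws. b (v # ws))
      = r * shuffle vs (\<lambda>ws. (-1) ^ length ws * a ws) (\<lambda>ws. b (v # ws))"
    using Cons[of "\<lambda>ws. (-1) ^ length ws * a ws" "\<lambda>ws. b (v # ws)"] by (simp add: mult_ac)
  then show ?case using Cons[of "\<lambda>ws. a (v # ws)" b] by (simp add: algebra_simps)
qed simp

lemma shuffle_scale_right: "shuffle vs a (\<lambda>ws. r * b ws) = r * shuffle vs a b"
  by (induction vs arbitrary: a b) (simp_all add: algebra_simps)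

instantiation grass :: (type) real_algebra_1
begin

definition "0 = Grass (\<lambda>_. 0)"
definition "1 = Grass (\<lambda>vs. if vs = [] then 1 else 0)"
definition "a + b = Grass (\<lambda>vs. ev a vs + ev b vs)"
definition "- a = Grass (\<lambda>vs. - ev a vs)" for a :: "'a grass"
definition "a - b = Grass (\<lambda>vs. ev a vs - ev b vs)"
definition "r *\<^sub>R a = Grass (\<lambda>vs. r * ev a vs)"
definition "a * b = Grass (\<lambda>vs. shuffle vs (ev a) (ev b))"

lemma ev_simps:
  "ev 0 vs = 0" "ev 1 vs = (if vs = [] then 1 else 0)" "ev (a + b) vs = ev a vs + ev b vs"
  "ev (- a) vs = - ev a vs" "ev (a - b) vs = ev a vs - ev b vs" "ev (r *\<^sub>R a) vs = r * ev a vs"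
  by (simp_all add: zero_grass_def one_grass_def plus_grass_def uminus_grass_def minus_grass_def
      scaleR_grass_def)

lemma ev_iota: "ev (iota v a) vs = ev a (v # vs)"
  by (simp add: iota_def)

lemma ev_sg: "ev (sg a) vs = (-1) ^ length vs * ev a vs"
  by (simp add: sg_def)

lemma ev_mult_Nil: "ev (a * b) [] = ev a [] * ev b []"
  by (simp add: times_grass_def)

lemma ev_mult_Cons: "ev (a * b) (v # vs) = ev (iota v a * b) vs + ev (sg a * iota v b) vs"
  by (simp add: times_grass_def iota_def sg_def)

lemma grass_distrib_right: "(a + b) * c = a * c + b * c" for a b c :: "'a grass"
  using shuffle_add_left[of _ "ev a" "ev b" "ev c"]
  by (intro grass_eqI) (simp add: times_grass_def plus_grass_def)

lemma grass_distrib_left: "a * (b + c) = a * b + a * c" for a b c :: "'a grass"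
  using shuffle_add_right[of _ "ev a" "ev b" "ev c"]
  by (intro grass_eqI) (simp add: times_grass_def plus_grass_def)

lemma grass_scale_left: "(r *\<^sub>R a) * b = r *\<^sub>R (a * b)" for a b :: "'a grass"
  using shuffle_scale_left[of _ r "ev a" "ev b"]
  by (intro grass_eqI) (simp add: times_grass_def scaleR_grass_def)

lemma grass_scale_right: "a * (r *\<^sub>R b) = r *\<^sub>R (a * b)" for a b :: "'a grass"
  using shuffle_scale_right[of _ "ev a" r "ev b"]
  by (intro grass_eqI) (simp add: times_grass_def scaleR_grass_def)

lemma sg_sg [simp]: "sg (sg a) = a"
  by (rule grass_eqI) (simp add: ev_sg flip: mult.assoc power_add mult_2)

lemma iota_mult: "iota v (a * b) = iota v a * b + sg a * iota v b"
  by (rule grass_eqI) (simp add: ev_iota ev_simps ev_mult_Cons)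

lemma iota_sg: "iota v (sg a) = (- 1) *\<^sub>R sg (iota v a)"
  by (rule grass_eqI) (simp add: ev_iota ev_sg ev_simps)

lemma sg_mult: "sg (a * b) = sg a * sg b"
proof (rule grass_eqI)
  show "ev (sg (a * b)) vs = ev (sg a * sg b) vs" for vs
  proof (induction vs arbitrary: a b)
    case Nil
    show ?case by (simp add: ev_sg ev_mult_Nil)
  next
    case (Cons v vs)
    show ?case
      using Cons[of "iota v a" b] Cons[of "sg a" "iota v b"]
      by (simp add: ev_sg ev_mult_Cons iota_sg grass_scale_left grass_scale_right ev_simps
          algebra_simps)
  qed
qed

text \<open>Contraction is an antiderivation and \<open>sg\<close> is multiplicative, so peeling off
  the first vector splits both bracketings into the same three triple products, each covered by the
  induction hypothesis.\<close>

lemma grass_mult_assoc: "a * b * c = a * (b * c)" for a b c :: "'a grass"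
proof (rule grass_eqI)
  show "ev (a * b * c) vs = ev (a * (b * c)) vs" for vs
  proof (induction vs arbitrary: a b c)
    case Nil
    show ?case by (simp add: ev_mult_Nil)
  next
    case (Cons v vs)
    show ?case
      by (simp add: ev_mult_Cons iota_mult sg_mult grass_distrib_left grass_distrib_right ev_simps Cons)
  qed
qed

lemma iota_1: "iota v 1 = 0"
  by (rule grass_eqI) (simp add: ev_iota ev_simps)

lemma sg_1: "sg 1 = 1"
  by (rule grass_eqI) (simp add: ev_sg ev_simps)

lemma zero_mult_ev: "ev (0 * a) vs = 0"
  using grass_scale_left[of 0 0 a] by (simp add: scaleR_grass_def zero_grass_def)

lemma mult_zero_ev: "ev (a * 0) vs = 0"
  using grass_scale_right[of a 0 0] by (simp add: scaleR_grass_def zero_grass_def)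

lemma grass_one_mult: "1 * a = a" for a :: "'a grass"
proof (rule grass_eqI)
  show "ev (1 * a) vs = ev a vs" for vs
    by (induction vs arbitrary: a)
      (simp_all add: ev_mult_Nil ev_mult_Cons iota_1 sg_1 zero_mult_ev ev_simps ev_iota)
qed

lemma grass_mult_one: "a * 1 = a" for a :: "'a grass"
proof (rule grass_eqI)
  show "ev (a * 1) vs = ev a vs" for vs
    by (induction vs arbitrary: a)
      (simp_all add: ev_mult_Nil ev_mult_Cons iota_1 mult_zero_ev ev_simps ev_iota)
qed

instance
proof
  fix a b c :: "'a grass" and r s :: real
  show "a * b * c = a * (b * c)" by (rule grass_mult_assoc)
  show "1 * a = a" "a * 1 = a" by (rule grass_one_mult grass_mult_one)+
  show "(a + b) * c = a * c + b * c" "a * (b + c) = a * b + a * c"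
    by (rule grass_distrib_right grass_distrib_left)+
  show "(r *\<^sub>R a) * b = r *\<^sub>R (a * b)" "a * (r *\<^sub>R b) = r *\<^sub>R (a * b)"
    by (rule grass_scale_left grass_scale_right)+
  have "ev (0 :: 'a grass) [] \<noteq> ev 1 []" by (simp add: ev_simps)
  then show "(0 :: 'a grass) \<noteq> 1" by metis
qed (rule grass_eqI; simp add: ev_simps algebra_simps)+

end

declare ev_simps [simp]

lemma iota_linear [simp]:
  "iota v 0 = 0" "iota v 1 = 0" "iota v (a + b) = iota v a + iota v b" "iota v (- a) = - iota v a"
  "iota v (a - b) = iota v a - iota v b" "iota v (r *\<^sub>R a) = r *\<^sub>R iota v a"
  by (rule grass_eqI; simp add: ev_iota)+

lemma sg_linear [simp]:
  "sg 0 = 0" "sg 1 = 1" "sg (a + b) = sg a + sg b" "sg (- a) = - sg a"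
  "sg (a - b) = sg a - sg b" "sg (r *\<^sub>R a) = r *\<^sub>R sg a"
  by (rule grass_eqI; simp add: ev_sg algebra_simps)+

declare sg_mult [simp] iota_mult [simp]

lemma iota_sg_minus: "iota v (sg a) = - sg (iota v a)"
  by (simp add: iota_sg)

lemma ev_Cons: "ev a (v # vs) = ev (iota v a) vs"
  by (simp add: ev_iota)

text \<open>No linearity is asked of \<open>f\<close>; components of connection forms can thus enter
  before they are known to be linear.\<close>

definition one :: "('a \<Rightarrow> real) \<Rightarrow> 'a grass" where
  "one f = Grass (\<lambda>vs. case vs of [v] \<Rightarrow> f v | _ \<Rightarrow> 0)"

lemma iota_one [simp]: "iota v (one f) = f v *\<^sub>R 1"
  by (rule grass_eqI) (auto simp: ev_iota one_def split: list.splits)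

lemma ev_one_Nil [simp]: "ev (one f) [] = 0"
  by (simp add: one_def)

lemma ev_one [simp]: "ev (one f) [v] = f v"
  by (simp add: one_def)

lemma sg_one [simp]: "sg (one f) = - one f"
  by (rule grass_eqI) (auto simp: ev_sg one_def split: list.splits)

text \<open>Contracting either side with \<open>v\<close> gives \<open>f v\<close> times
  \<open>a\<close> minus the corresponding side for \<open>iota v a\<close>, so induction on the
  arguments proves it for every \<open>a\<close>, alternating or not.\<close>

lemma one_mult_commute: "one f * a = sg a * one f"
proof (rule grass_eqI)
  show "ev (one f * a) vs = ev (sg a * one f) vs" for vs
  proof (induction vs arbitrary: a)
    case Nil
    show ?case by (simp add: ev_mult_Nil)
  next
    case (Cons v vs)
    show ?case
      using Cons[of "iota v a"]
      by (simp add: ev_mult_Cons iota_sg_minus)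
  qed
qed

lemma one_anticommute: "one f * one g = - (one g * one f)"
  by (subst one_mult_commute) simp

lemma one_square: "one f * one f = 0"
proof -
  have "one f * one f + one f * one f = 0"
    using one_anticommute[of f f] by (simp add: eq_neg_iff_add_eq_0)
  then have "(2::real) *\<^sub>R (one f * one f) = 0" by (simp add: scaleR_2)
  then show ?thesis by simp
qed

lemma one_square_left: "one f * (one f * a) = 0"
  by (simp add: one_square flip: mult.assoc)

lemma one_anticommute_left: "one f * (one g * a) = - (one g * (one f * a))"
  by (metis one_anticommute minus_mult_left mult.assoc)

lemma one_add: "one (\<lambda>v. f v + g v) = one f + one g"
  and one_diff: "one (\<lambda>v. f v - g v) = one f - one g"
  and one_uminus: "one (\<lambda>v. - f v) = - one f"
  and one_scale: "one (\<lambda>v. r * f v) = r *\<^sub>R one f"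
  and one_zero: "one (\<lambda>v. 0) = 0"
  by (rule grass_eqI; simp add: one_def split: list.split)+

section \<open>Homogeneous and alternating elements\<close>

definition hom :: "nat \<Rightarrow> 'a grass \<Rightarrow> bool" where
  "hom k a \<longleftrightarrow> (\<forall>vs. length vs \<noteq> k \<longrightarrow> ev a vs = 0)"

lemma hom_eqI:
  assumes "hom k a" "hom k b" "\<And>vs. length vs = k \<Longrightarrow> ev a vs = ev b vs"
  shows "a = b"
  using assms by (intro grass_eqI) (metis hom_def)

lemma hom_linear [intro]:
  "hom k 0" "hom k a \<Longrightarrow> hom k (- a)" "hom k a \<Longrightarrow> hom k b \<Longrightarrow> hom k (a + b)"
  "hom k a \<Longrightarrow> hom k b \<Longrightarrow> hom k (a - b)" "hom k a \<Longrightarrow> hom k (r *\<^sub>R a)"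
  by (auto simp: hom_def)

lemma hom_one [intro]: "hom (Suc 0) (one f)"
  by (auto simp: hom_def one_def split: list.splits)

lemma hom_iota: "hom (Suc k) a \<Longrightarrow> hom k (iota v a)"
  by (auto simp: hom_def ev_iota)

lemma hom_0_iota: "hom 0 a \<Longrightarrow> iota v a = 0"
  by (rule grass_eqI) (auto simp: hom_def ev_iota)

lemma hom_sg: "hom k a \<Longrightarrow> hom k (sg a)"
  by (auto simp: hom_def ev_sg)

lemma hom_mult: "hom k a \<Longrightarrow> hom l b \<Longrightarrow> hom (k + l) (a * b)"
proof -
  have "ev (a * b) vs = 0" if "hom k a" "hom l b" "length vs \<noteq> k + l" for vs
    using that
  proof (induction vs arbitrary: k l a b)
    case Nil
    then show ?case by (auto simp: ev_mult_Nil hom_def)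
  next
    case (Cons v vs)
    have "ev (iota v a * b) vs = 0"
    proof (cases k)
      case 0
      then show ?thesis using Cons.prems by (simp add: hom_0_iota)
    next
      case (Suc k')
      then show ?thesis
        using Cons.IH[of k' "iota v a" l b] Cons.prems by (simp add: hom_iota)
    qed
    moreover have "ev (sg a * iota v b) vs = 0"
    proof (cases l)
      case 0
      then show ?thesis using Cons.prems by (simp add: hom_0_iota)
    next
      case (Suc l')
      then show ?thesis
        using Cons.IH[of k "sg a" l' "iota v b"] Cons.prems by (simp add: hom_iota hom_sg)
    qed
    ultimately show ?case by (simp add: ev_mult_Cons)
  qed
  then show "hom k a \<Longrightarrow> hom l b \<Longrightarrow> hom (k + l) (a * b)" by (auto simp: hom_def)
qed

lemma hom2 [intro]: "hom (Suc 0) a \<Longrightarrow> hom (Suc 0) b \<Longrightarrow> hom 2 (a * b)"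
  using hom_mult[of "Suc 0" a "Suc 0" b] by (simp add: numeral_2_eq_2)

text \<open>Exchanges of neighbours generate all exchanges of arguments. This local form survives
  the list inductions and yields the antisymmetry that the \<open>alt_wedge\<close> lemmas ask
  for.\<close>

definition skew :: "'a grass \<Rightarrow> bool" where
  "skew a \<longleftrightarrow> (\<forall>us v w vs. ev a (us @ v # w # vs) = - ev a (us @ w # v # vs))"

lemma skewI: "(\<And>us v w vs. ev a (us @ v # w # vs) = - ev a (us @ w # v # vs)) \<Longrightarrow> skew a"
  unfolding skew_def by blast

lemma skewD: "skew a \<Longrightarrow> ev a (us @ v # w # vs) = - ev a (us @ w # v # vs)"
  unfolding skew_def by blast

lemma skew_iota: "skew a \<Longrightarrow> skew (iota v a)"
  by (rule skewI) (metis append_Cons ev_iota skewD)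

lemma skew_sg: "skew a \<Longrightarrow> skew (sg a)"
  by (rule skewI) (subst (1 2) ev_sg, subst skewD, simp_all)

lemma skew_linear [intro]:
  "skew 0" "skew a \<Longrightarrow> skew (- a)" "skew a \<Longrightarrow> skew b \<Longrightarrow> skew (a + b)"
  "skew a \<Longrightarrow> skew b \<Longrightarrow> skew (a - b)" "skew a \<Longrightarrow> skew (r *\<^sub>R a)"
proof -
  show "skew 0" by (rule skewI) simp
  have swap: "skew a \<Longrightarrow> ev a (us @ v # w # vs) + ev a (us @ w # v # vs) = 0" for a us v w vs
    using skewD[of a us v w vs] by linarith
  show "skew (- a)" "skew (r *\<^sub>R a)" if "skew a"
    by (rule skewI, simp only: ev_simps, subst skewD[OF that], simp)+
  show "skew (a + b)" "skew (a - b)" if "skew a" "skew b"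
    by (rule skewI; use swap[OF that(1)] swap[OF that(2)] in \<open>smt (verit) ev_simps\<close>)+
qed

lemma skew_one [intro]: "skew (one f)"
proof (rule skewI)
  show "ev (one f) (us @ v # w # vs) = - ev (one f) (us @ w # v # vs)" for us v w vs
    by (cases us) (simp_all add: one_def split: list.split)
qed

lemma skew_iota2: "skew a \<Longrightarrow> iota v (iota w a) = - iota w (iota v a)"
  by (rule grass_eqI) (metis append_Nil ev_iota ev_simps(4) skewD)

lemma skew_mult [intro]:
  assumes "skew a" "skew b"
  shows "skew (a * b)"
proof -
  have "ev (a * b) (us @ v # w # vs) = - ev (a * b) (us @ w # v # vs)" for us v w vs
    using assms
  proof (induction us arbitrary: a b)
    case Nil
    \<comment> \<open>The terms with one vector in each factor form a difference that changes sign
      when \<open>v\<close> and \<open>w\<close> are exchanged; the other two terms are skew by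
      \<open>skew_iota2\<close>.\<close>
    then have "iota w (iota v (a * b)) = - iota v (iota w (a * b))"
      using skew_iota2[of a v w] skew_iota2[of b v w] by (simp add: iota_sg_minus algebra_simps)
    then show ?case by (metis append_Nil ev_iota ev_simps(4))
  next
    case (Cons u us)
    then show ?case
      using Cons.IH[of "iota u a" b] Cons.IH[of "sg a" "iota u b"]
      by (simp add: ev_mult_Cons skew_iota skew_sg)
  qed
  then show ?thesis by (rule skewI)
qed

section \<open>Smooth functions\<close>

lemma frechet_derivative_eqI:
  "(f has_derivative f') (at x) \<Longrightarrow> frechet_derivative f (at x) = f'"
  using frechet_derivative_at by metis

lemma frechet_derivative_cong_open:
  assumes "open S" "x \<in> S" "\<And>y. y \<in> S \<Longrightarrow> f y = g y"
  shows "frechet_derivative f (at x) = frechet_derivative g (at x)"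
proof -
  have "(f has_derivative f') (at x) \<longleftrightarrow> (g has_derivative f') (at x)" for f'
    using has_derivative_transform_within_open[OF _ assms(1,2), of f f' UNIV g]
      has_derivative_transform_within_open[OF _ assms(1,2), of g f' UNIV f] assms(3) by auto
  then show ?thesis by (simp add: frechet_derivative_def)
qed

lemma differentiable_cong_open:
  assumes "open S" "x \<in> S" "\<And>y. y \<in> S \<Longrightarrow> f y = g y"
  shows "f differentiable (at x) \<longleftrightarrow> g differentiable (at x)"
  using has_derivative_transform_within_open[OF _ assms(1,2), of f _ UNIV g]
    has_derivative_transform_within_open[OF _ assms(1,2), of g _ UNIV f] assms(3)
  by (auto simp: differentiable_def)

lemma Ck_on_cong:
  assumes "open S" "\<And>x. x \<in> S \<Longrightarrow> f x = g x"
  shows "Ck_on k S f \<longleftrightarrow> Ck_on k S g"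
  using assms(2)
proof (induction k arbitrary: f g)
  case 0
  then show ?case by (simp cong: continuous_on_cong)
next
  case (Suc k)
  have "Ck_on k S (\<lambda>x. frechet_derivative f (at x) w)
      \<longleftrightarrow> Ck_on k S (\<lambda>x. frechet_derivative g (at x) w)" for w
    by (rule Suc.IH, rule fun_cong[where x = w], rule frechet_derivative_cong_open[OF assms(1)])
      (use Suc.prems in auto)
  moreover have "f differentiable (at x) \<longleftrightarrow> g differentiable (at x)" if "x \<in> S" for x
    by (rule differentiable_cong_open[OF assms(1) that Suc.prems])
  ultimately show ?case by simp
qed

lemma Ck_on_transform:
  "open S \<Longrightarrow> Ck_on k S g \<Longrightarrow> (\<And>x. x \<in> S \<Longrightarrow> f x = g x) \<Longrightarrow> Ck_on k S f"
  using Ck_on_cong by blast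

lemma Ck_on_local:
  assumes "\<And>x. x \<in> S \<Longrightarrow> \<exists>U. open U \<and> x \<in> U \<and> Ck_on k U f"
  shows "Ck_on k S f"
  using assms
proof (induction k arbitrary: f)
  case 0
  then show ?case
    by (fastforce intro!: continuous_at_imp_continuous_on simp: continuous_on_eq_continuous_at)
next
  case (Suc k)
  then show ?case by (fastforce simp del: ex_simps)
qed

lemma Ck_on_subset: "Ck_on k S f \<Longrightarrow> T \<subseteq> S \<Longrightarrow> Ck_on k T f"
  by (induction k arbitrary: f) (auto intro: continuous_on_subset)

lemma Ck_on_SucD: "Ck_on (Suc k) S f \<Longrightarrow> Ck_on k S f"
proof (induction k arbitrary: f)
  case 0
  then show ?case
    by (auto intro!: continuous_at_imp_continuous_on differentiable_imp_continuous_within)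
qed simp

lemma Ck_on_const: "Ck_on k S (\<lambda>x. c)"
  by (induction k arbitrary: c) auto

lemma Ck_on_add:
  assumes "open S" "Ck_on k S f" "Ck_on k S g"
  shows "Ck_on k S (\<lambda>x. f x + g x)"
  using assms(2,3)
proof (induction k arbitrary: f g)
  case (Suc k)
  have der: "frechet_derivative (\<lambda>x. f x + g x) (at x)
      = (\<lambda>w. frechet_derivative f (at x) w + frechet_derivative g (at x) w)" if "x \<in> S" for x
    using Suc.prems that
    by (intro frechet_derivative_eqI has_derivative_add) (simp_all add: frechet_derivative_works)
  have "Ck_on k S (\<lambda>x. frechet_derivative (\<lambda>x. f x + g x) (at x) w)" for w
    by (rule Ck_on_transform[OF assms(1) Suc.IH[of "\<lambda>x. frechet_derivative f (at x) w"
          "\<lambda>x. frechet_derivative g (at x) w"]]) (use Suc.prems der in auto)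
  then show ?case using Suc.prems by (auto intro: differentiable_add)
qed (auto intro: continuous_on_add)

lemma Ck_on_bounded_linear:
  assumes "open S" "bounded_linear h" "Ck_on k S f"
  shows "Ck_on k S (\<lambda>x. h (f x))"
  using assms(3)
proof (induction k arbitrary: f)
  case 0
  then show ?case by (auto intro: continuous_on_compose2[OF linear_continuous_on[OF assms(2), of UNIV]])
next
  case (Suc k)
  have der: "((\<lambda>x. h (f x)) has_derivative (\<lambda>w. h (frechet_derivative f (at x) w))) (at x)"
    if "x \<in> S" for x
    using Suc.prems that
    by (intro bounded_linear.has_derivative[OF assms(2)]) (simp add: frechet_derivative_works)
  have "Ck_on k S (\<lambda>x. frechet_derivative (\<lambda>x. h (f x)) (at x) w)" for w
    by (rule Ck_on_transform[OF assms(1) Suc.IH[of "\<lambda>x. frechet_derivative f (at x) w"]])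
      (use Suc.prems frechet_derivative_eqI[OF der] in auto)
  then show ?case using der by (auto simp: differentiable_def)
qed

lemma Ck_on_bilinear:
  assumes "open S" "bounded_bilinear h" "Ck_on k S f" "Ck_on k S g"
  shows "Ck_on k S (\<lambda>x. h (f x) (g x))"
  using assms(3,4)
proof (induction k arbitrary: f g)
  case 0
  then show ?case by (auto intro: bounded_bilinear.continuous_on[OF assms(2)])
next
  case (Suc k)
  have der: "((\<lambda>x. h (f x) (g x)) has_derivative
      (\<lambda>w. h (f x) (frechet_derivative g (at x) w) + h (frechet_derivative f (at x) w) (g x))) (at x)"
    if "x \<in> S" for x
    using Suc.prems that
    by (intro bounded_bilinear.FDERIV[OF assms(2)]) (simp_all add: frechet_derivative_works)
  have "Ck_on k S (\<lambda>x. frechet_derivative (\<lambda>x. h (f x) (g x)) (at x) w)" for w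
    by (rule Ck_on_transform[OF assms(1) Ck_on_add[OF assms(1)
          Suc.IH[of f "\<lambda>x. frechet_derivative g (at x) w"]
          Suc.IH[of "\<lambda>x. frechet_derivative f (at x) w" g]]])
      (use Suc.prems Ck_on_SucD[OF Suc.prems(1)] Ck_on_SucD[OF Suc.prems(2)]
         frechet_derivative_eqI[OF der] in auto)
  then show ?case using der by (auto simp: differentiable_def)
qed

lemma Ck_on_sum:
  assumes "open S" "finite B" "\<And>b. b \<in> B \<Longrightarrow> Ck_on k S (f b)"
  shows "Ck_on k S (\<lambda>x. \<Sum>b\<in>B. f b x)"
  using assms(2,3) by (induction B) (auto intro: Ck_on_add[OF assms(1)] Ck_on_const)

lemma linear_basis_expand:
  fixes D :: "'b::euclidean_space \<Rightarrow> 'c::real_vector"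
  assumes "linear D"
  shows "D w = (\<Sum>b\<in>Basis. (w \<bullet> b) *\<^sub>R D b)"
  by (metis (mono_tags, lifting) assms euclidean_representation linear_scale linear_sum sum.cong)

text \<open>The derivative of the composite is that of \<open>g\<close> at \<open>f x\<close> in a
  direction varying with \<open>x\<close>, to which the induction hypothesis does not apply
  directly. Expanding the direction in a finite basis leaves sums of products with fixed directions,
  whence the Euclidean middle space.\<close>

lemma Ck_on_compose:
  fixes f :: "'a::real_normed_vector \<Rightarrow> 'b::euclidean_space"
    and g :: "'b \<Rightarrow> 'c::real_normed_vector"
  assumes "open S" "f ` S \<subseteq> T" "Ck_on k S f" "Ck_on k T g"
  shows "Ck_on k S (\<lambda>x. g (f x))"
  using assms(3,4)
proof (induction k arbitrary: g)
  case 0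
  then show ?case using assms(2) by (auto intro: continuous_on_compose2)
next
  case (Suc k)
  have fd: "(f has_derivative frechet_derivative f (at x)) (at x)" if "x \<in> S" for x
    using Suc.prems that by (simp add: frechet_derivative_works)
  have gd: "(g has_derivative frechet_derivative g (at (f x))) (at (f x))" if "x \<in> S" for x
    using Suc.prems that assms(2) by (auto simp: frechet_derivative_works)
  have der: "((\<lambda>x. g (f x)) has_derivative
      (\<lambda>w. frechet_derivative g (at (f x)) (frechet_derivative f (at x) w))) (at x)"
    if "x \<in> S" for x
    using diff_chain_at[OF fd[OF that] gd[OF that]] by (simp add: o_def)
  have eq: "frechet_derivative (\<lambda>x. g (f x)) (at x) w
      = (\<Sum>b\<in>Basis. (frechet_derivative f (at x) w \<bullet> b) *\<^sub>R frechet_derivative g (at (f x)) b)"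
    if "x \<in> S" for x w
    using that by (subst frechet_derivative_eqI[OF der], simp,
        intro linear_basis_expand has_derivative_linear[OF gd])
  have "Ck_on k S (\<lambda>x. frechet_derivative (\<lambda>x. g (f x)) (at x) w)" for w
  proof (subst Ck_on_cong[OF assms(1)])
    show "Ck_on k S (\<lambda>x. \<Sum>b\<in>Basis.
        (frechet_derivative f (at x) w \<bullet> b) *\<^sub>R frechet_derivative g (at (f x)) b)"
      using Suc.prems Ck_on_SucD[OF Suc.prems(1)]
      by (intro Ck_on_sum Ck_on_bilinear[OF _ bounded_bilinear_scaleR] Suc.IH
          Ck_on_bounded_linear[OF _ bounded_linear_inner_left] assms(1)) auto
  qed (use eq in simp)
  then show ?case using der by (auto simp: differentiable_def)
qed

lemma smooth_on_cong: "open S \<Longrightarrow> (\<And>x. x \<in> S \<Longrightarrow> f x = g x) \<Longrightarrow> smooth_on S f \<longleftrightarrow> smooth_on S g"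
  unfolding smooth_on_def using Ck_on_cong by blast

lemma smooth_on_local:
  "(\<And>x. x \<in> S \<Longrightarrow> \<exists>U. open U \<and> x \<in> U \<and> smooth_on U f) \<Longrightarrow> smooth_on S f"
  unfolding smooth_on_def by (meson Ck_on_local)

lemma smooth_on_subset: "smooth_on S f \<Longrightarrow> T \<subseteq> S \<Longrightarrow> smooth_on T f"
  unfolding smooth_on_def using Ck_on_subset by blast

lemma smooth_on_const: "smooth_on S (\<lambda>x. c)"
  by (simp add: smooth_on_def Ck_on_const)

lemma smooth_on_add: "open S \<Longrightarrow> smooth_on S f \<Longrightarrow> smooth_on S g \<Longrightarrow> smooth_on S (\<lambda>x. f x + g x)"
  by (simp add: smooth_on_def Ck_on_add)

lemma smooth_on_bounded_linear:
  "open S \<Longrightarrow> bounded_linear h \<Longrightarrow> smooth_on S f \<Longrightarrow> smooth_on S (\<lambda>x. h (f x))"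
  by (simp add: smooth_on_def Ck_on_bounded_linear)

lemma smooth_on_mult:
  "open S \<Longrightarrow> smooth_on S f \<Longrightarrow> smooth_on S g \<Longrightarrow> smooth_on S (\<lambda>x. f x * g x :: real)"
  by (simp add: smooth_on_def Ck_on_bilinear[OF _ bounded_bilinear_mult])

lemma smooth_on_cmult: "open S \<Longrightarrow> smooth_on S f \<Longrightarrow> smooth_on S (\<lambda>x. r * f x :: real)"
  by (simp add: smooth_on_mult smooth_on_const)

lemma smooth_on_minus: "open S \<Longrightarrow> smooth_on S f \<Longrightarrow> smooth_on S (\<lambda>x. - f x :: real)"
  using smooth_on_cmult[of S f "-1"] by simp

lemma smooth_on_diff:
  "open S \<Longrightarrow> smooth_on S f \<Longrightarrow> smooth_on S g \<Longrightarrow> smooth_on S (\<lambda>x. f x - g x :: real)"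
  using smooth_on_add[of S f "\<lambda>x. - g x"] by (simp add: smooth_on_minus)

lemma smooth_on_compose:
  fixes f :: "'a::real_normed_vector \<Rightarrow> 'b::euclidean_space"
  shows "open S \<Longrightarrow> f ` S \<subseteq> T \<Longrightarrow> smooth_on S f \<Longrightarrow> smooth_on T g \<Longrightarrow> smooth_on S (\<lambda>x. g (f x))"
  unfolding smooth_on_def using Ck_on_compose by blast

lemma smooth_on_differentiable: "smooth_on S f \<Longrightarrow> x \<in> S \<Longrightarrow> f differentiable (at x)"
  unfolding smooth_on_def by (metis Ck_on.simps(2))

lemma smooth_on_has_derivative:
  "smooth_on S f \<Longrightarrow> x \<in> S \<Longrightarrow> (f has_derivative frechet_derivative f (at x)) (at x)"
  using smooth_on_differentiable frechet_derivative_works by blast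

lemma smooth_on_frechet: "smooth_on S f \<Longrightarrow> smooth_on S (\<lambda>x. frechet_derivative f (at x) w)"
  unfolding smooth_on_def by (metis Ck_on.simps(2))

lemma smooth_on_continuous: "smooth_on S f \<Longrightarrow> continuous_on S f"
  unfolding smooth_on_def by (metis Ck_on.simps(1))

lemma has_derivative_line:
  fixes f :: "'a::real_normed_vector \<Rightarrow> real"
  assumes "f differentiable (at (x + r *\<^sub>R v))"
  shows "((\<lambda>t. f (x + t *\<^sub>R v)) has_real_derivative frechet_derivative f (at (x + r *\<^sub>R v)) v) (at r)"
proof -
  have 1: "((\<lambda>t. x + t *\<^sub>R v) has_derivative (\<lambda>t. t *\<^sub>R v)) (at r)"
    by (auto intro!: derivative_eq_intros)
  have 2: "(f has_derivative frechet_derivative f (at (x + r *\<^sub>R v))) (at (x + r *\<^sub>R v))"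
    using assms frechet_derivative_works by blast
  have "((\<lambda>t. f (x + t *\<^sub>R v)) has_derivative
      (\<lambda>t. frechet_derivative f (at (x + r *\<^sub>R v)) (t *\<^sub>R v))) (at r)"
    using diff_chain_at[OF 1 2] by (simp add: o_def)
  then show ?thesis
    using linear_frechet_derivative[OF assms]
    by (simp add: has_field_derivative_def linear_scale mult_commute_abs)
qed

text \<open>Both mixed second derivatives are limits of the same second difference quotient.\<close>
lemma second_difference:
  fixes f :: "'a::real_normed_vector \<Rightarrow> real"
  assumes "h > 0" and diff: "\<And>s t. 0 \<le> s \<Longrightarrow> s \<le> h \<Longrightarrow> 0 \<le> t \<Longrightarrow> t \<le> h \<Longrightarrow>
      f differentiable (at (x + s *\<^sub>R v + t *\<^sub>R w))"
    and diff2: "\<And>s t. 0 \<le> s \<Longrightarrow> s \<le> h \<Longrightarrow> 0 \<le> t \<Longrightarrow> t \<le> h \<Longrightarrow>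
      (\<lambda>y. frechet_derivative f (at y) v) differentiable (at (x + s *\<^sub>R v + t *\<^sub>R w))"
  shows "\<exists>s t. 0 \<le> s \<and> s \<le> h \<and> 0 \<le> t \<and> t \<le> h \<and>
    f (x + h *\<^sub>R v + h *\<^sub>R w) - f (x + h *\<^sub>R v) - f (x + h *\<^sub>R w) + f x
      = h * h * frechet_derivative (\<lambda>y. frechet_derivative f (at y) v) (at (x + s *\<^sub>R v + t *\<^sub>R w)) w"
proof -
  define Df where "Df = (\<lambda>y. frechet_derivative f (at y) v)"
  \<comment> \<open>The second difference is \<open>g h - g 0\<close>. The mean value theorem is
    applied to \<open>g\<close> along \<open>v\<close>, then to \<open>Df\<close> along
    \<open>w\<close>.\<close>
  define g where "g = (\<lambda>s. f (x + h *\<^sub>R w + s *\<^sub>R v) - f (x + s *\<^sub>R v))"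
  have g': "(g has_real_derivative Df (x + h *\<^sub>R w + s *\<^sub>R v) - Df (x + s *\<^sub>R v)) (at s)"
    if "0 \<le> s" "s \<le> h" for s
    unfolding g_def Df_def using that assms(1) diff[of s h] diff[of s 0]
    by (intro DERIV_diff has_derivative_line) (simp_all add: add_ac)
  obtain s where s: "0 < s" "s < h" "g h - g 0 = h * (Df (x + h *\<^sub>R w + s *\<^sub>R v) - Df (x + s *\<^sub>R v))"
    using MVT2[OF assms(1), of g "\<lambda>s. Df (x + h *\<^sub>R w + s *\<^sub>R v) - Df (x + s *\<^sub>R v)"] g' by auto
  have k': "((\<lambda>t. Df (x + s *\<^sub>R v + t *\<^sub>R w)) has_real_derivative
      frechet_derivative Df (at (x + s *\<^sub>R v + t *\<^sub>R w)) w) (at t)" if "0 \<le> t" "t \<le> h" for t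
    using that s diff2[of s t] unfolding Df_def by (intro has_derivative_line) simp_all
  obtain t where t: "0 < t" "t < h" "Df (x + s *\<^sub>R v + h *\<^sub>R w) - Df (x + s *\<^sub>R v + 0 *\<^sub>R w)
      = h * frechet_derivative Df (at (x + s *\<^sub>R v + t *\<^sub>R w)) w"
    using MVT2[OF assms(1), of "\<lambda>t. Df (x + s *\<^sub>R v + t *\<^sub>R w)"
        "\<lambda>t. frechet_derivative Df (at (x + s *\<^sub>R v + t *\<^sub>R w)) w"] k' by auto
  have "f (x + h *\<^sub>R v + h *\<^sub>R w) - f (x + h *\<^sub>R v) - f (x + h *\<^sub>R w) + f x = g h - g 0"
    by (simp add: g_def add_ac)
  also have "\<dots> = h * h * frechet_derivative Df (at (x + s *\<^sub>R v + t *\<^sub>R w)) w"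
    using s(3) t(3) by (simp add: add_ac)
  finally show ?thesis using s t unfolding Df_def by (metis less_eq_real_def)
qed

text \<open>The second difference is symmetric in \<open>v\<close> and \<open>w\<close>, so the two
  iterated derivatives share a value, at possibly different points of an arbitrarily small
  parallelogram; continuity moves both to \<open>x\<close>.\<close>

lemma second_derivative_symmetric_real:
  fixes f :: "'a::real_normed_vector \<Rightarrow> real"
  assumes S: "open S" "x \<in> S" and f: "smooth_on S f"
  shows "frechet_derivative (\<lambda>y. frechet_derivative f (at y) v) (at x) w
       = frechet_derivative (\<lambda>y. frechet_derivative f (at y) w) (at x) v"
proof -
  define D where "D = (\<lambda>v w y. frechet_derivative (\<lambda>y. frechet_derivative f (at y) v) (at y) w)"
  have cont: "isCont (D v w) x" for v w
    unfolding D_def using smooth_on_continuous[OF smooth_on_frechet[OF smooth_on_frechet[OF f]]] S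
    by (simp add: continuous_on_eq_continuous_at)
  have dist0: "\<bar>D v w x - D w v x\<bar> < e" if "e > 0" for e
  proof -
    have "e / 2 > 0" using that by simp
    obtain d1 where d1: "d1 > 0" "\<And>y. dist y x < d1 \<Longrightarrow> dist (D v w y) (D v w x) < e / 2"
      using cont[of v w] \<open>e / 2 > 0\<close> unfolding continuous_at_eps_delta by meson
    obtain d2 where d2: "d2 > 0" "\<And>y. dist y x < d2 \<Longrightarrow> dist (D w v y) (D w v x) < e / 2"
      using cont[of w v] \<open>e / 2 > 0\<close> unfolding continuous_at_eps_delta by meson
    obtain d3 where d3: "d3 > 0" "ball x d3 \<subseteq> S" using S open_contains_ball by metis
    define d where "d = Min {d1, d2, d3}"
    have d: "d > 0" "d \<le> d1" "d \<le> d2" "d \<le> d3" using d1 d2 d3 by (auto simp: d_def)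
    \<comment> \<open>Small enough to keep the parallelogram inside the ball of radius
      \<open>d\<close>; the summand 1 avoids a division by 0.\<close>
    define h where "h = d / (2 * (norm v + norm w + 1))"
    have nvw: "norm v + norm w + 1 > 0" by (simp add: add_nonneg_pos)
    have h: "h > 0" using d nvw by (simp add: h_def)
    have near: "dist (x + s *\<^sub>R v + t *\<^sub>R w) x < d" if "0 \<le> s" "s \<le> h" "0 \<le> t" "t \<le> h" for s t
    proof -
      have "dist (x + s *\<^sub>R v + t *\<^sub>R w) x = norm (s *\<^sub>R v + t *\<^sub>R w)" by (simp add: dist_norm)
      also have "\<dots> \<le> s * norm v + t * norm w"
        using norm_triangle_ineq[of "s *\<^sub>R v" "t *\<^sub>R w"] that by simp
      also have "\<dots> \<le> h * norm v + h * norm w" using that by (intro add_mono mult_right_mono) auto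
      also have "\<dots> < h * (norm v + norm w + 1) * 2" using h by (simp add: algebra_simps add_nonneg_pos)
      also have "\<dots> = d" using nvw by (simp add: h_def del: distrib_left_numeral mult_2)
      finally show ?thesis .
    qed
    have inS: "x + s *\<^sub>R v + t *\<^sub>R w \<in> S" if "0 \<le> s" "s \<le> h" "0 \<le> t" "t \<le> h" for s t
      using near[OF that] d d3 by (auto simp: dist_commute subset_iff)
    have inS': "x + s *\<^sub>R w + t *\<^sub>R v \<in> S" if "0 \<le> s" "s \<le> h" "0 \<le> t" "t \<le> h" for s t
      using inS[of t s] that by (simp add: add_ac)
    obtain s t where 1: "0 \<le> s" "s \<le> h" "0 \<le> t" "t \<le> h"
      "f (x + h *\<^sub>R v + h *\<^sub>R w) - f (x + h *\<^sub>R v) - f (x + h *\<^sub>R w) + f x = h * h * D v w (x + s *\<^sub>R v + t *\<^sub>R w)"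
      using second_difference[OF h, of f x v w] smooth_on_differentiable[OF f inS]
        smooth_on_differentiable[OF smooth_on_frechet[OF f] inS] unfolding D_def by blast
    obtain s' t' where 2: "0 \<le> s'" "s' \<le> h" "0 \<le> t'" "t' \<le> h"
      "f (x + h *\<^sub>R w + h *\<^sub>R v) - f (x + h *\<^sub>R w) - f (x + h *\<^sub>R v) + f x = h * h * D w v (x + s' *\<^sub>R w + t' *\<^sub>R v)"
      using second_difference[OF h, of f x w v] smooth_on_differentiable[OF f inS']
        smooth_on_differentiable[OF smooth_on_frechet[OF f] inS'] unfolding D_def by blast
    have comm: "x + h *\<^sub>R w + h *\<^sub>R v = x + h *\<^sub>R v + h *\<^sub>R w" by (simp add: add_ac)
    have "h * h * D v w (x + s *\<^sub>R v + t *\<^sub>R w) = h * h * D w v (x + s' *\<^sub>R w + t' *\<^sub>R v)"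
      using 1(5) 2(5)[unfolded comm] by linarith
    then have "D v w (x + s *\<^sub>R v + t *\<^sub>R w) = D w v (x + t' *\<^sub>R v + s' *\<^sub>R w)"
      using h by (simp add: add_ac)
    moreover have "dist (D v w (x + s *\<^sub>R v + t *\<^sub>R w)) (D v w x) < e / 2"
      using d1(2) near[OF 1(1-4)] d by force
    moreover have "dist (D w v (x + t' *\<^sub>R v + s' *\<^sub>R w)) (D w v x) < e / 2"
      using d2(2) near[OF 2(3,4,1,2)] d by force
    ultimately show ?thesis unfolding dist_real_def by linarith
  qed
  have "D v w x = D w v x"
    using dist0[of "\<bar>D v w x - D w v x\<bar>"] by linarith
  then show ?thesis by (simp add: D_def)
qed

section \<open>Exterior derivative of fields of forms on a normed space\<close>

text \<open>\<open>grass\<close> carries no topology, so differentiability is imposed on each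
  evaluation.\<close>

definition gdiff :: "('e::real_normed_vector \<Rightarrow> 't grass) \<Rightarrow> 'e \<Rightarrow> bool" where
  "gdiff a x \<longleftrightarrow> (\<forall>vs. (\<lambda>y. ev (a y) vs) differentiable (at x))"

definition fD :: "('e::real_normed_vector \<Rightarrow> 't grass) \<Rightarrow> 'e \<Rightarrow> 'e \<Rightarrow> 't grass" where
  "fD a x v = Grass (\<lambda>vs. frechet_derivative (\<lambda>y. ev (a y) vs) (at x) v)"

lemma gdiff_has_derivative:
  "gdiff a x \<Longrightarrow> ((\<lambda>y. ev (a y) vs) has_derivative (\<lambda>v. ev (fD a x v) vs)) (at x)"
  by (simp add: gdiff_def fD_def flip: frechet_derivative_works)

lemma fD_I:
  assumes "\<And>vs. ((\<lambda>y. ev (a y) vs) has_derivative (\<lambda>v. ev (a' v) vs)) (at x)"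
  shows "gdiff a x" "fD a x = a'"
proof -
  show "gdiff a x" using assms by (auto simp: gdiff_def differentiable_def)
  show "fD a x = a'"
    by (rule ext, rule grass_eqI) (simp add: fD_def frechet_derivative_eqI[OF assms])
qed

lemma gdiff_iota: "gdiff a x \<Longrightarrow> gdiff (\<lambda>y. iota v (a y)) x"
  by (simp add: gdiff_def ev_iota)

lemma fD_iota: "fD (\<lambda>y. iota v (a y)) x w = iota v (fD a x w)"
  by (rule grass_eqI) (simp add: fD_def ev_iota)

lemma gdiff_sg: "gdiff a x \<Longrightarrow> gdiff (\<lambda>y. sg (a y)) x"
  by (simp add: gdiff_def ev_sg)

lemma fD_sg: "gdiff a x \<Longrightarrow> fD (\<lambda>y. sg (a y)) x w = sg (fD a x w)"
proof -
  assume a: "gdiff a x"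
  have "fD (\<lambda>y. sg (a y)) x = (\<lambda>w. sg (fD a x w))"
    by (rule fD_I(2)) (auto simp: ev_sg intro!: has_derivative_mult_right gdiff_has_derivative a)
  then show ?thesis by simp
qed

lemma
  assumes "gdiff a x" "gdiff b x"
  shows gdiff_add: "gdiff (\<lambda>y. a y + b y) x"
    and fD_add: "fD (\<lambda>y. a y + b y) x = (\<lambda>w. fD a x w + fD b x w)"
    and gdiff_diff: "gdiff (\<lambda>y. a y - b y) x"
    and fD_diff: "fD (\<lambda>y. a y - b y) x = (\<lambda>w. fD a x w - fD b x w)"
proof -
  have "((\<lambda>y. ev (a y + b y) vs) has_derivative (\<lambda>w. ev (fD a x w + fD b x w) vs)) (at x)" for vs
    using assms by (auto intro!: has_derivative_add gdiff_has_derivative)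
  from fD_I[OF this] show "gdiff (\<lambda>y. a y + b y) x"
    "fD (\<lambda>y. a y + b y) x = (\<lambda>w. fD a x w + fD b x w)" .
  have "((\<lambda>y. ev (a y - b y) vs) has_derivative (\<lambda>w. ev (fD a x w - fD b x w) vs)) (at x)" for vs
    using assms by (auto intro!: has_derivative_diff gdiff_has_derivative)
  from fD_I[OF this] show "gdiff (\<lambda>y. a y - b y) x"
    "fD (\<lambda>y. a y - b y) x = (\<lambda>w. fD a x w - fD b x w)" .
qed

lemma
  assumes "gdiff a x" "gdiff b x"
  shows gdiff_mult: "gdiff (\<lambda>y. a y * b y) x"
    and fD_mult: "fD (\<lambda>y. a y * b y) x = (\<lambda>w. fD a x w * b x + a x * fD b x w)"
proof -
  have "((\<lambda>y. ev (a y * b y) vs) has_derivative (\<lambda>w. ev (fD a x w * b x + a x * fD b x w) vs)) (at x)" for vs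
    using assms
  proof (induction vs arbitrary: a b)
    case Nil
    then show ?case
      by (auto simp: ev_mult_Nil add.commute intro!: has_derivative_mult gdiff_has_derivative)
  next
    case (Cons v vs)
    have "((\<lambda>y. ev (iota v (a y) * b y) vs + ev (sg (a y) * iota v (b y)) vs) has_derivative
      (\<lambda>w. ev (fD (\<lambda>y. iota v (a y)) x w * b x + iota v (a x) * fD b x w) vs
        + ev (fD (\<lambda>y. sg (a y)) x w * iota v (b x) + sg (a x) * fD (\<lambda>y. iota v (b y)) x w) vs)) (at x)"
      by (intro has_derivative_add Cons.IH gdiff_iota gdiff_sg Cons.prems)
    then show ?case
      using Cons.prems by (simp add: ev_mult_Cons fD_iota fD_sg algebra_simps)
  qed
  from fD_I[OF this] show "gdiff (\<lambda>y. a y * b y) x"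
    "fD (\<lambda>y. a y * b y) x = (\<lambda>w. fD a x w * b x + a x * fD b x w)" .
qed

lemma
  assumes "f differentiable (at x)"
  shows gdiff_fun: "gdiff (\<lambda>y. f y *\<^sub>R 1) x"
    and fD_fun: "fD (\<lambda>y. f y *\<^sub>R 1) x = (\<lambda>w. frechet_derivative f (at x) w *\<^sub>R 1)"
proof -
  have "((\<lambda>y. ev (f y *\<^sub>R 1) vs) has_derivative (\<lambda>w. ev (frechet_derivative f (at x) w *\<^sub>R 1) vs)) (at x)" for vs
    using assms by (auto simp flip: frechet_derivative_works intro!: derivative_eq_intros)
  from fD_I[OF this] show "gdiff (\<lambda>y. f y *\<^sub>R 1) x"
    "fD (\<lambda>y. f y *\<^sub>R 1) x = (\<lambda>w. frechet_derivative f (at x) w *\<^sub>R 1)" .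
qed

lemma gdiff_const: "gdiff (\<lambda>y. a) x"
  by (simp add: gdiff_def)

lemma gdiff_scale: "f differentiable (at x) \<Longrightarrow> gdiff a x \<Longrightarrow> gdiff (\<lambda>y. f y *\<^sub>R a y) x"
  using gdiff_mult[OF gdiff_fun, of f x a] by simp

primrec ddl :: "'e list \<Rightarrow> ('e::real_normed_vector \<Rightarrow> 'e grass) \<Rightarrow> 'e \<Rightarrow> real" where
  "ddl [] a x = 0"
| "ddl (v # vs) a x = frechet_derivative (\<lambda>y. ev (a y) vs) (at x) v - ddl vs (\<lambda>y. iota v (a y)) x"

text \<open>Cartan's formula \<open>\<iota>\<^sub>v d + d \<iota>\<^sub>v = L\<^sub>v\<close> for constant vector fields \<open>v\<close> is taken as the definition.\<close>
definition dd :: "('e::real_normed_vector \<Rightarrow> 'e grass) \<Rightarrow> 'e \<Rightarrow> 'e grass" where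
  "dd a x = Grass (\<lambda>vs. ddl vs a x)"

lemma ev_dd_Nil [simp]: "ev (dd a x) [] = 0"
  by (simp add: dd_def)

lemma iota_dd: "iota v (dd a x) = fD a x v - dd (\<lambda>y. iota v (a y)) x"
  by (rule grass_eqI) (simp add: ev_iota dd_def fD_def)

lemma dd_add:
  assumes "gdiff a x" "gdiff b x"
  shows "dd (\<lambda>y. a y + b y) x = dd a x + dd b x"
proof (rule grass_eqI)
  show "ev (dd (\<lambda>y. a y + b y) x) vs = ev (dd a x + dd b x) vs" for vs
    using assms by (induction vs arbitrary: a b) (simp_all add: ev_Cons iota_dd fD_add gdiff_iota)
qed

lemma dd_diff:
  assumes "gdiff a x" "gdiff b x"
  shows "dd (\<lambda>y. a y - b y) x = dd a x - dd b x"
proof (rule grass_eqI)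
  show "ev (dd (\<lambda>y. a y - b y) x) vs = ev (dd a x - dd b x) vs" for vs
    using assms by (induction vs arbitrary: a b) (simp_all add: ev_Cons iota_dd fD_diff gdiff_iota)
qed

lemma dd_const: "dd (\<lambda>y. a) x = 0"
proof (rule grass_eqI)
  show "ev (dd (\<lambda>y. a) x) vs = ev 0 vs" for vs
    by (induction vs arbitrary: a) (simp_all add: ev_Cons iota_dd, simp add: fD_def)
qed

lemma dd_uminus: "gdiff a x \<Longrightarrow> dd (\<lambda>y. - a y) x = - dd a x"
  using dd_diff[OF gdiff_const, of a x 0] by (simp add: dd_const)

lemma dd_sg:
  assumes "gdiff a x"
  shows "dd (\<lambda>y. sg (a y)) x = - sg (dd a x)"
proof (rule grass_eqI)
  show "ev (dd (\<lambda>y. sg (a y)) x) vs = ev (- sg (dd a x)) vs" for vs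
    using assms
  proof (induction vs arbitrary: a)
    case Nil
    show ?case by (simp add: ev_sg)
  next
    case (Cons v vs)
    have "dd (\<lambda>y. iota v (sg (a y))) x = - dd (\<lambda>y. sg (iota v (a y))) x"
      using Cons.prems by (simp add: iota_sg_minus dd_uminus gdiff_iota gdiff_sg)
    then show ?case
      using Cons.IH[of "\<lambda>y. iota v (a y)"] Cons.prems
      by (simp add: ev_Cons iota_dd iota_sg_minus fD_sg gdiff_iota)
  qed
qed

text \<open>Contraction is an antiderivation and \<open>fD\<close> a derivation. By Cartan's formula
  both sides therefore have the same contraction with the first vector, once the induction
  hypothesis is applied to the two contracted products.\<close>

lemma dd_mult:
  assumes "gdiff a x" "gdiff b x"
  shows "dd (\<lambda>y. a y * b y) x = dd a x * b x + sg (a x) * dd b x"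
proof (rule grass_eqI)
  show "ev (dd (\<lambda>y. a y * b y) x) vs = ev (dd a x * b x + sg (a x) * dd b x) vs" for vs
    using assms
  proof (induction vs arbitrary: a b)
    case Nil
    show ?case by (simp add: ev_mult_Nil)
  next
    case (Cons v vs)
    have "dd (\<lambda>y. iota v (a y) * b y + sg (a y) * iota v (b y)) x
        = dd (\<lambda>y. iota v (a y) * b y) x + dd (\<lambda>y. sg (a y) * iota v (b y)) x"
      by (intro dd_add gdiff_mult gdiff_iota gdiff_sg Cons.prems)
    then show ?case
      using Cons.IH[of "\<lambda>y. iota v (a y)" b] Cons.IH[of "\<lambda>y. sg (a y)" "\<lambda>y. iota v (b y)"] Cons.prems
      by (simp add: ev_Cons[of _ v] iota_dd fD_mult gdiff_iota gdiff_sg iota_sg_minus dd_sg algebra_simps)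
  qed
qed

lemma dd_fun:
  assumes "f differentiable (at x)"
  shows "dd (\<lambda>y. f y *\<^sub>R 1) x = one (frechet_derivative f (at x))"
proof (rule grass_eqI)
  show "ev (dd (\<lambda>y. f y *\<^sub>R 1) x) vs = ev (one (frechet_derivative f (at x))) vs" for vs
    by (cases vs) (simp_all add: ev_Cons iota_dd fD_fun assms dd_const)
qed

lemma dd_scale:
  assumes "f differentiable (at x)" "gdiff a x"
  shows "dd (\<lambda>y. f y *\<^sub>R a y) x = one (frechet_derivative f (at x)) * a x + f x *\<^sub>R dd a x"
  using dd_mult[OF gdiff_fun[OF assms(1)] assms(2)] by (simp add: dd_fun assms(1))

lemma hom_fD: "(\<And>y. hom k (a y)) \<Longrightarrow> hom k (fD a x v)"
  by (simp add: hom_def fD_def)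

lemma hom_dd:
  assumes "\<And>y. hom k (a y)"
  shows "hom (Suc k) (dd a x)"
proof -
  have "ev (dd a x) vs = 0" if "\<And>y. hom k (a y)" "length vs \<noteq> Suc k" for vs
    using that
  proof (induction vs arbitrary: k a)
    case (Cons v vs)
    have "ev (fD a x v) vs = 0" using Cons.prems hom_fD[of k a x v] by (simp add: hom_def)
    moreover have "ev (dd (\<lambda>y. iota v (a y)) x) vs = 0"
    proof (cases k)
      case 0
      then show ?thesis using Cons.prems(1) by (simp add: hom_0_iota dd_const)
    next
      case (Suc k')
      then show ?thesis using Cons.IH[of k' "\<lambda>y. iota v (a y)"] Cons.prems by (simp add: hom_iota)
    qed
    ultimately show ?case by (simp add: ev_Cons iota_dd)
  qed simp
  then show ?thesis using assms by (auto simp: hom_def)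
qed

text \<open>Unrolling Cartan's recursion removes one vector at a time and alternates the sign. This
  is the bridge from \<open>dd\<close> to the chart formula in \<open>ext_d\<close>.\<close>

lemma ev_dd_sum:
  "ev (dd a x) (map v [0..<Suc k]) = (\<Sum>i\<le>k. (-1) ^ i *
     frechet_derivative (\<lambda>y. ev (a y) (map (\<lambda>j. v (if j < i then j else Suc j)) [0..<k])) (at x) (v i))"
proof (induction k arbitrary: a v)
  case 0
  show ?case by (simp add: dd_def)
next
  case (Suc k)
  have upt: "map f [0..<Suc n] = f 0 # map (\<lambda>j. f (Suc j)) [0..<n]" for f :: "nat \<Rightarrow> 'b" and n
    by (simp add: upt_rec[of 0] map_Suc_upt[symmetric] del: upt_Suc)
  define G where "G = (\<lambda>i. frechet_derivative (\<lambda>y. ev (a y)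
      (map (\<lambda>j. v (if j < i then j else Suc j)) [0..<Suc k])) (at x) (v i))"
  have "ev (dd a x) (map v [0..<Suc (Suc k)])
      = G 0 - ev (dd (\<lambda>y. iota (v 0) (a y)) x) (map (\<lambda>j. v (Suc j)) [0..<Suc k])"
    by (subst upt) (simp add: dd_def G_def del: upt_Suc)
  also have "ev (dd (\<lambda>y. iota (v 0) (a y)) x) (map (\<lambda>j. v (Suc j)) [0..<Suc k])
      = (\<Sum>i\<le>k. (-1) ^ i * G (Suc i))"
    unfolding G_def
  proof (subst Suc, rule sum.cong[OF refl])
    fix i
    have "map (\<lambda>j. v (if j < Suc i then j else Suc j)) [0..<Suc k]
        = v 0 # map (\<lambda>j. v (Suc (if j < i then j else Suc j))) [0..<k]"
      by (subst upt) (auto intro!: arg_cong[where f = v])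
    then show "(-1) ^ i * frechet_derivative (\<lambda>y. ev (iota (v 0) (a y))
          (map (\<lambda>j. v (Suc (if j < i then j else Suc j))) [0..<k])) (at x) (v (Suc i))
        = (-1) ^ i * frechet_derivative (\<lambda>y. ev (a y)
           (map (\<lambda>j. v (if j < Suc i then j else Suc j)) [0..<Suc k])) (at x) (v (Suc i))"
      by (simp only: ev_iota)
  qed
  also have "G 0 - (\<Sum>i\<le>k. (-1) ^ i * G (Suc i)) = (\<Sum>i\<le>Suc k. (-1) ^ i * G i)"
    unfolding sum.atMost_Suc_shift by (simp add: sum_negf)
  finally show ?case by (simp only: G_def)
qed

section \<open>The model forms on R8\<close>

lemma exhaust_8: "x = 0 \<or> x = 1 \<or> x = 2 \<or> x = 3 \<or> x = 4 \<or> x = 5 \<or> x = 6 \<or> x = 7" for x :: 8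
proof (induct x)
  case (of_int z)
  then have "0 \<le> z" and "z < 8" by simp_all
  then have "z = 0 \<or> z = 1 \<or> z = 2 \<or> z = 3 \<or> z = 4 \<or> z = 5 \<or> z = 6 \<or> z = 7" by arith
  then show ?case by auto
qed

lemma UNIV_8: "(UNIV :: 8 set) = {0, 1, 2, 3, 4, 5, 6, 7}"
  using exhaust_8 by auto

lemma sum_8: "sum f (UNIV :: 8 set) = f 0 + (f 1 + (f 2 + (f 3 + (f 4 + (f 5 + (f 6 + f 7))))))"
  unfolding UNIV_8 by simp

lemma all_8: "(\<forall>x::8. P x) \<longleftrightarrow> P 0 \<and> P 1 \<and> P 2 \<and> P 3 \<and> P 4 \<and> P 5 \<and> P 6 \<and> P 7"
proof
  assume *: "P 0 \<and> P 1 \<and> P 2 \<and> P 3 \<and> P 4 \<and> P 5 \<and> P 6 \<and> P 7"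
  show "\<forall>x. P x"
  proof
    show "P x" for x using exhaust_8[of x] * by (elim disjE) simp_all
  qed
qed blast

lemma inner_8: "u \<bullet> v = u $ 0 * v $ 0 + u $ 1 * v $ 1 + u $ 2 * v $ 2 + u $ 3 * v $ 3 + u $ 4 * v $ 4
    + u $ 5 * v $ 5 + u $ 6 * v $ 6 + u $ 7 * v $ 7" for u v :: "real ^ 8"
  by (simp add: inner_vec_def sum_8 add.assoc)

text \<open>Pluecker coordinates of the bivector u wedge v.\<close>

definition pl :: "real ^ 8 \<Rightarrow> real ^ 8 \<Rightarrow> 8 \<Rightarrow> 8 \<Rightarrow> real" where
  "pl u v a b = u $ a * v $ b - u $ b * v $ a"

text \<open>The triple cross product on R8: component k is the coefficient of x_k in
  \<open>Phi0\<close> evaluated on (u, v, w, x), collected by the Pluecker coordinates of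
  \<open>u\<close> and \<open>v\<close>.\<close>

definition cp :: "real ^ 8 \<Rightarrow> real ^ 8 \<Rightarrow> real ^ 8 \<Rightarrow> real ^ 8" where
  "cp u v w = (\<chi> k. if k = 0 then (- pl u v 2 3 - pl u v 4 5 - pl u v 6 7) * w $ 1 + (pl u v 1 3 - pl u v 4 6 + pl u v 5 7) * w $ 2 + (- pl u v 1 2 + pl u v 4 7 + pl u v 5 6) * w $ 3 + (pl u v 1 5 + pl u v 2 6 - pl u v 3 7) * w $ 4 + (- pl u v 1 4 - pl u v 2 7 - pl u v 3 6) * w $ 5 + (pl u v 1 7 - pl u v 2 4 + pl u v 3 5) * w $ 6 + (- pl u v 1 6 + pl u v 2 5 + pl u v 3 4) * w $ 7 else
    if k = 1 then (pl u v 2 3 + pl u v 4 5 + pl u v 6 7) * w $ 0 + (- pl u v 0 3 + pl u v 4 7 + pl u v 5 6) * w $ 2 + (pl u v 0 2 + pl u v 4 6 - pl u v 5 7) * w $ 3 + (- pl u v 0 5 - pl u v 2 7 - pl u v 3 6) * w $ 4 + (pl u v 0 4 - pl u v 2 6 + pl u v 3 7) * w $ 5 + (- pl u v 0 7 + pl u v 2 5 + pl u v 3 4) * w $ 6 + (pl u v 0 6 + pl u v 2 4 - pl u v 3 5) * w $ 7 else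
    if k = 2 then (- pl u v 1 3 + pl u v 4 6 - pl u v 5 7) * w $ 0 + (pl u v 0 3 - pl u v 4 7 - pl u v 5 6) * w $ 1 + (- pl u v 0 1 - pl u v 4 5 - pl u v 6 7) * w $ 3 + (- pl u v 0 6 + pl u v 1 7 + pl u v 3 5) * w $ 4 + (pl u v 0 7 + pl u v 1 6 - pl u v 3 4) * w $ 5 + (pl u v 0 4 - pl u v 1 5 + pl u v 3 7) * w $ 6 + (- pl u v 0 5 - pl u v 1 4 - pl u v 3 6) * w $ 7 else
    if k = 3 then (pl u v 1 2 - pl u v 4 7 - pl u v 5 6) * w $ 0 + (- pl u v 0 2 - pl u v 4 6 + pl u v 5 7) * w $ 1 + (pl u v 0 1 + pl u v 4 5 + pl u v 6 7) * w $ 2 + (pl u v 0 7 + pl u v 1 6 - pl u v 2 5) * w $ 4 + (pl u v 0 6 - pl u v 1 7 + pl u v 2 4) * w $ 5 + (- pl u v 0 5 - pl u v 1 4 - pl u v 2 7) * w $ 6 + (- pl u v 0 4 + pl u v 1 5 + pl u v 2 6) * w $ 7 else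
    if k = 4 then (- pl u v 1 5 - pl u v 2 6 + pl u v 3 7) * w $ 0 + (pl u v 0 5 + pl u v 2 7 + pl u v 3 6) * w $ 1 + (pl u v 0 6 - pl u v 1 7 - pl u v 3 5) * w $ 2 + (- pl u v 0 7 - pl u v 1 6 + pl u v 2 5) * w $ 3 + (- pl u v 0 1 - pl u v 2 3 - pl u v 6 7) * w $ 5 + (- pl u v 0 2 + pl u v 1 3 + pl u v 5 7) * w $ 6 + (pl u v 0 3 + pl u v 1 2 - pl u v 5 6) * w $ 7 else
    if k = 5 then (pl u v 1 4 + pl u v 2 7 + pl u v 3 6) * w $ 0 + (- pl u v 0 4 + pl u v 2 6 - pl u v 3 7) * w $ 1 + (- pl u v 0 7 - pl u v 1 6 + pl u v 3 4) * w $ 2 + (- pl u v 0 6 + pl u v 1 7 - pl u v 2 4) * w $ 3 + (pl u v 0 1 + pl u v 2 3 + pl u v 6 7) * w $ 4 + (pl u v 0 3 + pl u v 1 2 - pl u v 4 7) * w $ 6 + (pl u v 0 2 - pl u v 1 3 + pl u v 4 6) * w $ 7 else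
    if k = 6 then (- pl u v 1 7 + pl u v 2 4 - pl u v 3 5) * w $ 0 + (pl u v 0 7 - pl u v 2 5 - pl u v 3 4) * w $ 1 + (- pl u v 0 4 + pl u v 1 5 - pl u v 3 7) * w $ 2 + (pl u v 0 5 + pl u v 1 4 + pl u v 2 7) * w $ 3 + (pl u v 0 2 - pl u v 1 3 - pl u v 5 7) * w $ 4 + (- pl u v 0 3 - pl u v 1 2 + pl u v 4 7) * w $ 5 + (- pl u v 0 1 - pl u v 2 3 - pl u v 4 5) * w $ 7 else
    (pl u v 1 6 - pl u v 2 5 - pl u v 3 4) * w $ 0 + (- pl u v 0 6 - pl u v 2 4 + pl u v 3 5) * w $ 1 + (pl u v 0 5 + pl u v 1 4 + pl u v 3 6) * w $ 2 + (pl u v 0 4 - pl u v 1 5 - pl u v 2 6) * w $ 3 + (- pl u v 0 3 - pl u v 1 2 + pl u v 5 6) * w $ 4 + (- pl u v 0 2 + pl u v 1 3 - pl u v 4 6) * w $ 5 + (pl u v 0 1 + pl u v 2 3 + pl u v 4 5) * w $ 6)"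

lemma cp_nth:
  "cp u v w $ 0 = (- pl u v 2 3 - pl u v 4 5 - pl u v 6 7) * w $ 1 + (pl u v 1 3 - pl u v 4 6 + pl u v 5 7) * w $ 2 + (- pl u v 1 2 + pl u v 4 7 + pl u v 5 6) * w $ 3 + (pl u v 1 5 + pl u v 2 6 - pl u v 3 7) * w $ 4 + (- pl u v 1 4 - pl u v 2 7 - pl u v 3 6) * w $ 5 + (pl u v 1 7 - pl u v 2 4 + pl u v 3 5) * w $ 6 + (- pl u v 1 6 + pl u v 2 5 + pl u v 3 4) * w $ 7"
  "cp u v w $ 1 = (pl u v 2 3 + pl u v 4 5 + pl u v 6 7) * w $ 0 + (- pl u v 0 3 + pl u v 4 7 + pl u v 5 6) * w $ 2 + (pl u v 0 2 + pl u v 4 6 - pl u v 5 7) * w $ 3 + (- pl u v 0 5 - pl u v 2 7 - pl u v 3 6) * w $ 4 + (pl u v 0 4 - pl u v 2 6 + pl u v 3 7) * w $ 5 + (- pl u v 0 7 + pl u v 2 5 + pl u v 3 4) * w $ 6 + (pl u v 0 6 + pl u v 2 4 - pl u v 3 5) * w $ 7"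
  "cp u v w $ 2 = (- pl u v 1 3 + pl u v 4 6 - pl u v 5 7) * w $ 0 + (pl u v 0 3 - pl u v 4 7 - pl u v 5 6) * w $ 1 + (- pl u v 0 1 - pl u v 4 5 - pl u v 6 7) * w $ 3 + (- pl u v 0 6 + pl u v 1 7 + pl u v 3 5) * w $ 4 + (pl u v 0 7 + pl u v 1 6 - pl u v 3 4) * w $ 5 + (pl u v 0 4 - pl u v 1 5 + pl u v 3 7) * w $ 6 + (- pl u v 0 5 - pl u v 1 4 - pl u v 3 6) * w $ 7"
  "cp u v w $ 3 = (pl u v 1 2 - pl u v 4 7 - pl u v 5 6) * w $ 0 + (- pl u v 0 2 - pl u v 4 6 + pl u v 5 7) * w $ 1 + (pl u v 0 1 + pl u v 4 5 + pl u v 6 7) * w $ 2 + (pl u v 0 7 + pl u v 1 6 - pl u v 2 5) * w $ 4 + (pl u v 0 6 - pl u v 1 7 + pl u v 2 4) * w $ 5 + (- pl u v 0 5 - pl u v 1 4 - pl u v 2 7) * w $ 6 + (- pl u v 0 4 + pl u v 1 5 + pl u v 2 6) * w $ 7"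
  "cp u v w $ 4 = (- pl u v 1 5 - pl u v 2 6 + pl u v 3 7) * w $ 0 + (pl u v 0 5 + pl u v 2 7 + pl u v 3 6) * w $ 1 + (pl u v 0 6 - pl u v 1 7 - pl u v 3 5) * w $ 2 + (- pl u v 0 7 - pl u v 1 6 + pl u v 2 5) * w $ 3 + (- pl u v 0 1 - pl u v 2 3 - pl u v 6 7) * w $ 5 + (- pl u v 0 2 + pl u v 1 3 + pl u v 5 7) * w $ 6 + (pl u v 0 3 + pl u v 1 2 - pl u v 5 6) * w $ 7"
  "cp u v w $ 5 = (pl u v 1 4 + pl u v 2 7 + pl u v 3 6) * w $ 0 + (- pl u v 0 4 + pl u v 2 6 - pl u v 3 7) * w $ 1 + (- pl u v 0 7 - pl u v 1 6 + pl u v 3 4) * w $ 2 + (- pl u v 0 6 + pl u v 1 7 - pl u v 2 4) * w $ 3 + (pl u v 0 1 + pl u v 2 3 + pl u v 6 7) * w $ 4 + (pl u v 0 3 + pl u v 1 2 - pl u v 4 7) * w $ 6 + (pl u v 0 2 - pl u v 1 3 + pl u v 4 6) * w $ 7"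
  "cp u v w $ 6 = (- pl u v 1 7 + pl u v 2 4 - pl u v 3 5) * w $ 0 + (pl u v 0 7 - pl u v 2 5 - pl u v 3 4) * w $ 1 + (- pl u v 0 4 + pl u v 1 5 - pl u v 3 7) * w $ 2 + (pl u v 0 5 + pl u v 1 4 + pl u v 2 7) * w $ 3 + (pl u v 0 2 - pl u v 1 3 - pl u v 5 7) * w $ 4 + (- pl u v 0 3 - pl u v 1 2 + pl u v 4 7) * w $ 5 + (- pl u v 0 1 - pl u v 2 3 - pl u v 4 5) * w $ 7"
  "cp u v w $ 7 = (pl u v 1 6 - pl u v 2 5 - pl u v 3 4) * w $ 0 + (- pl u v 0 6 - pl u v 2 4 + pl u v 3 5) * w $ 1 + (pl u v 0 5 + pl u v 1 4 + pl u v 3 6) * w $ 2 + (pl u v 0 4 - pl u v 1 5 - pl u v 2 6) * w $ 3 + (- pl u v 0 3 - pl u v 1 2 + pl u v 5 6) * w $ 4 + (- pl u v 0 2 + pl u v 1 3 - pl u v 4 6) * w $ 5 + (pl u v 0 1 + pl u v 2 3 + pl u v 4 5) * w $ 6"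
  by (simp_all add: cp_def)

lemma axis_nth_8: "axis (i::8) (1::real) $ j = (if j = i then 1 else 0)"
  by (simp add: axis_def eq_commute)

lemma dx_transposed:
  "dx is v = (\<Sum>\<sigma> | \<sigma> permutes {..<length is}. of_int (sign \<sigma>) * (\<Prod>j<length is. v j $ (is ! \<sigma> j)))"
proof -
  let ?n = "length is"
  let ?g = "\<lambda>\<sigma>. of_int (sign \<sigma>) * (\<Prod>j<?n. v (\<sigma> j) $ (is ! j)) :: real"
  have "?g (inv \<sigma>) = of_int (sign \<sigma>) * (\<Prod>j<?n. v j $ (is ! \<sigma> j))" if \<sigma>: "\<sigma> permutes {..<?n}" for \<sigma>
  proof -
    have "(\<Prod>j<?n. v (inv \<sigma> j) $ (is ! j)) = (\<Prod>j<?n. v (inv \<sigma> (\<sigma> j)) $ (is ! \<sigma> j))"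
      using prod.permute[OF \<sigma>, of "\<lambda>j. v (inv \<sigma> j) $ (is ! j)"] by (simp add: o_def)
    then show ?thesis
      using \<sigma> by (simp add: permutes_inverses sign_inverse permutes_imp_permutation[OF finite_lessThan \<sigma>])
  qed
  then show ?thesis
    unfolding dx_def by (subst sum_permutations_inverse) (intro sum.cong refl, simp)
qed

lemma dx_Nil [simp]: "dx [] v = 1"
  by (simp add: dx_def)

text \<open>Expansion of a determinant along the last vector. A permutation of the larger index set
  is a transposition of the last position with \<open>b\<close> after a permutation of the rest;
  replacing entry \<open>b\<close> by \<open>i\<close> in place therefore gives the sign -1 whatever
  \<open>b\<close> is.\<close>

lemma dx_snoc:
  "dx (is @ [i]) v = v (length is) $ i * dx is v
     - (\<Sum>b<length is. v (length is) $ (is ! b) * dx (is[b := i]) v)"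
proof -
  let ?n = "length is"
  have summand: "of_int (sign (Transposition.transpose ?n b \<circ> q)) * (\<Prod>j<Suc ?n. v j $ ((is @ [i]) ! ((Transposition.transpose ?n b \<circ> q) j)))
      = (if b = ?n then 1 else -1) * v ?n $ ((is @ [i]) ! b) *
        (of_int (sign q) * (\<Prod>j<?n. v j $ ((if b = ?n then is else is[b := i]) ! q j)))"
    if b: "b \<le> ?n" and q: "q permutes {..<?n}" for b q
  proof -
    have "sign (Transposition.transpose ?n b \<circ> q) = (if b = ?n then 1 else -1) * sign q"
      using permutes_imp_permutation[OF finite_lessThan q]
      by (simp add: sign_compose permutation_swap_id sign_swap_id)
    moreover have "q ?n = ?n" using q by (simp add: permutes_def)
    moreover have "(is @ [i]) ! Transposition.transpose ?n b (q j) = (if b = ?n then is else is[b := i]) ! q j" if "j < ?n" for j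
      using permutes_in_image[OF q, of j] that b
      by (auto simp: transpose_def nth_append nth_list_update)
    ultimately show ?thesis by simp
  qed
  have "dx (is @ [i]) v = (\<Sum>b\<in>insert ?n {..<?n}. \<Sum>q | q permutes {..<?n}.
      of_int (sign (Transposition.transpose ?n b \<circ> q)) * (\<Prod>j<Suc ?n. v j $ ((is @ [i]) ! ((Transposition.transpose ?n b \<circ> q) j))))"
    unfolding dx_transposed length_append_singleton lessThan_Suc
    by (subst sum_over_permutations_insert) (simp_all add: lessThan_Suc)
  also have "\<dots> = (\<Sum>b\<in>insert ?n {..<?n}. (if b = ?n then 1 else -1) * v ?n $ ((is @ [i]) ! b) *
      dx (if b = ?n then is else is[b := i]) v)"
  proof (intro sum.cong refl)
    fix b assume "b \<in> insert ?n {..<?n}"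
    then have b: "b \<le> ?n" by auto
    have len: "length (if b = ?n then is else is[b := i]) = ?n" by simp
    show "(\<Sum>q | q permutes {..<?n}. of_int (sign (Transposition.transpose ?n b \<circ> q)) *
        (\<Prod>j<Suc ?n. v j $ ((is @ [i]) ! ((Transposition.transpose ?n b \<circ> q) j))))
      = (if b = ?n then 1 else -1) * v ?n $ ((is @ [i]) ! b) * dx (if b = ?n then is else is[b := i]) v"
      unfolding dx_transposed len sum_distrib_left
      by (rule sum.cong[OF refl], rule summand[OF b]) simp
  qed
  also have "\<dots> = v ?n $ i * dx is v - (\<Sum>b<?n. v ?n $ (is ! b) * dx (is[b := i]) v)"
    by (simp add: nth_append sum_negf flip: sum_negf cong: sum.cong_simp)
  finally show ?thesis .
qed

lemma dx_swap:
  assumes "a < length is" "b < length is" "a \<noteq> b"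
  shows "dx is (v \<circ> Transposition.transpose a b) = - dx is v"
proof -
  let ?n = "length is"
  have t: "Transposition.transpose a b permutes {..<?n}" using assms by (intro permutes_swap_id) auto
  have "dx is v = (\<Sum>\<sigma> | \<sigma> permutes {..<?n}. of_int (sign (Transposition.transpose a b \<circ> \<sigma>)) * (\<Prod>j<?n. v ((Transposition.transpose a b \<circ> \<sigma>) j) $ (is ! j)))"
    unfolding dx_def by (rule setum_permutations_compose_left[OF t])
  also have "\<dots> = (\<Sum>\<sigma> | \<sigma> permutes {..<?n}. - (of_int (sign \<sigma>) * (\<Prod>j<?n. (v \<circ> Transposition.transpose a b) (\<sigma> j) $ (is ! j))))"
    using assms(3)
    by (intro sum.cong refl)
      (auto simp: sign_compose permutation_swap_id sign_swap_id permutes_imp_permutation[OF finite_lessThan])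
  finally show ?thesis by (simp add: dx_def sum_negf)
qed

lemma dx_1: "dx [a] v = v 0 $ a"
  using dx_snoc[of "[]" a v] by simp

lemma dx_2: "dx [a, b] v = v 1 $ b * dx [a] v - v 1 $ a * dx [b] v"
  using dx_snoc[of "[a]" b v] by simp

lemma dx_3: "dx [a, b, c] v = v 2 $ c * dx [a, b] v - v 2 $ a * dx [c, b] v - v 2 $ b * dx [a, c] v"
  using dx_snoc[of "[a, b]" c v] by (simp add: lessThan_Suc numeral_2_eq_2 eval_nat_numeral)

lemma dx_4: "dx [a, b, c, d] v = v 3 $ d * dx [a, b, c] v - v 3 $ a * dx [d, b, c] v
    - v 3 $ b * dx [a, d, c] v - v 3 $ c * dx [a, b, d] v"
  using dx_snoc[of "[a, b, c]" d v] by (simp add: lessThan_Suc eval_nat_numeral)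

lemma dx_5: "dx [a, b, c, d, e] v = v 4 $ e * dx [a, b, c, d] v - v 4 $ a * dx [e, b, c, d] v
    - v 4 $ b * dx [a, e, c, d] v - v 4 $ c * dx [a, b, e, d] v - v 4 $ d * dx [a, b, c, e] v"
  using dx_snoc[of "[a, b, c, d]" e v] by (simp add: lessThan_Suc eval_nat_numeral)

lemma dx_6: "dx [a, b, c, d, e, f] v = v 5 $ f * dx [a, b, c, d, e] v - v 5 $ a * dx [f, b, c, d, e] v
    - v 5 $ b * dx [a, f, c, d, e] v - v 5 $ c * dx [a, b, f, d, e] v
    - v 5 $ d * dx [a, b, c, f, e] v - v 5 $ e * dx [a, b, c, d, f] v"
  using dx_snoc[of "[a, b, c, d, e]" f v] by (simp add: lessThan_Suc eval_nat_numeral)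

lemma dx_7: "dx [a, b, c, d, e, f, g] v = v 6 $ g * dx [a, b, c, d, e, f] v
    - v 6 $ a * dx [g, b, c, d, e, f] v - v 6 $ b * dx [a, g, c, d, e, f] v
    - v 6 $ c * dx [a, b, g, d, e, f] v - v 6 $ d * dx [a, b, c, g, e, f] v
    - v 6 $ e * dx [a, b, c, d, g, f] v - v 6 $ f * dx [a, b, c, d, e, g] v"
  using dx_snoc[of "[a, b, c, d, e, f]" g v] by (simp add: lessThan_Suc eval_nat_numeral)

text \<open>Laplace expansion of a 4 by 4 determinant along its first two vectors.\<close>

lemma dx_4_pl: "dx [a, b, c, d] v = pl (v 0) (v 1) a b * pl (v 2) (v 3) c d - pl (v 0) (v 1) a c * pl (v 2) (v 3) b d
    + pl (v 0) (v 1) a d * pl (v 2) (v 3) b c + pl (v 0) (v 1) b c * pl (v 2) (v 3) a d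
    - pl (v 0) (v 1) b d * pl (v 2) (v 3) a c + pl (v 0) (v 1) c d * pl (v 2) (v 3) a b"
  unfolding dx_4 dx_3 dx_2 dx_1 pl_def by algebra

lemma Phi0_cp: "Phi0 v = cp (v 0) (v 1) (v 2) \<bullet> v 3"
  unfolding Phi0_def plus_fun_def fun_diff_def dx_4_pl inner_8 cp_nth pl_def by algebra

lemma phi0_cp: "phi0 v = cp (axis 0 1) (v 0) (v 1) \<bullet> v 2"
  by (simp add: phi0_def interior_def Phi0_cp eval_nat_numeral)

lemma vec_eq_8I: "u = v" if "u $ 0 = v $ 0" "u $ 1 = v $ 1" "u $ 2 = v $ 2" "u $ 3 = v $ 3"
    "u $ 4 = v $ 4" "u $ 5 = v $ 5" "u $ 6 = v $ 6" "u $ 7 = v $ 7" for u v :: "real ^ 8"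
  using that by (simp add: vec_eq_iff all_8)

lemma cp_linear:
  "cp (u + u') v w = cp u v w + cp u' v w" "cp u (v + v') w = cp u v w + cp u v' w"
  "cp u v (w + w') = cp u v w + cp u v w'"
  "cp (r *\<^sub>R u) v w = r *\<^sub>R cp u v w" "cp u (r *\<^sub>R v) w = r *\<^sub>R cp u v w" "cp u v (r *\<^sub>R w) = r *\<^sub>R cp u v w"
  by (rule vec_eq_8I;
      unfold cp_nth pl_def vector_add_component vector_scaleR_component real_scaleR_def; algebra)+

lemma cp_alternating:
  "cp u u w = 0" "cp u w u = 0" "cp w u u = 0"
  by (rule vec_eq_8I; unfold cp_nth pl_def zero_index; algebra)+

lemma cp_inner_swap: "cp u v w \<bullet> x = - (cp u v x \<bullet> w)"
  unfolding inner_8 cp_nth pl_def by algebra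

lemma cp_inner_zero: "cp u v w \<bullet> u = 0" "cp u v w \<bullet> v = 0" "cp u v w \<bullet> w = 0"
  unfolding inner_8 cp_nth pl_def by algebra+

lemma cp_minus: "cp u v (- w) = - cp u v w"
  using cp_linear(6)[of u v "-1" w] by simp

text \<open>The inner product of the bivectors u wedge v and u wedge w.\<close>

definition gram :: "real ^ 8 \<Rightarrow> real ^ 8 \<Rightarrow> real ^ 8 \<Rightarrow> real" where
  "gram u v w = (u \<bullet> u) * (v \<bullet> w) - (u \<bullet> v) * (u \<bullet> w)"

text \<open>For orthonormal \<open>u\<close>, \<open>v\<close> the map \<open>cp u v\<close> is a
  complex structure on the orthogonal complement of their plane; this is the homogeneous form of
  that fact, a polynomial identity in the components.\<close>

lemma cp_cp:
  "cp u v (cp u v w) = (- gram u v v) *\<^sub>R w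
      + ((u \<bullet> w) * (v \<bullet> v) - (v \<bullet> w) * (u \<bullet> v)) *\<^sub>R u + ((v \<bullet> w) * (u \<bullet> u) - (u \<bullet> w) * (u \<bullet> v)) *\<^sub>R v"
  by (rule vec_eq_8I; unfold cp_nth vector_add_component vector_scaleR_component inner_8 pl_def
      real_scaleR_def gram_def; algebra)

text \<open>Polarisation of \<open>cp_cp\<close> in its second argument.\<close>

lemma cp_cp_polar:
  "cp u v (cp u x w) + cp u x (cp u v w) = (- 2 * gram u v x) *\<^sub>R w
      + (2 * (u \<bullet> w) * (v \<bullet> x) - (v \<bullet> w) * (u \<bullet> x) - (x \<bullet> w) * (u \<bullet> v)) *\<^sub>R u
      + ((x \<bullet> w) * (u \<bullet> u) - (u \<bullet> w) * (u \<bullet> x)) *\<^sub>R v + ((v \<bullet> w) * (u \<bullet> u) - (u \<bullet> w) * (u \<bullet> v)) *\<^sub>R x"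
proof -
  have "cp u v (cp u x w) + cp u x (cp u v w)
      = cp u (v + x) (cp u (v + x) w) - cp u v (cp u v w) - cp u x (cp u x w)"
    by (simp add: cp_linear)
  then show ?thesis
    by (simp add: cp_cp gram_def inner_add_left inner_add_right inner_commute algebra_simps)
qed

lemma cp_norm:
  assumes "u \<bullet> v = 0" "u \<bullet> w = 0" "v \<bullet> w = 0"
  shows "cp u v w \<bullet> cp u v w = (u \<bullet> u) * (v \<bullet> v) * (w \<bullet> w)"
  using cp_inner_swap[of u v w "cp u v w"] assms by (simp add: cp_cp gram_def)

lemma perp_exists:
  fixes S :: "(real ^ 8) set"
  assumes "finite S" "card S < 8"
  obtains a where "a \<noteq> 0" "\<And>s. s \<in> S \<Longrightarrow> a \<bullet> s = 0"
proof -
  have "dim S < DIM(real ^ 8)" using dim_le_card'[OF assms(1)] assms(2) by simp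
  then show ?thesis
    using orthogonal_to_subspace_exists[of S] that by (metis orthogonal_def span_base)
qed

text \<open>For an orthonormal triple \<open>v, x, y\<close> the equation \<open>v \<times> (x + i y) \<times> w = 0\<close> has a solution \<open>w = a + i b\<close>
  outside the complex span of \<open>v\<close> and \<open>x + i y\<close>; by \<open>cp_cp\<close> this is only possible if \<open>x + i y\<close> is isotropic
  modulo \<open>v\<close>, and the condition is invariant under \<open>F\<close>.\<close>
lemma gram_eq_0:
  assumes F: "linear F" "bij F"
    and inv: "\<And>x y z. cp (F v) (F x) (F y) \<bullet> F z = cp v x y \<bullet> z"
    and on: "v \<bullet> v = 1" "x \<bullet> x = 1" "y \<bullet> y = 1" "v \<bullet> x = 0" "v \<bullet> y = 0" "x \<bullet> y = 0"
  shows "gram (F v) (F x) (F y) = 0"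
proof -
  \<comment> \<open>Orthogonality to \<open>cp v x y\<close> is what makes
    \<open>w = cp v x a\<close> orthogonal to \<open>y\<close>.\<close>
  obtain a where a: "a \<noteq> 0" "a \<bullet> v = 0" "a \<bullet> x = 0" "a \<bullet> y = 0" "a \<bullet> cp v x y = 0"
  proof (rule perp_exists[of "{v, x, y, cp v x y}"])
    show "card {v, x, y, cp v x y} < 8" using card_length[of "[v, x, y, cp v x y]"] by simp
  qed (use that in auto)
  define w where "w = cp v x a"
  \<comment> \<open>Since \<open>cp v y\<close> squares to -1 on \<open>w\<close>, this
    \<open>b\<close> solves \<open>cp v y b = w\<close>. The facts \<open>b1\<close> and
    \<open>b2\<close> are the real and the imaginary part of the equation to be solved by
    \<open>a + i b\<close>.\<close>
  define b where "b = - cp v y w"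
  have w0: "v \<bullet> w = 0" "x \<bullet> w = 0" "y \<bullet> w = 0"
    using cp_inner_zero[of v x a] cp_inner_swap[of v x a y] a(5) by (simp_all add: w_def inner_commute)
  have b1: "cp v y b = cp v x a"
    using on w0 by (simp add: b_def cp_minus cp_cp gram_def flip: w_def)
  have c1: "cp v x w = - a"
    using on a by (simp add: w_def cp_cp gram_def inner_commute)
  have "cp v x (cp v y w) + cp v y (cp v x w) = 0"
    using on w0 by (simp add: cp_cp_polar gram_def)
  then have c2: "cp v x (cp v y w) = - cp v y (cp v x w)"
    by (simp add: eq_neg_iff_add_eq_0)
  have b2: "cp v x b = - cp v y a"
    by (simp add: b_def cp_minus c1 c2)
  define V X Y A B where "V = F v" and "X = F x" and "Y = F y" and "A = F a" and "B = F b"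
  \<comment> \<open>The invariance controls cross products of images only through their pairing with
    a further image; as \<open>F\<close> is onto, this determines the vectors.\<close>
  have ext: "u = u'" if "\<And>z. u \<bullet> F z = u' \<bullet> F z" for u u'
  proof -
    obtain z where "F z = u - u'" using F(2) by (metis bij_pointE)
    then have "(u - u') \<bullet> (u - u') = 0" using that[of z] by (simp add: inner_diff_left)
    then show ?thesis by simp
  qed
  have E1: "cp V Y B = cp V X A" unfolding V_def X_def Y_def A_def B_def
    by (rule ext) (simp add: inv b1)
  have E2: "cp V X B = - cp V Y A" unfolding V_def X_def Y_def A_def B_def
    by (rule ext) (simp add: inv b2)
  \<comment> \<open>\<open>p + i q\<close> is the complex bilinear extension of
    \<open>gram V\<close> on the pair \<open>X + i Y\<close>, \<open>X + i Y\<close>. Its vanishing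
    is the goal.\<close>
  define p q where "p = gram V X X - gram V Y Y" and "q = 2 * gram V X Y"
  define sp where "sp = span {V, X, Y}"
  have VXY: "r *\<^sub>R V \<in> sp" "r *\<^sub>R X \<in> sp" "r *\<^sub>R Y \<in> sp" for r
    unfolding sp_def by (rule span_scale, rule span_base, simp)+
  have add: "u + u' \<in> sp" if "u \<in> sp" "u' \<in> sp" for u u'
    using that by (simp add: sp_def span_add)
  have scale: "r *\<^sub>R u \<in> sp" if "u \<in> sp" for r u
    using that by (simp add: sp_def span_scale)
  have cc1: "cp V X (cp V X u) + gram V X X *\<^sub>R u \<in> sp" for u
  proof -
    have "cp V X (cp V X u) + gram V X X *\<^sub>R u
        = ((V \<bullet> u) * (X \<bullet> X) - (X \<bullet> u) * (V \<bullet> X)) *\<^sub>R V + ((X \<bullet> u) * (V \<bullet> V) - (V \<bullet> u) * (V \<bullet> X)) *\<^sub>R X"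
      unfolding cp_cp by simp
    then show ?thesis by (simp only: add VXY)
  qed
  have cc2: "cp V Y (cp V Y u) + gram V Y Y *\<^sub>R u \<in> sp" for u
  proof -
    have "cp V Y (cp V Y u) + gram V Y Y *\<^sub>R u
        = ((V \<bullet> u) * (Y \<bullet> Y) - (Y \<bullet> u) * (V \<bullet> Y)) *\<^sub>R V + ((Y \<bullet> u) * (V \<bullet> V) - (V \<bullet> u) * (V \<bullet> Y)) *\<^sub>R Y"
      unfolding cp_cp by simp
    then show ?thesis by (simp only: add VXY)
  qed
  have cc3: "cp V X (cp V Y u) + cp V Y (cp V X u) + q *\<^sub>R u \<in> sp" for u
  proof -
    have "cp V X (cp V Y u) + cp V Y (cp V X u) + q *\<^sub>R u
        = (2 * (V \<bullet> u) * (X \<bullet> Y) - (X \<bullet> u) * (V \<bullet> Y) - (Y \<bullet> u) * (V \<bullet> X)) *\<^sub>R V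
        + ((Y \<bullet> u) * (V \<bullet> V) - (V \<bullet> u) * (V \<bullet> Y)) *\<^sub>R X + ((X \<bullet> u) * (V \<bullet> V) - (V \<bullet> u) * (V \<bullet> X)) *\<^sub>R Y"
      unfolding cp_cp_polar q_def by simp
    then show ?thesis by (simp only: add VXY)
  qed
  \<comment> \<open>Crossing the transported equation once more with \<open>V\<close> and
    \<open>X + i Y\<close> leaves (p + i q)(A + i B) in the complex span of \<open>V, X, Y\<close>.
    \<open>S1\<close> and \<open>S2\<close> are its real and imaginary part.\<close>
  have S1: "p *\<^sub>R A - q *\<^sub>R B \<in> sp"
  proof -
    have "p *\<^sub>R A - q *\<^sub>R B = (cp V X (cp V X A) + gram V X X *\<^sub>R A)
        + ((-1) *\<^sub>R (cp V Y (cp V Y A) + gram V Y Y *\<^sub>R A)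
        + (-1) *\<^sub>R (cp V X (cp V Y B) + cp V Y (cp V X B) + q *\<^sub>R B))"
      using E1 E2 by (simp add: p_def cp_minus algebra_simps)
    then show ?thesis by (simp only: add scale cc1 cc2 cc3)
  qed
  have S2: "p *\<^sub>R B + q *\<^sub>R A \<in> sp"
  proof -
    have YB: "cp V Y A = - cp V X B" using E2 by simp
    have "p *\<^sub>R B + q *\<^sub>R A = (cp V X (cp V X B) + gram V X X *\<^sub>R B)
        + ((-1) *\<^sub>R (cp V Y (cp V Y B) + gram V Y Y *\<^sub>R B)
        + (cp V X (cp V Y A) + cp V Y (cp V X A) + q *\<^sub>R A))"
      using E1 YB by (simp add: p_def cp_minus algebra_simps)
    then show ?thesis by (simp only: add scale cc1 cc2 cc3)
  qed
  \<comment> \<open>Multiplying by \<open>p - i q\<close> isolates a multiple of \<open>A\<close>.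
    Pulled back by \<open>F\<close> it lies in the span of \<open>v, x, y\<close>, to which
    \<open>a\<close> is orthogonal.\<close>
  have "p *\<^sub>R (p *\<^sub>R A - q *\<^sub>R B) + q *\<^sub>R (p *\<^sub>R B + q *\<^sub>R A) \<in> sp"
    by (simp only: add scale S1 S2)
  moreover have "p *\<^sub>R (p *\<^sub>R A - q *\<^sub>R B) + q *\<^sub>R (p *\<^sub>R B + q *\<^sub>R A) = F ((p * p + q * q) *\<^sub>R a)"
    by (simp add: linear_scale[OF F(1)] linear_add[OF F(1)] A_def algebra_simps)
  moreover have "sp = F ` span {v, x, y}"
    using linear_span_image[OF F(1), of "{v, x, y}"] by (simp add: sp_def V_def X_def Y_def)
  ultimately obtain t where t: "t \<in> span {v, x, y}" "F ((p * p + q * q) *\<^sub>R a) = F t"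
    by auto
  then have t': "(p * p + q * q) *\<^sub>R a = t"
    using F(2) by (simp add: bij_def inj_eq)
  have "orthogonal a t"
    using t(1) by (rule orthogonal_to_span) (use a in \<open>auto simp: orthogonal_def\<close>)
  then have "(p * p + q * q) * (a \<bullet> a) = 0" by (simp add: orthogonal_def flip: t')
  then have "p * p + q * q = 0" using a(1) by simp
  then have "q = 0" using sum_squares_eq_zero_iff[of p q] by blast
  then show ?thesis by (simp add: q_def V_def X_def Y_def)
qed

text \<open>If \<open>x\<close> and \<open>y\<close> have equal length, then x + y and x - y are
  orthogonal; since their images are orthogonal too, \<open>F x\<close> and \<open>F y\<close> have
  equal length. So all lengths are scaled by one factor, and polarisation gives inner
  products.\<close>

lemma conformal:
  fixes F :: "real ^ 8 \<Rightarrow> real ^ 8"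
  assumes F: "linear F" and W: "subspace W" "e \<in> W" "e \<bullet> e = 1"
    and H: "\<And>x y. x \<in> W \<Longrightarrow> y \<in> W \<Longrightarrow> x \<bullet> x = 1 \<Longrightarrow> y \<bullet> y = 1 \<Longrightarrow> x \<bullet> y = 0 \<Longrightarrow> F x \<bullet> F y = 0"
    and xy: "x \<in> W" "y \<in> W"
  shows "F x \<bullet> F y = (F e \<bullet> F e) * (x \<bullet> y)"
proof -
  note lin = linear_add[OF F] linear_diff[OF F] linear_scale[OF F]
  have orth: "F x \<bullet> F y = 0" if "x \<in> W" "y \<in> W" "x \<bullet> y = 0" for x y
  proof (cases "x = 0 \<or> y = 0")
    case True
    then show ?thesis using linear_0[OF F] by auto
  next
    case False
    have "F ((1 / norm x) *\<^sub>R x) \<bullet> F ((1 / norm y) *\<^sub>R y) = 0"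
      using that False subspace_scale[OF W(1)]
      by (intro H) (simp_all add: dot_square_norm power2_eq_square)
    then show ?thesis using False by (simp add: lin)
  qed
  have eq: "F x \<bullet> F x = F y \<bullet> F y" if "x \<in> W" "y \<in> W" "x \<bullet> x = y \<bullet> y" for x y
  proof -
    have "(x + y) \<bullet> (x - y) = 0"
      by (simp add: inner_add_left inner_diff_right inner_commute[of y x] that(3))
    then have "F (x + y) \<bullet> F (x - y) = 0"
      using that W(1) by (intro orth subspace_add subspace_diff)
    then show ?thesis
      by (simp add: lin inner_add_left inner_diff_right inner_commute[of "F y" "F x"])
  qed
  have sq: "F x \<bullet> F x = (F e \<bullet> F e) * (x \<bullet> x)" if "x \<in> W" for x
  proof -
    have "F x \<bullet> F x = F (norm x *\<^sub>R e) \<bullet> F (norm x *\<^sub>R e)"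
      using that W by (intro eq subspace_scale) (simp_all add: dot_square_norm power2_eq_square)
    then show ?thesis by (simp add: lin dot_square_norm power2_eq_square)
  qed
  show ?thesis
    using sq[of "x + y"] sq[of x] sq[of y] xy subspace_add[OF W(1)]
    by (simp add: lin inner_add_left inner_add_right inner_commute algebra_simps)
qed

lemma inner_axis_8: "axis (i::8) (1::real) \<bullet> axis j 1 = (if i = j then 1 else 0)"
  by (simp add: inner_axis_axis)

text \<open>The adjoint of a conformal \<open>F\<close> is \<open>l\<close> times its inverse, so
  the vector that the adjoint sends to \<open>c\<close> is \<open>F c\<close> divided by
  \<open>l\<close>.\<close>

lemma inverse_scale_F:
  fixes F :: "real ^ 8 \<Rightarrow> real ^ 8"
  assumes "bij F" "l \<noteq> 0" "\<And>z. F c \<bullet> F z = l * (c \<bullet> z)" "\<And>z. u \<bullet> F z = c \<bullet> z"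
  shows "l *\<^sub>R u = F c"
proof -
  obtain z where z: "F z = l *\<^sub>R u - F c" using assms(1) by (metis bij_pointE)
  have "(l *\<^sub>R u - F c) \<bullet> F z = 0" using assms(3)[of z] assms(4)[of z] by (simp add: inner_diff_left)
  then show ?thesis using z by simp
qed

text \<open>Applying \<open>gram_eq_0\<close> to an orthonormal triple in two orders rules out a
  nonzero \<open>F x \<bullet> F y\<close>, so \<open>F\<close> is conformal with factor
  \<open>l\<close>. Comparing the lengths of a cross product of three orthonormal vectors before and
  after \<open>F\<close> leaves \<open>l ^ 4 = 1\<close>.\<close>

lemma stabiliser_Phi0:
  fixes F :: "real ^ 8 \<Rightarrow> real ^ 8"
  assumes F: "linear F" "bij F"
    and inv: "\<And>v x y z. cp (F v) (F x) (F y) \<bullet> F z = cp v x y \<bullet> z"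
  shows "F x \<bullet> F y = x \<bullet> y"
proof -
  have inj: "F x \<noteq> 0" if "x \<noteq> 0" for x
    using F that by (metis bij_def inj_eq linear_0)
  have orth: "F x \<bullet> F y = 0" if on: "x \<bullet> x = 1" "y \<bullet> y = 1" "x \<bullet> y = 0" for x y
  proof (rule ccontr)
    assume r: "F x \<bullet> F y \<noteq> 0"
    obtain v' where v': "v' \<noteq> 0" "v' \<bullet> x = 0" "v' \<bullet> y = 0"
      by (rule perp_exists[of "{x, y}"]) (use card_length[of "[x, y]"] in auto)
    define v where "v = (1 / norm v') *\<^sub>R v'"
    have v: "v \<bullet> v = 1" "v \<bullet> x = 0" "v \<bullet> y = 0"
      using v' by (simp_all add: v_def dot_square_norm power2_eq_square)
    define A B C p q r where "A = F v \<bullet> F v" and "B = F x \<bullet> F x" and "C = F y \<bullet> F y"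
      and "p = F v \<bullet> F x" and "q = F v \<bullet> F y" and "r = F x \<bullet> F y"
    have Fv: "F v \<noteq> 0" using inj[of v] v(1) by (metis inner_zero_left zero_neq_one)
    have "A * r = p * q" "B * q = p * r"
      using gram_eq_0[OF F inv, of v x y] gram_eq_0[OF F inv, of x v y] v on
      by (simp_all add: gram_def A_def B_def p_def q_def r_def inner_commute)
    moreover have "A > 0"
      using Fv by (simp add: A_def)
    ultimately have "p * q \<noteq> 0" "A * B * (r * q) = p * p * (r * q)" using r
      by (auto simp: r_def, algebra)
    then have "A * B = p * p" using r by (simp add: r_def)
    \<comment> \<open>Equality in the Cauchy-Schwarz inequality makes \<open>F v\<close> and
      \<open>F x\<close> dependent; \<open>z\<close> is the combination that \<open>F\<close> would
      annihilate.\<close>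
    define z where "z = A *\<^sub>R x - p *\<^sub>R v"
    have "F z \<bullet> F z = A * (A * B - p * p)"
      by (simp add: z_def linear_diff[OF F(1)] linear_scale[OF F(1)] inner_diff_left inner_diff_right
          A_def B_def p_def inner_commute algebra_simps)
    then have "z = 0" using \<open>A * B = p * p\<close> inj[of z] by auto
    then have "x \<bullet> z = 0" by simp
    then show False using on v \<open>A > 0\<close> by (simp add: z_def inner_diff_right inner_commute)
  qed
  define l where "l = F (axis 0 1) \<bullet> F (axis 0 1)"
  have conf: "F x \<bullet> F y = l * (x \<bullet> y)" for x y
    unfolding l_def
    by (rule conformal[OF F(1) subspace_UNIV]) (use orth in \<open>auto simp: inner_axis_8\<close>)
  have l: "l > 0" using inj[of "axis 0 1"] by (simp add: l_def)
  define u where "u = cp (F (axis 0 1)) (F (axis 1 1)) (F (axis 2 1))"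
  define c where "c = cp (axis 0 1) (axis 1 1) (axis 2 1)"
  have "l *\<^sub>R u = F c" by (rule inverse_scale_F[OF F(2)]) (use l conf inv in \<open>auto simp: u_def c_def\<close>)
  then have "(l *\<^sub>R u) \<bullet> (l *\<^sub>R u) = l * (c \<bullet> c)" using conf by simp
  moreover have "u \<bullet> u = l * l * l" unfolding u_def
    by (subst cp_norm) (simp_all add: conf inner_axis_8)
  moreover have "c \<bullet> c = 1" unfolding c_def
    by (subst cp_norm) (simp_all add: inner_axis_8)
  ultimately have "l ^ 4 = 1" using l by (simp add: power4_eq_xxxx)
  then have "l = 1" using l by (metis power_eq_1_iff less_eq_real_def real_norm_def abs_of_pos zero_neq_numeral)
  then show ?thesis using conf by simp
qed

text \<open>Here the fixed vector \<open>axis 0 1\<close> takes the role of \<open>v\<close> in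
  \<open>gram_eq_0\<close>. As it is orthogonal to \<open>R7\<close>, the Gram expression is the
  plain inner product of \<open>F x\<close> and \<open>F y\<close>, and the length of a cross
  product of two vectors leaves \<open>l ^ 3 = 1\<close>.\<close>

lemma stabiliser_phi0:
  fixes F :: "real ^ 8 \<Rightarrow> real ^ 8"
  assumes F: "linear F" "bij F" "F (axis 0 1) = axis 0 1" "F ` R7 \<subseteq> R7"
    and inv: "\<And>x y z. x \<in> R7 \<Longrightarrow> y \<in> R7 \<Longrightarrow> z \<in> R7 \<Longrightarrow>
        cp (axis 0 1) (F x) (F y) \<bullet> F z = cp (axis 0 1) x y \<bullet> z"
    and xy: "x \<in> R7" "y \<in> R7"
  shows "F x \<bullet> F y = x \<bullet> y"
proof -
  let ?e = "axis 0 1 :: real ^ 8"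
  have e_R7: "?e \<bullet> x = 0" if "x \<in> R7" for x
    using that by (simp add: R7_def inner_axis' )
  have split: "\<exists>x'\<in>R7. x = x $ 0 *\<^sub>R ?e + x'" for x
    by (rule bexI[of _ "x - x $ 0 *\<^sub>R ?e"]) (simp_all add: R7_def)
  have inv': "cp (F ?e) (F x) (F y) \<bullet> F z = cp ?e x y \<bullet> z" for x y z
  proof -
    obtain x' y' z' where *: "x' \<in> R7" "x = x $ 0 *\<^sub>R ?e + x'" "y' \<in> R7" "y = y $ 0 *\<^sub>R ?e + y'"
      "z' \<in> R7" "z = z $ 0 *\<^sub>R ?e + z'" using split by metis
    have red: "cp ?e (r *\<^sub>R ?e + X) (s *\<^sub>R ?e + Y) \<bullet> (t *\<^sub>R ?e + Z) = cp ?e X Y \<bullet> Z" for r s t X Y Z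
      using cp_inner_zero(1)[of ?e X Y] by (simp add: cp_linear cp_alternating inner_add_right)
    have "cp (F ?e) (F x) (F y) \<bullet> F z
        = cp ?e (x $ 0 *\<^sub>R ?e + F x') (y $ 0 *\<^sub>R ?e + F y') \<bullet> (z $ 0 *\<^sub>R ?e + F z')"
      by (subst *(2), subst *(4), subst *(6)) (simp only: linear_add[OF F(1)] linear_scale[OF F(1)] F(3))
    also have "\<dots> = cp ?e x' y' \<bullet> z'" using * by (simp add: red inv)
    also have "\<dots> = cp ?e (x $ 0 *\<^sub>R ?e + x') (y $ 0 *\<^sub>R ?e + y') \<bullet> (z $ 0 *\<^sub>R ?e + z')" by (simp add: red)
    also have "\<dots> = cp ?e x y \<bullet> z" using * by metis
    finally show ?thesis .
  qed
  have sub: "subspace R7" by (auto simp: R7_def subspace_def)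
  have orth: "F x \<bullet> F y = 0" if "x \<in> R7" "y \<in> R7" "x \<bullet> x = 1" "y \<bullet> y = 1" "x \<bullet> y = 0" for x y
  proof -
    have "F x \<in> R7" "F y \<in> R7" using F(4) that by auto
    then show ?thesis
      using gram_eq_0[OF F(1,2) inv', of x y] that e_R7 by (simp add: gram_def F(3) inner_axis_8)
  qed
  define l where "l = F (axis 1 1) \<bullet> F (axis 1 1)"
  have ax: "axis 1 1 \<in> R7" "axis 2 1 \<in> R7" by (simp_all add: R7_def axis_nth_8)
  have conf: "F x \<bullet> F y = l * (x \<bullet> y)" if "x \<in> R7" "y \<in> R7" for x y
    unfolding l_def
    by (rule conformal[OF F(1) sub]) (use orth that ax in \<open>auto simp: inner_axis_8\<close>)
  have l: "l > 0" using F(1,2) by (auto simp: l_def bij_def linear_injective_0 axis_eq_0_iff)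
  define u where "u = cp ?e (F (axis 1 1)) (F (axis 2 1))"
  define c where "c = cp ?e (axis 1 1) (axis 2 1)"
  have uc: "u \<in> R7" "c \<in> R7"
    using cp_inner_zero(1)[of ?e] by (simp_all add: u_def c_def R7_def inner_axis)
  have "l *\<^sub>R u = F c"
  proof -
    have mem: "l *\<^sub>R u - F c \<in> R7"
      using uc F(4) by (intro subspace_diff[OF sub] subspace_scale[OF sub]) auto
    obtain z where z: "F z = l *\<^sub>R u - F c" using F(2) by (metis bij_pointE)
    obtain z' where z': "z' \<in> R7" "z = z $ 0 *\<^sub>R ?e + z'" using split by metis
    have "F z = z $ 0 *\<^sub>R ?e + F z'"
      by (subst z'(2)) (simp only: linear_add[OF F(1)] linear_scale[OF F(1)] F(3))
    moreover have "F z \<in> R7" "F z' \<in> R7" using z mem z' F(4) by auto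
    ultimately have "F z = F z'" by (simp add: R7_def axis_nth_8)
    then have "(l *\<^sub>R u - F c) \<bullet> F z = 0"
      using conf[OF uc(2) z'(1)] inv[OF ax z'(1)] by (simp add: inner_diff_left u_def c_def)
    then show ?thesis using z by simp
  qed
  then have "(l *\<^sub>R u) \<bullet> (l *\<^sub>R u) = l * (c \<bullet> c)" using conf uc by simp
  moreover have "u \<bullet> u = l * l"
    using ax F(4) e_R7 unfolding u_def by (subst cp_norm) (auto simp: conf inner_axis_8 image_subset_iff)
  moreover have "c \<bullet> c = 1" unfolding c_def
    by (subst cp_norm) (simp_all add: inner_axis_8)
  ultimately have "l ^ 3 = 1" using l by (simp add: power3_eq_cube)
  then have "l = 1" using l by (metis power_eq_1_iff less_eq_real_def real_norm_def abs_of_pos zero_neq_numeral)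
  then show ?thesis using conf xy by simp
qed

section \<open>Frames\<close>

abbreviation e0 :: "real ^ 8" where "e0 \<equiv> axis 0 1"

definition quad :: "'t \<Rightarrow> 't \<Rightarrow> 't \<Rightarrow> 't \<Rightarrow> nat \<Rightarrow>
    't" where
  "quad u v w x = (\<lambda>i. if i = 0 then u else if i = 1 then v else if i = 2 then w else x)"

lemma quad_nth [simp]: "quad u v w x 0 = u" "quad u v w x 1 = v" "quad u v w x (Suc 0) = v"
  "quad u v w x 2 = w" "quad u v w x 3 = x"
  by (simp_all add: quad_def)

lemma all_quad: "(\<forall>i. quad u v w x i \<in> T) \<longleftrightarrow> u \<in> T \<and> v \<in> T
    \<and> w \<in> T \<and> x \<in> T"
proof
  assume *: "\<forall>i. quad u v w x i \<in> T"
  show "u \<in> T \<and> v \<in> T \<and> w \<in> T \<and> x \<in> T"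
    using *[rule_format, of 0] *[rule_format, of 1] *[rule_format, of 2] *[rule_format, of 3] by simp
qed (simp add: quad_def)

lemma linear_on_inv:
  assumes T: "subspace T" and f: "linear f" "bij_betw f T U" and xy: "x \<in> U" "y \<in> U" "x + y \<in> U"
  shows "inv_into T f (x + y) = inv_into T f x + inv_into T f y"
proof -
  have "inv_into T f x \<in> T" "inv_into T f y \<in> T" "inv_into T f (x + y) \<in> T"
    using f(2) xy by (metis bij_betw_imp_surj_on inv_into_into)+
  moreover have "f (inv_into T f x) = x" "f (inv_into T f y) = y" "f (inv_into T f (x + y)) = x + y"
    using f(2) xy by (metis bij_betw_inv_into_right)+
  ultimately show ?thesis
    by (intro inj_onD[OF bij_betw_imp_inj_on[OF f(2)]])
      (simp_all add: linear_add[OF f(1)] subspace_add[OF T])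
qed

lemma linear_on_inv_scale:
  assumes T: "subspace T" and f: "linear f" "bij_betw f T U" and x: "x \<in> U" "r *\<^sub>R x \<in> U"
  shows "inv_into T f (r *\<^sub>R x) = r *\<^sub>R inv_into T f x"
proof -
  have "inv_into T f x \<in> T" "inv_into T f (r *\<^sub>R x) \<in> T"
    using f(2) x by (metis bij_betw_imp_surj_on inv_into_into)+
  moreover have "f (inv_into T f x) = x" "f (inv_into T f (r *\<^sub>R x)) = r *\<^sub>R x"
    using f(2) x by (metis bij_betw_inv_into_right)+
  ultimately show ?thesis
    by (intro inj_onD[OF bij_betw_imp_inj_on[OF f(2)]])
      (simp_all add: linear_scale[OF f(1)] subspace_scale[OF T])
qed

text \<open>The change of frame preserves \<open>Phi0\<close>, hence is orthogonal by
  \<open>stabiliser_Phi0\<close>. This removes the choice from \<open>spin7_metric\<close>.\<close>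

lemma spin7_frames_inner:
  assumes T: "subspace T" and f: "spin7_frame T \<Phi> f" and f': "spin7_frame T \<Phi> f'"
    and vw: "v \<in> T" "w \<in> T"
  shows "f v \<bullet> f w = f' v \<bullet> f' w"
proof -
  have f1: "linear f" "bij_betw f T UNIV" "\<And>v. (\<forall>i. v i \<in> T) \<Longrightarrow> \<Phi> v =
    Phi0 (f \<circ> v)"
    using f by (auto simp: spin7_frame_def)
  have f2: "linear f'" "bij_betw f' T UNIV" "\<And>v. (\<forall>i. v i \<in> T) \<Longrightarrow> \<Phi> v =
    Phi0 (f' \<circ> v)"
    using f' by (auto simp: spin7_frame_def)
  define g where "g = inv_into T f'"
  have g: "g x \<in> T" "f' (g x) = x" for x
    using f2(2) by (metis UNIV_I bij_betw_imp_surj_on g_def inv_into_into, metis UNIV_I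
    bij_betw_inv_into_right g_def)
  have gf: "g (f' x) = x" if "x \<in> T" for x
    using f2(2) that by (simp add: g_def bij_betw_inv_into_left)
  have lin: "linear (\<lambda>x. f (g x))"
  proof (rule linearI)
    show "f (g (x + y)) = f (g x) + f (g y)" for x y
      using linear_on_inv[OF T f2(1,2), of x y] linear_add[OF f1(1)] by (simp add: g_def)
    show "f (g (r *\<^sub>R x)) = r *\<^sub>R f (g x)" for r x
      using linear_on_inv_scale[OF T f2(1,2), of x r] linear_scale[OF f1(1)] by (simp add: g_def)
  qed
  have bij: "bij (\<lambda>x. f (g x))"
    using bij_betw_trans[OF bij_betw_inv_into[OF f2(2)] f1(2)] by (simp add: g_def o_def)
  have "cp (f (g v)) (f (g x)) (f (g y)) \<bullet> f (g z) = cp v x y \<bullet> z" for v x y z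
    using f1(3)[of "quad (g v) (g x) (g y) (g z)"] f2(3)[of "quad (g v) (g x) (g y) (g z)"] g
    by (simp add: all_quad Phi0_cp)
  from stabiliser_Phi0[OF lin bij this, of "f' v" "f' w"] show ?thesis
    using gf vw by simp
qed

lemma spin7_metric_frame:
  assumes "subspace T" "spin7_frame T \<Phi> f" "v \<in> T" "w \<in> T"
  shows "spin7_metric T \<Phi> v w = f v \<bullet> f w"
  unfolding spin7_metric_def Let_def
  by (rule spin7_frames_inner[OF assms(1) someI[of "spin7_frame T \<Phi>", OF assms(2)] assms(2-)])

lemma g2_frames_inner:
  assumes T: "subspace T" and f: "g2_frame T \<phi> f" and f': "g2_frame T \<phi> f'"
    and vw: "v \<in> T" "w \<in> T"
  shows "f v \<bullet> f w = f' v \<bullet> f' w"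
proof -
  have f1: "linear f" "bij_betw f T R7" "\<And>v. (\<forall>i. v i \<in> T) \<Longrightarrow> \<phi> v =
    phi0 (f \<circ> v)"
    using f by (auto simp: g2_frame_def)
  have f2: "linear f'" "bij_betw f' T R7" "\<And>v. (\<forall>i. v i \<in> T) \<Longrightarrow> \<phi> v =
    phi0 (f' \<circ> v)"
    using f' by (auto simp: g2_frame_def)
  have R7: "subspace R7" by (auto simp: R7_def subspace_def)
  define g where "g = inv_into T f'"
  have g: "g x \<in> T" "f' (g x) = x" if "x \<in> R7" for x
    using f2(2) that by (metis bij_betw_imp_surj_on g_def inv_into_into, metis bij_betw_inv_into_right g_def)
  have gf: "g (f' x) = x" if "x \<in> T" for x
    using f2(2) that by (simp add: g_def bij_betw_inv_into_left)
  have fR7: "f x \<in> R7" "f' x \<in> R7" if "x \<in> T" for x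
    using f1(2) f2(2) that by (auto simp: bij_betw_def)
  define h where "h = (\<lambda>x. x - x $ 0 *\<^sub>R e0 :: real ^ 8)"
  have h: "h x \<in> R7" "h (x + y) = h x + h y" "h (r *\<^sub>R x) = r *\<^sub>R h x" for x y r
    by (simp_all add: h_def R7_def axis_nth_8 algebra_simps)
  \<comment> \<open>The change of frame lives on \<open>R7\<close> only; extended by fixing
    \<open>e0\<close> it becomes an endomorphism of R8, as \<open>stabiliser_phi0\<close>
    expects.\<close>
  define F where "F = (\<lambda>x. x $ 0 *\<^sub>R e0 + f (g (h x)))"
  have lin: "linear F"
  proof (rule linearI)
    show "F (x + y) = F x + F y" for x y
      using linear_on_inv[OF T f2(1,2), of "h x" "h y"] linear_add[OF f1(1)] subspace_add[OF R7] h
      by (simp add: F_def g_def scaleR_add_left)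
    show "F (r *\<^sub>R x) = r *\<^sub>R F x" for r x
      using linear_on_inv_scale[OF T f2(1,2), of "h x" r] linear_scale[OF f1(1)] subspace_scale[OF R7] h
      by (simp add: F_def g_def scaleR_add_right)
  qed
  have F_R7: "F x = f (g x)" if "x \<in> R7" for x
    using that by (simp add: F_def h_def R7_def)
  have inj: "inj F"
  proof -
    have "x = 0" if "F x = 0" for x
    proof -
      have "F x $ 0 = x $ 0"
        using fR7(1)[OF g(1)[OF h(1)], of x] by (simp add: F_def R7_def axis_nth_8)
      then have "x \<in> R7" using that by (simp add: R7_def)
      then have "f (g x) = f 0" "g x \<in> T" using that F_R7 g linear_0[OF f1(1)] by auto
      then have "g x = 0" using f1(2) subspace_0[OF T] by (metis bij_betw_imp_inj_on inj_onD)
      then show ?thesis using g(2)[OF \<open>x \<in> R7\<close>] linear_0[OF f2(1)] by simp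
    qed
    then show ?thesis by (simp add: linear_injective_0[OF lin])
  qed
  have bij: "bij F" using inj linear_inj_imp_surj[OF lin inj] by (simp add: bij_def)
  have Fe: "F e0 = e0"
  proof -
    have "h e0 = 0" by (simp add: h_def axis_nth_8)
    moreover have "g 0 = 0"
      using gf[OF subspace_0[OF T]] linear_0[OF f2(1)] by simp
    ultimately show ?thesis using linear_0[OF f1(1)] by (simp add: F_def axis_nth_8)
  qed
  have "cp e0 (F x) (F y) \<bullet> F z = cp e0 x y \<bullet> z" if "x \<in> R7" "y \<in> R7" "z \<in> R7"
    for x y z
    using f1(3)[of "quad (g x) (g y) (g z) (g z)"] f2(3)[of "quad (g x) (g y) (g z) (g z)"] g that
    by (simp add: all_quad phi0_cp F_R7)
  from stabiliser_phi0[OF lin bij Fe _ this, of "f' v" "f' w"]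
  have "F (f' v) \<bullet> F (f' w) = f' v \<bullet> f' w"
    using fR7 vw g(1) F_R7 by auto
  then show ?thesis using vw fR7 gf F_R7 by simp
qed

section \<open>The Hodge dual of the model form\<close>

text \<open>The seven terms of \<open>Phi0\<close> that do not contain dx0, so that
  \<open>Phi0\<close> is dx0 wedge \<open>phi0\<close> plus \<open>psi0\<close>.\<close>

definition psi0 :: "(nat \<Rightarrow> real ^ 8) \<Rightarrow> real" where
  "psi0 = dx [2,3,4,5] + dx [2,3,6,7] + dx [4,5,6,7] - dx [1,2,4,7] - dx [1,2,5,6]
        - dx [1,3,4,6] + dx [1,3,5,7]"

lemma phi0_expand: "cp e0 x y \<bullet> z = x $ 1 * y $ 2 * z $ 3 - x $ 1 * y $ 3 * z $ 2 + x $ 1 * y $ 4 *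
    z $ 5 - x $ 1 * y $ 5 * z $ 4 + x $ 1 * y $ 6 * z $ 7 - x $ 1 * y $ 7 * z $ 6 - x $ 2 * y $ 1 * z $ 3 +
    x $ 2 * y $ 3 * z $ 1 + x $ 2 * y $ 4 * z $ 6 - x $ 2 * y $ 5 * z $ 7 - x $ 2 * y $ 6 * z $ 4 + x $ 2 *
    y $ 7 * z $ 5 + x $ 3 * y $ 1 * z $ 2 - x $ 3 * y $ 2 * z $ 1 - x $ 3 * y $ 4 * z $ 7 - x $ 3 * y $ 5 *
    z $ 6 + x $ 3 * y $ 6 * z $ 5 + x $ 3 * y $ 7 * z $ 4 - x $ 4 * y $ 1 * z $ 5 - x $ 4 * y $ 2 * z $ 6 +
    x $ 4 * y $ 3 * z $ 7 + x $ 4 * y $ 5 * z $ 1 + x $ 4 * y $ 6 * z $ 2 - x $ 4 * y $ 7 * z $ 3 + x $ 5 *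
    y $ 1 * z $ 4 + x $ 5 * y $ 2 * z $ 7 + x $ 5 * y $ 3 * z $ 6 - x $ 5 * y $ 4 * z $ 1 - x $ 5 * y $ 6 *
    z $ 3 - x $ 5 * y $ 7 * z $ 2 - x $ 6 * y $ 1 * z $ 7 + x $ 6 * y $ 2 * z $ 4 - x $ 6 * y $ 3 * z $ 5 -
    x $ 6 * y $ 4 * z $ 2 + x $ 6 * y $ 5 * z $ 3 + x $ 6 * y $ 7 * z $ 1 + x $ 7 * y $ 1 * z $ 6 - x $ 7 *
    y $ 2 * z $ 5 - x $ 7 * y $ 3 * z $ 4 + x $ 7 * y $ 4 * z $ 3 + x $ 7 * y $ 5 * z $ 2 - x $ 7 * y $ 6 *
    z $ 1"
  unfolding inner_8 cp_nth pl_def by (simp add: axis_nth_8) algebra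

lemma cross_nth:
  "cp e0 x y $ 0 = 0" "cp e0 x y $ 1 = pl x y 2 3 + pl x y 4 5 + pl x y 6 7"
  "cp e0 x y $ 2 = - pl x y 1 3 + pl x y 4 6 - pl x y 5 7"
  "cp e0 x y $ 3 = pl x y 1 2 - pl x y 4 7 - pl x y 5 6"
  "cp e0 x y $ 4 = - pl x y 1 5 - pl x y 2 6 + pl x y 3 7"
  "cp e0 x y $ 5 = pl x y 1 4 + pl x y 2 7 + pl x y 3 6"
  "cp e0 x y $ 6 = - pl x y 1 7 + pl x y 2 4 - pl x y 3 5"
  "cp e0 x y $ 7 = pl x y 1 6 - pl x y 2 5 - pl x y 3 4"
  by (simp_all add: cp_nth pl_def axis_nth_8 algebra_simps)

lemma cross_R7: "cp e0 x y \<in> R7"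
  by (simp add: R7_def cross_nth)

text \<open>Reduces \<open>psi0\<close> to the cross product and the inner product of R7, both of
  which are already determined by the 3-form.\<close>

lemma psi0_cp:
  assumes "v 0 \<in> R7" "v 1 \<in> R7" "v 2 \<in> R7" "v 3 \<in> R7"
  shows "psi0 v = - (cp e0 (v 0) (cp e0 (v 1) (v 2)) \<bullet> v 3)
    - ((v 0 \<bullet> v 1) * (v 2 \<bullet> v 3) - (v 0 \<bullet> v 2) * (v 1 \<bullet> v 3))"
proof -
  have "v 0 $ 0 = 0" "v 1 $ 0 = 0" "v 2 $ 0 = 0" "v 3 $ 0 = 0"
    using assms by (auto simp: R7_def)
  then show ?thesis
    unfolding psi0_def plus_fun_def fun_diff_def dx_4_pl inner_8 cross_nth pl_def by algebra
qed

lemma psi0_frame_independent: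
  assumes T: "subspace T" and f: "g2_frame T \<phi> f" and f': "g2_frame T \<phi> f'"
    and v: "\<And>i. v i \<in> T"
  shows "psi0 (f \<circ> v) = psi0 (f' \<circ> v)"
proof -
  have f1: "bij_betw f T R7" "\<And>v. (\<forall>i. v i \<in> T) \<Longrightarrow> \<phi> v = phi0 (f \<circ> v)"
    using f by (auto simp: g2_frame_def)
  have f2: "bij_betw f' T R7" "\<And>v. (\<forall>i. v i \<in> T) \<Longrightarrow> \<phi> v = phi0 (f'
    \<circ> v)"
    using f' by (auto simp: g2_frame_def)
  have R7: "subspace R7" by (auto simp: R7_def subspace_def)
  note inner = g2_frames_inner[OF T f f']
  have fR7: "f x \<in> R7" "f' x \<in> R7" if "x \<in> T" for x
    using f1(1) f2(1) that by (auto simp: bij_betw_def)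
  have phi: "cp e0 (f x) (f y) \<bullet> f z = cp e0 (f' x) (f' y) \<bullet> f' z" if "x \<in> T" "y \<in>
    T" "z \<in> T" for x y z
    using f1(2)[of "quad x y z z"] f2(2)[of "quad x y z z"] that by (simp add: all_quad phi0_cp)
  obtain c where c: "c \<in> T" "f c = cp e0 (f (v 1)) (f (v 2))"
    using f1(1) cross_R7 by (metis bij_betw_imp_surj_on imageE)
  \<comment> \<open>The defect between two candidates for the cross product in the frame
    \<open>f'\<close>. It lies in \<open>R7\<close>, hence is the image of some \<open>w\<close>,
    and it pairs to 0 with that image: it is orthogonal to itself.\<close>
  define d where "d = f' c - cp e0 (f' (v 1)) (f' (v 2))"
  have "d \<in> R7" using fR7(2)[OF c(1)] cross_R7 subspace_diff[OF R7] by (simp add: d_def)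
  then obtain w where w: "w \<in> T" "f' w = d"
    using f2(1) by (metis bij_betw_imp_surj_on imageE)
  have "d \<bullet> f' w = 0"
    using inner[OF c(1) w(1)] phi[OF v v w(1)] by (simp add: d_def c(2) inner_diff_left)
  then have c': "f' c = cp e0 (f' (v 1)) (f' (v 2))" using w(2) by (simp add: d_def)
  show ?thesis
    using phi[OF v c(1) v, of 0 3] inner[OF v v] fR7 v
    by (simp add: psi0_cp c(2) c')
qed

lemma sum_PiE_3:
  "(\<Sum>i\<in>{..<3::nat} \<rightarrow>\<^sub>E S. f (i 0) (i 1) (i 2)) = (\<Sum>a\<in>S. \<Sum>b\<in>S.
    \<Sum>c\<in>S. f a b c)"
proof -
  have less3: "x < 3 \<longleftrightarrow> x = 0 \<or> x = 1 \<or> x = 2" for x :: nat by linarith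
  have "(\<Sum>a\<in>S. \<Sum>b\<in>S. \<Sum>c\<in>S. f a b c) = (\<Sum>(a, b, c)\<in>S \<times> S \<times>
    S. f a b c)"
    by (simp add: sum.cartesian_product split_def)
  also have "\<dots> = (\<Sum>i\<in>{..<3::nat} \<rightarrow>\<^sub>E S. f (i 0) (i 1) (i 2))"
    by (rule sum.reindex_bij_witness[where j = "\<lambda>(a, b, c). \<lambda>j\<in>{..<3::nat}. if j = 0
    then a else if j = 1 then b else c"
          and i = "\<lambda>i. (i 0, i 1, i 2)"])
      (auto simp: PiE_iff less3 extensional_def restrict_def fun_eq_iff)
  finally show ?thesis ..
qed

definition hodge_vol :: "(nat \<Rightarrow> real ^ 8) \<Rightarrow> 8 \<Rightarrow> 8 \<Rightarrow> 8
    \<Rightarrow> real" where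
  "hodge_vol v a b c = vol7 (\<lambda>j. if j = 0 then axis a 1 else if j = 1 then axis b 1
     else if j = 2 then axis c 1 else v (j - 3))"

text \<open>Reversing seven arguments takes three transpositions, hence the sign. The basis vectors
  then stand last, where \<open>dx_snoc\<close> expands first and most terms vanish at once.\<close>

lemma hodge_vol_last:
  "hodge_vol v a b c = - vol7 (\<lambda>j. if j = 6 then axis a 1 else if j = 5 then axis b 1
     else if j = 4 then axis c 1 else v (3 - j))"
proof -
  define w where "w = (\<lambda>j::nat. if j = 6 then axis a 1 else if j = 5 then axis b 1
     else if j = 4 then axis c 1 else v (3 - j))"
  have "vol7 (\<lambda>j. if j = 0 then axis a 1 else if j = 1 then axis b 1
     else if j = 2 then axis c 1 else v (j - 3))
    = vol7 (w \<circ> Transposition.transpose 0 6 \<circ> Transposition.transpose 1 5 \<circ>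
    Transposition.transpose 2 4)"
    unfolding vol7_def dx_transposed
  proof (intro sum.cong refl arg_cong2[where f = "(*)"] prod.cong arg_cong2[where f = "($)"])
    fix j assume "j \<in> {..<length [1, 2, 3, 4, 5, 6, 7 :: 8]}"
    then have "j = 0 \<or> j = 1 \<or> j = 2 \<or> j = 3 \<or> j = 4 \<or> j = 5 \<or> j = 6" by auto
    then show "(if j = 0 then axis a 1 else if j = 1 then axis b 1 else if j = 2 then axis c 1 else v (j - 3))
      = (w \<circ> Transposition.transpose 0 6 \<circ> Transposition.transpose 1 5 \<circ>
    Transposition.transpose 2 4) j"
      by (elim disjE) (simp_all add: w_def transpose_def)
  qed
  also have "\<dots> = - vol7 w"
    unfolding vol7_def by (simp add: dx_swap)
  finally show ?thesis by (simp add: hodge_vol_def w_def)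
qed

text \<open>The 42 ordered triples are the six orderings of the index triples of the seven terms of
  \<open>phi0\<close>.\<close>

lemma hodge_vol_values:
  "hodge_vol v 1 2 3 = dx [4, 5, 6, 7] v"
  "hodge_vol v 1 3 2 = - dx [4, 5, 6, 7] v"
  "hodge_vol v 1 4 5 = dx [2, 3, 6, 7] v"
  "hodge_vol v 1 5 4 = - dx [2, 3, 6, 7] v"
  "hodge_vol v 1 6 7 = dx [2, 3, 4, 5] v"
  "hodge_vol v 1 7 6 = - dx [2, 3, 4, 5] v"
  "hodge_vol v 2 1 3 = - dx [4, 5, 6, 7] v"
  "hodge_vol v 2 3 1 = dx [4, 5, 6, 7] v"
  "hodge_vol v 2 4 6 = dx [1, 3, 5, 7] v"
  "hodge_vol v 2 5 7 = dx [1, 3, 4, 6] v"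
  "hodge_vol v 2 6 4 = - dx [1, 3, 5, 7] v"
  "hodge_vol v 2 7 5 = - dx [1, 3, 4, 6] v"
  "hodge_vol v 3 1 2 = dx [4, 5, 6, 7] v"
  "hodge_vol v 3 2 1 = - dx [4, 5, 6, 7] v"
  "hodge_vol v 3 4 7 = dx [1, 2, 5, 6] v"
  "hodge_vol v 3 5 6 = dx [1, 2, 4, 7] v"
  "hodge_vol v 3 6 5 = - dx [1, 2, 4, 7] v"
  "hodge_vol v 3 7 4 = - dx [1, 2, 5, 6] v"
  "hodge_vol v 4 1 5 = - dx [2, 3, 6, 7] v"
  "hodge_vol v 4 2 6 = - dx [1, 3, 5, 7] v"
  "hodge_vol v 4 3 7 = - dx [1, 2, 5, 6] v"
  "hodge_vol v 4 5 1 = dx [2, 3, 6, 7] v"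
  "hodge_vol v 4 6 2 = dx [1, 3, 5, 7] v"
  "hodge_vol v 4 7 3 = dx [1, 2, 5, 6] v"
  "hodge_vol v 5 1 4 = dx [2, 3, 6, 7] v"
  "hodge_vol v 5 2 7 = - dx [1, 3, 4, 6] v"
  "hodge_vol v 5 3 6 = - dx [1, 2, 4, 7] v"
  "hodge_vol v 5 4 1 = - dx [2, 3, 6, 7] v"
  "hodge_vol v 5 6 3 = dx [1, 2, 4, 7] v"
  "hodge_vol v 5 7 2 = dx [1, 3, 4, 6] v"
  "hodge_vol v 6 1 7 = - dx [2, 3, 4, 5] v"
  "hodge_vol v 6 2 4 = dx [1, 3, 5, 7] v"
  "hodge_vol v 6 3 5 = dx [1, 2, 4, 7] v"
  "hodge_vol v 6 4 2 = - dx [1, 3, 5, 7] v"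
  "hodge_vol v 6 5 3 = - dx [1, 2, 4, 7] v"
  "hodge_vol v 6 7 1 = dx [2, 3, 4, 5] v"
  "hodge_vol v 7 1 6 = dx [2, 3, 4, 5] v"
  "hodge_vol v 7 2 5 = dx [1, 3, 4, 6] v"
  "hodge_vol v 7 3 4 = dx [1, 2, 5, 6] v"
  "hodge_vol v 7 4 3 = - dx [1, 2, 5, 6] v"
  "hodge_vol v 7 5 2 = - dx [1, 3, 4, 6] v"
  "hodge_vol v 7 6 1 = - dx [2, 3, 4, 5] v"
  by (simp add: hodge_vol_last vol7_def dx_7 axis_nth_8, simp add: dx_6 axis_nth_8, simp add: dx_5 axis_nth_8,
      simp add: dx_4_pl pl_def, algebra)+

lemma sum_monomial:
  assumes "i \<in> S" "j \<in> S" "k \<in> S" "finite S"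
  shows "(\<Sum>a\<in>S. \<Sum>b\<in>S. \<Sum>c\<in>S. (axis (a::8) 1 $ i * axis b 1 $ j * axis c 1 $ k) * V
    a b c) = (V i j k :: real)"
  using assms by (simp add: axis_nth_8 if_distrib[of "\<lambda>x. x * _"] if_distrib[of "\<lambda>x. _ * x"]
    cong: if_cong)

lemma hodge_phi0: "hodge_star (UNIV - {0}) (\<lambda>i. axis i 1) vol7 3 phi0 v = psi0 v"
proof -
  let ?S = "UNIV - {0} :: 8 set"
  have less3: "j < 3 \<longleftrightarrow> j = 0 \<or> j = 1 \<or> j = 2" for j :: nat by linarith
  have seq: "(\<lambda>j. if j < 3 then axis (i j) 1 else v (j - 3)) = (\<lambda>j. if j = 0 then axis (i 0) 1
      else if j = 1 then axis (i (Suc 0)) 1 else if j = 2 then axis (i 2) 1 else v (j - 3))" for i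
    by (rule ext) (auto simp: less3)
  have "fact 3 * hodge_star ?S (\<lambda>i. axis i 1) vol7 3 phi0 v
      = (\<Sum>i\<in>{..<3::nat} \<rightarrow>\<^sub>E ?S. (cp e0 (axis (i 0) 1) (axis (i 1) 1) \<bullet>
    axis (i 2) 1) * hodge_vol v (i 0) (i 1) (i 2))"
    by (simp add: hodge_star_def phi0_cp seq hodge_vol_def)
  also have "\<dots> = (\<Sum>a\<in>?S. \<Sum>b\<in>?S. \<Sum>c\<in>?S. (cp e0 (axis a 1) (axis b 1)
    \<bullet> axis c 1) * hodge_vol v a b c)"
    by (rule sum_PiE_3)
  also have "\<dots> = hodge_vol v 1 2 3 - hodge_vol v 1 3 2 + hodge_vol v 1 4 5 - hodge_vol v 1 5 4 +
    hodge_vol v 1 6 7 - hodge_vol v 1 7 6 - hodge_vol v 2 1 3 + hodge_vol v 2 3 1 + hodge_vol v 2 4 6 -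
    hodge_vol v 2 5 7 - hodge_vol v 2 6 4 + hodge_vol v 2 7 5 + hodge_vol v 3 1 2 - hodge_vol v 3 2 1 -
    hodge_vol v 3 4 7 - hodge_vol v 3 5 6 + hodge_vol v 3 6 5 + hodge_vol v 3 7 4 - hodge_vol v 4 1 5 -
    hodge_vol v 4 2 6 + hodge_vol v 4 3 7 + hodge_vol v 4 5 1 + hodge_vol v 4 6 2 - hodge_vol v 4 7 3 +
    hodge_vol v 5 1 4 + hodge_vol v 5 2 7 + hodge_vol v 5 3 6 - hodge_vol v 5 4 1 - hodge_vol v 5 6 3 -
    hodge_vol v 5 7 2 - hodge_vol v 6 1 7 + hodge_vol v 6 2 4 - hodge_vol v 6 3 5 - hodge_vol v 6 4 2 +
    hodge_vol v 6 5 3 + hodge_vol v 6 7 1 + hodge_vol v 7 1 6 - hodge_vol v 7 2 5 - hodge_vol v 7 3 4 +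
    hodge_vol v 7 4 3 + hodge_vol v 7 5 2 - hodge_vol v 7 6 1"
    unfolding phi0_expand distrib_right left_diff_distrib sum.distrib sum_subtractf
    by (simp add: sum_monomial)
  \<comment> \<open>Each term of \<open>psi0\<close> is produced by six orderings of one triple,
    which is the \<open>fact 3\<close> of the Hodge star.\<close>
  also have "\<dots> = 6 * psi0 v"
    unfolding hodge_vol_values psi0_def by simp
  finally show ?thesis by (simp add: fact_numeral)
qed

text \<open>The chosen frame transports the star to the model, where it gives \<open>psi0\<close>;
  frame independence then replaces the chosen frame by the given one.\<close>

lemma g2_star_frame:
  assumes T: "subspace T" and f: "g2_frame T \<phi> f" and v: "\<And>i. v i \<in> T"
  shows "g2_star T \<phi> 3 \<phi> v = psi0 (f \<circ> v)"
proof -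
  define f' where "f' = (SOME f. g2_frame T \<phi> f)"
  have f': "g2_frame T \<phi> f'" unfolding f'_def by (rule someI[where P = "g2_frame T \<phi>", OF f])
  then have f2: "linear f'" "bij_betw f' T R7" "\<And>v. (\<forall>i. v i \<in> T) \<Longrightarrow> \<phi>
    v = phi0 (f' \<circ> v)"
    by (auto simp: g2_frame_def)
  let ?e = "\<lambda>i. inv_into T f' (axis i 1)"
  have e: "?e i \<in> T" "f' (?e i) = axis i 1" if "i \<noteq> 0" for i
  proof -
    have "axis i 1 \<in> R7" using that by (simp add: R7_def axis_nth_8)
    then show "?e i \<in> T" "f' (?e i) = axis i 1"
      using f2(2) by (metis bij_betw_imp_surj_on inv_into_into, metis bij_betw_inv_into_right)
  qed
  have "g2_star T \<phi> 3 \<phi> v = hodge_star (UNIV - {0}) ?e (\<lambda>v. vol7 (f' \<circ> v)) 3 \<phi> v"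
    by (simp add: g2_star_def f'_def Let_def)
  also have "\<dots> = hodge_star (UNIV - {0}) (\<lambda>i. axis i 1) vol7 3 phi0 (f' \<circ> v)"
    unfolding hodge_star_def
  proof (intro arg_cong2[where f = "(/)"] sum.cong refl arg_cong2[where f = "(*)"])
    fix i assume i: "i \<in> {..<3::nat} \<rightarrow>\<^sub>E UNIV - {0::8}"
    then have i0: "i j \<noteq> 0" if "j < 3" for j using that by auto
    have "\<phi> (\<lambda>j. if j < 3 then ?e (i j) else 0) = phi0 (f' \<circ> (\<lambda>j. if j < 3 then
    ?e (i j) else 0))"
      using e(1) i0 subspace_0[OF T] by (intro f2(3)) auto
    also have "f' \<circ> (\<lambda>j. if j < 3 then ?e (i j) else 0) = (\<lambda>j. if j < 3 then axis (i
    j) 1 else 0)"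
      using e(2) i0 linear_0[OF f2(1)] by auto
    finally show "\<phi> (\<lambda>j. if j < 3 then ?e (i j) else 0) = phi0 (\<lambda>j. if j < 3 then axis
    (i j) 1 else 0)" .
    have "f' \<circ> (\<lambda>j. if j < 3 then ?e (i j) else v (j - 3))
        = (\<lambda>j. if j < 3 then axis (i j) 1 else (f' \<circ> v) (j - 3))"
      using e(2) i0 by auto
    then show "vol7 (f' \<circ> (\<lambda>j. if j < 3 then ?e (i j) else v (j - 3)))
        = vol7 (\<lambda>j. if j < 3 then axis (i j) 1 else (f' \<circ> v) (j - 3))" by simp
  qed
  also have "\<dots> = psi0 (f \<circ> v)"
    by (simp add: hodge_phi0 psi0_frame_independent[OF T f' f v])
  finally show ?thesis .
qed

lemma less_3_cases: "i < 3 \<longleftrightarrow> i = 0 \<or> i = 1 \<or> i = 2" for i :: nat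
  by linarith

lemma less_4_cases: "i < 4 \<longleftrightarrow> i = 0 \<or> i = 1 \<or> i = 2 \<or> i = 3" for i :: nat
  by linarith

text \<open>The first clause of \<open>alternating_form\<close> ranges over all sequences, not only
  over those in \<open>T\<close>, where \<open>a\<close> is known to be a pullback of
  \<open>Phi0\<close>; it is therefore a separate hypothesis.\<close>

lemma alternating_form_Phi0:
  assumes f: "linear f" and 1: "\<And>v v'. (\<forall>i<4. v i = v' i) \<Longrightarrow> a v = a v'"
    and T: "subspace T" and a: "\<And>v. (\<forall>i. v i \<in> T) \<Longrightarrow> a v = Phi0 (f \<circ> v)"
  shows "alternating_form T 4 a"
proof -
  have mem: "\<forall>i. (v(k := x)) i \<in> T" if "\<forall>i. v i \<in> T" "x \<in> T" for v x and k ::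
    nat using that by auto
  have add: "Phi0 (f \<circ> v(i := x + y)) = Phi0 (f \<circ> v(i := x)) + Phi0 (f \<circ> v(i := y))" if "i
    < 4" for v x y i
    using that unfolding less_4_cases
    by (elim disjE) (simp_all add: Phi0_cp cp_linear linear_add[OF f] inner_add_left inner_add_right)
  have scale: "Phi0 (f \<circ> v(i := r *\<^sub>R x)) = r * Phi0 (f \<circ> v(i := x))" if "i < 4" for v x r i
    using that unfolding less_4_cases
    by (elim disjE) (simp_all add: Phi0_cp cp_linear linear_scale[OF f])
  have alt: "Phi0 (f \<circ> v) = 0" if "i < 4" "j < 4" "i \<noteq> j" "v i = v j" for v i j
    using that unfolding less_4_cases
    by (elim disjE) (simp_all add: Phi0_cp cp_alternating cp_inner_zero)
  show ?thesis unfolding alternating_form_def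
  proof (intro conjI allI impI)
    show "a v = a v'" if "\<forall>i<4. v i = v' i" for v v' using 1 that .
    show "a (v(i := x + y)) = a (v(i := x)) + a (v(i := y))"
      if "\<forall>i. v i \<in> T" "x \<in> T" "y \<in> T" "i < 4" for v x y i
      using that add[OF \<open>i < 4\<close>] a mem subspace_add[OF T] by simp
    show "a (v(i := r *\<^sub>R x)) = r * a (v(i := x))" if "\<forall>i. v i \<in> T" "x \<in> T" "i < 4"
    for v x r i
      using that scale[OF \<open>i < 4\<close>] a mem subspace_scale[OF T] by simp
    show "a v = 0" if "\<forall>i. v i \<in> T" "i < 4" "j < 4" "i \<noteq> j" "v i = v j" for v i j
      using that alt[of i j v] a by simp
  qed
qed

lemma alternating_form_phi0:
  assumes f: "linear f" and 1: "\<And>v v'. (\<forall>i<3. v i = v' i) \<Longrightarrow> a v = a v'"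
    and T: "subspace T" and a: "\<And>v. (\<forall>i. v i \<in> T) \<Longrightarrow> a v = phi0 (f \<circ> v)"
  shows "alternating_form T 3 a"
proof -
  have mem: "\<forall>i. (v(k := x)) i \<in> T" if "\<forall>i. v i \<in> T" "x \<in> T" for v x and k ::
    nat using that by auto
  have add: "phi0 (f \<circ> v(i := x + y)) = phi0 (f \<circ> v(i := x)) + phi0 (f \<circ> v(i := y))" if "i
    < 3" for v x y i
    using that unfolding less_3_cases
    by (elim disjE) (simp_all add: phi0_cp cp_linear linear_add[OF f] inner_add_left inner_add_right)
  have scale: "phi0 (f \<circ> v(i := r *\<^sub>R x)) = r * phi0 (f \<circ> v(i := x))" if "i < 3" for v x r i
    using that unfolding less_3_cases
    by (elim disjE) (simp_all add: phi0_cp cp_linear linear_scale[OF f])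
  have alt: "phi0 (f \<circ> v) = 0" if "i < 3" "j < 3" "i \<noteq> j" "v i = v j" for v i j
    using that unfolding less_3_cases
    by (elim disjE) (simp_all add: phi0_cp cp_alternating cp_inner_zero)
  show ?thesis unfolding alternating_form_def
  proof (intro conjI allI impI)
    show "a v = a v'" if "\<forall>i<3. v i = v' i" for v v' using 1 that .
    show "a (v(i := x + y)) = a (v(i := x)) + a (v(i := y))"
      if "\<forall>i. v i \<in> T" "x \<in> T" "y \<in> T" "i < 3" for v x y i
      using that add[OF \<open>i < 3\<close>] a mem subspace_add[OF T] by simp
    show "a (v(i := r *\<^sub>R x)) = r * a (v(i := x))" if "\<forall>i. v i \<in> T" "x \<in> T" "i < 3"
    for v x r i
      using that scale[OF \<open>i < 3\<close>] a mem subspace_scale[OF T] by simp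
    show "a v = 0" if "\<forall>i. v i \<in> T" "i < 3" "j < 3" "i \<noteq> j" "v i = v j" for v i j
      using that alt[of i j v] a by simp
  qed
qed

section \<open>Wedge products of low degree\<close>

lemma alt_wedge_1_1:
  assumes a: "\<And>w. (\<forall>i. w i \<in> T) \<Longrightarrow> a w = f (w 0)"
    and b: "\<And>w. (\<forall>i. w i \<in> T) \<Longrightarrow> b w = g (w 0)"
    and v: "\<forall>i. v i \<in> T"
  shows "alt_wedge 1 1 a b v = f (v 0) * g (v 1) - f (v 1) * g (v 0)"
proof -
  have set: "{..<1 + 1 :: nat} = insert 0 (insert 1 {})" by auto
  show ?thesis
    unfolding alt_wedge_def set using v
    by (simp add: a b sum_over_permutations_insert sign_swap_id transpose_def)
qed

lemma alt_wedge_1_2: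
  fixes g :: "_ \<Rightarrow> _ \<Rightarrow> 'v::real_normed_field"
  assumes a: "\<And>w. (\<forall>i. w i \<in> T) \<Longrightarrow> a w = f (w 0)"
    and b: "\<And>w. (\<forall>i. w i \<in> T) \<Longrightarrow> b w = g (w 0) (w 1)"
    and g: "\<And>x y. x \<in> T \<Longrightarrow> y \<in> T \<Longrightarrow> g y x = - g x y"
    and v: "\<forall>i. v i \<in> T"
  shows "alt_wedge 1 2 a b v = f (v 0) * g (v 1) (v 2) - f (v 1) * g (v 0) (v 2) + f (v 2) * g (v 0) (v 1)" (is "_ = ?rhs")
proof -
  let ?sum = "(\<Sum>\<sigma> | \<sigma> permutes {..<1 + 2}.
      of_int (sign \<sigma>) * f (v (\<sigma> 0)) * g (v (\<sigma> 1)) (v (\<sigma> 2)))"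
  have set: "{..<1 + 2 :: nat} = insert 0 (insert 1 (insert 2 {}))" by auto
  have wedge: "alt_wedge 1 2 a b v = ?sum / 2"
    unfolding alt_wedge_def using v by (simp add: a b numeral_2_eq_2 numeral_3_eq_3)
  have sum: "?sum = 2 * ?rhs"
    unfolding set using v g[of "v 0" "v 1"] g[of "v 0" "v 2"] g[of "v 1" "v 2"]
    by (simp add: sum_over_permutations_insert sign_compose permutation_compose permutation_swap_id
        sign_swap_id transpose_def algebra_simps)
  show ?thesis unfolding wedge sum by simp
qed

text \<open>The right-hand side is that of \<open>alt_wedge_1_2\<close>, because a 2-form commutes
  with a 1-form.\<close>

lemma alt_wedge_2_1:
  fixes g :: "_ \<Rightarrow> _ \<Rightarrow> 'v::real_normed_field"
  assumes a: "\<And>w. (\<forall>i. w i \<in> T) \<Longrightarrow> a w = f (w 0)"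
    and b: "\<And>w. (\<forall>i. w i \<in> T) \<Longrightarrow> b w = g (w 0) (w 1)"
    and g: "\<And>x y. x \<in> T \<Longrightarrow> y \<in> T \<Longrightarrow> g y x = - g x y"
    and v: "\<forall>i. v i \<in> T"
  shows "alt_wedge 2 1 b a v = f (v 0) * g (v 1) (v 2) - f (v 1) * g (v 0) (v 2) + f (v 2) * g (v 0) (v 1)" (is "_ = ?rhs")
proof -
  let ?sum = "(\<Sum>\<sigma> | \<sigma> permutes {..<2 + 1}.
      of_int (sign \<sigma>) * g (v (\<sigma> 0)) (v (\<sigma> 1)) * f (v (\<sigma> 2)))"
  have set: "{..<2 + 1 :: nat} = insert 0 (insert 1 (insert 2 {}))" by auto
  have wedge: "alt_wedge 2 1 b a v = ?sum / 2"
    unfolding alt_wedge_def using v by (simp add: a b numeral_2_eq_2 numeral_3_eq_3)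
  have sum: "?sum = 2 * ?rhs"
    unfolding set using v g[of "v 0" "v 1"] g[of "v 0" "v 2"] g[of "v 1" "v 2"]
    by (simp add: sum_over_permutations_insert sign_compose permutation_compose permutation_swap_id
        sign_swap_id transpose_def algebra_simps)
  show ?thesis unfolding wedge sum by simp
qed

text \<open>Antisymmetry of both factors collects the 24 permutations into six shuffles of four
  equal terms, which cancels the factorials.\<close>

lemma alt_wedge_2_2:
  fixes g h :: "_ \<Rightarrow> _ \<Rightarrow> 'v::real_normed_field"
  assumes a: "\<And>w. (\<forall>i. w i \<in> T) \<Longrightarrow> a w = g (w 0) (w 1)"
    and b: "\<And>w. (\<forall>i. w i \<in> T) \<Longrightarrow> b w = h (w 0) (w 1)"
    and g: "\<And>x y. x \<in> T \<Longrightarrow> y \<in> T \<Longrightarrow> g y x = - g x y"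
    and h: "\<And>x y. x \<in> T \<Longrightarrow> y \<in> T \<Longrightarrow> h y x = - h x y"
    and v: "\<forall>i. v i \<in> T"
  shows "alt_wedge 2 2 a b v = g (v 0) (v 1) * h (v 2) (v 3) - g (v 0) (v 2) * h (v 1) (v 3)
    + g (v 0) (v 3) * h (v 1) (v 2) + g (v 1) (v 2) * h (v 0) (v 3)
    - g (v 1) (v 3) * h (v 0) (v 2) + g (v 2) (v 3) * h (v 0) (v 1)" (is "_ = ?rhs")
proof -
  let ?sum = "(\<Sum>\<sigma> | \<sigma> permutes {..<2 + 2}.
      of_int (sign \<sigma>) * g (v (\<sigma> 0)) (v (\<sigma> 1)) * h (v (\<sigma> 2)) (v (\<sigma> 3)))"
  have set: "{..<2 + 2 :: nat} = insert 0 (insert 1 (insert 2 (insert 3 {})))" by auto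
  have wedge: "alt_wedge 2 2 a b v = ?sum / 4"
    unfolding alt_wedge_def using v by (simp add: a b numeral_2_eq_2 numeral_3_eq_3)
  have sum: "?sum = 4 * ?rhs"
    unfolding set using v g[of "v 0" "v 1"] g[of "v 0" "v 2"] g[of "v 0" "v 3"] g[of "v 1" "v 2"]
      g[of "v 1" "v 3"] g[of "v 2" "v 3"] h[of "v 0" "v 1"] h[of "v 0" "v 2"] h[of "v 0" "v 3"]
      h[of "v 1" "v 2"] h[of "v 1" "v 3"] h[of "v 2" "v 3"]
    by (simp add: sum_over_permutations_insert sign_compose permutation_compose permutation_swap_id
        sign_swap_id transpose_def algebra_simps)
  show ?thesis unfolding wedge sum by simp
qed

lemma alt_wedge_1_3:
  fixes g :: "_ \<Rightarrow> _ \<Rightarrow> _ \<Rightarrow> 'v::real_normed_field"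
  assumes a: "\<And>w. (\<forall>i. w i \<in> T) \<Longrightarrow> a w = f (w 0)"
    and b: "\<And>w. (\<forall>i. w i \<in> T) \<Longrightarrow> b w = g (w 0) (w 1) (w 2)"
    and g1: "\<And>x y z. x \<in> T \<Longrightarrow> y \<in> T \<Longrightarrow> z \<in> T \<Longrightarrow> g y x z = - g x y z"
    and g2: "\<And>x y z. x \<in> T \<Longrightarrow> y \<in> T \<Longrightarrow> z \<in> T \<Longrightarrow> g x z y = - g x y z"
    and v: "\<forall>i. v i \<in> T"
  shows "alt_wedge 1 3 a b v = f (v 0) * g (v 1) (v 2) (v 3) - f (v 1) * g (v 0) (v 2) (v 3)
    + f (v 2) * g (v 0) (v 1) (v 3) - f (v 3) * g (v 0) (v 1) (v 2)" (is "_ = ?rhs")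
proof -
  let ?sum = "(\<Sum>\<sigma> | \<sigma> permutes {..<1 + 3}.
      of_int (sign \<sigma>) * f (v (\<sigma> 0)) * g (v (\<sigma> 1)) (v (\<sigma> 2)) (v (\<sigma> 3)))"
  have set: "{..<1 + 3 :: nat} = insert 0 (insert 1 (insert 2 (insert 3 {})))" by auto
  have wedge: "alt_wedge 1 3 a b v = ?sum / 6"
    unfolding alt_wedge_def using v by (simp add: a b fact_numeral numeral_2_eq_2 numeral_3_eq_3)
  \<comment> \<open>The two adjacent exchanges generate all orderings of three arguments.\<close>
  have orders: "g x z y = - g x y z" "g y x z = - g x y z" "g y z x = g x y z" "g z x y = g x y z" "g z y x = - g x y z"
    if "x \<in> T" "y \<in> T" "z \<in> T" for x y z
  proof -
    show "g x z y = - g x y z" "g y x z = - g x y z" using that g1 g2 by blast+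
    then show "g y z x = g x y z" "g z x y = g x y z" using that g1[of x z y] g2[of y x z] by simp_all
    then show "g z y x = - g x y z" using that g2[of z x y] by simp
  qed
  have sum: "?sum = 6 * ?rhs"
    unfolding set using v orders[of "v 0" "v 1" "v 2"] orders[of "v 0" "v 1" "v 3"]
      orders[of "v 0" "v 2" "v 3"] orders[of "v 1" "v 2" "v 3"]
    by (simp add: sum_over_permutations_insert sign_compose permutation_compose permutation_swap_id
        sign_swap_id transpose_def algebra_simps)
  show ?thesis unfolding wedge sum by simp
qed

section \<open>Charts and tangent vectors\<close>

lemma
  assumes "smooth_atlas A" "c \<in> A"
  shows open_chart: "open (fst c)" and open_chart_image: "open (snd c ` fst c)"
    and inj_chart: "inj_on (snd c) (fst c)" and continuous_chart: "continuous_on (fst c) (snd c)"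
    and continuous_chart_inv: "continuous_on (snd c ` fst c) (chart_inv c)"
proof -
  obtain g where g: "homeomorphism (fst c) (snd c ` fst c) (snd c) g"
    and o: "open (fst c)" "open (snd c ` fst c)"
    using assms unfolding smooth_atlas_def by blast
  show "open (fst c)" "open (snd c ` fst c)" by (fact o)+
  show inj: "inj_on (snd c) (fst c)" using g by (metis homeomorphism_apply1 inj_on_inverseI)
  show "continuous_on (fst c) (snd c)" using g by (simp add: homeomorphism_def)
  have "continuous_on (snd c ` fst c) g" using g by (simp add: homeomorphism_def)
  moreover have "g x = chart_inv c x" if "x \<in> snd c ` fst c" for x
    using that g inj by (auto simp: homeomorphism_def)
  ultimately show "continuous_on (snd c ` fst c) (chart_inv c)"
    by (simp cong: continuous_on_cong)
qed

lemma chart_inv_in: "x \<in> snd c ` fst c \<Longrightarrow> chart_inv c x \<in> fst c"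
  by (rule inv_into_into)

lemma chart_chart_inv: "x \<in> snd c ` fst c \<Longrightarrow> snd c (chart_inv c x) = x"
  by (rule f_inv_into_f)

lemma chart_inv_chart: "smooth_atlas A \<Longrightarrow> c \<in> A \<Longrightarrow> p \<in> fst c \<Longrightarrow> chart_inv c (snd c p) = p"
  by (simp add: inj_chart)

lemma open_image_chart:
  assumes A: "smooth_atlas A" "c \<in> A" and U: "open U"
  shows "open (snd c ` (fst c \<inter> U))"
proof -
  have "snd c ` (fst c \<inter> U) = snd c ` fst c \<inter> chart_inv c -` U"
    using chart_inv_chart[OF A] by force
  then show ?thesis
    using continuous_open_preimage[OF continuous_chart_inv[OF A] open_chart_image[OF A] U] by simp
qed

lemma charts_atD: "c \<in> charts_at A p \<Longrightarrow> c \<in> A" "c \<in> charts_at A p \<Longrightarrow> p \<in> fst c"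
  by (simp_all add: charts_at_def)

lemma some_chart: "p \<in> points A \<Longrightarrow> some_chart A p \<in> charts_at A p"
  unfolding some_chart_def points_def charts_at_def by (rule someI_ex) auto

lemma charts_at_points: "c \<in> charts_at A p \<Longrightarrow> p \<in> points A"
  by (auto simp: charts_at_def points_def)

lemma transition_smooth:
  "smooth_atlas A \<Longrightarrow> c \<in> A \<Longrightarrow> c' \<in> A \<Longrightarrow> smooth_on (snd c ` (fst c \<inter> fst c')) (transition c c')"
  by (simp add: smooth_atlas_def)

lemma transition_has_derivative:
  assumes "smooth_atlas A" "c \<in> charts_at A p" "c' \<in> charts_at A p"
  shows "(transition c c' has_derivative frechet_derivative (transition c c') (at (snd c p))) (at (snd c p))"
  by (rule smooth_on_has_derivative[OF transition_smooth[OF assms(1)]])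
    (use assms in \<open>auto simp: charts_at_def\<close>)

abbreviation lrep where "lrep c d f \<equiv> snd d \<circ> f \<circ> chart_inv c"

text \<open>The values of \<open>f\<close> may lie in any space, so this covers both local representatives and transition maps.\<close>
lemma change_chart_derivative:
  fixes f :: "'a::{t2_space,second_countable_topology} \<Rightarrow> 'b::real_normed_vector"
  assumes A: "smooth_atlas A" "c \<in> charts_at A p" "c' \<in> charts_at A p"
    and f: "((\<lambda>x. f (chart_inv c' x)) has_derivative f') (at (snd c' p))"
  shows "((\<lambda>x. f (chart_inv c x)) has_derivative
    (\<lambda>w. f' (frechet_derivative (transition c c') (at (snd c p)) w))) (at (snd c p))"
proof -
  have c: "c \<in> A" "c' \<in> A" "p \<in> fst c" "p \<in> fst c'" using A by (auto simp: charts_at_def)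
  have "transition c c' (snd c p) = snd c' p"
    using c by (simp add: transition_def chart_inv_chart[OF A(1)])
  then have "((\<lambda>x. f (chart_inv c' (transition c c' x))) has_derivative
    (\<lambda>w. f' (frechet_derivative (transition c c') (at (snd c p)) w))) (at (snd c p))"
    using diff_chain_at[OF transition_has_derivative[OF A], of "\<lambda>x. f (chart_inv c' x)" f'] f
    by (simp add: o_def)
  then show ?thesis
  proof (rule has_derivative_transform_within_open)
    show "open (snd c ` (fst c \<inter> fst c'))" by (intro open_image_chart[OF A(1)] open_chart[OF A(1)] c)
    show "snd c p \<in> snd c ` (fst c \<inter> fst c')" using c by auto
    show "f (chart_inv c' (transition c c' x)) = f (chart_inv c x)" if "x \<in> snd c ` (fst c \<inter> fst c')" for x
      using that c by (auto simp: transition_def chart_inv_chart[OF A(1)])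
  qed
qed

lemma transition_self:
  assumes A: "smooth_atlas A" "c \<in> charts_at A p"
  shows "frechet_derivative (transition c c) (at (snd c p)) = (\<lambda>w. w)"
proof (rule frechet_derivative_eqI)
  have c: "c \<in> A" "p \<in> fst c" using A by (auto simp: charts_at_def)
  show "(transition c c has_derivative (\<lambda>w. w)) (at (snd c p))"
  proof (rule has_derivative_transform_within_open[OF has_derivative_ident])
    show "open (snd c ` fst c)" by (rule open_chart_image[OF A(1) c(1)])
  qed (use c in \<open>auto simp: transition_def chart_inv_chart[OF A(1)]\<close>)
qed

lemma transition_compose:
  assumes A: "smooth_atlas A" "c \<in> charts_at A p" "c' \<in> charts_at A p" "c'' \<in> charts_at A p"
  shows "frechet_derivative (transition c c'') (at (snd c p)) w
    = frechet_derivative (transition c' c'') (at (snd c' p)) (frechet_derivative (transition c c') (at (snd c p)) w)"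
  using change_chart_derivative[OF A(1-3), of "snd c''"] transition_has_derivative[OF A(1,3,4)]
  by (subst frechet_derivative_eqI[where f = "transition c c''"]) (simp_all add: transition_def o_def)

lemma tangent_spaceI:
  "(\<And>c. c \<notin> charts_at A p \<Longrightarrow> v c = 0) \<Longrightarrow>
   (\<And>c c'. c \<in> charts_at A p \<Longrightarrow> c' \<in> charts_at A p \<Longrightarrow>
     v c' = frechet_derivative (transition c c') (at (snd c p)) (v c)) \<Longrightarrow> v \<in> tangent_space A p"
  unfolding tangent_space_def by blast

lemma tangent_space_0: "v \<in> tangent_space A p \<Longrightarrow> c \<notin> charts_at A p \<Longrightarrow> v c = 0"
  unfolding tangent_space_def by blast

lemma tangent_of_in:
  assumes "smooth_atlas A" "c \<in> charts_at A p"
  shows "tangent_of A c p w \<in> tangent_space A p"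
  unfolding tangent_space_def
proof (intro CollectI conjI allI impI ballI)
  show "tangent_of A c p w c' = 0" if "c' \<notin> charts_at A p" for c'
    using that by (simp add: tangent_of_def)
  show "tangent_of A c p w c'' = frechet_derivative (transition c' c'') (at (snd c' p)) (tangent_of A c p w c')"
    if "c' \<in> charts_at A p" "c'' \<in> charts_at A p" for c' c''
    using that transition_compose[OF assms(1,2) that, of w] by (simp only: tangent_of_def if_True)
qed

lemma tangent_of_apply:
  "smooth_atlas A \<Longrightarrow> c \<in> charts_at A p \<Longrightarrow> tangent_of A c p w c = w"
  by (simp add: tangent_of_def transition_self)

lemma tangent_spaceD:
  "v \<in> tangent_space A p \<Longrightarrow> c \<in> charts_at A p \<Longrightarrow> c' \<in> charts_at A p \<Longrightarrow>
    v c' = frechet_derivative (transition c c') (at (snd c p)) (v c)"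
  unfolding tangent_space_def by blast

lemma tangent_of_tangent:
  assumes "c \<in> charts_at A p" "v \<in> tangent_space A p"
  shows "tangent_of A c p (v c) = v"
proof
  fix c'
  have "v c' = 0" if "c' \<notin> charts_at A p" using assms(2) that unfolding tangent_space_def by blast
  then show "tangent_of A c p (v c) c' = v c'"
    using tangent_spaceD[OF assms(2,1), of c'] unfolding tangent_of_def by metis
qed

lemma linear_transition:
  assumes "smooth_atlas A" "c \<in> charts_at A p" "c' \<in> charts_at A p"
  shows "linear (frechet_derivative (transition c c') (at (snd c p)))"
  using has_derivative_linear[OF transition_has_derivative[OF assms]] .

lemma subspace_tangent_space:
  assumes "smooth_atlas A"
  shows "subspace (tangent_space A p)"
  unfolding subspace_def
proof (intro conjI ballI allI)
  note lin = linear_transition[OF assms, of _ p]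
  show "0 \<in> tangent_space A p"
    unfolding tangent_space_def using linear_0[OF lin] by auto
  show "v + w \<in> tangent_space A p" if "v \<in> tangent_space A p" "w \<in> tangent_space A p" for v w
  proof -
    have eq: "v c' + w c' = frechet_derivative (transition c c') (at (snd c p)) (v c + w c)"
      if c: "c \<in> charts_at A p" "c' \<in> charts_at A p" for c c'
      using tangent_spaceD[OF \<open>v \<in> _\<close> c] tangent_spaceD[OF \<open>w \<in> _\<close> c] linear_add[OF lin[OF c]] by simp
    show ?thesis
    proof (rule tangent_spaceI)
      show "(v + w) c = 0" if "c \<notin> charts_at A p" for c
        using tangent_space_0[OF \<open>v \<in> _\<close> that] tangent_space_0[OF \<open>w \<in> _\<close> that] by simp
    qed (unfold plus_fun_apply, rule eq)
  qed
  show "r *\<^sub>R v \<in> tangent_space A p" if "v \<in> tangent_space A p" for r v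
  proof -
    have eq: "r *\<^sub>R v c' = frechet_derivative (transition c c') (at (snd c p)) (r *\<^sub>R v c)"
      if c: "c \<in> charts_at A p" "c' \<in> charts_at A p" for c c'
      using tangent_spaceD[OF \<open>v \<in> _\<close> c] linear_scale[OF lin[OF c]] by simp
    show ?thesis
    proof (rule tangent_spaceI)
      show "(r *\<^sub>R v) c = 0" if "c \<notin> charts_at A p" for c
        using tangent_space_0[OF \<open>v \<in> _\<close> that] by simp
    qed (unfold scaleR_fun_apply, rule eq)
  qed
qed

lemma tangent_of_linear:
  assumes "smooth_atlas A" "c \<in> charts_at A p"
  shows "tangent_of A c p (v + w) = tangent_of A c p v + tangent_of A c p w"
    "tangent_of A c p (r *\<^sub>R v) = r *\<^sub>R tangent_of A c p v"
  using linear_transition[OF assms] by (auto simp: tangent_of_def linear_add linear_scale fun_eq_iff)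

lemma bij_betw_tangent:
  assumes "smooth_atlas A" "c \<in> charts_at A p"
  shows "bij_betw (\<lambda>v. v c) (tangent_space A p) UNIV"
  by (rule bij_betw_byWitness[where f' = "tangent_of A c p"])
    (use assms tangent_of_tangent[OF assms(2)] in \<open>auto simp: tangent_of_apply tangent_of_in\<close>)

text \<open>\<open>dmap\<close> fixes one chart at the source. By the chain rule, the transition
  derivative between two charts is compensated by the transformation law of the tangent
  vector.\<close>

lemma dmap_chart:
  assumes A: "smooth_atlas A" "c \<in> charts_at A p" and v: "v \<in> tangent_space A p"
    and d: "d \<in> charts_at B (f p)"
    and f: "\<And>c. c \<in> charts_at A p \<Longrightarrow> lrep c d f differentiable (at (snd c p))"
  shows "dmap A B f p v d = frechet_derivative (lrep c d f) (at (snd c p)) (v c)"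
proof -
  let ?c = "some_chart A p"
  have c0: "?c \<in> charts_at A p" using A(2) by (meson charts_at_points some_chart)
  have "((\<lambda>x. snd d (f (chart_inv c x))) has_derivative frechet_derivative (lrep c d f) (at (snd c p))) (at (snd c p))"
    using f[OF A(2)] by (simp add: frechet_derivative_works o_def)
  from change_chart_derivative[OF A(1) c0 A(2), of "\<lambda>q. snd d (f q)", OF this]
  have "frechet_derivative (lrep ?c d f) (at (snd ?c p)) = (\<lambda>w. frechet_derivative (lrep c d f) (at (snd c p))
      (frechet_derivative (transition ?c c) (at (snd ?c p)) w))"
    by (intro frechet_derivative_eqI) (simp add: o_def)
  moreover have "frechet_derivative (transition ?c c) (at (snd ?c p)) (v ?c) = v c"
    using tangent_spaceD[OF v c0 A(2)] by (rule sym)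
  ultimately show ?thesis using d by (simp add: dmap_def Let_def)
qed

lemma smooth_map_lrep:
  assumes "smooth_map A B f" "c \<in> A" "d \<in> B"
  shows "smooth_on (snd c ` (fst c \<inter> f -` fst d)) (lrep c d f)"
  using assms by (simp add: smooth_map_def)

lemma smooth_map_differentiable:
  assumes "smooth_map A B f" "c \<in> charts_at A p" "d \<in> charts_at B (f p)"
  shows "lrep c d f differentiable (at (snd c p))"
  by (rule smooth_on_differentiable[OF smooth_map_lrep[OF assms(1)]])
    (use assms in \<open>auto simp: charts_at_def\<close>)

lemma smooth_map_dmap:
  assumes "smooth_atlas A" "smooth_map A B f" "c \<in> charts_at A p" "d \<in> charts_at B (f p)" "v \<in> tangent_space A p"
  shows "dmap A B f p v d = frechet_derivative (lrep c d f) (at (snd c p)) (v c)"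
  using assms by (intro dmap_chart smooth_map_differentiable)

lemma smooth_map_point: "smooth_map A B f \<Longrightarrow> p \<in> points A \<Longrightarrow> f p \<in> points B"
  by (auto simp: smooth_map_def)

lemma open_lrep_domain:
  assumes A: "smooth_atlas A" "smooth_map A B f" "c \<in> A" and U: "open U"
  shows "open (snd c ` (fst c \<inter> f -` U))"
proof -
  have "continuous_on (fst c) f"
    using A by (auto simp: smooth_map_def points_def intro: continuous_on_subset)
  then have "open (fst c \<inter> f -` U)"
    by (rule continuous_open_preimage[OF _ open_chart[OF A(1,3)] U])
  from open_image_chart[OF A(1,3) this] show ?thesis by (simp add: Int_absorb1 Int_assoc[symmetric])
qed

lemma dmap_tangent:
  assumes A: "smooth_atlas A" and B: "smooth_atlas B" and f: "smooth_map A B f"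
    and p: "p \<in> points A" and v: "v \<in> tangent_space A p"
  shows "dmap A B f p v \<in> tangent_space B (f p)"
proof -
  let ?c = "some_chart A p"
  have c: "?c \<in> charts_at A p" using p by (rule some_chart)
  then have cA: "?c \<in> A" "p \<in> fst ?c" by (auto simp: charts_at_def)
  have inv: "chart_inv ?c (snd ?c p) = p" using cA by (rule chart_inv_chart[OF A])
  have "dmap A B f p v d' = frechet_derivative (transition d d') (at (snd d (f p))) (dmap A B f p v d)"
    if d: "d \<in> charts_at B (f p)" "d' \<in> charts_at B (f p)" for d d'
  proof -
    have dB: "d \<in> B" "d' \<in> B" "f p \<in> fst d" "f p \<in> fst d'" using d by (auto simp: charts_at_def)
    have "(lrep ?c d f has_derivative frechet_derivative (lrep ?c d f) (at (snd ?c p))) (at (snd ?c p))"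
      using smooth_map_differentiable[OF f c d(1)] by (simp add: frechet_derivative_works)
    moreover have "(transition d d' has_derivative frechet_derivative (transition d d') (at (snd d (f p))))
        (at (lrep ?c d f (snd ?c p)))"
      using transition_has_derivative[OF B d] by (simp add: inv)
    ultimately have "((\<lambda>x. transition d d' (lrep ?c d f x)) has_derivative
      (\<lambda>w. frechet_derivative (transition d d') (at (snd d (f p))) (frechet_derivative (lrep ?c d f) (at (snd ?c p)) w)))
        (at (snd ?c p))"
      using diff_chain_at[of "lrep ?c d f" _ "snd ?c p" "transition d d'"] by (simp add: o_def)
    then have "(lrep ?c d' f has_derivative
      (\<lambda>w. frechet_derivative (transition d d') (at (snd d (f p))) (frechet_derivative (lrep ?c d f) (at (snd ?c p)) w)))
        (at (snd ?c p))"
    proof (rule has_derivative_transform_within_open)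
      show "open (snd ?c ` (fst ?c \<inter> f -` fst d))"
        by (rule open_lrep_domain[OF A f cA(1) open_chart[OF B dB(1)]])
      show "snd ?c p \<in> snd ?c ` (fst ?c \<inter> f -` fst d)" using cA dB by auto
      show "transition d d' (lrep ?c d f x) = lrep ?c d' f x" if "x \<in> snd ?c ` (fst ?c \<inter> f -` fst d)" for x
        using that cA chart_inv_chart[OF A cA(1)] chart_inv_chart[OF B dB(1)] by (auto simp: transition_def)
    qed
    then show ?thesis
      using d by (simp add: smooth_map_dmap[OF A f c _ v] frechet_derivative_eqI)
  qed
  moreover have "dmap A B f p v d = 0" if "d \<notin> charts_at B (f p)" for d
    using that by (simp add: dmap_def Let_def)
  ultimately show ?thesis unfolding tangent_space_def by blast
qed

section \<open>The product of a surface and an interval\<close>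

abbreviation pch :: "real set \<Rightarrow> ('m, 'e) chart \<Rightarrow> ('m \<times> real, 'e \<times> real) chart" where
  "pch I d \<equiv> (fst d \<times> I, map_prod (snd d) (\<lambda>x. x))"

lemma prod_atlas_interval: "prod_atlas M (open_atlas I) = pch I ` M"
proof -
  have "cb \<in> prod_atlas M (open_atlas I) \<longleftrightarrow> (\<exists>d\<in>M. cb = pch I d)" for cb
    unfolding prod_atlas_def open_atlas_def mem_Collect_eq
    by (metis fst_conv insertCI singletonD snd_conv)
  then show ?thesis unfolding image_def by blast
qed

lemma points_prod: "points (prod_atlas M (open_atlas I)) = points M \<times> I" for I :: "real set"
  by (auto simp: prod_atlas_interval points_def)

lemma charts_at_prod:
  "snd b \<in> I \<Longrightarrow> charts_at (prod_atlas M (open_atlas I)) b = pch I ` charts_at M (fst b)"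
proof -
  have filter: "{x \<in> f ` S. P x} = f ` {y \<in> S. P (f y)}" for f :: "'x \<Rightarrow> 'y" and S P by blast
  assume "snd b \<in> I"
  then have "b \<in> fst (pch I d) \<longleftrightarrow> fst b \<in> fst d" for d :: "('a, 'b) chart"
    by (cases b) simp
  then show ?thesis unfolding charts_at_def prod_atlas_interval filter by simp
qed

lemma image_pch: "snd (pch I d) ` fst (pch I d) = (snd d ` fst d) \<times> I"
  by (force simp: image_iff)

lemma chart_inv_pch:
  assumes "smooth_atlas M" "d \<in> M" "z \<in> snd d ` fst d" "t \<in> I"
  shows "chart_inv (pch I d) (z, t) = (chart_inv d z, t)"
proof -
  have "inj_on (snd (pch I d)) (fst (pch I d))"
    using inj_chart[OF assms(1,2)] by (auto simp: inj_on_def)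
  moreover have "snd (pch I d) (chart_inv d z, t) = (z, t)" "(chart_inv d z, t) \<in> fst (pch I d)"
    using assms(3,4) chart_inv_in[OF assms(3)] chart_chart_inv[OF assms(3)] by auto
  ultimately show ?thesis by (intro inv_into_f_eq)
qed

lemma transition_pch_derivative:
  assumes M: "smooth_atlas M" "d \<in> charts_at M m" "e \<in> charts_at M m" and I: "open I" "t \<in> I"
  shows "frechet_derivative (transition (pch I d) (pch I e)) (at (snd (pch I d) (m, t))) (w, r)
    = (frechet_derivative (transition d e) (at (snd d m)) w, r)"
proof -
  have d: "d \<in> M" "m \<in> fst d" "e \<in> M" "m \<in> fst e" using M by (auto simp: charts_at_def)
  have "(fst has_derivative fst) (at (snd d m, t))"
    by (rule bounded_linear_imp_has_derivative[OF bounded_linear_fst])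
  from diff_chain_at[OF this, of "transition d e"]
  have tr: "((\<lambda>x. transition d e (fst x)) has_derivative
      (\<lambda>w. frechet_derivative (transition d e) (at (snd d m)) (fst w))) (at (snd d m, t))"
    using transition_has_derivative[OF M] by (simp add: o_def)
  have *: "((\<lambda>x. (transition d e (fst x), snd x)) has_derivative
      (\<lambda>w. (frechet_derivative (transition d e) (at (snd d m)) (fst w), snd w))) (at (snd d m, t))"
    by (intro has_derivative_Pair tr has_derivative_snd has_derivative_ident)
  have "(transition (pch I d) (pch I e) has_derivative
      (\<lambda>w. (frechet_derivative (transition d e) (at (snd d m)) (fst w), snd w))) (at (snd d m, t))"
  proof (rule has_derivative_transform_within_open[OF *])
    show "open ((snd d ` fst d) \<times> I)" by (intro open_Times open_chart_image[OF M(1)] d I)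
    show "(transition d e (fst x), snd x) = transition (pch I d) (pch I e) x" if "x \<in> (snd d ` fst d) \<times> I" for x
      using that chart_inv_pch[OF M(1) d(1), of "fst x" "snd x" I] by (auto simp: transition_def)
  qed (use d I in auto)
  from frechet_derivative_eqI[OF this] show ?thesis by simp
qed

lemma fst_lrep_derivative:
  assumes M: "smooth_atlas M" "d \<in> charts_at M m" "e \<in> charts_at M m" and I: "open I" "t \<in> I"
  shows "frechet_derivative (lrep (pch I d) e fst) (at (snd (pch I d) (m, t))) w
    = frechet_derivative (transition d e) (at (snd d m)) (fst w)"
    "lrep (pch I d) e fst differentiable (at (snd (pch I d) (m, t)))"
proof -
  have d: "d \<in> M" "m \<in> fst d" "e \<in> M" "m \<in> fst e" using M by (auto simp: charts_at_def)
  have "(fst has_derivative fst) (at (snd d m, t))"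
    by (rule bounded_linear_imp_has_derivative[OF bounded_linear_fst])
  from diff_chain_at[OF this, of "transition d e"]
  have *: "((\<lambda>x. transition d e (fst x)) has_derivative
      (\<lambda>w. frechet_derivative (transition d e) (at (snd d m)) (fst w))) (at (snd d m, t))"
    using transition_has_derivative[OF M] by (simp add: o_def)
  have "(lrep (pch I d) e fst has_derivative
      (\<lambda>w. frechet_derivative (transition d e) (at (snd d m)) (fst w))) (at (snd d m, t))"
  proof (rule has_derivative_transform_within_open[OF *])
    show "open ((snd d ` fst d) \<times> I)" by (intro open_Times open_chart_image[OF M(1)] d I)
    show "transition d e (fst x) = lrep (pch I d) e fst x" if "x \<in> (snd d ` fst d) \<times> I" for x
      using that chart_inv_pch[OF M(1) d(1), of "fst x" "snd x" I] by (auto simp: transition_def)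
  qed (use d I in auto)
  note der = this
  show "frechet_derivative (lrep (pch I d) e fst) (at (snd (pch I d) (m, t))) w
    = frechet_derivative (transition d e) (at (snd d m)) (fst w)"
    using frechet_derivative_eqI[OF der] by simp
  show "lrep (pch I d) e fst differentiable (at (snd (pch I d) (m, t)))"
    using differentiableI[OF der] by simp
qed

text \<open>The differential of \<open>fst\<close> is computed in some product chart
  \<open>pch I d0\<close>; going from \<open>d\<close> to \<open>d0\<close> and on to
  \<open>e\<close> composes to the transition from \<open>d\<close> to \<open>e\<close>.\<close>

lemma dmap_fst_tangent_of:
  assumes M: "smooth_atlas M" "d \<in> charts_at M m" and I: "open I" "t \<in> I"
  shows "dmap (prod_atlas M (open_atlas I)) M fst (m, t)
      (tangent_of (prod_atlas M (open_atlas I)) (pch I d) (m, t) (w, r)) = tangent_of M d m w"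
proof
  let ?B = "prod_atlas M (open_atlas I)"
  have b: "charts_at ?B (m, t) = pch I ` charts_at M m" using charts_at_prod[of "(m, t)" I M] I by simp
  have "(m, t) \<in> points ?B" using charts_at_points[OF M(2)] I by (simp add: points_prod)
  then obtain d0 where d0: "d0 \<in> charts_at M m" "some_chart ?B (m, t) = pch I d0"
    using some_chart[of "(m, t)" ?B] b by auto
  have tan: "tangent_of ?B (pch I d) (m, t) (w, r) (pch I d0) = (frechet_derivative (transition d d0) (at (snd d m)) w, r)"
    using transition_pch_derivative[OF M d0(1) I] b d0 by (simp add: tangent_of_def)
  show "dmap ?B M fst (m, t) (tangent_of ?B (pch I d) (m, t) (w, r)) e = tangent_of M d m w e" for e
  proof (cases "e \<in> charts_at M m")
    case True
    have "dmap ?B M fst (m, t) (tangent_of ?B (pch I d) (m, t) (w, r)) e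
        = frechet_derivative (lrep (pch I d0) e fst) (at (snd (pch I d0) (m, t)))
            (frechet_derivative (transition d d0) (at (snd d m)) w, r)"
      using True tan by (simp add: dmap_def Let_def d0(2))
    also have "\<dots> = frechet_derivative (transition d0 e) (at (snd d0 m)) (frechet_derivative (transition d d0) (at (snd d m)) w)"
      using fst_lrep_derivative(1)[OF M(1) d0(1) True I] by simp
    also have "\<dots> = tangent_of M d m w e"
      using transition_compose[OF M d0(1) True] True by (simp add: tangent_of_def)
    finally show ?thesis .
  qed (simp add: dmap_def tangent_of_def Let_def)
qed

section \<open>Alternating 2-forms\<close>

lemma vec2_nth [simp]: "vec2 v w 0 = v" "vec2 v w (Suc 0) = w" "vec2 v w 1 = w"
  by (simp_all add: vec2_def)

lemma alternating_form_cong: "alternating_form T k a \<Longrightarrow> (\<And>i. i < k \<Longrightarrow> v i = v' i) \<Longrightarrow> a v = a v'"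
  by (simp add: alternating_form_def)

lemma alternating_form_vec2: "alternating_form T 2 a \<Longrightarrow> a v = a (vec2 (v 0) (v 1))"
  by (rule alternating_form_cong) (auto simp: vec2_def numeral_2_eq_2 less_Suc_eq)

lemma
  assumes a: "alternating_form T 2 a" and T: "subspace T" and x: "x \<in> T" "y \<in> T" "z \<in> T"
  shows alternating_2_add: "a (vec2 (x + y) z) = a (vec2 x z) + a (vec2 y z)"
      "a (vec2 z (x + y)) = a (vec2 z x) + a (vec2 z y)"
    and alternating_2_scale: "a (vec2 (r *\<^sub>R x) z) = r * a (vec2 x z)" "a (vec2 z (r *\<^sub>R x)) = r * a (vec2 z x)"
    and alternating_2_same: "a (vec2 x x) = 0"
    and alternating_2_swap: "a (vec2 y x) = - a (vec2 x y)"
proof -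
  have mem: "\<forall>i. vec2 v w i \<in> T" if "v \<in> T" "w \<in> T" for v w using that by (simp add: vec2_def)
  note ax = a[unfolded alternating_form_def, THEN conjunct2]
  note add_ax = ax[THEN conjunct1]
    and scale_ax = ax[THEN conjunct2, THEN conjunct1]
    and alt_ax = ax[THEN conjunct2, THEN conjunct2]
  have upd: "a ((vec2 v w)(0 := v')) = a (vec2 v' w)" "a ((vec2 v w)(Suc 0 := w')) = a (vec2 v w')" for v w v' w'
    by (rule alternating_form_cong[OF a]; auto simp: vec2_def numeral_2_eq_2 less_Suc_eq)+
  have add: "a ((vec2 v w)(i := x + y)) = a ((vec2 v w)(i := x)) + a ((vec2 v w)(i := y))"
    if "i < 2" "v \<in> T" "w \<in> T" "x \<in> T" "y \<in> T" for v w x y i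
    using add_ax[rule_format, of "vec2 v w" x y i] mem that by blast
  have scale: "a ((vec2 v w)(i := r *\<^sub>R x)) = r * a ((vec2 v w)(i := x))"
    if "i < 2" "v \<in> T" "w \<in> T" "x \<in> T" for v w x i
    using scale_ax[rule_format, of "vec2 v w" x i r] mem that by blast
  have add1: "a (vec2 (x + y) z) = a (vec2 x z) + a (vec2 y z)"
    and add2: "a (vec2 z (x + y)) = a (vec2 z x) + a (vec2 z y)"
    if "x \<in> T" "y \<in> T" "z \<in> T" for x y z
    using add[of 0 x z x y] add[of "Suc 0" z z x y] that by (simp_all add: upd)
  show "a (vec2 (x + y) z) = a (vec2 x z) + a (vec2 y z)" "a (vec2 z (x + y)) = a (vec2 z x) + a (vec2 z y)"
    using add1 add2 x by blast+
  show "a (vec2 (r *\<^sub>R x) z) = r * a (vec2 x z)" "a (vec2 z (r *\<^sub>R x)) = r * a (vec2 z x)"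
    using scale[of 0 x z x] scale[of "Suc 0" z z x] x by (simp_all add: upd)
  have same: "a (vec2 v v) = 0" if "v \<in> T" for v
    using alt_ax[rule_format, of "vec2 v v" 0 "Suc 0"] mem[OF that that] by simp
  show "a (vec2 x x) = 0" using same x by blast
  show "a (vec2 y x) = - a (vec2 x y)"
    using same[of "x + y"] same[of x] same[of y] x subspace_add[OF T]
    by (simp add: add1 add2)
qed

section \<open>Coordinates on a complex surface\<close>

lemma complex2_expand:
  "w = Re (w $ 1) *\<^sub>R axis 1 1 + Im (w $ 1) *\<^sub>R axis 1 \<i> + Re (w $ 2) *\<^sub>R axis 2 1 + Im (w $ 2) *\<^sub>R axis 2 \<i>"
  for w :: "complex ^ 2"
  by (simp add: vec_eq_iff forall_2 axis_def complex_eq_iff)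

lemma smooth_formD1: "smooth_form A k \<omega> \<Longrightarrow> p \<in> points A \<Longrightarrow> alternating_form (tangent_space A p) k (\<omega> p)"
  by (simp add: smooth_form_def)

lemma smooth_formD2: "smooth_form A k \<omega> \<Longrightarrow> c \<in> A \<Longrightarrow> smooth_on (snd c ` fst c)
    (\<lambda>x. \<omega> (chart_inv c x) (\<lambda>i. tangent_of A c (chart_inv c x) (w i)))"
  by (simp add: smooth_form_def)

text \<open>The data on the base, to be shared by the bundles L and N.\<close>

locale surface_data =
  fixes M :: "('m::{t2_space,second_countable_topology}, complex ^ 2) chart set"
    and \<omega>2 \<omega>3 :: "('m, complex ^ 2, real) form"
    and A :: int and c :: real and I :: "real set"
    and \<omega>1 :: "real \<Rightarrow> ('m, complex ^ 2, real) form"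
    and u :: "real \<Rightarrow> 'm \<Rightarrow> real"
    and B :: "('m \<times> real, (complex ^ 2) \<times> real) chart set"
    and ds F :: "('m \<times> real, (complex ^ 2) \<times> real, real) form"
  assumes M: "complex_surface M"
    and form23: "smooth_form M 2 \<omega>2" "smooth_form M 2 \<omega>3"
      "holomorphic_2_0_form M (complex_form \<omega>2 \<omega>3)"
    and A: "A \<noteq> 0"
    and I: "open I" "I \<subseteq> {0<..}" "\<forall>s\<in>I. (s + c) / of_int A > 0"
    and B: "B = prod_atlas M (open_atlas I)"
    and kaehler: "smooth_form B 2 (family_form M I \<omega>1)" "\<forall>s\<in>I. kaehler_form M (\<omega>1 s)"
    and u: "smooth_form B 0 (fun_form (\<lambda>x. u (snd x) (fst x)))"
      "\<forall>s\<in>I. \<forall>p\<in>points M. u s p > 0"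
    and eq1: "\<forall>s\<in>I. form_eq M
        ((\<lambda>p. 1 / 2 * u s p) \<cdot> (complex_form \<omega>2 \<omega>3 \<and>\<^bsub>2,2\<^esub> complex_form \<omega>2 (- \<omega>3)))
        (complex_form ((s * (s + c) / of_int A) *\<^sub>R (\<omega>1 s \<and>\<^bsub>2,2\<^esub> \<omega>1 s)) 0)"
    and ds: "ds = ext_d B 0 (fun_form snd)"
    and F: "F = - (1 / of_int A) *\<^sub>R (family_form M I (\<lambda>s. dc M (u s)) \<and>\<^bsub>1,1\<^esub> ds)
                + of_int A *\<^sub>R family_form M I (family_deriv \<omega>1)"
begin

lemma Ms: "smooth_atlas M"
  using M by (simp add: complex_surface_def)

text \<open>The transition maps are holomorphic, so their derivatives commute with multiplication by
  the imaginary unit.\<close>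

lemma J_tangent_of:
  assumes d: "d \<in> charts_at M m"
  shows "J (tangent_of M d m w) = tangent_of M d m (\<i> *s w)"
proof
  fix e
  show "J (tangent_of M d m w) e = tangent_of M d m (\<i> *s w) e"
  proof (cases "e \<in> charts_at M m")
    case True
    have "holomorphic_map (snd d ` (fst d \<inter> fst e)) (transition d e)"
      using M d True by (simp add: complex_surface_def charts_at_def)
    then obtain D where D: "(transition d e has_derivative D) (at (snd d m))" "\<And>w. D (\<i> *s w) = \<i> *s D w"
      using d True unfolding holomorphic_map_def charts_at_def by blast
    then show ?thesis
      using True by (simp add: J_def tangent_of_def frechet_derivative_eqI[OF D(1)])
  qed (simp add: J_def tangent_of_def)
qed

lemma J_apply: "J v d = \<i> *s v d"
  by (simp add: J_def)

definition kk :: "('m, complex ^ 2) chart \<Rightarrow> complex ^ 2 \<Rightarrow> complex ^ 2 \<Rightarrow> (complex ^ 2) \<times> real \<Rightarrow> real" where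
  "kk d v w = (\<lambda>x. \<omega>1 (snd x) (chart_inv d (fst x))
     (vec2 (tangent_of M d (chart_inv d (fst x)) v) (tangent_of M d (chart_inv d (fst x)) w)))"

text \<open>A real (1,1)-form in two complex variables has four real coefficients: \<open>ka\<close>
  and \<open>kd\<close> are the diagonal ones, \<open>ke\<close> and \<open>kf\<close> the two parts
  of the off-diagonal entry of its Hermitian matrix.\<close>

definition ka where "ka d = kk d (axis 1 1) (axis 1 \<i>)"
definition kd where "kd d = kk d (axis 2 1) (axis 2 \<i>)"
definition ke where "ke d = kk d (axis 1 1) (axis 2 1)"
definition kf where "kf d = kk d (axis 1 1) (axis 2 \<i>)"

text \<open>The form dz1 dz2 takes the value 1 on the coordinate vectors of x1 and x2, so
  \<open>hr\<close> and \<open>hi\<close> are the real and imaginary part of the coefficient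
  h.\<close>

definition hr :: "('m, complex ^ 2) chart \<Rightarrow> complex ^ 2 \<Rightarrow> real" where
  "hr d = (\<lambda>z. \<omega>2 (chart_inv d z) (vec2 (tangent_of M d (chart_inv d z) (axis 1 1)) (tangent_of M d (chart_inv d z) (axis 2 1))))"
definition hi :: "('m, complex ^ 2) chart \<Rightarrow> complex ^ 2 \<Rightarrow> real" where
  "hi d = (\<lambda>z. \<omega>3 (chart_inv d z) (vec2 (tangent_of M d (chart_inv d z) (axis 1 1)) (tangent_of M d (chart_inv d z) (axis 2 1))))"

definition uu :: "('m, complex ^ 2) chart \<Rightarrow> (complex ^ 2) \<times> real \<Rightarrow> real" where
  "uu d = (\<lambda>x. u (snd x) (chart_inv d (fst x)))"

lemma chart_inv_charts_at: "d \<in> M \<Longrightarrow> z \<in> snd d ` fst d \<Longrightarrow> d \<in> charts_at M (chart_inv d z)"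
  by (simp add: charts_at_def chart_inv_in)

lemma smooth_kk:
  assumes d: "d \<in> M"
  shows "smooth_on ((snd d ` fst d) \<times> I) (kk d v w)"
proof -
  have dB: "pch I d \<in> B" using d by (simp add: B prod_atlas_interval)
  have "smooth_on ((snd d ` fst d) \<times> I) (\<lambda>x. family_form M I \<omega>1 (chart_inv (pch I d) x)
      (\<lambda>i. tangent_of B (pch I d) (chart_inv (pch I d) x) (vec2 v w i, 0)))"
    using smooth_formD2[OF kaehler(1) dB] unfolding image_pch .
  then show ?thesis
  proof (rule iffD1[OF smooth_on_cong, rotated 2])
    show "open ((snd d ` fst d) \<times> I)" by (intro open_Times open_chart_image[OF Ms] d I)
    fix x assume x: "x \<in> (snd d ` fst d) \<times> I"
    let ?m = "chart_inv d (fst x)"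
    have inv: "chart_inv (pch I d) x = (?m, snd x)"
      using chart_inv_pch[OF Ms d, of "fst x" "snd x" I] x by auto
    have at: "d \<in> charts_at M ?m" using x by (intro chart_inv_charts_at d) auto
    have dm: "dmap B M fst (?m, snd x) (tangent_of B (pch I d) (?m, snd x) (w, 0)) = tangent_of M d ?m w" for w
      unfolding B using x by (intro dmap_fst_tangent_of[OF Ms at I(1)]) auto
    have "snd x \<in> I" using x by auto
    then have al: "alternating_form (tangent_space M ?m) 2 (\<omega>1 (snd x) ?m)"
      using kaehler(2) charts_at_points[OF at] unfolding kaehler_form_def by (metis smooth_formD1)
    show "family_form M I \<omega>1 (chart_inv (pch I d) x)
      (\<lambda>i. tangent_of B (pch I d) (chart_inv (pch I d) x) (vec2 v w i, 0)) = kk d v w x"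
      unfolding inv family_form_def kk_def B[symmetric]
      using alternating_form_vec2[OF al, of "\<lambda>i. tangent_of M d ?m (vec2 v w i)"] by (simp add: dm)
  qed
qed

lemma smooth_uu:
  assumes d: "d \<in> M"
  shows "smooth_on ((snd d ` fst d) \<times> I) (uu d)"
proof -
  have dB: "pch I d \<in> B" using d by (simp add: B prod_atlas_interval)
  have "smooth_on ((snd d ` fst d) \<times> I) (\<lambda>x. fun_form (\<lambda>x. u (snd x) (fst x)) (chart_inv (pch I d) x)
      (\<lambda>i. tangent_of B (pch I d) (chart_inv (pch I d) x) 0))"
    using smooth_formD2[OF u(1) dB] unfolding image_pch .
  then show ?thesis
  proof (rule iffD1[OF smooth_on_cong, rotated 2])
    show "open ((snd d ` fst d) \<times> I)" by (intro open_Times open_chart_image[OF Ms] d I)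
    fix x assume x: "x \<in> (snd d ` fst d) \<times> I"
    have inv: "chart_inv (pch I d) x = (chart_inv d (fst x), snd x)"
      using chart_inv_pch[OF Ms d, of "fst x" "snd x" I] x by auto
    show "fun_form (\<lambda>x. u (snd x) (fst x)) (chart_inv (pch I d) x)
      (\<lambda>i. tangent_of B (pch I d) (chart_inv (pch I d) x) 0) = uu d x"
      unfolding inv by (simp add: fun_form_def uu_def)
  qed
qed

lemma smooth_2form_coefficient:
  assumes \<omega>: "smooth_form M 2 \<omega>" and d: "d \<in> M"
  shows "smooth_on (snd d ` fst d) (\<lambda>z. \<omega> (chart_inv d z) (vec2 (tangent_of M d (chart_inv d z) v) (tangent_of M d (chart_inv d z) w)))"
  using smooth_formD2[OF \<omega> d, of "vec2 v w"]
proof (rule iffD1[OF smooth_on_cong, rotated 2])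
  show "open (snd d ` fst d)" by (rule open_chart_image[OF Ms d])
  fix z assume z: "z \<in> snd d ` fst d"
  show "\<omega> (chart_inv d z) (\<lambda>i. tangent_of M d (chart_inv d z) (vec2 v w i))
      = \<omega> (chart_inv d z) (vec2 (tangent_of M d (chart_inv d z) v) (tangent_of M d (chart_inv d z) w))"
    by (subst alternating_form_vec2[OF smooth_formD1[OF \<omega> charts_at_points[OF chart_inv_charts_at[OF d z]]]]) simp
qed

lemma smooth_hr: "d \<in> M \<Longrightarrow> smooth_on (snd d ` fst d) (hr d)"
  and smooth_hi: "d \<in> M \<Longrightarrow> smooth_on (snd d ` fst d) (hi d)"
  unfolding hr_def hi_def using form23 by (auto intro: smooth_2form_coefficient)

lemma alternating_kaehler:
  assumes "s \<in> I" "m \<in> points M"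
  shows "alternating_form (tangent_space M m) 2 (\<omega>1 s m)"
  using kaehler(2) assms unfolding kaehler_form_def by (metis smooth_formD1)

abbreviation x1 where "x1 w \<equiv> Re ((w :: complex ^ 2) $ 1)"
abbreviation y1 where "y1 w \<equiv> Im ((w :: complex ^ 2) $ 1)"
abbreviation x2 where "x2 w \<equiv> Re ((w :: complex ^ 2) $ 2)"
abbreviation y2 where "y2 w \<equiv> Im ((w :: complex ^ 2) $ 2)"

lemma tangent_of_expand:
  assumes "d \<in> charts_at M m"
  shows "tangent_of M d m w = x1 w *\<^sub>R tangent_of M d m (axis 1 1) + y1 w *\<^sub>R tangent_of M d m (axis 1 \<i>)
    + x2 w *\<^sub>R tangent_of M d m (axis 2 1) + y2 w *\<^sub>R tangent_of M d m (axis 2 \<i>)"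
  by (subst complex2_expand[of w]) (simp only: tangent_of_linear[OF Ms assms])

text \<open>Invariance under J equates the value on (y1, y2) with that on (x1, x2), and the value on
  (y1, x2) with minus that on (x1, y2). This leaves four of the six coefficients; bilinearity does
  the rest.\<close>

lemma kaehler_coordinates:
  assumes d: "d \<in> charts_at M m" and s: "s \<in> I"
  shows "\<omega>1 s m (vec2 (tangent_of M d m v) (tangent_of M d m w))
    = ka d (snd d m, s) * (x1 v * y1 w - y1 v * x1 w) + kd d (snd d m, s) * (x2 v * y2 w - y2 v * x2 w)
    + ke d (snd d m, s) * (x1 v * x2 w - x2 v * x1 w + (y1 v * y2 w - y2 v * y1 w))
    + kf d (snd d m, s) * (x1 v * y2 w - y2 v * x1 w - (y1 v * x2 w - x2 v * y1 w))"
proof -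
  have m: "m \<in> points M" "chart_inv d (snd d m) = m"
    using charts_at_points[OF d] charts_atD[OF d] by (auto simp: chart_inv_chart[OF Ms])
  let ?q = "\<lambda>v w. \<omega>1 s m (vec2 (tangent_of M d m v) (tangent_of M d m w))"
  note al = alternating_kaehler[OF s m(1)] and T = subspace_tangent_space[OF Ms, of m]
  note mem = tangent_of_in[OF Ms d]
  note add = alternating_2_add[OF al T] and scale = alternating_2_scale[OF al T]
    and same = alternating_2_same[OF al T] and swap = alternating_2_swap[OF al T]
  have J: "?q (\<i> *s v) (\<i> *s w) = ?q v w" for v w
    using kaehler(2) s m(1) mem unfolding kaehler_form_def by (metis J_tangent_of[OF d])
  have neg: "?q (- v) w = - ?q v w" for v w
    using scale(1)[OF mem mem mem, of "-1" v] tangent_of_linear(2)[OF Ms d, of "-1" v] by simp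
  have i: "\<i> *s axis 1 1 = axis 1 \<i>" "\<i> *s axis 2 1 = axis 2 \<i>" "\<i> *s axis 1 \<i> = - axis 1 1"
    "\<i> *s axis 2 \<i> = - axis 2 1"
    by (simp_all add: vec_eq_iff forall_2 axis_def)
  have j1: "?q (axis 1 \<i>) (axis 2 \<i>) = ?q (axis 1 1) (axis 2 1)"
    using J[of "axis 1 1" "axis 2 1"] by (simp add: i)
  have j2: "?q (axis 1 \<i>) (axis 2 1) = - ?q (axis 1 1) (axis 2 \<i>)"
    using J[of "axis 1 \<i>" "axis 2 1"] by (simp add: i neg)
  have swp: "?q w v = - ?q v w" for v w
    by (rule swap[OF mem mem mem])
  have sw: "?q (axis 1 \<i>) (axis 1 1) = - ?q (axis 1 1) (axis 1 \<i>)"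
    "?q (axis 2 \<i>) (axis 2 1) = - ?q (axis 2 1) (axis 2 \<i>)"
    "?q (axis 2 1) (axis 1 1) = - ?q (axis 1 1) (axis 2 1)" "?q (axis 2 \<i>) (axis 1 1) = - ?q (axis 1 1) (axis 2 \<i>)"
    "?q (axis 2 1) (axis 1 \<i>) = ?q (axis 1 1) (axis 2 \<i>)" "?q (axis 2 \<i>) (axis 1 \<i>) = - ?q (axis 1 1) (axis 2 1)"
    using swp[of "axis 1 1" "axis 1 \<i>"] swp[of "axis 2 1" "axis 2 \<i>"] swp[of "axis 1 1" "axis 2 1"]
      swp[of "axis 1 1" "axis 2 \<i>"] swp[of "axis 1 \<i>" "axis 2 1"] swp[of "axis 1 \<i>" "axis 2 \<i>"] j1 j2
    by linarith+
  have k: "ka d (snd d m, s) = ?q (axis 1 1) (axis 1 \<i>)" "kd d (snd d m, s) = ?q (axis 2 1) (axis 2 \<i>)"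
    "ke d (snd d m, s) = ?q (axis 1 1) (axis 2 1)" "kf d (snd d m, s) = ?q (axis 1 1) (axis 2 \<i>)"
    by (simp_all add: ka_def kd_def ke_def kf_def kk_def m)
  have scl: "\<omega>1 s m (vec2 (r *\<^sub>R tangent_of M d m v) (tangent_of M d m w)) = r * ?q v w"
    "\<omega>1 s m (vec2 (tangent_of M d m v) (r *\<^sub>R tangent_of M d m w)) = r * ?q v w" for r v w
    by (rule scale[OF mem mem mem])+
  have lin1: "?q v w = x1 v * ?q (axis 1 1) w + y1 v * ?q (axis 1 \<i>) w + x2 v * ?q (axis 2 1) w + y2 v * ?q (axis 2 \<i>) w" for v w
    by (subst tangent_of_expand[OF d, of v])
      (simp only: add(1) scl mem subspace_scale[OF T] subspace_add[OF T])
  have lin2: "?q v w = x1 w * ?q v (axis 1 1) + y1 w * ?q v (axis 1 \<i>) + x2 w * ?q v (axis 2 1) + y2 w * ?q v (axis 2 \<i>)" for v w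
    by (subst tangent_of_expand[OF d, of w])
      (simp only: add(2) scl mem subspace_scale[OF T] subspace_add[OF T])
  have dg: "?q (axis 1 1) (axis 1 1) = 0" "?q (axis 1 \<i>) (axis 1 \<i>) = 0" "?q (axis 2 1) (axis 2 1) = 0" "?q (axis 2 \<i>) (axis 2 \<i>) = 0"
    using same[OF mem mem mem] by blast+
  show ?thesis
    unfolding k
    by (subst lin1, subst (1 2 3 4) lin2) (simp only: dg sw j1 j2, simp add: algebra_simps)
qed

lemma holomorphic_coordinates:
  assumes d: "d \<in> charts_at M m"
  shows "\<omega>2 m (vec2 (tangent_of M d m v) (tangent_of M d m w))
      = hr d (snd d m) * (x1 v * x2 w - x2 v * x1 w - (y1 v * y2 w - y2 v * y1 w))
      - hi d (snd d m) * (x1 v * y2 w - y2 v * x1 w + (y1 v * x2 w - x2 v * y1 w))" (is ?thesis2)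
    and "\<omega>3 m (vec2 (tangent_of M d m v) (tangent_of M d m w))
      = hr d (snd d m) * (x1 v * y2 w - y2 v * x1 w + (y1 v * x2 w - x2 v * y1 w))
      + hi d (snd d m) * (x1 v * x2 w - x2 v * x1 w - (y1 v * y2 w - y2 v * y1 w))" (is ?thesis3)
    and "\<exists>D. ((\<lambda>z. Complex (hr d z) (hi d z)) has_derivative D) (at (snd d m)) \<and> (\<forall>w. D (\<i> *s w) = \<i> * D w)"
proof -
  have dM: "d \<in> M" "m \<in> fst d" using charts_atD[OF d] by auto
  obtain h where h: "holomorphic_fun (snd d ` fst d) h"
    "\<And>z w. z \<in> snd d ` fst d \<Longrightarrow> complex_form \<omega>2 \<omega>3 (chart_inv d z) (\<lambda>i. tangent_of M d (chart_inv d z) (w i))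
       = h z * (w 0 $ 1 * w 1 $ 2 - w 0 $ 2 * w 1 $ 1)"
    using form23(3) dM(1) unfolding holomorphic_2_0_form_def by meson
  have val: "Complex (\<omega>2 (chart_inv d z) (vec2 (tangent_of M d (chart_inv d z) v) (tangent_of M d (chart_inv d z) w)))
      (\<omega>3 (chart_inv d z) (vec2 (tangent_of M d (chart_inv d z) v) (tangent_of M d (chart_inv d z) w)))
      = h z * (v $ 1 * w $ 2 - v $ 2 * w $ 1)" if z: "z \<in> snd d ` fst d" for z v w
  proof -
    have p: "chart_inv d z \<in> points M" using charts_at_points[OF chart_inv_charts_at[OF dM(1) z]] .
    show ?thesis
      using h(2)[OF z, of "vec2 v w"] alternating_form_vec2[OF smooth_formD1[OF form23(1) p], of "\<lambda>i. tangent_of M d (chart_inv d z) (vec2 v w i)"]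
        alternating_form_vec2[OF smooth_formD1[OF form23(2) p], of "\<lambda>i. tangent_of M d (chart_inv d z) (vec2 v w i)"]
      by (simp add: complex_form_def)
  qed
  have hri: "Complex (hr d z) (hi d z) = h z" if "z \<in> snd d ` fst d" for z
    using val[OF that, of "axis 1 1" "axis 2 1"] by (simp add: hr_def hi_def axis_def)
  have z: "snd d m \<in> snd d ` fst d" "chart_inv d (snd d m) = m"
    using dM by (auto simp: chart_inv_chart[OF Ms])
  have "h (snd d m) = Complex (hr d (snd d m)) (hi d (snd d m))" using hri z by simp
  then show ?thesis2 ?thesis3
    using val[OF z(1), of v w] unfolding z(2) by (auto simp: complex_eq_iff algebra_simps)
  obtain D where D: "(h has_derivative D) (at (snd d m))" "\<And>w. D (\<i> *s w) = \<i> * D w"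
    using h(1) z(1) unfolding holomorphic_fun_def by blast
  have "((\<lambda>z. Complex (hr d z) (hi d z)) has_derivative D) (at (snd d m))"
    by (rule has_derivative_transform_within_open[OF D(1) open_chart_image[OF Ms dM(1)] z(1)]) (simp add: hri)
  then show "\<exists>D. ((\<lambda>z. Complex (hr d z) (hi d z)) has_derivative D) (at (snd d m)) \<and> (\<forall>w. D (\<i> *s w) = \<i> * D w)"
    using D(2) by blast
qed

lemma coefficients_positive:
  assumes d: "d \<in> charts_at M m" and s: "s \<in> I"
  shows "ka d (snd d m, s) > 0" "kd d (snd d m, s) > 0"
proof -
  have m: "m \<in> points M" using charts_at_points[OF d] .
  have "\<omega>1 s m (vec2 (tangent_of M d m w) (tangent_of M d m (\<i> *s w))) > 0" if "w \<noteq> 0" for w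
  proof -
    have "tangent_of M d m w \<noteq> 0"
      using tangent_of_apply[OF Ms d, of w] that by (metis zero_fun_apply)
    then show ?thesis
      using kaehler(2) s m tangent_of_in[OF Ms d] J_tangent_of[OF d]
      unfolding kaehler_form_def by metis
  qed
  from this[of "axis 1 1"] this[of "axis 2 1"]
  show "ka d (snd d m, s) > 0" "kd d (snd d m, s) > 0"
    unfolding kaehler_coordinates[OF d s] by (simp_all add: axis_def vec_eq_iff)
qed

text \<open>The equation of 4-forms is evaluated on the real coordinate frame. The form wedge its
  conjugate gives 4 |h|^2 and the square of the Kaehler form twice its Hermitian determinant; the
  factor 1/2 of the hypothesis evens this out.\<close>

lemma monge_ampere:
  assumes d: "d \<in> charts_at M m" and s: "s \<in> I"
  shows "u s m * ((hr d (snd d m))\<^sup>2 + (hi d (snd d m))\<^sup>2)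
    = s * (s + c) / of_int A * (ka d (snd d m, s) * kd d (snd d m, s) - (ke d (snd d m, s))\<^sup>2 - (kf d (snd d m, s))\<^sup>2)"
proof -
  have m: "m \<in> points M" using charts_at_points[OF d] .
  let ?T = "tangent_space M m"
  note T = subspace_tangent_space[OF Ms, of m]
  note mem = tangent_of_in[OF Ms d]
  define v where "v = (\<lambda>i. tangent_of M d m (quad (axis 1 1) (axis 1 \<i>) (axis 2 1) (axis 2 \<i>) i))"
  have v: "\<forall>i. v i \<in> ?T" by (simp add: v_def mem)
  note al1 = alternating_kaehler[OF s m] and al2 = smooth_formD1[OF form23(1) m] and al3 = smooth_formD1[OF form23(2) m]
  let ?O = "\<lambda>x y. Complex (\<omega>2 m (vec2 x y)) (\<omega>3 m (vec2 x y))"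
  let ?O' = "\<lambda>x y. Complex (\<omega>2 m (vec2 x y)) (- \<omega>3 m (vec2 x y))"
  have w1: "alt_wedge 2 2 (complex_form \<omega>2 \<omega>3 m) (complex_form \<omega>2 (- \<omega>3) m) v
      = ?O (v 0) (v 1) * ?O' (v 2) (v 3) - ?O (v 0) (v 2) * ?O' (v 1) (v 3)
      + ?O (v 0) (v 3) * ?O' (v 1) (v 2) + ?O (v 1) (v 2) * ?O' (v 0) (v 3)
      - ?O (v 1) (v 3) * ?O' (v 0) (v 2) + ?O (v 2) (v 3) * ?O' (v 0) (v 1)"
  proof (rule alt_wedge_2_2[OF _ _ _ _ v])
    show "complex_form \<omega>2 \<omega>3 m w = ?O (w 0) (w 1)" for w
      using alternating_form_vec2[OF al2, of w] alternating_form_vec2[OF al3, of w] by (simp add: complex_form_def)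
    show "complex_form \<omega>2 (- \<omega>3) m w = ?O' (w 0) (w 1)" for w
      using alternating_form_vec2[OF al2, of w] alternating_form_vec2[OF al3, of w] by (simp add: complex_form_def)
    show "?O y x = - ?O x y" "?O' y x = - ?O' x y" if "x \<in> ?T" "y \<in> ?T" for x y
      using alternating_2_swap[OF al2 T that that(1)] alternating_2_swap[OF al3 T that that(1)] by (simp_all add: complex_eq_iff)
  qed
  let ?K = "\<lambda>x y. \<omega>1 s m (vec2 x y)"
  have w2: "alt_wedge 2 2 (\<omega>1 s m) (\<omega>1 s m) v
      = ?K (v 0) (v 1) * ?K (v 2) (v 3) - ?K (v 0) (v 2) * ?K (v 1) (v 3)
      + ?K (v 0) (v 3) * ?K (v 1) (v 2) + ?K (v 1) (v 2) * ?K (v 0) (v 3)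
      - ?K (v 1) (v 3) * ?K (v 0) (v 2) + ?K (v 2) (v 3) * ?K (v 0) (v 1)"
  proof (rule alt_wedge_2_2[OF _ _ _ _ v])
    show "\<omega>1 s m w = ?K (w 0) (w 1)" for w using alternating_form_vec2[OF al1, of w] .
    then show "\<omega>1 s m w = ?K (w 0) (w 1)" for w .
    show "?K y x = - ?K x y" if "x \<in> ?T" "y \<in> ?T" for x y
      using alternating_2_swap[OF al1 T that that(1)] .
    then show "?K y x = - ?K x y" if "x \<in> ?T" "y \<in> ?T" for x y using that .
  qed
  have "(1 / 2 * u s m) *\<^sub>R alt_wedge 2 2 (complex_form \<omega>2 \<omega>3 m) (complex_form \<omega>2 (- \<omega>3) m) v
      = Complex ((s * (s + c) / of_int A) * alt_wedge 2 2 (\<omega>1 s m) (\<omega>1 s m) v) 0"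
    using eq1 s m v by (simp add: form_eq_def fmult_def wedge_def complex_form_def)
  then have E1: "1 / 2 * u s m * Re (alt_wedge 2 2 (complex_form \<omega>2 \<omega>3 m) (complex_form \<omega>2 (- \<omega>3) m) v)
      = (s * (s + c) / of_int A) * alt_wedge 2 2 (\<omega>1 s m) (\<omega>1 s m) v"
    by (simp add: complex_eq_iff)
  have E2: "Re (alt_wedge 2 2 (complex_form \<omega>2 \<omega>3 m) (complex_form \<omega>2 (- \<omega>3) m) v)
      = 4 * ((hr d (snd d m))\<^sup>2 + (hi d (snd d m))\<^sup>2)"
    unfolding w1 by (simp add: v_def holomorphic_coordinates[OF d] axis_def power2_eq_square)
  have E3: "alt_wedge 2 2 (\<omega>1 s m) (\<omega>1 s m) v
      = 2 * (ka d (snd d m, s) * kd d (snd d m, s) - (ke d (snd d m, s))\<^sup>2 - (kf d (snd d m, s))\<^sup>2)"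
    unfolding w2 by (simp add: v_def kaehler_coordinates[OF d s] axis_def power2_eq_square)
  have aux: "a * x = r * y" if "1 / 2 * a * p = r * q" "p = 4 * x" "q = 2 * y" for a x r y p q :: real
    using that by simp
  show ?thesis by (rule aux[OF E1 E2 E3])
qed

lemma partial_derivative:
  assumes f: "f differentiable (at (z, s))"
  shows "((\<lambda>z. f (z, s)) has_derivative (\<lambda>w. frechet_derivative f (at (z, s)) (w, 0))) (at z)"
proof -
  have "((\<lambda>z. (z, s)) has_derivative (\<lambda>w. (w, 0))) (at z)"
    by (intro has_derivative_Pair has_derivative_ident has_derivative_const)
  from diff_chain_at[OF this, of f] show ?thesis
    using f by (simp add: o_def frechet_derivative_works)
qed

text \<open>\<open>ext_d\<close> is evaluated in \<open>some_chart\<close>, so \<open>d\<close> has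
  to be that chart. Directions \<open>(v, 0)\<close> keep \<open>s\<close> fixed: each member of the
  family is closed on M, and nothing is asserted about the direction of \<open>s\<close>.\<close>

lemma kaehler_closed:
  assumes m: "m \<in> points M" and d: "d = some_chart M m" and s: "s \<in> I"
  shows "frechet_derivative (kk d v1 v2) (at (snd d m, s)) (v0, 0)
    - frechet_derivative (kk d v0 v2) (at (snd d m, s)) (v1, 0)
    + frechet_derivative (kk d v0 v1) (at (snd d m, s)) (v2, 0) = 0"
proof -
  have dm: "d \<in> charts_at M m" using some_chart[OF m] d by simp
  have dM: "d \<in> M" "m \<in> fst d" using charts_atD[OF dm] by auto
  define v where "v = (\<lambda>i. tangent_of M d m (quad v0 v1 v2 0 i))"
  have vd: "v i d = quad v0 v1 v2 0 i" for i by (simp add: v_def tangent_of_apply[OF Ms dm])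
  have der: "frechet_derivative (\<lambda>z. \<omega>1 s (chart_inv d z) (\<lambda>j. tangent_of M d (chart_inv d z) (w j))) (at (snd d m)) w'
      = frechet_derivative (kk d (w 0) (w 1)) (at (snd d m, s)) (w', 0)" for w w'
  proof -
    have "frechet_derivative (\<lambda>z. \<omega>1 s (chart_inv d z) (\<lambda>j. tangent_of M d (chart_inv d z) (w j))) (at (snd d m))
        = frechet_derivative (\<lambda>z. kk d (w 0) (w 1) (z, s)) (at (snd d m))"
    proof (rule frechet_derivative_cong_open[OF open_chart_image[OF Ms dM(1)]])
      show "snd d m \<in> snd d ` fst d" using dM by simp
      fix z assume z: "z \<in> snd d ` fst d"
      show "\<omega>1 s (chart_inv d z) (\<lambda>j. tangent_of M d (chart_inv d z) (w j)) = kk d (w 0) (w 1) (z, s)"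
        unfolding kk_def fst_conv snd_conv
        by (rule alternating_form_vec2[OF alternating_kaehler[OF s charts_at_points[OF chart_inv_charts_at[OF dM(1) z]]]])
    qed
    moreover have "kk d (w 0) (w 1) differentiable (at (snd d m, s))"
      by (rule smooth_on_differentiable[OF smooth_kk[OF dM(1)]]) (use dM s in auto)
    ultimately show ?thesis by (simp add: frechet_derivative_eqI[OF partial_derivative])
  qed
  have "ext_d M 2 (\<omega>1 s) m v = 0"
    using kaehler(2) s m tangent_of_in[OF Ms dm]
    unfolding kaehler_form_def closed_form_def form_eq_def v_def by simp
  moreover have "{..2} = {0, 1, 2 :: nat}" by auto
  ultimately show ?thesis
    by (simp add: ext_d_def Let_def vd der numeral_2_eq_2[symmetric] flip: d)
qed

lemma kk_values:
  assumes d: "d \<in> M" and x: "x \<in> (snd d ` fst d) \<times> I"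
  shows "kk d v w x = ka d x * (x1 v * y1 w - y1 v * x1 w) + kd d x * (x2 v * y2 w - y2 v * x2 w)
    + ke d x * (x1 v * x2 w - x2 v * x1 w + (y1 v * y2 w - y2 v * y1 w))
    + kf d x * (x1 v * y2 w - y2 v * x1 w - (y1 v * x2 w - x2 v * y1 w))"
  using kaehler_coordinates[of d "chart_inv d (fst x)" "snd x" v w] chart_inv_charts_at[OF d, of "fst x"] x
  by (auto simp: kk_def chart_chart_inv)

lemma smooth_coefficients:
  assumes "d \<in> M"
  shows "smooth_on ((snd d ` fst d) \<times> I) (ka d)" "smooth_on ((snd d ` fst d) \<times> I) (kd d)"
    "smooth_on ((snd d ` fst d) \<times> I) (ke d)" "smooth_on ((snd d ` fst d) \<times> I) (kf d)"
  unfolding ka_def kd_def ke_def kf_def by (rule smooth_kk[OF assms])+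

text \<open>The four components of closedness on coordinate triples, solved for derivatives of the
  diagonal coefficients; this is the shape that \<open>kform_closed\<close> consumes.\<close>

lemma kaehler_closed_coordinates:
  assumes m: "m \<in> points M" and d: "d = some_chart M m" and s: "s \<in> I"
  defines "D \<equiv> \<lambda>f w. frechet_derivative f (at (snd d m, s)) (w, 0)"
  shows "D (ka d) (axis 2 1) = D (kf d) (axis 1 1) + D (ke d) (axis 1 \<i>)"
    "D (ka d) (axis 2 \<i>) = D (kf d) (axis 1 \<i>) - D (ke d) (axis 1 1)"
    "D (kd d) (axis 1 1) = D (kf d) (axis 2 1) - D (ke d) (axis 2 \<i>)"
    "D (kd d) (axis 1 \<i>) = D (ke d) (axis 2 1) + D (kf d) (axis 2 \<i>)"
proof -
  have dm: "d \<in> charts_at M m" using some_chart[OF m] d by simp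
  have dM: "d \<in> M" "m \<in> fst d" using charts_atD[OF dm] by auto
  let ?S = "(snd d ` fst d) \<times> I"
  have S: "open ?S" "(snd d m, s) \<in> ?S" using open_Times[OF open_chart_image[OF Ms dM(1)] I(1)] dM s by auto
  have diff: "kf d differentiable (at (snd d m, s))"
    using smooth_on_differentiable[OF smooth_coefficients(4)[OF dM(1)] S(2)] .
  have 1: "D (kk d (axis 1 \<i>) (axis 2 \<i>)) = D (ke d)"
    unfolding D_def
    by (subst frechet_derivative_cong_open[OF S, of _ "ke d"]) (simp_all add: kk_values[OF dM(1)] axis_def)
  have 2: "D (kk d (axis 1 \<i>) (axis 2 1)) = (\<lambda>w. - D (kf d) w)"
    unfolding D_def using diff
    by (subst frechet_derivative_cong_open[OF S, of _ "\<lambda>x. - kf d x"])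
      (simp_all add: kk_values[OF dM(1)] axis_def frechet_derivative_eqI[OF has_derivative_minus] frechet_derivative_works)
  note cl = kaehler_closed[OF m d s]
  note 1 = 1[THEN fun_cong, unfolded D_def] and 2 = 2[THEN fun_cong, unfolded D_def]
  show "D (ka d) (axis 2 1) = D (kf d) (axis 1 1) + D (ke d) (axis 1 \<i>)"
    unfolding D_def using cl[of "axis 1 \<i>" "axis 2 1" "axis 1 1"] by (simp add: 2 flip: ka_def ke_def)
  show "D (ka d) (axis 2 \<i>) = D (kf d) (axis 1 \<i>) - D (ke d) (axis 1 1)"
    unfolding D_def using cl[of "axis 1 \<i>" "axis 2 \<i>" "axis 1 1"] by (simp add: 1 flip: ka_def kf_def)
  show "D (kd d) (axis 1 1) = D (kf d) (axis 2 1) - D (ke d) (axis 2 \<i>)"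
    unfolding D_def using cl[of "axis 2 1" "axis 2 \<i>" "axis 1 1"] by (simp flip: kd_def ke_def kf_def)
  show "D (kd d) (axis 1 \<i>) = D (ke d) (axis 2 1) + D (kf d) (axis 2 \<i>)"
    unfolding D_def using cl[of "axis 2 1" "axis 2 \<i>" "axis 1 \<i>"] by (simp add: 1 2 flip: kd_def)
qed

lemma cauchy_riemann:
  assumes m: "m \<in> points M" and d: "d \<in> charts_at M m"
  defines "D \<equiv> \<lambda>f. frechet_derivative f (at (snd d m))"
  shows "D (hr d) (\<i> *s w) = - D (hi d) w" "D (hi d) (\<i> *s w) = D (hr d) w"
proof -
  obtain D' where D': "((\<lambda>z. Complex (hr d z) (hi d z)) has_derivative D') (at (snd d m))"
    "\<And>w. D' (\<i> *s w) = \<i> * D' w" using holomorphic_coordinates(3)[OF d] by blast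
  have "D (hr d) = (\<lambda>w. Re (D' w))" "D (hi d) = (\<lambda>w. Im (D' w))"
    unfolding D_def
    using frechet_derivative_eqI[OF has_derivative_Re[OF D'(1)]] frechet_derivative_eqI[OF has_derivative_Im[OF D'(1)]]
    by simp_all
  then show "D (hr d) (\<i> *s w) = - D (hi d) w" "D (hi d) (\<i> *s w) = D (hr d) w"
    by (simp_all add: D'(2))
qed

end

section \<open>The algebra behind the closedness\<close>

definition kform :: "real \<Rightarrow> real \<Rightarrow> real \<Rightarrow> real \<Rightarrow> 'a grass \<Rightarrow> 'a grass \<Rightarrow> 'a grass \<Rightarrow> 'a grass \<Rightarrow> 'a grass" where
  "kform a d e f t1 t2 t3 t4 = a *\<^sub>R (t1 * t2) + d *\<^sub>R (t3 * t4) + e *\<^sub>R (t1 * t3 + t2 * t4) + f *\<^sub>R (t1 * t4 - t2 * t3)"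

definition hform :: "real \<Rightarrow> real \<Rightarrow> 'a grass \<Rightarrow> 'a grass \<Rightarrow> 'a grass \<Rightarrow> 'a grass \<Rightarrow> 'a grass" where
  "hform r i t1 t2 t3 t4 = r *\<^sub>R (t1 * t3 - t2 * t4) - i *\<^sub>R (t1 * t4 + t2 * t3)"

text \<open>In terms of a complex coframe \<open>dz\<^sub>1 = t1 + i t2\<close>, \<open>dz\<^sub>2 = t3 + i t4\<close>, \<open>kform\<close> is the general real
  (1,1)-form and \<open>hform r i\<close>, \<open>hform i (- r)\<close> are the real and imaginary parts of \<open>(r + i i) dz\<^sub>1 \<and> dz\<^sub>2\<close>.\<close>
lemma hform_kform:
  "hform r i (one t1) (one t2) (one t3) (one t4) * kform a d e f (one t1) (one t2) (one t3) (one t4) = 0"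
  unfolding kform_def hform_def
  by (simp add: algebra_simps
    one_square[of t1] one_square[of t2] one_square[of t3] one_square[of t4] one_square_left[of t1]
    one_square_left[of t2] one_square_left[of t3] one_square_left[of t4] one_anticommute[of t2 t1]
    one_anticommute_left[of t2 t1] one_anticommute[of t3 t1] one_anticommute_left[of t3 t1]
    one_anticommute[of t3 t2] one_anticommute_left[of t3 t2] one_anticommute[of t4 t1]
    one_anticommute_left[of t4 t1] one_anticommute[of t4 t2] one_anticommute_left[of t4 t2]
    one_anticommute[of t4 t3] one_anticommute_left[of t4 t3])

text \<open>A (2,0)-form on a surface has square zero by type, and this product is half the
  imaginary part of the square.\<close>

lemma hform_hform:
  "hform r i (one t1) (one t2) (one t3) (one t4) * hform i (- r) (one t1) (one t2) (one t3) (one t4) = 0"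
  unfolding hform_def
  by (simp add: algebra_simps
    one_square[of t1] one_square[of t2] one_square[of t3] one_square[of t4] one_square_left[of t1]
    one_square_left[of t2] one_square_left[of t3] one_square_left[of t4] one_anticommute[of t2 t1]
    one_anticommute_left[of t2 t1] one_anticommute[of t3 t1] one_anticommute_left[of t3 t1]
    one_anticommute[of t3 t2] one_anticommute_left[of t3 t2] one_anticommute[of t4 t1]
    one_anticommute_left[of t4 t1] one_anticommute[of t4 t2] one_anticommute_left[of t4 t2]
    one_anticommute[of t4 t3] one_anticommute_left[of t4 t3])

lemma hform_square:
  "hform r i (one t1) (one t2) (one t3) (one t4) * hform r i (one t1) (one t2) (one t3) (one t4)
    = (2 * (r\<^sup>2 + i\<^sup>2)) *\<^sub>R (one t1 * (one t2 * (one t3 * one t4)))"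
  unfolding hform_def
  by (simp add: algebra_simps power2_eq_square scaleR_2[symmetric]
    one_square[of t1] one_square[of t2] one_square[of t3] one_square[of t4] one_square_left[of t1]
    one_square_left[of t2] one_square_left[of t3] one_square_left[of t4] one_anticommute[of t2 t1]
    one_anticommute_left[of t2 t1] one_anticommute[of t3 t1] one_anticommute_left[of t3 t1]
    one_anticommute[of t3 t2] one_anticommute_left[of t3 t2] one_anticommute[of t4 t1]
    one_anticommute_left[of t4 t1] one_anticommute[of t4 t2] one_anticommute_left[of t4 t2]
    one_anticommute[of t4 t3] one_anticommute_left[of t4 t3])

lemma kform_square:
  "kform a d e f (one t1) (one t2) (one t3) (one t4) * kform a d e f (one t1) (one t2) (one t3) (one t4)
    = (2 * (a * d - e\<^sup>2 - f\<^sup>2)) *\<^sub>R (one t1 * (one t2 * (one t3 * one t4)))"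
  unfolding kform_def
  by (simp add: algebra_simps power2_eq_square scaleR_2[symmetric]
    one_square[of t1] one_square[of t2] one_square[of t3] one_square[of t4] one_square_left[of t1]
    one_square_left[of t2] one_square_left[of t3] one_square_left[of t4] one_anticommute[of t2 t1]
    one_anticommute_left[of t2 t1] one_anticommute[of t3 t1] one_anticommute_left[of t3 t1]
    one_anticommute[of t3 t2] one_anticommute_left[of t3 t2] one_anticommute[of t4 t1]
    one_anticommute_left[of t4 t1] one_anticommute[of t4 t2] one_anticommute_left[of t4 t2]
    one_anticommute[of t4 t3] one_anticommute_left[of t4 t3])

text \<open>\<open>\<Omega> \<and> \<beta>\<close> only sees the (0,1)-part of \<open>\<beta>\<close>, on which \<open>J\<close> acts as \<open>- i\<close>.\<close>
lemma hform_J: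
  "hform r i (one t1) (one t2) (one t3) (one t4) *
      (- u1 *\<^sub>R one t2 + u2 *\<^sub>R one t1 - u3 *\<^sub>R one t4 + u4 *\<^sub>R one t3)
    = hform i (- r) (one t1) (one t2) (one t3) (one t4) * (u1 *\<^sub>R one t1 + u2 *\<^sub>R one t2 + u3 *\<^sub>R one t3 + u4 *\<^sub>R one t4)"
  "hform i (- r) (one t1) (one t2) (one t3) (one t4) *
      (- u1 *\<^sub>R one t2 + u2 *\<^sub>R one t1 - u3 *\<^sub>R one t4 + u4 *\<^sub>R one t3)
    = - (hform r i (one t1) (one t2) (one t3) (one t4) * (u1 *\<^sub>R one t1 + u2 *\<^sub>R one t2 + u3 *\<^sub>R one t3 + u4 *\<^sub>R one t4))"
  unfolding hform_def
  by (simp_all add: algebra_simps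
    one_square[of t1] one_square[of t2] one_square[of t3] one_square[of t4] one_square_left[of t1]
    one_square_left[of t2] one_square_left[of t3] one_square_left[of t4] one_anticommute[of t2 t1]
    one_anticommute_left[of t2 t1] one_anticommute[of t3 t1] one_anticommute_left[of t3 t1]
    one_anticommute[of t3 t2] one_anticommute_left[of t3 t2] one_anticommute[of t4 t1]
    one_anticommute_left[of t4 t1] one_anticommute[of t4 t2] one_anticommute_left[of t4 t2]
    one_anticommute[of t4 t3] one_anticommute_left[of t4 t3])

lemma two_ones_central: "one f * one g * a = a * (one f * one g)"
  by (metis mult.assoc one_mult_commute sg_sg)

lemma kform_central: "a * kform p q r s (one t1) (one t2) (one t3) (one t4) = kform p q r s (one t1) (one t2) (one t3) (one t4) * a"
  unfolding kform_def by (simp add: algebra_simps two_ones_central[of _ _ a, unfolded mult.assoc])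

lemma hform_central: "a * hform r i (one t1) (one t2) (one t3) (one t4) = hform r i (one t1) (one t2) (one t3) (one t4) * a"
  unfolding hform_def by (simp add: algebra_simps two_ones_central[of _ _ a, unfolded mult.assoc])

text \<open>Below \<open>X, L, E, T\<close> stand for \<open>\<xi>, \<alpha>, \<eta>, ds\<close> and \<open>U, V\<close> for \<open>d\<^sub>M u, d\<^sub>M\<^sup>c u\<close>; \<open>W1'\<close> is the
  \<open>s\<close>-derivative of \<open>W1\<close>.\<close>
lemma phi_closed_algebra:
  fixes W1 W1' W2 W3 :: "'a grass" and A s c u us :: real
  assumes A: "A \<noteq> 0"
    and central: "\<And>a. a * W1 = W1 * a" "\<And>a. a * W1' = W1' * a" "\<And>a. a * W2 = W2 * a" "\<And>a. a * W3 = W3 * a"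
    and rel: "W2 * W1 = 0" "W2 * W1' = 0" "W2 * V = W3 * U"
    and ones: "X = one x" "L = one l" "T = one t" "U = one uf" "V = one vf"
  shows "- W2 * (W1 + (1 / A) *\<^sub>R (T * L)) - X * (T * W1' - (1 / A) *\<^sub>R (T * (- (1 / A) *\<^sub>R (V * T) + A *\<^sub>R W1')))
    + (1 / A) *\<^sub>R (T * (W2 * L)) + ((s + c) / A) *\<^sub>R (W2 * (- (1 / A) *\<^sub>R (V * T) + A *\<^sub>R W1'))
    + ((s + c) / A\<^sup>2) *\<^sub>R ((U + us *\<^sub>R T) * (W3 * T)) + (u / A\<^sup>2) *\<^sub>R (T * (W3 * T)) = 0"
proof -
  \<comment> \<open>Centrality restated inside right-nested products, so that rewriting can move the
    2-forms to the front.\<close>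
  have comm: "a * (W1 * b) = W1 * (a * b)" "a * (W1' * b) = W1' * (a * b)" "a * (W2 * b) = W2 * (a * b)" "a * (W3 * b) = W3 * (a * b)" for a b
    by (metis central mult.assoc)+
  have rel': "W2 * (W1 * b) = 0" "W2 * (W1' * b) = 0" "W2 * (V * b) = W3 * (U * b)" for b
    using rel by (simp_all flip: mult.assoc)
  have TT: "T * T = 0" "T * (T * b) = 0" for b
    by (simp_all add: ones one_square one_square_left)
  have VT: "T * (V * T) = 0"
    by (simp add: ones one_anticommute_left[of t vf] one_square)
  show ?thesis
    using A by (simp add: algebra_simps TT VT rel rel' central[of T] central[of X] central[of L] central[of U]
        comm[of T] comm[of X] comm[of L] comm[of U] power2_eq_square)
qed

text \<open>The terms fall into four groups, carried by \<open>W1 * W1' * T\<close>,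
  \<open>W3 * W3 * T\<close>, \<open>W3 * X * T * L\<close> and \<open>W2 * X * U * T\<close>. Each
  group cancels by itself, the second one after the Monge-Ampere relation has turned squares of
  \<open>W1\<close> into squares of \<open>W3\<close>.\<close>

lemma Phi_closed_algebra:
  fixes W1 W1' W2 W3 :: "'a grass" and A s c u us :: real
  assumes A: "A \<noteq> 0"
    and central: "\<And>a. a * W1 = W1 * a" "\<And>a. a * W1' = W1' * a" "\<And>a. a * W2 = W2 * a" "\<And>a. a * W3 = W3 * a"
    and rel: "W2 * W1 = 0" "W3 * W1 = 0" "W3 * W1' = 0" "W2 * W3 = 0" "W2 * W2 = W3 * W3"
      "W3 * V = - (W2 * U)" "u *\<^sub>R (W3 * W3) = (s * (s + c) / A) *\<^sub>R (W1 * W1)"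
    and ones: "X = one x" "L = one l" "T = one t" "U = one uf" "V = one vf"
  defines "dL \<equiv> - (1 / A) *\<^sub>R (V * T) + A *\<^sub>R W1'"
  shows "- A *\<^sub>R (W3 * (X * (W1 + (1 / A) *\<^sub>R (T * L)) + ((s + c) / A) *\<^sub>R (W2 * L) + (u * (s + c) / A\<^sup>2) *\<^sub>R (W3 * T)))
    + ((s\<^sup>2 * (s + c)\<^sup>2 / A ^ 3) *\<^sub>R (- (T * (dL * W1)) + T * (L * (T * W1')))
     + ((s * (s + c) * (2 * s + c) / A\<^sup>2) *\<^sub>R (T * (W1 * W1)) + (s\<^sup>2 * (s + c)\<^sup>2 / (2 * A\<^sup>2)) *\<^sub>R (T * W1' * W1 + W1 * (T * W1')))
     + ((u / A) *\<^sub>R (T * (X * (T * W2))) + (s / A) *\<^sub>R ((U + us *\<^sub>R T) * (X * (T * W2))) + (s * u / A) *\<^sub>R (- W2 * (T * W2)))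
     - (T * (X * (L * W3)) + s *\<^sub>R ((- W2 * L - X * dL) * W3))) = 0"
proof -
  have comm: "a * (W1 * b) = W1 * (a * b)" "a * (W1' * b) = W1' * (a * b)" "a * (W2 * b) = W2 * (a * b)" "a * (W3 * b) = W3 * (a * b)" for a b
    by (metis central mult.assoc)+
  have W32: "W3 * W2 = 0" using central(3)[of W3] rel(4) by simp
  then have "W3 * (W2 * b) = 0" for b by (simp flip: mult.assoc)
  note W1'1 = central(1)[of W1'] comm(1)[of W1'] W32 this
  have rel': "W2 * (W1 * b) = 0" "W3 * (W1 * b) = 0" "W3 * (W1' * b) = 0" "W2 * (W3 * b) = 0"
      "W2 * (W2 * b) = W3 * (W3 * b)" "W3 * (V * b) = - (W2 * (U * b))" for b
    using rel(1-6) by (simp_all flip: mult.assoc)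
  have TT: "T * T = 0" "T * (T * b) = 0" for b
    by (simp_all add: ones one_square one_square_left)
  have VT: "T * (V * T) = 0" "T * (V * (T * b)) = 0" "T * (L * (T * b)) = 0" "T * (X * (T * b)) = 0" "T * (X * T) = 0" "T * (L * T) = 0" for b
    by (simp_all add: ones one_anticommute_left[of t] one_square one_square_left)
  have XT: "T * (X * L) = - (X * (T * L))" "U * (X * T) = - (X * (U * T))" "X * (V * T) = - (V * (X * T))"
    by (simp_all add: ones one_anticommute_left[of t x] one_anticommute_left[of uf x] one_anticommute_left[of x vf])
  have W11: "(s * (s + c) * (2 * s + c) / A\<^sup>2) *\<^sub>R (W1 * (W1 * T)) = ((2 * s + c) * u / A) *\<^sub>R (W3 * (W3 * T))"
  proof -
    have "(s * (s + c) * (2 * s + c) / A\<^sup>2) *\<^sub>R (W1 * (W1 * T)) = ((2 * s + c) / A) *\<^sub>R ((s * (s + c) / A) *\<^sub>R (W1 * W1) * T)"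
      by (simp add: mult.assoc power2_eq_square mult_ac)
    also have "\<dots> = ((2 * s + c) * u / A) *\<^sub>R (W3 * (W3 * T))"
      unfolding rel(7)[symmetric] by (simp add: mult.assoc)
    finally show ?thesis .
  qed
  have a1: "- A *\<^sub>R (W3 * (X * (W1 + (1 / A) *\<^sub>R (T * L)) + ((s + c) / A) *\<^sub>R (W2 * L) + (u * (s + c) / A\<^sup>2) *\<^sub>R (W3 * T)))
      = - (W3 * (X * (T * L))) - (u * (s + c) / A) *\<^sub>R (W3 * (W3 * T))"
  proof -
    have e: "W3 * (X * (W1 + (1 / A) *\<^sub>R (T * L)) + ((s + c) / A) *\<^sub>R (W2 * L) + (u * (s + c) / A\<^sup>2) *\<^sub>R (W3 * T))
      = (1 / A) *\<^sub>R (W3 * (X * (T * L))) + (u * (s + c) / A\<^sup>2) *\<^sub>R (W3 * (W3 * T))"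
      by (simp add: distrib_left scaleR_add_right central[of X] rel' W1'1)
    have cA: "- A * (1 / A) = - 1" "- A * (u * (s + c) / A\<^sup>2) = - (u * (s + c) / A)"
      using A by (simp_all add: power2_eq_square)
    show ?thesis
      by (simp only: e scaleR_add_right scaleR_scaleR cA scaleR_minus_left scaleR_one diff_conv_add_uminus)
  qed
  have a2: "- (T * (dL * W1)) + T * (L * (T * W1')) = - A *\<^sub>R (W1 * (W1' * T))"
    unfolding dL_def by (simp add: distrib_left distrib_right left_diff_distrib right_diff_distrib mult.assoc central[of T] central[of V] comm[of T] comm[of L] VT W1'1
        central[of L] comm[of V])
  have a3: "T * W1' * W1 + W1 * (T * W1') = 2 *\<^sub>R (W1 * (W1' * T))"
    by (simp add: mult.assoc comm[of T] central[of T] W1'1 scaleR_2)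
  have a4: "(U + us *\<^sub>R T) * (X * (T * W2)) = - (W2 * (X * (U * T)))" "T * (X * (T * W2)) = 0"
      "- W2 * (T * W2) = - (W3 * (W3 * T))"
    by (simp_all add: distrib_right central[of T] comm[of X] comm[of U] comm[of T] VT XT rel')
  have a5: "T * (X * (L * W3)) = - (W3 * (X * (T * L)))"
    by (simp add: central[of L] comm[of X] comm[of T] XT)
  have "X * dL * W3 = (- (1 / A)) *\<^sub>R (W3 * (X * (V * T)))"
  proof -
    have e1: "X * dL * W3 = W3 * (X * dL)" by (rule central)
    have e2: "X * dL = (- (1 / A)) *\<^sub>R (X * (V * T)) + A *\<^sub>R (W1' * X)"
      by (simp add: dL_def distrib_left right_diff_distrib central(2)[of X])
    show ?thesis
      unfolding e1 unfolding e2
      by (simp only: distrib_left mult_scaleR_right rel'(3) scaleR_zero_right add_0_right)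
  qed
  also have "W3 * (X * (V * T)) = W2 * (U * (X * T))"
    by (simp add: XT(3) rel')
  finally have a6: "X * dL * W3 = (1 / A) *\<^sub>R (W2 * (X * (U * T)))"
    by (simp add: XT(2))
  have a7: "(- W2 * L - X * dL) * W3 = - (1 / A) *\<^sub>R (W2 * (X * (U * T)))"
    by (simp add: left_diff_distrib a6[unfolded mult.assoc] mult.assoc central[of L] rel')
  \<comment> \<open>The coefficient (2s + c) stems from the derivative of s^2 (s+c)^2 / 2. In the
    second identity its parts s + c and s balance eta wedge phi and the \<open>W2 * W2\<close> term,
    respectively.\<close>
  have coef: "- (s\<^sup>2 * (s + c)\<^sup>2 / A ^ 3 * A) + s\<^sup>2 * (s + c)\<^sup>2 / (2 * A\<^sup>2) * 2 = 0"
    "- (u * (s + c) / A) + (2 * s + c) * u / A - s * u / A = 0" "- (s / A) + s * (1 / A) = 0"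
    using A by (simp_all add: field_simps power2_eq_square power3_eq_cube)
  have t1: "T * (W1 * W1) = W1 * (W1 * T)" by (simp add: comm[of T] central[of T])
  have "(s\<^sup>2 * (s + c)\<^sup>2 / A ^ 3) *\<^sub>R (- A *\<^sub>R (W1 * (W1' * T))) + (s\<^sup>2 * (s + c)\<^sup>2 / (2 * A\<^sup>2)) *\<^sub>R (2 *\<^sub>R (W1 * (W1' * T)))
      = (- (s\<^sup>2 * (s + c)\<^sup>2 / A ^ 3 * A) + s\<^sup>2 * (s + c)\<^sup>2 / (2 * A\<^sup>2) * 2) *\<^sub>R (W1 * (W1' * T))"
    by (simp add: scaleR_left_distrib scaleR_left_diff_distrib)
  then have b1: "(s\<^sup>2 * (s + c)\<^sup>2 / A ^ 3) *\<^sub>R (- A *\<^sub>R (W1 * (W1' * T))) + (s\<^sup>2 * (s + c)\<^sup>2 / (2 * A\<^sup>2)) *\<^sub>R (2 *\<^sub>R (W1 * (W1' * T))) = 0"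
    unfolding coef by simp
  have "- ((u * (s + c) / A) *\<^sub>R (W3 * (W3 * T))) + ((2 * s + c) * u / A) *\<^sub>R (W3 * (W3 * T)) + (s * u / A) *\<^sub>R (- (W3 * (W3 * T)))
      = (- (u * (s + c) / A) + (2 * s + c) * u / A - s * u / A) *\<^sub>R (W3 * (W3 * T))"
    by (simp add: scaleR_left_distrib scaleR_left_diff_distrib)
  then have b2: "- ((u * (s + c) / A) *\<^sub>R (W3 * (W3 * T))) + ((2 * s + c) * u / A) *\<^sub>R (W3 * (W3 * T)) + (s * u / A) *\<^sub>R (- (W3 * (W3 * T))) = 0"
    unfolding coef by simp
  have b3: "(s / A) *\<^sub>R (- (W2 * (X * (U * T)))) - s *\<^sub>R (- (1 / A) *\<^sub>R (W2 * (X * (U * T)))) = 0"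
    by simp
  show ?thesis
    unfolding a1 a2 a3 a4 a5 a7 t1 W11 using b1 b2 b3 by (simp add: algebra_simps)
qed

section \<open>Smooth fields of forms\<close>

definition gsmooth :: "'e::real_normed_vector set \<Rightarrow> ('e \<Rightarrow> 't grass) \<Rightarrow> bool" where
  "gsmooth S a \<longleftrightarrow> (\<forall>vs. smooth_on S (\<lambda>y. ev (a y) vs))"

lemma gsmooth_gdiff: "gsmooth S a \<Longrightarrow> x \<in> S \<Longrightarrow> gdiff a x"
  by (auto simp: gsmooth_def gdiff_def intro: smooth_on_differentiable)

lemma gsmooth_linear:
  assumes "open S" "gsmooth S a" "gsmooth S b"
  shows "gsmooth S (\<lambda>y. a y + b y)" "gsmooth S (\<lambda>y. a y - b y)" "gsmooth S (\<lambda>y. - a y)"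
  using assms by (simp_all add: gsmooth_def smooth_on_add smooth_on_diff smooth_on_minus)

lemma gsmooth_scale: "open S \<Longrightarrow> smooth_on S f \<Longrightarrow> gsmooth S a \<Longrightarrow> gsmooth S (\<lambda>y. f y *\<^sub>R a y)"
  by (simp add: gsmooth_def smooth_on_mult)

lemma gsmooth_cscale: "open S \<Longrightarrow> gsmooth S a \<Longrightarrow> gsmooth S (\<lambda>y. r *\<^sub>R a y)"
  by (simp add: gsmooth_def smooth_on_cmult)

lemma gsmooth_mult:
  assumes "open S" "gsmooth S a" "gsmooth S b"
  shows "gsmooth S (\<lambda>y. a y * b y)"
proof -
  have "smooth_on S (\<lambda>y. ev (a y * b y) vs)" if "gsmooth S a" "gsmooth S b" for vs
    using that
  proof (induction vs arbitrary: a b)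
    case Nil
    then show ?case using assms(1) by (simp add: ev_mult_Nil gsmooth_def smooth_on_mult)
  next
    case (Cons v vs)
    have "gsmooth S (\<lambda>y. iota v (a y))" "gsmooth S (\<lambda>y. iota v (b y))" "gsmooth S (\<lambda>y. sg (a y))"
      using Cons.prems assms(1) by (simp_all add: gsmooth_def ev_iota ev_sg smooth_on_cmult)
    then show ?case
      using Cons.IH Cons.prems assms(1) by (simp add: ev_mult_Cons smooth_on_add)
  qed
  then show ?thesis using assms by (simp add: gsmooth_def)
qed

lemma gsmooth_one:
  assumes "\<And>w. smooth_on S (\<lambda>y. f y w)"
  shows "gsmooth S (\<lambda>y. one (f y))"
  unfolding gsmooth_def
proof
  fix vs
  consider v where "vs = [v]" | "\<And>f :: 'a \<Rightarrow> real. ev (one f) vs = 0"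
    by (cases vs; cases "tl vs") (auto simp: one_def)
  then show "smooth_on S (\<lambda>y. ev (one (f y)) vs)"
    by cases (simp_all add: assms smooth_on_const)
qed

definition dfun :: "('e::real_normed_vector \<Rightarrow> real) \<Rightarrow> 'e \<Rightarrow> 'e grass" where
  "dfun f x = one (frechet_derivative f (at x))"

lemma gsmooth_dfun: "smooth_on S f \<Longrightarrow> gsmooth S (dfun f)"
  unfolding dfun_def by (intro gsmooth_one smooth_on_frechet)

text \<open>Homogeneity reduces the claim to pairs of vectors, where it is the symmetry of second
  derivatives.\<close>

lemma dd_dfun:
  assumes S: "open S" "x \<in> S" and f: "smooth_on S f"
  shows "dd (dfun f) x = 0"
proof (rule hom_eqI[where k = 2])
  show "hom 2 (dd (dfun f) x)"
    using hom_dd[of "Suc 0" "dfun f" x] by (simp add: dfun_def hom_one numeral_2_eq_2)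
  show "hom 2 0" by (rule hom_linear)
  fix vs :: "'a list" assume "length vs = 2"
  then obtain v w where vs: "vs = [v, w]" by (metis (no_types, lifting) One_nat_def Suc_1 length_0_conv length_Suc_conv)
  show "ev (dd (dfun f) x) vs = ev 0 vs"
    using second_derivative_symmetric_real[OF S f, of v w]
    by (simp add: vs dd_def dfun_def)
qed

text \<open>By \<open>ev_dd_sum\<close> both operators are the same alternating sum of derivatives.
  Derivatives are local, so form and field have to agree only on an open set around the
  point.\<close>

lemma ext_d_dd:
  assumes S: "open S" "snd (some_chart A p) p \<in> S"
    and a: "\<And>x w. x \<in> S \<Longrightarrow> \<omega> (chart_inv (some_chart A p) x)
        (\<lambda>j. tangent_of A (some_chart A p) (chart_inv (some_chart A p) x) (w j)) = ev (a x) (map w [0..<k])"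
  shows "ext_d A k \<omega> p v = ev (dd a (snd (some_chart A p) p)) (map (\<lambda>i. v i (some_chart A p)) [0..<Suc k])"
  unfolding ext_d_def Let_def ev_dd_sum
proof (intro sum.cong refl arg_cong2[where f = "(*)"])
  let ?c = "some_chart A p"
  fix i
  show "frechet_derivative (\<lambda>x. \<omega> (chart_inv ?c x)
        (\<lambda>j. tangent_of A ?c (chart_inv ?c x) (v (if j < i then j else Suc j) ?c))) (at (snd ?c p)) (v i ?c)
    = frechet_derivative (\<lambda>x. ev (a x) (map (\<lambda>j. v (if j < i then j else Suc j) ?c) [0..<k])) (at (snd ?c p)) (v i ?c)"
    by (rule fun_cong[where x = "v i ?c"], rule frechet_derivative_cong_open[OF S])
      (rule a[where w = "\<lambda>j. v (if j < i then j else Suc j) ?c"])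
qed

section \<open>Torus bundles over the product\<close>

lemma ev_one_one: "ev (one f * one g) [v, w] = f v * g w - f w * g v"
  by (simp add: ev_mult_Cons ev_mult_Nil)

lemma ev_one_mult_3: "ev (one f * b) [v, w, x] = f v * ev b [w, x] - f w * ev b [v, x] + f x * ev b [v, w]"
  by (simp add: ev_mult_Cons ev_mult_Nil ev_iota)

lemma ev_one_mult_4: "ev (one f * b) [v, w, x, y] = f v * ev b [w, x, y] - f w * ev b [v, x, y]
    + f x * ev b [v, w, y] - f y * ev b [v, w, x]"
  by (simp add: ev_mult_Cons ev_mult_Nil ev_iota)

lemma skew2: "skew b \<Longrightarrow> ev b [w, v] = - ev b [v, w]"
  using skewD[of b "[]" w v "[]"] by simp

lemma skew3: "skew b \<Longrightarrow> ev b [w, v, x] = - ev b [v, w, x]" "skew b \<Longrightarrow> ev b [v, x, w] = - ev b [v, w, x]"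
  using skewD[of b "[]" w v "[x]"] skewD[of b "[v]" x w "[]"] by simp_all

lemma frechet_linear_comp:
  assumes "f differentiable (at x)" "bounded_linear h"
  shows "frechet_derivative (\<lambda>x. h (f x)) (at x) = (\<lambda>w. h (frechet_derivative f (at x) w))"
  using assms(1) unfolding frechet_derivative_works
  by (rule frechet_derivative_eqI[OF bounded_linear.has_derivative[OF assms(2)]])

lemma bounded_linear_coordinate: "bounded_linear (\<lambda>w. Re (w $ i))" "bounded_linear (\<lambda>w. Im (w $ i))"
  by (auto intro!: bounded_linear_compose[OF bounded_linear_Re] bounded_linear_compose[OF bounded_linear_Im]
      bounded_linear_vec_nth)

lemma map_upt_small:
  "map w [0..<Suc 0] = [w 0]" "map w [0..<1] = [w 0]" "map w [0..<2] = [w 0, w 1]"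
  "map w [0..<3] = [w 0, w 1, w 2]" "map w [0..<4] = [w 0, w 1, w 2, w 3]"
  "map w [0..<Suc 1] = [w 0, w 1]" "map w [0..<Suc 3] = [w 0, w 1, w 2, w 3]" "map w [0..<Suc 4] = [w 0, w 1, w 2, w 3, w 4]"
  by (simp_all add: numeral_2_eq_2 numeral_3_eq_3 eval_nat_numeral)

text \<open>The number of circles is a parameter, so that L and N are two instances, with
  \<open>ia\<close> and \<open>ix\<close> the indices of alpha and xi. The form eta exists on N
  alone and is introduced by the lemmas that concern it.\<close>

locale torus_bundle = surface_data +
  fixes P :: "('p::{t2_space,second_countable_topology}, 'e::euclidean_space) chart set"
    and \<pi> :: "'p \<Rightarrow> 'a \<times> real" and \<rho> :: "real ^ 'k \<Rightarrow> 'p \<Rightarrow> 'p"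
    and \<theta> :: "'k \<Rightarrow> ('p, 'e, real) form" and ia ix :: 'k
  assumes torus: "principal_torus_bundle P B \<pi> \<rho>"
    and connection: "\<And>j. connection_form P \<rho> j (\<theta> j)"
    and curvature_xi: "form_eq P (ext_d P 1 (\<theta> ix)) (pullback P B \<pi> (- pullback B M fst \<omega>2))"
    and curvature_al: "form_eq P (ext_d P 1 (\<theta> ia)) (pullback P B \<pi> F)"
begin

definition pr :: "'p \<Rightarrow> 'a" where "pr = (\<lambda>p. fst (\<pi> p))"
definition sP :: "'p \<Rightarrow> real" where "sP = (\<lambda>p. snd (\<pi> p))"

lemma pi_eq: "\<pi> p = (pr p, sP p)"
  by (simp add: pr_def sP_def)

lemma proj_pi: "fst (\<pi> p) = pr p" "snd (\<pi> p) = sP p"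
  by (simp_all add: pr_def sP_def)

lemma Ps: "smooth_atlas P" and smooth_pi: "smooth_map P B \<pi>"
  using torus by (simp_all add: principal_torus_bundle_def)

lemma in_base:
  assumes "y \<in> points P"
  shows "sP y \<in> I" "pr y \<in> points M"
  using smooth_map_point[OF smooth_pi assms] by (simp_all add: B points_prod sP_def pr_def mem_Times_iff)

lemma charts_at_pi: "y \<in> points P \<Longrightarrow> charts_at B (\<pi> y) = pch I ` charts_at M (pr y)"
  using charts_at_prod[of "\<pi> y" I M] in_base[of y] by (simp add: B pi_eq)

lemma in_points: "ch \<in> P \<Longrightarrow> y \<in> fst ch \<Longrightarrow> y \<in> points P"
  by (auto simp: points_def)

text \<open>The coordinates of points lying over the chart \<open>d\<close> of M; the domain of
  \<open>ch\<close> may project to several charts of M.\<close>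

definition dom :: "('p, 'e) chart \<Rightarrow> ('a, complex ^ 2) chart \<Rightarrow> 'e set" where
  "dom ch d = snd ch ` (fst ch \<inter> pr -` fst d)"

abbreviation GG :: "('p, 'e) chart \<Rightarrow> ('a, complex ^ 2) chart \<Rightarrow> 'e \<Rightarrow> complex ^ 2" where
  "GG ch d \<equiv> lrep ch d pr"
definition SS :: "('p, 'e) chart \<Rightarrow> 'e \<Rightarrow> real" where
  "SS ch = (\<lambda>x. sP (chart_inv ch x))"
definition ZZ :: "('p, 'e) chart \<Rightarrow> ('a, complex ^ 2) chart \<Rightarrow> 'e \<Rightarrow> (complex ^ 2) \<times> real" where
  "ZZ ch d = (\<lambda>x. (GG ch d x, SS ch x))"

lemma lrep_pi: "lrep ch (pch I d) \<pi> = ZZ ch d"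
  by (simp add: fun_eq_iff ZZ_def SS_def pi_eq)

lemma dom_eq:
  assumes "ch \<in> P"
  shows "dom ch d = snd ch ` (fst ch \<inter> \<pi> -` fst (pch I d))"
proof -
  have "sP y \<in> I" if "y \<in> fst ch" for y using in_base(1) in_points[OF assms that] .
  then show ?thesis unfolding dom_def by (intro arg_cong[where f = "image (snd ch)"]) (auto simp: pi_eq)
qed

lemma pch_in: "d \<in> M \<Longrightarrow> pch I d \<in> B"
  by (simp add: B prod_atlas_interval)

lemma smooth_ZZ: "ch \<in> P \<Longrightarrow> d \<in> M \<Longrightarrow> smooth_on (dom ch d) (ZZ ch d)"
  using smooth_map_lrep[OF smooth_pi _ pch_in, of ch d] by (simp only: lrep_pi dom_eq)

lemma open_dom: "ch \<in> P \<Longrightarrow> d \<in> M \<Longrightarrow> open (dom ch d)"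
  unfolding dom_eq
  by (rule open_lrep_domain[OF Ps smooth_pi]) (auto intro: open_Times open_chart[OF Ms] I)

lemma smooth_GG: "ch \<in> P \<Longrightarrow> d \<in> M \<Longrightarrow> smooth_on (dom ch d) (GG ch d)"
  and smooth_SS: "ch \<in> P \<Longrightarrow> d \<in> M \<Longrightarrow> smooth_on (dom ch d) (SS ch)"
  using smooth_on_bounded_linear[OF open_dom bounded_linear_fst smooth_ZZ, of ch d]
    smooth_on_bounded_linear[OF open_dom bounded_linear_snd smooth_ZZ, of ch d]
  by (simp_all add: ZZ_def o_def)

lemma domE:
  assumes "ch \<in> P" "d \<in> M" "x \<in> dom ch d"
  shows "chart_inv ch x \<in> fst ch" "pr (chart_inv ch x) \<in> fst d" "snd ch (chart_inv ch x) = x"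
    "ch \<in> charts_at P (chart_inv ch x)" "d \<in> charts_at M (pr (chart_inv ch x))"
    "ZZ ch d x \<in> (snd d ` fst d) \<times> I" "chart_inv ch x \<in> points P"
    "ZZ ch d x = (snd d (pr (chart_inv ch x)), sP (chart_inv ch x))"
proof -
  obtain y where y: "x = snd ch y" "y \<in> fst ch" "pr y \<in> fst d" using assms(3) by (auto simp: dom_def)
  then have "chart_inv ch x = y" using chart_inv_chart[OF Ps assms(1)] by simp
  moreover have "sP y \<in> I" using in_base(1) in_points[OF assms(1) y(2)] by simp
  ultimately show "chart_inv ch x \<in> fst ch" "pr (chart_inv ch x) \<in> fst d" "snd ch (chart_inv ch x) = x"
    "ch \<in> charts_at P (chart_inv ch x)" "d \<in> charts_at M (pr (chart_inv ch x))"
    "ZZ ch d x \<in> (snd d ` fst d) \<times> I" "chart_inv ch x \<in> points P"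
    "ZZ ch d x = (snd d (pr (chart_inv ch x)), sP (chart_inv ch x))"
    using y assms in_points by (auto simp: charts_at_def ZZ_def SS_def)
qed

lemma in_dom: "ch \<in> charts_at P y \<Longrightarrow> d \<in> charts_at M (pr y) \<Longrightarrow> snd ch y \<in> dom ch d"
  by (auto simp: dom_def charts_at_def)

lemma smooth_pr: "smooth_map P M pr"
  unfolding smooth_map_def
proof (intro conjI ballI)
  show "pr ` points P \<subseteq> points M" using in_base(2) by blast
  have "continuous_on (points P) \<pi>" using smooth_pi by (simp add: smooth_map_def)
  then show "continuous_on (points P) pr" unfolding pr_def by (rule continuous_on_fst)
  show "smooth_on (snd ch ` (fst ch \<inter> pr -` fst d)) (GG ch d)" if "ch \<in> P" "d \<in> M" for ch d
    using smooth_GG[OF that] by (simp add: dom_def)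
qed

lemma ZZ_derivative:
  assumes "ch \<in> P" "d \<in> M" "x \<in> dom ch d"
  shows "frechet_derivative (ZZ ch d) (at x) = (\<lambda>w. (frechet_derivative (GG ch d) (at x) w, frechet_derivative (SS ch) (at x) w))"
  using smooth_on_has_derivative[OF smooth_GG[OF assms(1,2)] assms(3)]
    smooth_on_has_derivative[OF smooth_SS[OF assms(1,2)] assms(3)]
  unfolding ZZ_def by (intro frechet_derivative_eqI has_derivative_Pair)

abbreviation \<tau> where "\<tau> y v \<equiv> dmap P M pr y v"

text \<open>A chain rule for the two successive projections, checked in the product chart that
  \<open>dmap\<close> selects at the base point.\<close>

lemma dmap_pr:
  assumes y: "y \<in> points P" and v: "v \<in> tangent_space P y"
  shows "dmap B M fst (\<pi> y) (dmap P B \<pi> y v) = \<tau> y v"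
proof
  let ?ch = "some_chart P y"
  have ch: "?ch \<in> charts_at P y" using some_chart[OF y] .
  have "\<pi> y \<in> points B" using smooth_map_point[OF smooth_pi y] .
  from some_chart[OF this] have "some_chart B (\<pi> y) \<in> pch I ` charts_at M (pr y)"
    unfolding charts_at_pi[OF y] .
  then obtain d0 where d0: "d0 \<in> charts_at M (pr y)" "some_chart B (\<pi> y) = pch I d0" by blast
  have d0B: "pch I d0 \<in> charts_at B (\<pi> y)" using d0(1) charts_at_pi[OF y] by simp
  have w: "dmap P B \<pi> y v (pch I d0) = frechet_derivative (ZZ ?ch d0) (at (snd ?ch y)) (v ?ch)"
    using smooth_map_dmap[OF Ps smooth_pi ch d0B v] by (simp only: lrep_pi)
  show "dmap B M fst (\<pi> y) (dmap P B \<pi> y v) e = \<tau> y v e" for e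
  proof (cases "e \<in> charts_at M (pr y)")
    case True
    have "dmap B M fst (\<pi> y) (dmap P B \<pi> y v) e
        = frechet_derivative (lrep (pch I d0) e fst) (at (snd (pch I d0) (pr y, sP y)))
           (frechet_derivative (ZZ ?ch d0) (at (snd ?ch y)) (v ?ch))"
    proof -
      have gen: "dmap B M fst (\<pi> y) V e
          = frechet_derivative (lrep (pch I d0) e fst) (at (snd (pch I d0) (\<pi> y))) (V (pch I d0))" for V
        using True unfolding dmap_def Let_def d0(2) pr_def by simp
      show ?thesis unfolding gen w by (simp only: pi_eq)
    qed
    also have "\<dots> = frechet_derivative (transition d0 e) (at (snd d0 (pr y)))
        (frechet_derivative (GG ?ch d0) (at (snd ?ch y)) (v ?ch))"
      using fst_lrep_derivative(1)[OF Ms d0(1) True I(1), of "sP y"] in_base(1)[OF y]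
        ZZ_derivative[OF _ _ in_dom[OF ch d0(1)]] charts_atD[OF ch] charts_atD[OF d0(1)] by simp
    also have "frechet_derivative (GG ?ch d0) (at (snd ?ch y)) (v ?ch) = \<tau> y v d0"
      using smooth_map_dmap[OF Ps smooth_pr ch d0(1) v] by simp
    also have "frechet_derivative (transition d0 e) (at (snd d0 (pr y))) (\<tau> y v d0) = \<tau> y v e"
      using tangent_spaceD[OF dmap_tangent[OF Ps Ms smooth_pr y v] d0(1) True] by simp
    finally show ?thesis .
  qed (simp add: dmap_def Let_def pr_def)
qed

lemma tau_chart:
  assumes "ch \<in> charts_at P y" "d \<in> charts_at M (pr y)" "v \<in> tangent_space P y"
  shows "\<tau> y v = tangent_of M d (pr y) (frechet_derivative (GG ch d) (at (snd ch y)) (v ch))"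
  using smooth_map_dmap[OF Ps smooth_pr assms]
    tangent_of_tangent[OF assms(2) dmap_tangent[OF Ps Ms smooth_pr charts_at_points[OF assms(1)] assms(3)]] by simp

lemma ds_pi:
  assumes ch: "ch \<in> charts_at P y" and v: "v \<in> tangent_space P y" and w: "w 0 = dmap P B \<pi> y v"
  shows "ds (\<pi> y) w = frechet_derivative (SS ch) (at (snd ch y)) (v ch)"
proof -
  have y: "y \<in> points P" using charts_at_points[OF ch] .
  have "\<pi> y \<in> points B" using smooth_map_point[OF smooth_pi y] .
  from some_chart[OF this] have "some_chart B (\<pi> y) \<in> pch I ` charts_at M (pr y)"
    unfolding charts_at_pi[OF y] .
  then obtain d0 where d0: "d0 \<in> charts_at M (pr y)" "some_chart B (\<pi> y) = pch I d0" by blast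
  have d0M: "d0 \<in> M" "pr y \<in> fst d0" using charts_atD[OF d0(1)] by auto
  have d0B: "pch I d0 \<in> charts_at B (\<pi> y)" using d0(1) charts_at_pi[OF y] by simp
  have "frechet_derivative (\<lambda>x. snd (chart_inv (pch I d0) x)) (at (snd d0 (pr y), sP y)) = snd"
  proof (rule frechet_derivative_eqI, rule has_derivative_transform_within_open)
    show "(snd has_derivative snd) (at (snd d0 (pr y), sP y))"
      by (rule bounded_linear_imp_has_derivative[OF bounded_linear_snd])
    show "open ((snd d0 ` fst d0) \<times> I)" by (intro open_Times open_chart_image[OF Ms] d0M I)
    show "(snd d0 (pr y), sP y) \<in> (snd d0 ` fst d0) \<times> I" using d0M in_base(1)[OF y] by simp
    show "snd x = snd (chart_inv (pch I d0) x)" if "x \<in> (snd d0 ` fst d0) \<times> I" for x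
      using that chart_inv_pch[OF Ms d0M(1), of "fst x" "snd x" I] by auto
  qed
  moreover have "ds (\<pi> y) w = frechet_derivative (\<lambda>x. snd (chart_inv (pch I d0) x)) (at (snd (pch I d0) (\<pi> y))) (w 0 (pch I d0))"
    unfolding ds ext_d_def Let_def d0(2) fun_form_def by simp
  moreover have "snd (pch I d0) (\<pi> y) = (snd d0 (pr y), sP y)" by (simp add: pi_eq)
  ultimately have "ds (\<pi> y) w = snd (dmap P B \<pi> y v (pch I d0))"
    unfolding w by (simp only:)
  also have "\<dots> = snd (frechet_derivative (ZZ ch d0) (at (snd ch y)) (v ch))"
    using smooth_map_dmap[OF Ps smooth_pi ch d0B v] by (simp only: lrep_pi)
  also have "\<dots> = frechet_derivative (SS ch) (at (snd ch y)) (v ch)"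
    using ZZ_derivative[OF _ _ in_dom[OF ch d0(1)]] charts_atD[OF ch] d0M by simp
  finally show ?thesis .
qed

lemma theta_smooth: "smooth_form P 1 (\<theta> j)"
  using connection by (simp add: connection_form_def)

lemma theta_1: "y \<in> points P \<Longrightarrow> v 0 = w 0 \<Longrightarrow> \<theta> j y v = \<theta> j y w"
  by (rule alternating_form_cong[OF smooth_formD1[OF theta_smooth]]) auto

definition th :: "('p, 'e) chart \<Rightarrow> 'k \<Rightarrow> 'e \<Rightarrow> 'e \<Rightarrow> real" where
  "th ch j x w = \<theta> j (chart_inv ch x) (\<lambda>_. tangent_of P ch (chart_inv ch x) w)"

lemma theta_eval:
  assumes ch: "ch \<in> charts_at P y" and v: "v 0 \<in> tangent_space P y"
  shows "\<theta> j y v = th ch j (snd ch y) (v 0 ch)"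
  using theta_1[OF charts_at_points[OF ch], of v "\<lambda>_. v 0" j] tangent_of_tangent[OF ch v] charts_atD[OF ch]
  by (simp add: th_def chart_inv_chart[OF Ps])

lemma theta_linear:
  assumes y: "y \<in> points P" and v: "v \<in> tangent_space P y" "w \<in> tangent_space P y"
  shows "\<theta> j y (\<lambda>_. v + w) = \<theta> j y (\<lambda>_. v) + \<theta> j y (\<lambda>_. w)"
    "\<theta> j y (\<lambda>_. r *\<^sub>R v) = r * \<theta> j y (\<lambda>_. v)"
proof -
  note ax = smooth_formD1[OF theta_smooth y, of j, unfolded alternating_form_def, THEN conjunct2]
  have t: "\<theta> j y ((\<lambda>_. v)(0 := z)) = \<theta> j y (\<lambda>_. z)" for z by (rule theta_1[OF y]) simp
  show "\<theta> j y (\<lambda>_. v + w) = \<theta> j y (\<lambda>_. v) + \<theta> j y (\<lambda>_. w)"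
    using ax[THEN conjunct1, rule_format, of "\<lambda>_. v" v w 0] v by (simp add: t)
  show "\<theta> j y (\<lambda>_. r *\<^sub>R v) = r * \<theta> j y (\<lambda>_. v)"
    using ax[THEN conjunct2, THEN conjunct1, rule_format, of "\<lambda>_. v" v 0 r] v by (simp add: t)
qed

text \<open>The pulled back differentials dx1, dy1, dx2, dy2. Introduced as differentials of
  functions, they are annihilated by \<open>dd\<close>.\<close>

definition t1 where "t1 ch d = dfun (\<lambda>x. x1 (GG ch d x))"
definition t2 where "t2 ch d = dfun (\<lambda>x. y1 (GG ch d x))"
definition t3 where "t3 ch d = dfun (\<lambda>x. x2 (GG ch d x))"
definition t4 where "t4 ch d = dfun (\<lambda>x. y2 (GG ch d x))"
definition DS where "DS ch = dfun (SS ch)"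
definition XI where "XI ch j x = one (th ch j x)"
definition W1 where "W1 ch d x = kform (ka d (ZZ ch d x)) (kd d (ZZ ch d x)) (ke d (ZZ ch d x)) (kf d (ZZ ch d x))
    (t1 ch d x) (t2 ch d x) (t3 ch d x) (t4 ch d x)"
definition W2 where "W2 ch d x = hform (hr d (GG ch d x)) (hi d (GG ch d x)) (t1 ch d x) (t2 ch d x) (t3 ch d x) (t4 ch d x)"
definition W3 where "W3 ch d x = hform (hi d (GG ch d x)) (- hr d (GG ch d x)) (t1 ch d x) (t2 ch d x) (t3 ch d x) (t4 ch d x)"

lemma t_one:
  assumes "ch \<in> P" "d \<in> M" "x \<in> dom ch d"
  shows "t1 ch d x = one (\<lambda>w. x1 (frechet_derivative (GG ch d) (at x) w))"
    "t2 ch d x = one (\<lambda>w. y1 (frechet_derivative (GG ch d) (at x) w))"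
    "t3 ch d x = one (\<lambda>w. x2 (frechet_derivative (GG ch d) (at x) w))"
    "t4 ch d x = one (\<lambda>w. y2 (frechet_derivative (GG ch d) (at x) w))"
  unfolding t1_def t2_def t3_def t4_def dfun_def
  by (simp_all only: frechet_linear_comp[OF smooth_on_differentiable[OF smooth_GG[OF assms(1,2)] assms(3)]
        bounded_linear_coordinate(1)] frechet_linear_comp[OF smooth_on_differentiable[OF smooth_GG[OF assms(1,2)] assms(3)]
        bounded_linear_coordinate(2)])

lemma t_dfun: "\<exists>f. t1 ch d x = one f" "\<exists>f. t2 ch d x = one f" "\<exists>f. t3 ch d x = one f" "\<exists>f. t4 ch d x = one f"
  by (auto simp: t1_def t2_def t3_def t4_def dfun_def)

lemma W_eval:
  assumes ch: "ch \<in> charts_at P y" and d: "d \<in> charts_at M (pr y)" and v: "v \<in> tangent_space P y" "w \<in> tangent_space P y"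
  shows "\<omega>1 (sP y) (pr y) (vec2 (\<tau> y v) (\<tau> y w)) = ev (W1 ch d (snd ch y)) [v ch, w ch]"
    "\<omega>2 (pr y) (vec2 (\<tau> y v) (\<tau> y w)) = ev (W2 ch d (snd ch y)) [v ch, w ch]"
    "\<omega>3 (pr y) (vec2 (\<tau> y v) (\<tau> y w)) = ev (W3 ch d (snd ch y)) [v ch, w ch]"
proof -
  have m: "ch \<in> P" "d \<in> M" "snd ch y \<in> dom ch d" "chart_inv ch (snd ch y) = y"
    using charts_atD[OF ch] charts_atD[OF d] in_dom[OF ch d] chart_inv_chart[OF Ps] by auto
  have z: "ZZ ch d (snd ch y) = (snd d (pr y), sP y)" "GG ch d (snd ch y) = snd d (pr y)"
    using domE(8)[OF m(1-3)] m(4) by (simp_all add: ZZ_def)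
  have s: "sP y \<in> I" using in_base(1)[OF charts_at_points[OF ch]] .
  show "\<omega>1 (sP y) (pr y) (vec2 (\<tau> y v) (\<tau> y w)) = ev (W1 ch d (snd ch y)) [v ch, w ch]"
    "\<omega>2 (pr y) (vec2 (\<tau> y v) (\<tau> y w)) = ev (W2 ch d (snd ch y)) [v ch, w ch]"
    "\<omega>3 (pr y) (vec2 (\<tau> y v) (\<tau> y w)) = ev (W3 ch d (snd ch y)) [v ch, w ch]"
    unfolding tau_chart[OF ch d v(1)] tau_chart[OF ch d v(2)] kaehler_coordinates[OF d s] holomorphic_coordinates[OF d]
      W1_def W2_def W3_def kform_def hform_def z t_one[OF m(1-3)]
    by (simp_all add: ev_one_one algebra_simps)
qed

lemma skew_W: "skew (W1 ch d x)" "skew (W2 ch d x)" "skew (W3 ch d x)" "skew (DS ch x)" "skew (XI ch j x)"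
  unfolding W1_def W2_def W3_def kform_def hform_def t1_def t2_def t3_def t4_def dfun_def DS_def XI_def
  by (intro skew_linear skew_mult skew_one)+

lemma central_W: "a * W1 ch d x = W1 ch d x * a" "a * W2 ch d x = W2 ch d x * a" "a * W3 ch d x = W3 ch d x * a"
  unfolding W1_def W2_def W3_def t1_def t2_def t3_def t4_def dfun_def by (rule kform_central hform_central)+

definition PHI where
  "PHI ch d x = XI ch ix x * (W1 ch d x + (1 / of_int A) *\<^sub>R (DS ch x * XI ch ia x))
    + ((SS ch x + c) / of_int A) *\<^sub>R (W2 ch d x * XI ch ia x)
    + (uu d (ZZ ch d x) * (SS ch x + c) / (of_int A)\<^sup>2) *\<^sub>R (W3 ch d x * DS ch x)"

text \<open>The candidate for s^(4/3) times the Hodge dual of phi in terms of the chart fields;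
  \<open>psi0_FR\<close> and \<open>g2_hodge_FR\<close> confirm it.\<close>

definition PSI where
  "PSI ch d x = ((SS ch x)\<^sup>2 * (SS ch x + c)\<^sup>2 / (of_int A) ^ 3) *\<^sub>R (DS ch x * (XI ch ia x * W1 ch d x))
    + ((SS ch x)\<^sup>2 * (SS ch x + c)\<^sup>2 / (2 * (of_int A)\<^sup>2)) *\<^sub>R (W1 ch d x * W1 ch d x)
    + (SS ch x * uu d (ZZ ch d x) / of_int A) *\<^sub>R (XI ch ix x * (DS ch x * W2 ch d x))
    - SS ch x *\<^sub>R (XI ch ix x * (XI ch ia x * W3 ch d x))"

definition phi :: "('p, 'e, real) form" where
  "phi = \<theta> ix \<and>\<^bsub>1,2\<^esub> (pullback P B \<pi> (family_form M I \<omega>1) + (1 / of_int A) *\<^sub>R (pullback P B \<pi> ds \<and>\<^bsub>1,1\<^esub> \<theta> ia))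
     + (\<lambda>p. (sP p + c) / of_int A) \<cdot> (pullback P B \<pi> (pullback B M fst \<omega>2) \<and>\<^bsub>2,1\<^esub> \<theta> ia)
     + (\<lambda>p. u (sP p) (pr p) * (sP p + c) / (of_int A)\<^sup>2) \<cdot> (pullback P B \<pi> (pullback B M fst \<omega>3) \<and>\<^bsub>2,1\<^esub> pullback P B \<pi> ds)"

lemma pullback_eval:
  assumes ch: "ch \<in> charts_at P y" and d: "d \<in> charts_at M (pr y)" and v: "\<forall>i. v i \<in> tangent_space P y"
  shows "pullback P B \<pi> (family_form M I \<omega>1) y v = ev (W1 ch d (snd ch y)) [v 0 ch, v 1 ch]"
    "pullback P B \<pi> (pullback B M fst \<omega>2) y v = ev (W2 ch d (snd ch y)) [v 0 ch, v 1 ch]"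
    "pullback P B \<pi> (pullback B M fst \<omega>3) y v = ev (W3 ch d (snd ch y)) [v 0 ch, v 1 ch]"
    "pullback P B \<pi> ds y v = ev (DS ch (snd ch y)) [v 0 ch]"
proof -
  have y: "y \<in> points P" using charts_at_points[OF ch] .
  have t: "dmap B M fst (\<pi> y) (dmap P B \<pi> y (v i)) = \<tau> y (v i)" for i using dmap_pr[OF y] v by simp
  have al: "alternating_form (tangent_space M (pr y)) 2 (\<omega>1 (sP y) (pr y))"
    "alternating_form (tangent_space M (pr y)) 2 (\<omega>2 (pr y))" "alternating_form (tangent_space M (pr y)) 2 (\<omega>3 (pr y))"
    by (rule alternating_kaehler[OF in_base[OF y]] smooth_formD1[OF form23(1) in_base(2)[OF y]]
        smooth_formD1[OF form23(2) in_base(2)[OF y]])+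
  note W = W_eval[OF ch d v[rule_format, of 0] v[rule_format, of 1]]
  show "pullback P B \<pi> (family_form M I \<omega>1) y v = ev (W1 ch d (snd ch y)) [v 0 ch, v 1 ch]"
    "pullback P B \<pi> (pullback B M fst \<omega>2) y v = ev (W2 ch d (snd ch y)) [v 0 ch, v 1 ch]"
    "pullback P B \<pi> (pullback B M fst \<omega>3) y v = ev (W3 ch d (snd ch y)) [v 0 ch, v 1 ch]"
    using alternating_form_vec2[OF al(1), of "\<lambda>i. \<tau> y (v i)"] alternating_form_vec2[OF al(2), of "\<lambda>i. \<tau> y (v i)"]
      alternating_form_vec2[OF al(3), of "\<lambda>i. \<tau> y (v i)"] W
    by (simp_all add: pullback_def family_form_def t proj_pi flip: B)
  show "pullback P B \<pi> ds y v = ev (DS ch (snd ch y)) [v 0 ch]"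
    unfolding pullback_def using ds_pi[OF ch v[rule_format, of 0]] by (simp add: DS_def dfun_def)
qed

text \<open>Each \<open>alt_wedge\<close> unfolds to the signed sum that the shuffle product yields
  on three arguments; centrality of the 2-forms restores the order of the factors in
  \<open>PHI\<close>.\<close>

lemma phi_eval:
  assumes ch: "ch \<in> charts_at P y" and d: "d \<in> charts_at M (pr y)" and v: "\<forall>i. v i \<in> tangent_space P y"
  shows "phi y v = ev (PHI ch d (snd ch y)) [v 0 ch, v 1 ch, v 2 ch]"
proof -
  let ?T = "tangent_space P y"
  let ?x = "snd ch y"
  have m: "ch \<in> P" "d \<in> M" "?x \<in> dom ch d" "chart_inv ch ?x = y"
    using charts_atD[OF ch] charts_atD[OF d] in_dom[OF ch d] chart_inv_chart[OF Ps] by auto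
  have z: "ZZ ch d ?x = (snd d (pr y), sP y)" "SS ch ?x = sP y"
    using domE(8)[OF m(1-3)] m(4) by (simp_all add: ZZ_def)
  have uu: "uu d (ZZ ch d ?x) = u (sP y) (pr y)"
    using charts_atD[OF d] by (simp add: uu_def z chart_inv_chart[OF Ms])
  note pe = pullback_eval[OF ch d]
  have th: "\<theta> j y w = th ch j ?x (w 0 ch)" if "\<forall>i. w i \<in> ?T" for w j
    using theta_eval[OF ch, of w j] that by simp
  have one: "one (th ch j ?x) = XI ch j ?x" for j by (simp add: XI_def)
  obtain dsf where dsf: "DS ch ?x = one dsf" by (auto simp: DS_def dfun_def)
  have dse: "pullback P B \<pi> ds y w = dsf (w 0 ch)" if "\<forall>i. w i \<in> ?T" for w
    using pe(4)[OF that] by (simp add: dsf)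
  have 1: "alt_wedge 1 1 (pullback P B \<pi> ds y) (\<theta> ia y) w = ev (DS ch ?x * XI ch ia ?x) [w 0 ch, w 1 ch]"
    if "\<forall>i. w i \<in> ?T" for w
    using alt_wedge_1_1[where T = ?T and a = "pullback P B \<pi> ds y" and b = "\<theta> ia y" and f = "\<lambda>v. dsf (v ch)" and g = "\<lambda>v. th ch ia ?x (v ch)", OF dse th that]
    by (simp add: dsf XI_def ev_one_one)
  let ?b = "W1 ch d ?x + (1 / of_int A) *\<^sub>R (DS ch ?x * XI ch ia ?x)"
  let ?form = "pullback P B \<pi> (family_form M I \<omega>1) + (1 / of_int A) *\<^sub>R (pullback P B \<pi> ds \<and>\<^bsub>1,1\<^esub> \<theta> ia)"
  have b: "?form y w = ev ?b [w 0 ch, w 1 ch]" if "\<forall>i. w i \<in> ?T" for w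
    using pe(1)[OF that] 1[OF that] by (simp add: wedge_def)
  have skb: "skew ?b" by (intro skew_linear skew_mult skew_W)
  have 2: "alt_wedge 1 2 (\<theta> ix y) (?form y) v = ev (one (th ch ix ?x) * ?b) [v 0 ch, v 1 ch, v 2 ch]"
    unfolding ev_one_mult_3
    by (rule alt_wedge_1_2[where T = ?T and a = "\<theta> ix y" and b = "?form y" and f = "\<lambda>v. th ch ix ?x (v ch)" and g = "\<lambda>v w. ev ?b [v ch, w ch]",
          OF th b skew2[OF skb] v])
  have 3: "alt_wedge 2 1 (pullback P B \<pi> (pullback B M fst \<omega>2) y) (\<theta> ia y) v
      = ev (one (th ch ia ?x) * W2 ch d ?x) [v 0 ch, v 1 ch, v 2 ch]"
    unfolding ev_one_mult_3
    by (rule alt_wedge_2_1[where T = ?T and a = "\<theta> ia y" and b = "pullback P B \<pi> (pullback B M fst \<omega>2) y" and f = "\<lambda>v. th ch ia ?x (v ch)" and g = "\<lambda>v w. ev (W2 ch d ?x) [v ch, w ch]",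
          OF th pe(2) skew2[OF skew_W(2)] v])
  have 4: "alt_wedge 2 1 (pullback P B \<pi> (pullback B M fst \<omega>3) y) (pullback P B \<pi> ds y) v
      = ev (one dsf * W3 ch d ?x) [v 0 ch, v 1 ch, v 2 ch]"
    unfolding ev_one_mult_3
    by (rule alt_wedge_2_1[where T = ?T and a = "pullback P B \<pi> ds y" and b = "pullback P B \<pi> (pullback B M fst \<omega>3) y" and f = "\<lambda>v. dsf (v ch)" and g = "\<lambda>v w. ev (W3 ch d ?x) [v ch, w ch]",
          OF dse pe(3) skew2[OF skew_W(3)] v])
  show ?thesis
    using 2[unfolded one] 3[unfolded one central_W] 4[folded dsf, unfolded central_W] by (simp add: phi_def PHI_def fmult_def wedge_def z(2) uu)
qed

end

text \<open>The hypotheses are the components of closedness along M, so the derivatives in base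
  directions cancel and those along \<open>T\<close> survive.\<close>

lemma kform_closed:
  assumes "a3 = r1 + e2" "a4 = r2 - e1" "d1 = r3 - e4" "d2 = e3 + r4"
  shows "(a1 *\<^sub>R one f1 + a2 *\<^sub>R one f2 + a3 *\<^sub>R one f3 + a4 *\<^sub>R one f4 + as *\<^sub>R T) * (one f1 * one f2)
    + (d1 *\<^sub>R one f1 + d2 *\<^sub>R one f2 + d3 *\<^sub>R one f3 + d4 *\<^sub>R one f4 + ds *\<^sub>R T) * (one f3 * one f4)
    + (e1 *\<^sub>R one f1 + e2 *\<^sub>R one f2 + e3 *\<^sub>R one f3 + e4 *\<^sub>R one f4 + es *\<^sub>R T) * (one f1 * one f3 + one f2 * one f4)
    + (r1 *\<^sub>R one f1 + r2 *\<^sub>R one f2 + r3 *\<^sub>R one f3 + r4 *\<^sub>R one f4 + rs *\<^sub>R T) * (one f1 * one f4 - one f2 * one f3)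
    = T * kform as ds es rs (one f1) (one f2) (one f3) (one f4)"
  unfolding kform_def assms
  by (simp add: algebra_simps
    one_square[of f1] one_square[of f2] one_square[of f3] one_square[of f4] one_square_left[of f1]
    one_square_left[of f2] one_square_left[of f3] one_square_left[of f4] one_anticommute[of f2 f1]
    one_anticommute_left[of f2 f1] one_anticommute[of f3 f1] one_anticommute_left[of f3 f1]
    one_anticommute[of f3 f2] one_anticommute_left[of f3 f2] one_anticommute[of f4 f1]
    one_anticommute_left[of f4 f1] one_anticommute[of f4 f2] one_anticommute_left[of f4 f2]
    one_anticommute[of f4 f3] one_anticommute_left[of f4 f3])

text \<open>The hypotheses are the Cauchy-Riemann equations for the coefficient: its differential is
  of type (1,0), and dz1 dz2 annihilates it.\<close>

lemma hform_closed:
  assumes "r2 = - i1" "r4 = - i3" "i2 = r1" "i4 = r3"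
  shows "(r1 *\<^sub>R one f1 + r2 *\<^sub>R one f2 + r3 *\<^sub>R one f3 + r4 *\<^sub>R one f4) * (one f1 * one f3 - one f2 * one f4)
    - (i1 *\<^sub>R one f1 + i2 *\<^sub>R one f2 + i3 *\<^sub>R one f3 + i4 *\<^sub>R one f4) * (one f1 * one f4 + one f2 * one f3) = 0"
  unfolding assms
  by (simp add: algebra_simps
    one_square[of f1] one_square[of f2] one_square[of f3] one_square[of f4] one_square_left[of f1]
    one_square_left[of f2] one_square_left[of f3] one_square_left[of f4] one_anticommute[of f2 f1]
    one_anticommute_left[of f2 f1] one_anticommute[of f3 f1] one_anticommute_left[of f3 f1]
    one_anticommute[of f3 f2] one_anticommute_left[of f3 f2] one_anticommute[of f4 f1]
    one_anticommute_left[of f4 f1] one_anticommute[of f4 f2] one_anticommute_left[of f4 f2]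
    one_anticommute[of f4 f3] one_anticommute_left[of f4 f3])

lemma (in surface_data) dc_apply_0:
  "dc M f m v = frechet_derivative (\<lambda>z. f (chart_inv (some_chart M m) z))
      (at (snd (some_chart M m) m)) (\<i> *s v 0 (some_chart M m))"
  by (simp add: dc_def J_form_def ext_d_def fun_form_def Let_def J_apply)

section \<open>Smoothness and differentials of the chart fields\<close>

context torus_bundle
begin

lemma gsmooth_basic:
  assumes "ch \<in> P" "d \<in> M"
  shows "gsmooth (dom ch d) (t1 ch d)" "gsmooth (dom ch d) (t2 ch d)" "gsmooth (dom ch d) (t3 ch d)"
    "gsmooth (dom ch d) (t4 ch d)" "gsmooth (dom ch d) (DS ch)" "gsmooth (dom ch d) (XI ch j)"
proof -
  show "gsmooth (dom ch d) (t1 ch d)" "gsmooth (dom ch d) (t2 ch d)" "gsmooth (dom ch d) (t3 ch d)"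
    "gsmooth (dom ch d) (t4 ch d)" "gsmooth (dom ch d) (DS ch)"
    unfolding t1_def t2_def t3_def t4_def DS_def
    by (intro gsmooth_dfun smooth_SS[OF assms]
        smooth_on_bounded_linear[OF open_dom[OF assms] bounded_linear_coordinate(1) smooth_GG[OF assms]]
        smooth_on_bounded_linear[OF open_dom[OF assms] bounded_linear_coordinate(2) smooth_GG[OF assms]])+
  have "smooth_on (snd ch ` fst ch) (\<lambda>x. th ch j x w)" for w
    unfolding th_def using smooth_formD2[OF theta_smooth assms(1), of j "\<lambda>_. w"] .
  then have "smooth_on (dom ch d) (\<lambda>x. th ch j x w)" for w
    by (rule smooth_on_subset) (auto simp: dom_def)
  then show "gsmooth (dom ch d) (XI ch j)"
    unfolding XI_def by (rule gsmooth_one)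
qed

lemma smooth_coefficient_fields:
  assumes "ch \<in> P" "d \<in> M"
  shows "smooth_on (dom ch d) (\<lambda>x. ka d (ZZ ch d x))" "smooth_on (dom ch d) (\<lambda>x. kd d (ZZ ch d x))"
    "smooth_on (dom ch d) (\<lambda>x. ke d (ZZ ch d x))" "smooth_on (dom ch d) (\<lambda>x. kf d (ZZ ch d x))"
    "smooth_on (dom ch d) (\<lambda>x. uu d (ZZ ch d x))" "smooth_on (dom ch d) (\<lambda>x. hr d (GG ch d x))"
    "smooth_on (dom ch d) (\<lambda>x. hi d (GG ch d x))"
proof -
  have Z: "ZZ ch d ` dom ch d \<subseteq> (snd d ` fst d) \<times> I" using domE(6)[OF assms] by blast
  then have G: "GG ch d ` dom ch d \<subseteq> snd d ` fst d" unfolding ZZ_def by auto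
  note cZ = smooth_on_compose[OF open_dom[OF assms] Z smooth_ZZ[OF assms]]
  note cG = smooth_on_compose[OF open_dom[OF assms] G smooth_GG[OF assms]]
  show "smooth_on (dom ch d) (\<lambda>x. ka d (ZZ ch d x))" "smooth_on (dom ch d) (\<lambda>x. kd d (ZZ ch d x))"
    "smooth_on (dom ch d) (\<lambda>x. ke d (ZZ ch d x))" "smooth_on (dom ch d) (\<lambda>x. kf d (ZZ ch d x))"
    "smooth_on (dom ch d) (\<lambda>x. uu d (ZZ ch d x))"
    by (rule cZ[OF smooth_coefficients(1)[OF assms(2)]] cZ[OF smooth_coefficients(2)[OF assms(2)]]
        cZ[OF smooth_coefficients(3)[OF assms(2)]] cZ[OF smooth_coefficients(4)[OF assms(2)]] cZ[OF smooth_uu[OF assms(2)]])+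
  show "smooth_on (dom ch d) (\<lambda>x. hr d (GG ch d x))" "smooth_on (dom ch d) (\<lambda>x. hi d (GG ch d x))"
    by (rule cG[OF smooth_hr[OF assms(2)]] cG[OF smooth_hi[OF assms(2)]])+
qed

lemma gsmooth_W:
  assumes "ch \<in> P" "d \<in> M"
  shows "gsmooth (dom ch d) (W1 ch d)" "gsmooth (dom ch d) (W2 ch d)" "gsmooth (dom ch d) (W3 ch d)"
  unfolding W1_def W2_def W3_def kform_def hform_def
  by (intro gsmooth_linear gsmooth_scale gsmooth_mult gsmooth_basic smooth_coefficient_fields smooth_on_minus assms open_dom)+

lemma smooth_S_polynomials:
  assumes "ch \<in> P" "d \<in> M"
  shows "smooth_on (dom ch d) (\<lambda>x. (SS ch x + c) / of_int A)"
    "smooth_on (dom ch d) (\<lambda>x. uu d (ZZ ch d x) * (SS ch x + c) / (of_int A)\<^sup>2)"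
    "smooth_on (dom ch d) (\<lambda>x. (SS ch x)\<^sup>2 * (SS ch x + c)\<^sup>2 / (of_int A) ^ 3)"
    "smooth_on (dom ch d) (\<lambda>x. (SS ch x)\<^sup>2 * (SS ch x + c)\<^sup>2 / (2 * (of_int A)\<^sup>2))"
    "smooth_on (dom ch d) (\<lambda>x. SS ch x * uu d (ZZ ch d x) / of_int A)"
  unfolding divide_inverse power2_eq_square[of "SS ch _"] power2_eq_square[of "SS ch _ + c"]
  by (intro smooth_on_mult smooth_on_add smooth_on_const smooth_SS smooth_coefficient_fields assms open_dom)+

lemma gsmooth_PHI: "ch \<in> P \<Longrightarrow> d \<in> M \<Longrightarrow> gsmooth (dom ch d) (PHI ch d)"
  unfolding PHI_def
  by (intro gsmooth_linear gsmooth_scale gsmooth_mult gsmooth_basic gsmooth_W gsmooth_cscale smooth_S_polynomials open_dom)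

lemma gsmooth_PSI: "ch \<in> P \<Longrightarrow> d \<in> M \<Longrightarrow> gsmooth (dom ch d) (PSI ch d)"
  unfolding PSI_def
  by (intro gsmooth_linear gsmooth_scale gsmooth_mult gsmooth_basic gsmooth_W smooth_S_polynomials smooth_SS open_dom)

lemma dd_basic:
  assumes "ch \<in> P" "d \<in> M" "x \<in> dom ch d"
  shows "dd (t1 ch d) x = 0" "dd (t2 ch d) x = 0" "dd (t3 ch d) x = 0" "dd (t4 ch d) x = 0" "dd (DS ch) x = 0"
  unfolding t1_def t2_def t3_def t4_def DS_def
  by (intro dd_dfun[OF open_dom[OF assms(1,2)] assms(3)] smooth_SS[OF assms(1,2)]
      smooth_on_bounded_linear[OF open_dom[OF assms(1,2)] bounded_linear_coordinate(1) smooth_GG[OF assms(1,2)]]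
      smooth_on_bounded_linear[OF open_dom[OF assms(1,2)] bounded_linear_coordinate(2) smooth_GG[OF assms(1,2)]])+

lemma dfun_ZZ:
  assumes "ch \<in> P" "d \<in> M" "x \<in> dom ch d" and f: "f differentiable (at (ZZ ch d x))"
  shows "dfun (\<lambda>x. f (ZZ ch d x)) x = frechet_derivative f (at (ZZ ch d x)) (axis 1 1, 0) *\<^sub>R t1 ch d x
    + frechet_derivative f (at (ZZ ch d x)) (axis 1 \<i>, 0) *\<^sub>R t2 ch d x
    + frechet_derivative f (at (ZZ ch d x)) (axis 2 1, 0) *\<^sub>R t3 ch d x
    + frechet_derivative f (at (ZZ ch d x)) (axis 2 \<i>, 0) *\<^sub>R t4 ch d x
    + frechet_derivative f (at (ZZ ch d x)) (0, 1) *\<^sub>R DS ch x"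
proof -
  let ?D = "frechet_derivative f (at (ZZ ch d x))"
  have lin: "linear ?D" using linear_frechet_derivative[OF f] .
  have ex: "?D (w, r) = x1 w * ?D (axis 1 1, 0) + y1 w * ?D (axis 1 \<i>, 0) + x2 w * ?D (axis 2 1, 0)
      + y2 w * ?D (axis 2 \<i>, 0) + r * ?D (0, 1)" for w r
  proof -
    have "(w, r) = x1 w *\<^sub>R (axis 1 1, 0) + y1 w *\<^sub>R (axis 1 \<i>, 0) + x2 w *\<^sub>R (axis 2 1, 0)
      + y2 w *\<^sub>R (axis 2 \<i>, 0) + r *\<^sub>R (0, 1)"
      using complex2_expand[of w] by simp
    then have "?D (w, r) = ?D (x1 w *\<^sub>R (axis 1 1, 0) + y1 w *\<^sub>R (axis 1 \<i>, 0) + x2 w *\<^sub>R (axis 2 1, 0)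
      + y2 w *\<^sub>R (axis 2 \<i>, 0) + r *\<^sub>R (0, 1))" by simp
    also have "\<dots> = x1 w * ?D (axis 1 1, 0) + y1 w * ?D (axis 1 \<i>, 0) + x2 w * ?D (axis 2 1, 0)
      + y2 w * ?D (axis 2 \<i>, 0) + r * ?D (0, 1)"
      by (simp only: linear_add[OF lin] linear_scale[OF lin] real_scaleR_def)
    finally show ?thesis .
  qed
  have Z: "ZZ ch d differentiable (at x)"
    by (rule smooth_on_differentiable[OF smooth_ZZ[OF assms(1,2)] assms(3)])
  have "frechet_derivative (\<lambda>x. f (ZZ ch d x)) (at x) = (\<lambda>w. ?D (frechet_derivative (ZZ ch d) (at x) w))"
    using frechet_derivative_compose[OF Z f] by (simp add: o_def)
  moreover define a1 a2 a3 a4 a5 where a: "a1 = ?D (axis 1 1, 0)" "a2 = ?D (axis 1 \<i>, 0)"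
    "a3 = ?D (axis 2 1, 0)" "a4 = ?D (axis 2 \<i>, 0)" "a5 = ?D (0, 1)"
  have ex': "?D (w, r) = x1 w * a1 + y1 w * a2 + x2 w * a3 + y2 w * a4 + r * a5" for w r
    unfolding a by (rule ex)
  have "(\<lambda>w. ?D (frechet_derivative (ZZ ch d) (at x) w))
      = (\<lambda>w. a1 * x1 (frechet_derivative (GG ch d) (at x) w) + a2 * y1 (frechet_derivative (GG ch d) (at x) w)
          + a3 * x2 (frechet_derivative (GG ch d) (at x) w) + a4 * y2 (frechet_derivative (GG ch d) (at x) w)
          + a5 * frechet_derivative (SS ch) (at x) w)"
    by (rule ext) (simp only: ZZ_derivative[OF assms(1-3)] ex' mult.commute)
  ultimately show ?thesis
    unfolding t_one[OF assms(1-3)] DS_def dfun_def a[symmetric] by (simp only: one_add one_scale)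
qed

lemma linear_uu_expand:
  assumes "f differentiable (at z)"
  shows "frechet_derivative f (at z) (w, 0) = x1 w * frechet_derivative f (at z) (axis 1 1, 0)
    + y1 w * frechet_derivative f (at z) (axis 1 \<i>, 0) + x2 w * frechet_derivative f (at z) (axis 2 1, 0)
    + y2 w * frechet_derivative f (at z) (axis 2 \<i>, 0 :: real)"
proof -
  let ?D = "frechet_derivative f (at z)"
  have lin: "linear ?D" using linear_frechet_derivative[OF assms] .
  have "(w, 0::real) = x1 w *\<^sub>R (axis 1 1, 0) + y1 w *\<^sub>R (axis 1 \<i>, 0) + x2 w *\<^sub>R (axis 2 1, 0) + y2 w *\<^sub>R (axis 2 \<i>, 0)"
    using complex2_expand[of w] by simp
  then have "?D (w, 0) = ?D (x1 w *\<^sub>R (axis 1 1, 0) + y1 w *\<^sub>R (axis 1 \<i>, 0) + x2 w *\<^sub>R (axis 2 1, 0) + y2 w *\<^sub>R (axis 2 \<i>, 0))"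
    by simp
  also have "\<dots> = x1 w * ?D (axis 1 1, 0) + y1 w * ?D (axis 1 \<i>, 0) + x2 w * ?D (axis 2 1, 0) + y2 w * ?D (axis 2 \<i>, 0)"
    by (simp only: linear_add[OF lin] linear_scale[OF lin] real_scaleR_def)
  finally show ?thesis .
qed

end

text \<open>The charts are arbitrary, because frames on L and on N are later compared over one and
  the same chart of M.\<close>

locale chart_point = torus_bundle +
  fixes p ch d
  assumes ch_at: "ch \<in> charts_at P p" and d_at: "d \<in> charts_at M (pr p)"
begin

lemma p: "p \<in> points P"
  by (rule charts_at_points[OF ch_at])

definition "X0 = snd ch p"
abbreviation "z0 \<equiv> ZZ ch d X0"
abbreviation "m0 \<equiv> pr p"
abbreviation "s0 \<equiv> sP p"

lemma ch: "ch \<in> charts_at P p" "ch \<in> P" "p \<in> fst ch"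
  using ch_at charts_atD[OF ch_at] by simp_all

lemma m0: "m0 \<in> points M" "s0 \<in> I"
  using in_base[OF p] by auto

lemma d: "d \<in> charts_at M m0" "d \<in> M" "m0 \<in> fst d"
  using d_at charts_atD[OF d_at] by simp_all

lemma X0: "X0 \<in> dom ch d"
  unfolding X0_def by (rule in_dom[OF ch(1) d(1)])

lemma inv_X0: "chart_inv ch X0 = p"
  unfolding X0_def by (rule chart_inv_chart[OF Ps ch(2,3)])

lemma z0: "z0 = (snd d m0, s0)" "GG ch d X0 = snd d m0" "SS ch X0 = s0"
  using domE(8)[OF ch(2) d(2) X0] by (simp_all add: ZZ_def inv_X0)

lemma z0_in: "z0 \<in> (snd d ` fst d) \<times> I"
  by (rule domE(6)[OF ch(2) d(2) X0])

lemma uu_z0: "uu d z0 = u s0 m0"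
  using d by (simp add: uu_def z0 chart_inv_chart[OF Ms])

lemma differentiable_z0:
  "ka d differentiable (at z0)" "kd d differentiable (at z0)" "ke d differentiable (at z0)"
  "kf d differentiable (at z0)" "uu d differentiable (at z0)"
  using smooth_on_differentiable[OF _ z0_in] smooth_coefficients[OF d(2)] smooth_uu[OF d(2)] by blast+

lemma gdiff_basic:
  "gdiff (t1 ch d) X0" "gdiff (t2 ch d) X0" "gdiff (t3 ch d) X0" "gdiff (t4 ch d) X0" "gdiff (DS ch) X0" "gdiff (XI ch j) X0"
  "gdiff (W1 ch d) X0" "gdiff (W2 ch d) X0" "gdiff (W3 ch d) X0" "gdiff (PHI ch d) X0" "gdiff (PSI ch d) X0"
  by (rule gsmooth_gdiff[OF _ X0], intro gsmooth_basic[OF ch(2) d(2)] gsmooth_W[OF ch(2) d(2)]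
      gsmooth_PHI[OF ch(2) d(2)] gsmooth_PSI[OF ch(2) d(2)])+

definition "W1' = kform (frechet_derivative (ka d) (at z0) (0, 1)) (frechet_derivative (kd d) (at z0) (0, 1))
    (frechet_derivative (ke d) (at z0) (0, 1)) (frechet_derivative (kf d) (at z0) (0, 1))
    (t1 ch d X0) (t2 ch d X0) (t3 ch d X0) (t4 ch d X0)"

lemma dd_products:
  "dd (\<lambda>x. t1 ch d x * t2 ch d x) X0 = 0" "dd (\<lambda>x. t3 ch d x * t4 ch d x) X0 = 0"
  "dd (\<lambda>x. t1 ch d x * t3 ch d x + t2 ch d x * t4 ch d x) X0 = 0"
  "dd (\<lambda>x. t1 ch d x * t4 ch d x - t2 ch d x * t3 ch d x) X0 = 0"
  "dd (\<lambda>x. t1 ch d x * t3 ch d x - t2 ch d x * t4 ch d x) X0 = 0"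
  "dd (\<lambda>x. t1 ch d x * t4 ch d x + t2 ch d x * t3 ch d x) X0 = 0"
  by (simp_all add: dd_add dd_diff dd_mult gdiff_mult gdiff_basic dd_basic[OF ch(2) d(2) X0])

lemma differentiable_fields:
  "(\<lambda>x. ka d (ZZ ch d x)) differentiable (at X0)" "(\<lambda>x. kd d (ZZ ch d x)) differentiable (at X0)"
  "(\<lambda>x. ke d (ZZ ch d x)) differentiable (at X0)" "(\<lambda>x. kf d (ZZ ch d x)) differentiable (at X0)"
  "(\<lambda>x. uu d (ZZ ch d x)) differentiable (at X0)" "(\<lambda>x. hr d (GG ch d x)) differentiable (at X0)"
  "(\<lambda>x. hi d (GG ch d x)) differentiable (at X0)" "SS ch differentiable (at X0)"
  using smooth_on_differentiable[OF _ X0] smooth_coefficient_fields[OF ch(2) d(2)] smooth_SS[OF ch(2) d(2)] by blast+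

end

text \<open>\<open>ext_d\<close> on the bundle and the closedness of the Kaehler forms are evaluated
  in the charts selected by \<open>some_chart\<close>, so differentials are computed in
  these.\<close>

locale bundle_point = chart_point +
  assumes ch_def: "ch = some_chart P p" and d_def: "d = some_chart M (pr p)"
begin

lemma dd_W1: "dd (W1 ch d) X0 = DS ch X0 * W1'"
proof -
  obtain f1 f2 f3 f4 where f: "t1 ch d X0 = one f1" "t2 ch d X0 = one f2" "t3 ch d X0 = one f3" "t4 ch d X0 = one f4"
    using t_dfun by meson
  have gd: "gdiff (\<lambda>x. t1 ch d x * t2 ch d x) X0" "gdiff (\<lambda>x. t3 ch d x * t4 ch d x) X0"
    "gdiff (\<lambda>x. t1 ch d x * t3 ch d x + t2 ch d x * t4 ch d x) X0" "gdiff (\<lambda>x. t1 ch d x * t4 ch d x - t2 ch d x * t3 ch d x) X0"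
    by (intro gdiff_add gdiff_diff gdiff_mult gdiff_basic)+
  have "dd (W1 ch d) X0 = dfun (\<lambda>x. ka d (ZZ ch d x)) X0 * (t1 ch d X0 * t2 ch d X0)
      + dfun (\<lambda>x. kd d (ZZ ch d x)) X0 * (t3 ch d X0 * t4 ch d X0)
      + dfun (\<lambda>x. ke d (ZZ ch d x)) X0 * (t1 ch d X0 * t3 ch d X0 + t2 ch d X0 * t4 ch d X0)
      + dfun (\<lambda>x. kf d (ZZ ch d x)) X0 * (t1 ch d X0 * t4 ch d X0 - t2 ch d X0 * t3 ch d X0)"
    unfolding W1_def kform_def dfun_def
    by (simp only: dd_add dd_scale gdiff_add gdiff_scale gd differentiable_fields dd_products scaleR_zero_right add_0_right)
  also have "\<dots> = DS ch X0 * W1'"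
    unfolding dfun_ZZ[OF ch(2) d(2) X0 differentiable_z0(1)] dfun_ZZ[OF ch(2) d(2) X0 differentiable_z0(2)]
      dfun_ZZ[OF ch(2) d(2) X0 differentiable_z0(3)] dfun_ZZ[OF ch(2) d(2) X0 differentiable_z0(4)] W1'_def f
    by (rule kform_closed) (use kaehler_closed_coordinates[OF m0(1) d_def m0(2)] in \<open>simp_all add: z0(1)\<close>)
  finally show ?thesis .
qed

lemma dfun_hr_hi:
  assumes f: "f differentiable (at (snd d m0))"
  shows "dfun (\<lambda>x. f (GG ch d x)) X0 = frechet_derivative f (at (snd d m0)) (axis 1 1) *\<^sub>R t1 ch d X0
    + frechet_derivative f (at (snd d m0)) (axis 1 \<i>) *\<^sub>R t2 ch d X0
    + frechet_derivative f (at (snd d m0)) (axis 2 1) *\<^sub>R t3 ch d X0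
    + frechet_derivative f (at (snd d m0)) (axis 2 \<i>) *\<^sub>R t4 ch d X0"
proof -
  have "(f has_derivative frechet_derivative f (at (snd d m0))) (at (fst z0))"
    using f by (simp add: z0(1) frechet_derivative_works)
  from diff_chain_at[OF bounded_linear_imp_has_derivative[OF bounded_linear_fst] this]
  have der: "((\<lambda>z. f (fst z)) has_derivative (\<lambda>w. frechet_derivative f (at (snd d m0)) (fst w))) (at z0)"
    by (simp add: o_def)
  have z: "frechet_derivative f (at (snd d m0)) 0 = 0"
    using linear_0[OF linear_frechet_derivative[OF f]] .
  have "dfun (\<lambda>x. f (GG ch d x)) X0 = dfun (\<lambda>x. f (fst (ZZ ch d x))) X0"
    by (simp add: ZZ_def o_def)
  then show ?thesis
    using dfun_ZZ[OF ch(2) d(2) X0 differentiableI[OF der]] by (simp add: frechet_derivative_eqI[OF der] z)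
qed

lemma dd_W23: "dd (W2 ch d) X0 = 0" "dd (W3 ch d) X0 = 0"
proof -
  obtain f1 f2 f3 f4 where f: "t1 ch d X0 = one f1" "t2 ch d X0 = one f2" "t3 ch d X0 = one f3" "t4 ch d X0 = one f4"
    using t_dfun by meson
  have gd: "gdiff (\<lambda>x. t1 ch d x * t3 ch d x - t2 ch d x * t4 ch d x) X0" "gdiff (\<lambda>x. t1 ch d x * t4 ch d x + t2 ch d x * t3 ch d x) X0"
    by (intro gdiff_add gdiff_diff gdiff_mult gdiff_basic)+
  have i: "\<i> *s axis 1 1 = axis 1 \<i>" "\<i> *s axis 2 1 = axis 2 \<i>"
    by (simp_all add: vec_eq_iff forall_2 axis_def)
  have hd: "hr d differentiable (at (snd d m0))" "hi d differentiable (at (snd d m0))"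
    using smooth_on_differentiable[OF smooth_hr[OF d(2)]] smooth_on_differentiable[OF smooth_hi[OF d(2)]] d(3) by auto
  note CR = cauchy_riemann[OF m0(1) d(1), of "axis 1 1"] cauchy_riemann[OF m0(1) d(1), of "axis 2 1"]
  let ?r = "\<lambda>w. frechet_derivative (hr d) (at (snd d m0)) w" and ?i = "\<lambda>w. frechet_derivative (hi d) (at (snd d m0)) w"
  have e2: "dd (W2 ch d) X0 = dfun (\<lambda>x. hr d (GG ch d x)) X0 * (t1 ch d X0 * t3 ch d X0 - t2 ch d X0 * t4 ch d X0)
      - dfun (\<lambda>x. hi d (GG ch d x)) X0 * (t1 ch d X0 * t4 ch d X0 + t2 ch d X0 * t3 ch d X0)"
    unfolding W2_def hform_def dfun_def
    by (simp only: dd_diff dd_scale gdiff_scale gd differentiable_fields dd_products scaleR_zero_right add_0_right)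
  show "dd (W2 ch d) X0 = 0"
    unfolding e2 dfun_hr_hi[OF hd(1)] dfun_hr_hi[OF hd(2)] f
    by (rule hform_closed) (use CR in \<open>simp_all add: i\<close>)
  have W3: "W3 ch d = (\<lambda>x. hi d (GG ch d x) *\<^sub>R (t1 ch d x * t3 ch d x - t2 ch d x * t4 ch d x)
      + hr d (GG ch d x) *\<^sub>R (t1 ch d x * t4 ch d x + t2 ch d x * t3 ch d x))"
    by (rule ext) (simp add: W3_def hform_def)
  have e3: "dd (W3 ch d) X0 = dfun (\<lambda>x. hi d (GG ch d x)) X0 * (t1 ch d X0 * t3 ch d X0 - t2 ch d X0 * t4 ch d X0)
      + dfun (\<lambda>x. hr d (GG ch d x)) X0 * (t1 ch d X0 * t4 ch d X0 + t2 ch d X0 * t3 ch d X0)"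
    unfolding W3 dfun_def
    by (simp only: dd_add dd_scale gdiff_scale gd differentiable_fields dd_products scaleR_zero_right add_0_right)
  \<comment> \<open>\<open>W3\<close> is the real part of dz1 dz2 with coefficient h divided by the
    imaginary unit; the pair \<open>hi\<close>, \<open>- hr\<close> satisfies the Cauchy-Riemann
    equations as well.\<close>
  have "dd (W3 ch d) X0 = (?i (axis 1 1) *\<^sub>R one f1 + ?i (axis 1 \<i>) *\<^sub>R one f2 + ?i (axis 2 1) *\<^sub>R one f3 + ?i (axis 2 \<i>) *\<^sub>R one f4)
        * (one f1 * one f3 - one f2 * one f4)
      - ((- ?r (axis 1 1)) *\<^sub>R one f1 + (- ?r (axis 1 \<i>)) *\<^sub>R one f2 + (- ?r (axis 2 1)) *\<^sub>R one f3 + (- ?r (axis 2 \<i>)) *\<^sub>R one f4)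
        * (one f1 * one f4 + one f2 * one f3)"
    unfolding e3 dfun_hr_hi[OF hd(1)] dfun_hr_hi[OF hd(2)] f by (simp add: algebra_simps)
  also have "\<dots> = 0" by (rule hform_closed) (use CR in \<open>simp_all add: i\<close>)
  finally show "dd (W3 ch d) X0 = 0" .
qed

end

section \<open>Curvature equations in a chart\<close>

context bundle_point
begin

lemma ev_dd_XI:
  "ev (dd (XI ch j) X0) [w0, w1] = ext_d P 1 (\<theta> j) p (\<lambda>i. tangent_of P ch p (vec2 w0 w1 i))"
proof -
  have "ext_d P 1 (\<theta> j) p (\<lambda>i. tangent_of P ch p (vec2 w0 w1 i))
      = ev (dd (XI ch j) (snd ch p)) (map (\<lambda>i. tangent_of P ch p (vec2 w0 w1 i) ch) [0..<Suc 1])"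
    unfolding ch_def
  proof (rule ext_d_dd[OF open_chart_image[OF Ps]])
    show "some_chart P p \<in> P" "snd (some_chart P p) p \<in> snd (some_chart P p) ` fst (some_chart P p)"
      using ch by (auto simp: ch_def)
    fix x w assume x: "x \<in> snd (some_chart P p) ` fst (some_chart P p)"
    have "chart_inv (some_chart P p) x \<in> points P"
      using in_points[OF ch(2)[unfolded ch_def] chart_inv_in[OF x]] .
    then show "\<theta> j (chart_inv (some_chart P p) x) (\<lambda>j. tangent_of P (some_chart P p) (chart_inv (some_chart P p) x) (w j))
        = ev (XI (some_chart P p) j x) (map w [0..<1])"
      using theta_1[of "chart_inv (some_chart P p) x" "\<lambda>j. tangent_of P (some_chart P p) (chart_inv (some_chart P p) x) (w j)"
          "\<lambda>_. tangent_of P (some_chart P p) (chart_inv (some_chart P p) x) (w 0)"]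
      by (simp add: XI_def th_def)
  qed
  then show ?thesis by (simp add: X0_def map_upt_small tangent_of_apply[OF Ps ch(1)])
qed

lemma dd_XI_I:
  assumes "hom 2 a"
    and "\<And>v. (\<forall>i. v i \<in> tangent_space P p) \<Longrightarrow> ext_d P 1 (\<theta> j) p v = ev a [v 0 ch, v 1 ch]"
  shows "dd (XI ch j) X0 = a"
proof (rule hom_eqI[OF _ assms(1)])
  show "hom 2 (dd (XI ch j) X0)"
    using hom_dd[of "Suc 0" "XI ch j" X0] by (simp add: XI_def hom_one numeral_2_eq_2)
  fix vs :: "'c list" assume "length vs = 2"
  then obtain w0 w1 where vs: "vs = [w0, w1]"
    by (metis (no_types, lifting) One_nat_def Suc_1 length_0_conv length_Suc_conv)
  show "ev (dd (XI ch j) X0) vs = ev a vs"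
    unfolding vs ev_dd_XI
    by (subst assms(2)) (simp_all add: tangent_of_in[OF Ps ch(1)] tangent_of_apply[OF Ps ch(1)])
qed

lemma hom_fields: "hom (Suc 0) (t1 ch d X0)" "hom (Suc 0) (t2 ch d X0)" "hom (Suc 0) (t3 ch d X0)" "hom (Suc 0) (t4 ch d X0)"
  "hom (Suc 0) (DS ch X0)" "hom 2 (W2 ch d X0)" "hom 2 (W3 ch d X0)" "hom 2 W1'"
proof -
  show t: "hom (Suc 0) (t1 ch d X0)" "hom (Suc 0) (t2 ch d X0)" "hom (Suc 0) (t3 ch d X0)" "hom (Suc 0) (t4 ch d X0)"
    "hom (Suc 0) (DS ch X0)"
    unfolding t1_def t2_def t3_def t4_def DS_def dfun_def by (rule hom_one)+
  show "hom 2 (W2 ch d X0)" "hom 2 (W3 ch d X0)" "hom 2 W1'"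
    unfolding W2_def W3_def W1'_def kform_def hform_def by (intro hom_linear hom2 t)+
qed

lemma dd_xi: "dd (XI ch ix) X0 = - W2 ch d X0"
proof (rule dd_XI_I)
  show "hom 2 (- W2 ch d X0)" by (intro hom_linear hom_fields)
  fix v :: "nat \<Rightarrow> _" assume v: "\<forall>i. v i \<in> tangent_space P p"
  have "ext_d P 1 (\<theta> ix) p v = - pullback P B \<pi> (pullback B M fst \<omega>2) p v"
    using curvature_xi p v by (simp add: form_eq_def pullback_def)
  then show "ext_d P 1 (\<theta> ix) p v = ev (- W2 ch d X0) [v 0 ch, v 1 ch]"
    using pullback_eval(2)[OF ch(1) d(1) v] by (simp add: X0_def)
qed

lemma dd_eta:
  assumes "form_eq P (ext_d P 1 (\<theta> j)) (pullback P B \<pi> (- of_int A *\<^sub>R pullback B M fst \<omega>3))"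
  shows "dd (XI ch j) X0 = - of_int A *\<^sub>R W3 ch d X0"
proof (rule dd_XI_I)
  show "hom 2 (- of_int A *\<^sub>R W3 ch d X0)" by (intro hom_linear hom_fields)
  fix v :: "nat \<Rightarrow> _" assume v: "\<forall>i. v i \<in> tangent_space P p"
  have "ext_d P 1 (\<theta> j) p v = - of_int A * pullback P B \<pi> (pullback B M fst \<omega>3) p v"
    using assms p v by (simp add: form_eq_def pullback_def)
  then show "ext_d P 1 (\<theta> j) p v = ev (- of_int A *\<^sub>R W3 ch d X0) [v 0 ch, v 1 ch]"
    using pullback_eval(3)[OF ch(1) d(1) v] by (simp add: X0_def)
qed

abbreviation "u1 \<equiv> frechet_derivative (uu d) (at z0) (axis 1 1, 0)"
abbreviation "u2 \<equiv> frechet_derivative (uu d) (at z0) (axis 1 \<i>, 0)"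
abbreviation "u3 \<equiv> frechet_derivative (uu d) (at z0) (axis 2 1, 0)"
abbreviation "u4 \<equiv> frechet_derivative (uu d) (at z0) (axis 2 \<i>, 0)"
abbreviation "us \<equiv> frechet_derivative (uu d) (at z0) (0, 1)"
definition "DU = u1 *\<^sub>R t1 ch d X0 + u2 *\<^sub>R t2 ch d X0 + u3 *\<^sub>R t3 ch d X0 + u4 *\<^sub>R t4 ch d X0"
text \<open>The composite of d_M u with J: multiplication by the imaginary unit turns the coordinate
  x into -y and y into x.\<close>

definition "DCU = - u1 *\<^sub>R t2 ch d X0 + u2 *\<^sub>R t1 ch d X0 - u3 *\<^sub>R t4 ch d X0 + u4 *\<^sub>R t3 ch d X0"

lemma dfun_uu: "dfun (\<lambda>x. uu d (ZZ ch d x)) X0 = DU + us *\<^sub>R DS ch X0"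
  unfolding dfun_ZZ[OF ch(2) d(2) X0 differentiable_z0(5)] DU_def by simp

lemma family_deriv_eval:
  assumes v: "\<forall>i. v i \<in> tangent_space P p"
  shows "family_deriv \<omega>1 s0 m0 (\<lambda>i. \<tau> p (v i)) = ev W1' [v 0 ch, v 1 ch]"
proof -
  let ?g = "\<lambda>i. frechet_derivative (GG ch d) (at X0) (v i ch)"
  have tv: "\<tau> p (v i) = tangent_of M d m0 (?g i)" for i
    using tau_chart[OF ch(1) d(1)] v by (simp add: X0_def)
  let ?k = "\<lambda>t. ka d (snd d m0, t) * (x1 (?g 0) * y1 (?g 1) - y1 (?g 0) * x1 (?g 1))
    + kd d (snd d m0, t) * (x2 (?g 0) * y2 (?g 1) - y2 (?g 0) * x2 (?g 1))
    + ke d (snd d m0, t) * (x1 (?g 0) * x2 (?g 1) - x2 (?g 0) * x1 (?g 1) + (y1 (?g 0) * y2 (?g 1) - y2 (?g 0) * y1 (?g 1)))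
    + kf d (snd d m0, t) * (x1 (?g 0) * y2 (?g 1) - y2 (?g 0) * x1 (?g 1) - (y1 (?g 0) * x2 (?g 1) - x2 (?g 0) * y1 (?g 1)))"
  have k: "\<omega>1 t m0 (\<lambda>i. \<tau> p (v i)) = ?k t" if "t \<in> I" for t
    using alternating_form_vec2[OF alternating_kaehler[OF that m0(1)], of "\<lambda>i. \<tau> p (v i)"]
      kaehler_coordinates[OF d(1) that, of "?g 0" "?g 1"] by (simp add: tv)
  have D: "((\<lambda>t. f (snd d m0, t)) has_real_derivative frechet_derivative f (at z0) (0, 1)) (at s0)"
    if f: "f differentiable (at z0)" for f
  proof -
    have "((\<lambda>t. (snd d m0, t)) has_derivative (\<lambda>t. (0, t))) (at s0)"
      by (intro has_derivative_Pair has_derivative_ident has_derivative_const)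
    from diff_chain_at[OF this, of f "frechet_derivative f (at z0)"]
    have "((\<lambda>t. f (snd d m0, t)) has_derivative (\<lambda>t. frechet_derivative f (at z0) (0, t))) (at s0)"
      using f by (simp add: o_def z0(1) frechet_derivative_works)
    moreover have "(\<lambda>t. frechet_derivative f (at z0) (0, t)) = (*) (frechet_derivative f (at z0) (0, 1))"
    proof
      show "frechet_derivative f (at z0) (0, t) = frechet_derivative f (at z0) (0, 1) * t" for t
        using linear_scale[OF linear_frechet_derivative[OF f], of t "(0, 1)"] by (simp add: mult.commute)
    qed
    ultimately show ?thesis by (simp only: has_field_derivative_def)
  qed
  have "(?k has_real_derivative ev W1' [v 0 ch, v 1 ch]) (at s0)"
    unfolding W1'_def kform_def t_one[OF ch(2) d(2) X0]
    by (rule DERIV_cong[OF DERIV_add[OF DERIV_add[OF DERIV_add[OF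
          DERIV_cmult_right[OF D[OF differentiable_z0(1)]] DERIV_cmult_right[OF D[OF differentiable_z0(2)]]]
          DERIV_cmult_right[OF D[OF differentiable_z0(3)]]] DERIV_cmult_right[OF D[OF differentiable_z0(4)]]]])
      (simp only: ev_simps ev_one_one, simp only: mult.commute)
  \<comment> \<open>The coordinate expression is valid for parameters in \<open>I\<close> only;
    \<open>I\<close> is open, so the derivative at \<open>s0\<close> is not affected.\<close>
  then have "((\<lambda>t. \<omega>1 t m0 (\<lambda>i. \<tau> p (v i))) has_real_derivative ev W1' [v 0 ch, v 1 ch]) (at s0)"
    by (rule has_field_derivative_transform_within_open[OF _ I(1) m0(2)]) (simp only: k)
  then show ?thesis unfolding family_deriv_def by (rule DERIV_imp_deriv)
qed

lemma dd_al: "dd (XI ch ia) X0 = - (1 / of_int A) *\<^sub>R (DCU * DS ch X0) + of_int A *\<^sub>R W1'"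
proof (rule dd_XI_I)
  show "hom 2 (- (1 / of_int A) *\<^sub>R (DCU * DS ch X0) + of_int A *\<^sub>R W1')"
    unfolding DCU_def by (intro hom_linear hom2 hom_fields)
  fix v :: "nat \<Rightarrow> _" assume v: "\<forall>i. v i \<in> tangent_space P p"
  let ?V = "\<lambda>i. dmap P B \<pi> p (v i)"
  have t: "dmap B M fst (\<pi> p) (?V i) = \<tau> p (v i)" for i using dmap_pr[OF p] v by simp
  let ?dc = "\<lambda>V. frechet_derivative (\<lambda>z. u s0 (chart_inv d z)) (at (snd d m0)) (\<i> *s dmap B M fst (\<pi> p) V d)"
  have g1: "\<tau> p (v i) d = frechet_derivative (GG ch d) (at X0) (v i ch)" for i
    using tau_chart[OF ch(1) d(1), of "v i"] v by (simp add: X0_def tangent_of_apply[OF Ms d(1)])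
  obtain fs where fs: "DS ch X0 = one fs" "fs = frechet_derivative (SS ch) (at X0)" by (simp add: DS_def dfun_def)
  have dcV: "?dc (?V i) = ev DCU [v i ch]" for i
  proof -
    have "frechet_derivative (\<lambda>z. u s0 (chart_inv d z)) (at (snd d m0)) = (\<lambda>w. frechet_derivative (uu d) (at z0) (w, 0))"
      using frechet_derivative_eqI[OF partial_derivative[OF differentiable_z0(5)[unfolded z0(1)]]]
      by (simp add: uu_def z0(1))
    then show ?thesis
      unfolding t g1 DCU_def t_one[OF ch(2) d(2) X0]
      by (simp only: linear_uu_expand[OF differentiable_z0(5), of "\<i> *s _"]) (simp add: mult.commute)
  qed
  have dcform: "family_form M I (\<lambda>s. dc M (u s)) (\<pi> p) w = ?dc (w 0)" for w
    unfolding family_form_def by (simp add: dc_apply_0 proj_pi d_def flip: B)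
  have dsform: "ds (\<pi> p) w = ds (\<pi> p) (\<lambda>_. w 0)" for w
    unfolding ds by (simp add: ext_d_def Let_def fun_form_def)
  have dsV: "ds (\<pi> p) (\<lambda>_. ?V i) = fs (v i ch)" for i
    using ds_pi[OF ch(1), of "v i" "\<lambda>_. ?V i"] v by (simp add: fs X0_def)
  have "alt_wedge 1 1 (family_form M I (\<lambda>s. dc M (u s)) (\<pi> p)) (ds (\<pi> p)) ?V
      = ?dc (?V 0) * ds (\<pi> p) (\<lambda>_. ?V 1) - ?dc (?V 1) * ds (\<pi> p) (\<lambda>_. ?V 0)"
    by (rule alt_wedge_1_1[where T = UNIV and f = ?dc and g = "\<lambda>w. ds (\<pi> p) (\<lambda>_. w)"])
      (simp_all only: dcform dsform[symmetric], simp)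
  also have "\<dots> = ev (DCU * DS ch X0) [v 0 ch, v 1 ch]"
    unfolding dcV dsV fs(1) DCU_def t_one[OF ch(2) d(2) X0]
    by (simp add: algebra_simps ev_one_one)
  finally have w: "alt_wedge 1 1 (family_form M I (\<lambda>s. dc M (u s)) (\<pi> p)) (ds (\<pi> p)) ?V
      = ev (DCU * DS ch X0) [v 0 ch, v 1 ch]" .
  have fd: "family_form M I (family_deriv \<omega>1) (\<pi> p) ?V = ev W1' [v 0 ch, v 1 ch]"
    using family_deriv_eval[OF v] unfolding family_form_def by (simp add: t proj_pi flip: B)
  have "ext_d P 1 (\<theta> ia) p v = F (\<pi> p) ?V"
    using curvature_al p v by (simp add: form_eq_def pullback_def)
  also have "\<dots> = - (1 / of_int A) * alt_wedge 1 1 (family_form M I (\<lambda>s. dc M (u s)) (\<pi> p)) (ds (\<pi> p)) ?V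
      + of_int A * family_form M I (family_deriv \<omega>1) (\<pi> p) ?V"
    by (simp add: F wedge_def)
  also have "\<dots> = - (1 / of_int A) * ev (DCU * DS ch X0) [v 0 ch, v 1 ch] + of_int A * ev W1' [v 0 ch, v 1 ch]"
    by (simp only: w fd)
  finally show "ext_d P 1 (\<theta> ia) p v = ev (- (1 / of_int A) *\<^sub>R (DCU * DS ch X0) + of_int A *\<^sub>R W1') [v 0 ch, v 1 ch]"
    by simp
qed

text \<open>Instances of the type identities for (2,0)- and (1,1)-forms. The relation with
  \<open>u\<close> is the Monge-Ampere equation multiplied by twice the coordinate volume
  form.\<close>

lemma relations:
  "W2 ch d X0 * W1 ch d X0 = 0" "W3 ch d X0 * W1 ch d X0 = 0" "W2 ch d X0 * W1' = 0" "W3 ch d X0 * W1' = 0"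
  "W2 ch d X0 * W3 ch d X0 = 0" "W2 ch d X0 * W2 ch d X0 = W3 ch d X0 * W3 ch d X0"
  "W2 ch d X0 * DCU = W3 ch d X0 * DU" "W3 ch d X0 * DCU = - (W2 ch d X0 * DU)"
  "u s0 m0 *\<^sub>R (W3 ch d X0 * W3 ch d X0) = (s0 * (s0 + c) / of_int A) *\<^sub>R (W1 ch d X0 * W1 ch d X0)"
  "\<And>a. a * W1' = W1' * a"
proof -
  obtain f1 f2 f3 f4 where f: "t1 ch d X0 = one f1" "t2 ch d X0 = one f2" "t3 ch d X0 = one f3" "t4 ch d X0 = one f4"
    using t_dfun by meson
  show "W2 ch d X0 * W1 ch d X0 = 0" "W3 ch d X0 * W1 ch d X0 = 0" "W2 ch d X0 * W1' = 0" "W3 ch d X0 * W1' = 0"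
    "W2 ch d X0 * W3 ch d X0 = 0" "W2 ch d X0 * DCU = W3 ch d X0 * DU" "W3 ch d X0 * DCU = - (W2 ch d X0 * DU)"
    "W2 ch d X0 * W2 ch d X0 = W3 ch d X0 * W3 ch d X0" "a * W1' = W1' * a" for a
    unfolding W1_def W2_def W3_def W1'_def DU_def DCU_def f
    by (rule hform_kform hform_hform hform_J kform_central | simp only: hform_square power2_minus add.commute)+
  have double: "x * y = z * w \<Longrightarrow> x * (2 * y) = z * (2 * w)" for x y z w :: real by algebra
  have "u s0 m0 * ((hi d (snd d m0))\<^sup>2 + (- hr d (snd d m0))\<^sup>2)
      = s0 * (s0 + c) / of_int A * (ka d z0 * kd d z0 - (ke d z0)\<^sup>2 - (kf d z0)\<^sup>2)"
    using monge_ampere[OF d(1) m0(2)] by (simp add: z0(1) add.commute)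
  then have "u s0 m0 * (2 * ((hi d (snd d m0))\<^sup>2 + (- hr d (snd d m0))\<^sup>2))
      = s0 * (s0 + c) / of_int A * (2 * (ka d z0 * kd d z0 - (ke d z0)\<^sup>2 - (kf d z0)\<^sup>2))"
    by (rule double)
  then show "u s0 m0 *\<^sub>R (W3 ch d X0 * W3 ch d X0) = (s0 * (s0 + c) / of_int A) *\<^sub>R (W1 ch d X0 * W1 ch d X0)"
    unfolding W1_def W3_def f hform_square kform_square z0(2) scaleR_scaleR by (simp only:)
qed

end

lemma dd_cscale: "gdiff a x \<Longrightarrow> dd (\<lambda>y. r *\<^sub>R a y) x = r *\<^sub>R dd a x"
  using dd_scale[of "\<lambda>_. r" x a] by (simp add: one_zero)

lemma gdiff_cscale: "gdiff a x \<Longrightarrow> gdiff (\<lambda>y. r *\<^sub>R a y) x"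
  by (rule gdiff_scale[of "\<lambda>_. r"]) simp

lemma dfun_eqI: "(f has_derivative f') (at x) \<Longrightarrow> dfun f x = one f'"
  unfolding dfun_def by (simp add: frechet_derivative_eqI)

context bundle_point
begin

lemma sg_fields:
  "sg (XI ch j X0) = - XI ch j X0" "sg (DS ch X0) = - DS ch X0"
  "sg (W1 ch d X0) = W1 ch d X0" "sg (W2 ch d X0) = W2 ch d X0" "sg (W3 ch d X0) = W3 ch d X0"
  unfolding XI_def DS_def dfun_def W1_def W2_def W3_def kform_def hform_def t1_def t2_def t3_def t4_def
  by (simp_all add: sg_mult)

lemma fields_one: "\<exists>f. XI ch j X0 = one f" "\<exists>f. DS ch X0 = one f" "\<exists>f. DU = one f" "\<exists>f. DCU = one f"
  using t_dfun[of ch d X0] unfolding XI_def DS_def dfun_def DU_def DCU_def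
  by (auto simp flip: one_add one_scale one_uminus one_diff)

lemma dd_DS_X0: "dd (DS ch) X0 = 0"
  by (rule dd_basic[OF ch(2) d(2) X0])

text \<open>For the third coefficient a multiple of ds is all that is asserted, since in the
  derivative of \<open>PSI\<close> its differential meets another factor ds.\<close>

lemma coefficient_derivatives:
  "dfun (\<lambda>x. (SS ch x + c) / of_int A) X0 = (1 / of_int A) *\<^sub>R DS ch X0"
  "dfun (\<lambda>x. uu d (ZZ ch d x) * (SS ch x + c) / (of_int A)\<^sup>2) X0
    = ((s0 + c) / (of_int A)\<^sup>2) *\<^sub>R (DU + us *\<^sub>R DS ch X0) + (u s0 m0 / (of_int A)\<^sup>2) *\<^sub>R DS ch X0"
  "\<exists>k. dfun (\<lambda>x. (SS ch x)\<^sup>2 * (SS ch x + c)\<^sup>2 / (of_int A) ^ 3) X0 = k *\<^sub>R DS ch X0"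
  "dfun (\<lambda>x. (SS ch x)\<^sup>2 * (SS ch x + c)\<^sup>2 / (2 * (of_int A)\<^sup>2)) X0
    = (s0 * (s0 + c) * (2 * s0 + c) / (of_int A)\<^sup>2) *\<^sub>R DS ch X0"
  "dfun (\<lambda>x. SS ch x * uu d (ZZ ch d x) / of_int A) X0
    = (u s0 m0 / of_int A) *\<^sub>R DS ch X0 + (s0 / of_int A) *\<^sub>R (DU + us *\<^sub>R DS ch X0)"
proof -
  define S' where "S' = frechet_derivative (SS ch) (at X0)"
  define u' where "u' = frechet_derivative (\<lambda>x. uu d (ZZ ch d x)) (at X0)"
  define S where "S = SS ch"
  define U where "U = (\<lambda>x. uu d (ZZ ch d x))"
  have S: "(S has_derivative S') (at X0)" and U: "(U has_derivative u') (at X0)"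
    using differentiable_fields(5,8) unfolding S'_def u'_def S_def U_def by (simp_all add: frechet_derivative_works)
  have v: "S X0 = s0" "U X0 = u s0 m0" by (simp_all add: S_def U_def z0(3) uu_z0)
  have o: "DS ch X0 = one S'" "DU + us *\<^sub>R one S' = one u'"
    using dfun_uu by (simp_all add: DS_def dfun_def S'_def u'_def)
  have c: "dfun f X0 = a *\<^sub>R one S' + b *\<^sub>R one u'" if "(f has_derivative (\<lambda>w. a * S' w + b * u' w)) (at X0)" for f a b
    using dfun_eqI[OF that] by (simp add: one_add one_scale)
  have A: "real_of_int A \<noteq> 0" "A \<noteq> 0" using A by simp_all
  show "dfun (\<lambda>x. (SS ch x + c) / of_int A) X0 = (1 / of_int A) *\<^sub>R DS ch X0"
    unfolding o S_def[symmetric]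
    by (rule trans[OF c[where a = "1 / of_int A" and b = 0]])
      (auto intro!: derivative_eq_intros S U simp: A field_simps)
  show "dfun (\<lambda>x. uu d (ZZ ch d x) * (SS ch x + c) / (of_int A)\<^sup>2) X0
    = ((s0 + c) / (of_int A)\<^sup>2) *\<^sub>R (DU + us *\<^sub>R DS ch X0) + (u s0 m0 / (of_int A)\<^sup>2) *\<^sub>R DS ch X0"
    unfolding o S_def[symmetric] unfolding U_def[symmetric, THEN fun_cong]
    by (rule trans[OF c[where a = "u s0 m0 / (of_int A)\<^sup>2" and b = "(s0 + c) / (of_int A)\<^sup>2"]])
      (auto intro!: derivative_eq_intros S U simp: v A field_simps)
  have "dfun (\<lambda>x. (S x)\<^sup>2 * (S x + c)\<^sup>2 / (of_int A) ^ 3) X0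
      = ((2 * s0 * (s0 + c)\<^sup>2 + 2 * s0\<^sup>2 * (s0 + c)) / (of_int A) ^ 3) *\<^sub>R one S' + 0 *\<^sub>R one u'"
    by (rule c) (auto intro!: derivative_eq_intros S U simp: v A field_simps power2_eq_square)
  then show "\<exists>k. dfun (\<lambda>x. (SS ch x)\<^sup>2 * (SS ch x + c)\<^sup>2 / (of_int A) ^ 3) X0 = k *\<^sub>R DS ch X0"
    unfolding o S_def by auto
  show "dfun (\<lambda>x. (SS ch x)\<^sup>2 * (SS ch x + c)\<^sup>2 / (2 * (of_int A)\<^sup>2)) X0
    = (s0 * (s0 + c) * (2 * s0 + c) / (of_int A)\<^sup>2) *\<^sub>R DS ch X0"
    unfolding o S_def[symmetric]
    by (rule trans[OF c[where a = "s0 * (s0 + c) * (2 * s0 + c) / (of_int A)\<^sup>2" and b = 0]])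
      (auto intro!: derivative_eq_intros S U simp: v A field_simps power2_eq_square)
  show "dfun (\<lambda>x. SS ch x * uu d (ZZ ch d x) / of_int A) X0
    = (u s0 m0 / of_int A) *\<^sub>R DS ch X0 + (s0 / of_int A) *\<^sub>R (DU + us *\<^sub>R DS ch X0)"
    unfolding o S_def[symmetric] unfolding U_def[symmetric, THEN fun_cong]
    by (rule c) (auto intro!: derivative_eq_intros S U simp: v A field_simps)
qed

lemma dd_PHI: "dd (PHI ch d) X0 = 0"
proof -
  let ?X = "XI ch ix X0" and ?L = "XI ch ia X0" and ?T = "DS ch X0"
  let ?dL = "- (1 / of_int A) *\<^sub>R (DCU * ?T) + of_int A *\<^sub>R W1'"
  have 1: "dd (\<lambda>x. XI ch ix x * (W1 ch d x + (1 / of_int A) *\<^sub>R (DS ch x * XI ch ia x))) X0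
      = - W2 ch d X0 * (W1 ch d X0 + (1 / of_int A) *\<^sub>R (?T * ?L)) - ?X * (?T * W1' - (1 / of_int A) *\<^sub>R (?T * ?dL))"
    by (simp only: dd_mult dd_add dd_cscale gdiff_mult gdiff_add gdiff_cscale gdiff_basic dd_xi dd_al dd_W1 dd_DS_X0 sg_fields
        mult_zero_left mult_minus_left add_0_left scaleR_minus_right diff_conv_add_uminus)
  have 2: "dd (\<lambda>x. ((SS ch x + c) / of_int A) *\<^sub>R (W2 ch d x * XI ch ia x)) X0
      = ((1 / of_int A) *\<^sub>R ?T) * (W2 ch d X0 * ?L) + ((s0 + c) / of_int A) *\<^sub>R (W2 ch d X0 * ?dL)"
    by (simp only: dd_scale dd_mult gdiff_mult gdiff_basic dd_W23 dd_al sg_fields z0(3) mult_zero_left add_0_left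
        smooth_on_differentiable[OF smooth_S_polynomials(1)[OF ch(2) d(2)] X0] coefficient_derivatives(1)[unfolded dfun_def])
  have 3: "dd (\<lambda>x. (uu d (ZZ ch d x) * (SS ch x + c) / (of_int A)\<^sup>2) *\<^sub>R (W3 ch d x * DS ch x)) X0
      = (((s0 + c) / (of_int A)\<^sup>2) *\<^sub>R (DU + us *\<^sub>R ?T) + (u s0 m0 / (of_int A)\<^sup>2) *\<^sub>R ?T) * (W3 ch d X0 * ?T)"
    by (simp only: dd_scale dd_mult gdiff_mult gdiff_basic dd_W23 dd_DS_X0 mult_zero_left mult_zero_right add_0_right scaleR_zero_right
        smooth_on_differentiable[OF smooth_S_polynomials(2)[OF ch(2) d(2)] X0] coefficient_derivatives(2)[unfolded dfun_def])
  have "dd (PHI ch d) X0 = - W2 ch d X0 * (W1 ch d X0 + (1 / of_int A) *\<^sub>R (?T * ?L)) - ?X * (?T * W1' - (1 / of_int A) *\<^sub>R (?T * ?dL))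
      + (((1 / of_int A) *\<^sub>R ?T) * (W2 ch d X0 * ?L) + ((s0 + c) / of_int A) *\<^sub>R (W2 ch d X0 * ?dL))
      + (((s0 + c) / (of_int A)\<^sup>2) *\<^sub>R (DU + us *\<^sub>R ?T) + (u s0 m0 / (of_int A)\<^sup>2) *\<^sub>R ?T) * (W3 ch d X0 * ?T)"
    unfolding PHI_def 1[symmetric] 2[symmetric] 3[symmetric]
    by (intro dd_add[THEN trans] arg_cong2[where f = "(+)"] refl gdiff_add gdiff_mult gdiff_cscale gdiff_scale gdiff_basic
        smooth_on_differentiable[OF smooth_S_polynomials(1)[OF ch(2) d(2)] X0]
        smooth_on_differentiable[OF smooth_S_polynomials(2)[OF ch(2) d(2)] X0])
  also have "\<dots> = - W2 ch d X0 * (W1 ch d X0 + (1 / of_int A) *\<^sub>R (?T * ?L)) - ?X * (?T * W1' - (1 / of_int A) *\<^sub>R (?T * ?dL))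
      + (1 / of_int A) *\<^sub>R (?T * (W2 ch d X0 * ?L)) + ((s0 + c) / of_int A) *\<^sub>R (W2 ch d X0 * ?dL)
      + ((s0 + c) / (of_int A)\<^sup>2) *\<^sub>R ((DU + us *\<^sub>R ?T) * (W3 ch d X0 * ?T)) + (u s0 m0 / (of_int A)\<^sup>2) *\<^sub>R (?T * (W3 ch d X0 * ?T))"
    by (simp only: distrib_right[of "_ *\<^sub>R _" "_ *\<^sub>R _"] mult_scaleR_left add.assoc)
  also have "\<dots> = 0"
  proof -
    obtain x l t uf vf where ones: "?X = one x" "?L = one l" "?T = one t" "DU = one uf" "DCU = one vf"
      using fields_one by metis
    show ?thesis
      by (rule phi_closed_algebra[OF _ central_W(1) relations(10) central_W(2,3) relations(1,3,7) ones]) (use A in simp)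
  qed
  finally show ?thesis .
qed

lemma dd_Phi:
  assumes "form_eq P (ext_d P 1 (\<theta> ie)) (pullback P B \<pi> (- of_int A *\<^sub>R pullback B M fst \<omega>3))"
  shows "dd (\<lambda>x. XI ch ie x * PHI ch d x + PSI ch d x) X0 = 0"
proof -
  let ?X = "XI ch ix X0" and ?L = "XI ch ia X0" and ?T = "DS ch X0" and ?W1 = "W1 ch d X0" and ?W2 = "W2 ch d X0" and ?W3 = "W3 ch d X0"
  let ?A = "real_of_int A"
  let ?dL = "- (1 / ?A) *\<^sub>R (DCU * ?T) + ?A *\<^sub>R W1'"
  obtain x l t uf vf where ones: "?X = one x" "?L = one l" "?T = one t" "DU = one uf" "DCU = one vf"
    using fields_one by metis
  have TT: "?T * (?T * b) = 0" for b by (simp add: ones one_square_left)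
  note sp = smooth_on_differentiable[OF smooth_S_polynomials(3)[OF ch(2) d(2)] X0]
    smooth_on_differentiable[OF smooth_S_polynomials(4)[OF ch(2) d(2)] X0]
    smooth_on_differentiable[OF smooth_S_polynomials(5)[OF ch(2) d(2)] X0] differentiable_fields(8)
  have 0: "dd (\<lambda>x. XI ch ie x * PHI ch d x) X0 = - ?A *\<^sub>R (?W3 * PHI ch d X0)"
    by (simp only: dd_mult gdiff_basic dd_eta[OF assms] dd_PHI mult_zero_right add_0_right mult_scaleR_left mult_minus_left)
  obtain k where k: "dfun (\<lambda>x. (SS ch x)\<^sup>2 * (SS ch x + c)\<^sup>2 / (of_int A) ^ 3) X0 = k *\<^sub>R ?T"
    using coefficient_derivatives(3) by blast
  have 1: "dd (\<lambda>x. ((SS ch x)\<^sup>2 * (SS ch x + c)\<^sup>2 / ?A ^ 3) *\<^sub>R (DS ch x * (XI ch ia x * W1 ch d x))) X0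
      = (s0\<^sup>2 * (s0 + c)\<^sup>2 / ?A ^ 3) *\<^sub>R (- (?T * (?dL * ?W1)) + ?T * (?L * (?T * W1')))"
  proof -
    have "dd (\<lambda>x. DS ch x * (XI ch ia x * W1 ch d x)) X0 = 0 * (?L * ?W1) + - ?T * (?dL * ?W1 + - ?L * (?T * W1'))"
      by (simp only: dd_mult gdiff_mult gdiff_basic dd_al dd_W1 dd_DS_X0 sg_fields)
    also have "\<dots> = - (?T * (?dL * ?W1)) + ?T * (?L * (?T * W1'))"
      by (simp add: right_diff_distrib)
    finally have e: "dd (\<lambda>x. DS ch x * (XI ch ia x * W1 ch d x)) X0 = - (?T * (?dL * ?W1)) + ?T * (?L * (?T * W1'))" .
    show ?thesis
      by (simp only: dd_scale sp gdiff_mult gdiff_basic e k[unfolded dfun_def] z0(3) mult_scaleR_left TT scaleR_zero_right add_0_left)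
  qed
  have 2: "dd (\<lambda>x. ((SS ch x)\<^sup>2 * (SS ch x + c)\<^sup>2 / (2 * ?A\<^sup>2)) *\<^sub>R (W1 ch d x * W1 ch d x)) X0
      = (s0 * (s0 + c) * (2 * s0 + c) / ?A\<^sup>2) *\<^sub>R (?T * (?W1 * ?W1)) + (s0\<^sup>2 * (s0 + c)\<^sup>2 / (2 * ?A\<^sup>2)) *\<^sub>R (?T * W1' * ?W1 + ?W1 * (?T * W1'))"
    by (simp only: dd_scale dd_mult sp gdiff_mult gdiff_basic dd_W1 sg_fields coefficient_derivatives(4)[unfolded dfun_def] z0(3) mult_scaleR_left)
  have 3: "dd (\<lambda>x. (SS ch x * uu d (ZZ ch d x) / ?A) *\<^sub>R (XI ch ix x * (DS ch x * W2 ch d x))) X0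
      = (u s0 m0 / ?A) *\<^sub>R (?T * (?X * (?T * ?W2))) + (s0 / ?A) *\<^sub>R ((DU + us *\<^sub>R ?T) * (?X * (?T * ?W2))) + (s0 * u s0 m0 / ?A) *\<^sub>R (- ?W2 * (?T * ?W2))"
  proof -
    have "dd (\<lambda>x. XI ch ix x * (DS ch x * W2 ch d x)) X0 = - ?W2 * (?T * ?W2) + - ?X * (0 * ?W2 + - ?T * 0)"
      by (simp only: dd_mult gdiff_mult gdiff_basic dd_xi dd_W23 dd_DS_X0 sg_fields)
    then have e: "dd (\<lambda>x. XI ch ix x * (DS ch x * W2 ch d x)) X0 = - ?W2 * (?T * ?W2)" by simp
    show ?thesis
      by (simp only: dd_scale sp gdiff_mult gdiff_basic e coefficient_derivatives(5)[unfolded dfun_def] z0(3) uu_z0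
          distrib_right[of "_ *\<^sub>R _" "_ *\<^sub>R _"] mult_scaleR_left)
  qed
  have 4: "dd (\<lambda>x. SS ch x *\<^sub>R (XI ch ix x * (XI ch ia x * W3 ch d x))) X0
      = ?T * (?X * (?L * ?W3)) + s0 *\<^sub>R ((- ?W2 * ?L - ?X * ?dL) * ?W3)"
  proof -
    have "dd (\<lambda>x. XI ch ix x * (XI ch ia x * W3 ch d x)) X0 = - ?W2 * (?L * ?W3) + - ?X * (?dL * ?W3 + - ?L * 0)"
      by (simp only: dd_mult gdiff_mult gdiff_basic dd_xi dd_al dd_W23 sg_fields)
    also have "\<dots> = (- ?W2 * ?L - ?X * ?dL) * ?W3"
      by (simp add: algebra_simps)
    finally have e: "dd (\<lambda>x. XI ch ix x * (XI ch ia x * W3 ch d x)) X0 = (- ?W2 * ?L - ?X * ?dL) * ?W3" .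
    show ?thesis
      by (simp only: dd_scale sp gdiff_mult gdiff_basic e DS_def[unfolded dfun_def, THEN fun_cong, symmetric] z0(3))
  qed
  have psi: "dd (PSI ch d) X0 = (s0\<^sup>2 * (s0 + c)\<^sup>2 / ?A ^ 3) *\<^sub>R (- (?T * (?dL * ?W1)) + ?T * (?L * (?T * W1')))
     + ((s0 * (s0 + c) * (2 * s0 + c) / ?A\<^sup>2) *\<^sub>R (?T * (?W1 * ?W1)) + (s0\<^sup>2 * (s0 + c)\<^sup>2 / (2 * ?A\<^sup>2)) *\<^sub>R (?T * W1' * ?W1 + ?W1 * (?T * W1')))
     + ((u s0 m0 / ?A) *\<^sub>R (?T * (?X * (?T * ?W2))) + (s0 / ?A) *\<^sub>R ((DU + us *\<^sub>R ?T) * (?X * (?T * ?W2))) + (s0 * u s0 m0 / ?A) *\<^sub>R (- ?W2 * (?T * ?W2)))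
     - (?T * (?X * (?L * ?W3)) + s0 *\<^sub>R ((- ?W2 * ?L - ?X * ?dL) * ?W3))"
    unfolding PSI_def 1[symmetric] 2[symmetric] 3[symmetric] 4[symmetric]
    by (intro dd_add[THEN trans] dd_diff[THEN trans] arg_cong2[where f = "(+)"] arg_cong2[where f = "(-)"] refl gdiff_add gdiff_mult gdiff_cscale gdiff_scale gdiff_basic sp)
  have p: "PHI ch d X0 = ?X * (?W1 + (1 / ?A) *\<^sub>R (?T * ?L)) + ((s0 + c) / ?A) *\<^sub>R (?W2 * ?L) + (u s0 m0 * (s0 + c) / ?A\<^sup>2) *\<^sub>R (?W3 * ?T)"
    by (simp only: PHI_def z0(3) uu_z0)
  have "dd (\<lambda>x. XI ch ie x * PHI ch d x + PSI ch d x) X0 = - ?A *\<^sub>R (?W3 * PHI ch d X0) + dd (PSI ch d) X0"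
    unfolding 0[symmetric] by (intro dd_add gdiff_mult gdiff_basic)
  also have "\<dots> = 0"
    unfolding psi p
    by (rule Phi_closed_algebra[OF _ central_W(1) relations(10) central_W(2,3) relations(1,2,4,5,6,8,9) ones]) (use A in simp)
  finally show ?thesis .
qed

end

section \<open>From chart fields back to global forms\<close>

context torus_bundle
begin

text \<open>A description of a form in all pairs of charts at once, from which both its smoothness
  and its closedness are read off.\<close>

definition represents :: "nat \<Rightarrow> ('p, 'e, real) form \<Rightarrow> (('p, 'e) chart \<Rightarrow> ('a, complex ^ 2) chart \<Rightarrow> 'e \<Rightarrow> 'e grass) \<Rightarrow> bool" where
  "represents k \<omega> G \<longleftrightarrow> (\<forall>y ch d v. ch \<in> charts_at P y \<longrightarrow> d \<in> charts_at M (pr y) \<longrightarrow> (\<forall>i. v i \<in> tangent_space P y) \<longrightarrow>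
     \<omega> y v = ev (G ch d (snd ch y)) (map (\<lambda>i. v i ch) [0..<k]))"

lemma represents_local:
  assumes "represents k \<omega> G" "ch \<in> P" "d \<in> M" "x \<in> dom ch d"
  shows "\<omega> (chart_inv ch x) (\<lambda>j. tangent_of P ch (chart_inv ch x) (w j)) = ev (G ch d x) (map w [0..<k])"
  using assms(1)[unfolded represents_def, rule_format, OF domE(4,5)[OF assms(2-4)], of "\<lambda>j. tangent_of P ch (chart_inv ch x) (w j)"]
    tangent_of_in[OF Ps domE(4)[OF assms(2-4)]]
  by (simp add: domE(3)[OF assms(2-4)] tangent_of_apply[OF Ps domE(4)[OF assms(2-4)]])

lemma represents_closed:
  assumes r: "represents k \<omega> G"
    and c: "\<And>p. p \<in> points P \<Longrightarrow> dd (G (some_chart P p) (some_chart M (pr p))) (snd (some_chart P p) p) = 0"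
  shows "closed_form P k \<omega>"
  unfolding closed_form_def form_eq_def
proof (intro ballI allI impI)
  fix p v assume p: "p \<in> points P"
  let ?ch = "some_chart P p" and ?d = "some_chart M (pr p)"
  have ch: "?ch \<in> charts_at P p" using some_chart[OF p] .
  have d: "?d \<in> charts_at M (pr p)" using some_chart[OF in_base(2)[OF p]] .
  have m: "?ch \<in> P" "?d \<in> M" using charts_atD[OF ch] charts_atD[OF d] by auto
  show "ext_d P k \<omega> p v = 0 p v"
    using ext_d_dd[OF open_dom[OF m] in_dom[OF ch d] represents_local[OF r m]] c[OF p] by simp
qed

text \<open>Every point of a chart image has an open neighbourhood lying over a single chart of M,
  where a smooth field gives the form; smoothness is local.\<close>

lemma represents_smooth:
  assumes r: "represents k \<omega> G" and G: "\<And>ch d. ch \<in> P \<Longrightarrow> d \<in> M \<Longrightarrow> gsmooth (dom ch d) (G ch d)"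
    and a: "\<And>p. p \<in> points P \<Longrightarrow> alternating_form (tangent_space P p) k (\<omega> p)"
  shows "smooth_form P k \<omega>"
  unfolding smooth_form_def
proof (intro conjI ballI allI a smooth_on_local)
  fix ch w x assume ch: "ch \<in> P" and x: "x \<in> snd ch ` fst ch"
  let ?y = "chart_inv ch x" let ?d = "some_chart M (pr ?y)"
  have y: "ch \<in> charts_at P ?y" using chart_inv_in[OF x] ch by (simp add: charts_at_def)
  have d: "?d \<in> charts_at M (pr ?y)" using some_chart[OF in_base(2)[OF charts_at_points[OF y]]] .
  then have m: "?d \<in> M" by (rule charts_atD(1))
  have xd: "x \<in> dom ch ?d" using in_dom[OF y d] chart_chart_inv[OF x] by simp
  have eq: "\<omega> (chart_inv ch z) (\<lambda>i. tangent_of P ch (chart_inv ch z) (w i)) = ev (G ch ?d z) (map w [0..<k])"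
    if "z \<in> dom ch ?d" for z by (rule represents_local[OF r ch m that])
  have "smooth_on (dom ch ?d) (\<lambda>x. ev (G ch ?d x) (map w [0..<k]))"
    using G[OF ch m] by (simp add: gsmooth_def)
  then have "smooth_on (dom ch ?d) (\<lambda>x. \<omega> (chart_inv ch x) (\<lambda>i. tangent_of P ch (chart_inv ch x) (w i)))"
    by (subst smooth_on_cong[OF open_dom[OF ch m], where g = "\<lambda>z. ev (G ch ?d z) (map w [0..<k])"]) (use eq in simp_all)
  then show "\<exists>U. open U \<and> x \<in> U \<and> smooth_on U (\<lambda>x. \<omega> (chart_inv ch x) (\<lambda>i. tangent_of P ch (chart_inv ch x) (w i)))"
    using open_dom[OF ch m] xd by blast
qed

lemma bundle_point_at: "p \<in> points P \<Longrightarrow> bundle_point M \<omega>2 \<omega>3 A c I \<omega>1 u B ds F P \<pi> \<rho> \<theta> ia ix p (some_chart P p) (some_chart M (pr p))"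
  using some_chart[of p P] some_chart[of "pr p" M] in_base(2)[of p] by unfold_locales auto

lemma represents_phi: "represents 3 phi PHI"
  unfolding represents_def map_upt_small using phi_eval by blast

lemma closed_phi: "closed_form P 3 phi"
proof (rule represents_closed[OF represents_phi])
  fix p assume "p \<in> points P"
  then interpret bp: bundle_point M \<omega>2 \<omega>3 A c I \<omega>1 u B ds F P \<pi> \<rho> \<theta> ia ix p "some_chart P p" "some_chart M (pr p)"
    by (rule bundle_point_at)
  show "dd (PHI (some_chart P p) (some_chart M (pr p))) (snd (some_chart P p) p) = 0"
    using bp.dd_PHI unfolding bp.X0_def .
qed

lemma closed_Phi:
  assumes "represents 4 \<omega> (\<lambda>ch d x. XI ch ie x * PHI ch d x + PSI ch d x)"
    and "form_eq P (ext_d P 1 (\<theta> ie)) (pullback P B \<pi> (- of_int A *\<^sub>R pullback B M fst \<omega>3))"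
  shows "closed_form P 4 \<omega>"
proof (rule represents_closed[OF assms(1)])
  fix p assume "p \<in> points P"
  then interpret bp: bundle_point M \<omega>2 \<omega>3 A c I \<omega>1 u B ds F P \<pi> \<rho> \<theta> ia ix p "some_chart P p" "some_chart M (pr p)"
    by (rule bundle_point_at)
  show "dd (\<lambda>x. XI (some_chart P p) ie x * PHI (some_chart P p) (some_chart M (pr p)) x
      + PSI (some_chart P p) (some_chart M (pr p)) x) (snd (some_chart P p) p) = 0"
    using bp.dd_Phi[OF assms(2)] unfolding bp.X0_def .
qed

end

section \<open>Vertical vectors\<close>

context torus_bundle
begin

lemma torus_facts:
  "DIM('e) = DIM((complex ^ 2) \<times> real) + CARD('k)"
  "smooth_map (prod_atlas (open_atlas UNIV) P) P (\<lambda>(t, p). \<rho> t p)"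
  "\<And>p. p \<in> points P \<Longrightarrow> \<rho> 0 p = p"
  "\<And>p q. p \<in> points P \<Longrightarrow> q \<in> points P \<Longrightarrow> \<pi> p = \<pi> q \<longleftrightarrow> (\<exists>t. q = \<rho> t p)"
  "\<And>b. b \<in> points B \<Longrightarrow> \<exists>W \<sigma>. open W \<and> b \<in> W \<and> W \<subseteq> points B \<and>
        smooth_map (restrict_atlas W B) P \<sigma> \<and> (\<forall>x\<in>W. \<pi> (\<sigma> x) = x)"
  using torus unfolding principal_torus_bundle_def by blast+

lemma points_action: "points (prod_atlas (open_atlas UNIV) P) = (UNIV :: (real ^ 'k) set) \<times> points P"
  by (auto simp: points_def prod_atlas_def open_atlas_def) (intro exI conjI, rule refl, rule refl, assumption, simp)

lemma action_point: "p \<in> points P \<Longrightarrow> \<rho> t p \<in> points P"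
  using smooth_map_point[OF torus_facts(2), of "(t, p)"] by (simp add: points_action)

lemma action_fibre: "p \<in> points P \<Longrightarrow> \<pi> (\<rho> t p) = \<pi> p"
  using torus_facts(4)[of p "\<rho> t p"] action_point[of p t] by metis

lemma action_continuous: "continuous_on (UNIV \<times> points P) (\<lambda>(t, p). \<rho> t p)"
  using torus_facts(2) by (simp add: smooth_map_def points_action)

lemma action_differentiable:
  assumes c': "c' \<in> charts_at P y" and ch: "ch \<in> charts_at P (\<rho> t y)"
  shows "(\<lambda>(t, x). snd ch (\<rho> t (chart_inv c' x))) differentiable (at (t, snd c' y))"
proof -
  have c'P: "c' \<in> P" "y \<in> fst c'" and chP: "ch \<in> P" "\<rho> t y \<in> fst ch" using charts_atD[OF c'] charts_atD[OF ch] by auto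
  let ?pc = "(UNIV \<times> fst c', map_prod (\<lambda>x. x) (snd c')) :: ((real ^ 'k) \<times> 'p, (real ^ 'k) \<times> 'e) chart"
  have pc: "?pc \<in> prod_atlas (open_atlas UNIV) P"
    using c'P by (force simp: prod_atlas_def open_atlas_def)
  have inv: "chart_inv ?pc (s, x) = (s, chart_inv c' x)" if "x \<in> snd c' ` fst c'" for s x
  proof (rule inv_into_f_eq)
    show "inj_on (snd ?pc) (fst ?pc)" using inj_chart[OF Ps c'P(1)] by (auto simp: inj_on_def)
  qed (use chart_inv_in[OF that] chart_chart_inv[OF that] in auto)
  have "(t, snd c' y) \<in> snd ?pc ` (fst ?pc \<inter> (\<lambda>(t, p). \<rho> t p) -` fst ch)"
    using c'P chP by (force simp: image_iff)
  from smooth_on_differentiable[OF smooth_map_lrep[OF torus_facts(2) pc chP(1)] this]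
  obtain D where D: "(lrep ?pc ch (\<lambda>(t, p). \<rho> t p) has_derivative D) (at (t, snd c' y))"
    unfolding differentiable_def by blast
  have "((\<lambda>(t, x). snd ch (\<rho> t (chart_inv c' x))) has_derivative D) (at (t, snd c' y))"
  proof (rule has_derivative_transform_within_open[OF D])
    show "open (UNIV \<times> snd c' ` fst c')" by (intro open_Times open_UNIV open_chart_image[OF Ps c'P(1)])
    show "(t, snd c' y) \<in> UNIV \<times> snd c' ` fst c'" using c'P by auto
    show "lrep ?pc ch (\<lambda>(t, p). \<rho> t p) z = (case z of (t, x) \<Rightarrow> snd ch (\<rho> t (chart_inv c' x)))"
      if "z \<in> UNIV \<times> snd c' ` fst c'" for z
      using inv[of "snd z" "fst z"] that by (auto simp: mem_Times_iff case_prod_beta)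
  qed
  then show ?thesis unfolding differentiable_def by blast
qed

text \<open>Moving a local section by the action gives one through any given point.\<close>
lemma submersion:
  assumes ch: "ch \<in> charts_at P p" and d: "d \<in> charts_at M (pr p)"
  shows "\<exists>w. frechet_derivative (ZZ ch d) (at (snd ch p)) w = z"
proof -
  have chP: "ch \<in> P" "p \<in> fst ch" and dM: "d \<in> M" "pr p \<in> fst d" using charts_atD[OF ch] charts_atD[OF d] by auto
  have p: "p \<in> points P" using charts_at_points[OF ch] .
  obtain W \<sigma> where W: "open W" "\<pi> p \<in> W" "W \<subseteq> points B" and \<sigma>: "smooth_map (restrict_atlas W B) P \<sigma>"
    and sec: "\<And>x. x \<in> W \<Longrightarrow> \<pi> (\<sigma> x) = x"
    using torus_facts(5)[OF smooth_map_point[OF smooth_pi p]] by blast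
  have "points (restrict_atlas W B) = points B \<inter> W" by (auto simp: points_def restrict_atlas_def)
  then have ptsW: "points (restrict_atlas W B) = W" using W(3) by blast
  have \<sigma>P: "\<sigma> x \<in> points P" if "x \<in> W" for x using smooth_map_point[OF \<sigma>] that by (simp add: ptsW)
  obtain t where t: "p = \<rho> t (\<sigma> (\<pi> p))"
    using torus_facts(4)[OF \<sigma>P[OF W(2)] p] sec[OF W(2)] by metis
  let ?c' = "some_chart P (\<sigma> (\<pi> p))"
  have c': "?c' \<in> charts_at P (\<sigma> (\<pi> p))" using some_chart[OF \<sigma>P[OF W(2)]] .
  have c'P: "?c' \<in> P" "\<sigma> (\<pi> p) \<in> fst ?c'" using charts_atD[OF c'] by auto
  let ?V = "(snd d ` fst d) \<times> I"
  let ?z0 = "(snd d (pr p), sP p)"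
  define \<beta> where "\<beta> = (\<lambda>z :: (complex ^ 2) \<times> real. (chart_inv d (fst z), snd z))"
  have sI: "sP p \<in> I" using in_base(1)[OF p] .
  have z0V: "?z0 \<in> ?V" using dM sI by auto
  have \<beta>0: "\<beta> ?z0 = \<pi> p" using chart_inv_chart[OF Ms dM] by (simp add: \<beta>_def pi_eq)
  have Vopen: "open ?V" by (intro open_Times open_chart_image[OF Ms dM(1)] I)
  have \<beta>cont: "continuous_on ?V \<beta>"
    unfolding \<beta>_def
    by (intro continuous_on_Pair continuous_on_compose2[OF continuous_chart_inv[OF Ms dM(1)]] continuous_on_fst continuous_on_snd continuous_on_id) auto
  let ?cW = "(fst (pch I d) \<inter> W, snd (pch I d))"
  have cW: "?cW \<in> restrict_atlas W B" unfolding restrict_atlas_def using pch_in[OF dM(1)] by (rule image_eqI[rotated]) simp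
  have \<beta>V: "\<beta> z \<in> fst (pch I d)" "snd (pch I d) (\<beta> z) = z" if "z \<in> ?V" for z
    using that chart_inv_in[of "fst z" d] chart_chart_inv[of "fst z" d] by (auto simp: \<beta>_def)
  have inv: "chart_inv ?cW z = \<beta> z" if "z \<in> ?V" "\<beta> z \<in> W" for z
  proof (rule inv_into_f_eq)
    have "inj_on (snd (pch I d)) (fst (pch I d))" using inj_chart[OF Ms dM(1)] by (auto simp: inj_on_def)
    then show "inj_on (snd ?cW) (fst ?cW)" unfolding fst_conv snd_conv by (rule inj_on_subset) simp
    show "\<beta> z \<in> fst ?cW" "snd ?cW (\<beta> z) = z" using \<beta>V[OF that(1)] that(2) by simp_all
  qed
  define H where "H = (\<lambda>x. \<rho> t (\<sigma> x))"
  have \<sigma>cont: "continuous_on W \<sigma>" using \<sigma> by (simp add: smooth_map_def ptsW)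
  have Hcont: "continuous_on W H"
  proof -
    have "continuous_on W (\<lambda>x. (\<lambda>(t, p). \<rho> t p) (t, \<sigma> x))"
      by (rule continuous_on_compose2[OF action_continuous]) (use \<sigma>P in \<open>auto intro!: continuous_on_Pair \<sigma>cont\<close>)
    then show ?thesis by (simp add: H_def)
  qed
  \<comment> \<open>Base coordinates at which the section lands in the chart \<open>?c'\<close> and
    the moved section in \<open>ch\<close>, so that all composites below make sense.\<close>
  define O1 where "O1 = ?V \<inter> \<beta> -` ((W \<inter> \<sigma> -` fst ?c') \<inter> (W \<inter> H -` fst ch))"
  have O1: "open O1" "?z0 \<in> O1"
    unfolding O1_def
    by (intro continuous_open_preimage[OF \<beta>cont Vopen] open_Int continuous_open_preimage[OF \<sigma>cont W(1)]
        continuous_open_preimage[OF Hcont W(1)] open_chart[OF Ps] chP c'P)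
      (use z0V \<beta>0 W(2) c'P chP t in \<open>auto simp: H_def\<close>)
  have "lrep ?cW ?c' \<sigma> differentiable (at ?z0)"
  proof (rule smooth_on_differentiable[OF smooth_map_lrep[OF \<sigma> cW c'P(1)]])
    show "?z0 \<in> snd ?cW ` (fst ?cW \<inter> \<sigma> -` fst ?c')"
      by (rule image_eqI[of _ _ "\<pi> p"]) (use dM sI W(2) c'P in \<open>auto simp: pi_eq\<close>)
  qed
  then obtain D1 where D1: "(lrep ?cW ?c' \<sigma> has_derivative D1) (at ?z0)" unfolding differentiable_def by blast
  have l0: "lrep ?cW ?c' \<sigma> ?z0 = snd ?c' (\<sigma> (\<pi> p))" using inv[OF z0V] \<beta>0 W(2) by simp
  have "ch \<in> charts_at P (\<rho> t (\<sigma> (\<pi> p)))" using ch t by simp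
  from action_differentiable[OF c' this]
  obtain D2 where D2: "((\<lambda>(t, x). snd ch (\<rho> t (chart_inv ?c' x))) has_derivative D2) (at (t, snd ?c' (\<sigma> (\<pi> p))))"
    unfolding differentiable_def by blast
  have "((\<lambda>z. (t, lrep ?cW ?c' \<sigma> z)) has_derivative (\<lambda>w. (0, D1 w))) (at ?z0)"
    by (intro has_derivative_Pair has_derivative_const D1)
  from diff_chain_at[OF this, of "\<lambda>(t, x). snd ch (\<rho> t (chart_inv ?c' x))" D2]
  have D: "((\<lambda>z. snd ch (\<rho> t (chart_inv ?c' (lrep ?cW ?c' \<sigma> z)))) has_derivative (\<lambda>w. D2 (0, D1 w))) (at ?z0)" (is "(?h has_derivative _) _")
    using D2 l0 by (simp add: o_def)
  have h: "?h z = snd ch (H (\<beta> z))" if "z \<in> O1" for z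
    using that inv[of z] chart_inv_chart[OF Ps c'P(1), of "\<sigma> (\<beta> z)"] by (auto simp: O1_def H_def)
  \<comment> \<open>The moved section is a right inverse of the projection near the point;
    differentiating this identity gives a right inverse of the derivative.\<close>
  have ZZ: "ZZ ch d (?h z) = z" if z: "z \<in> O1" for z
  proof -
    have b: "z \<in> ?V" "\<beta> z \<in> W" "H (\<beta> z) \<in> fst ch" using z by (auto simp: O1_def)
    have "\<pi> (H (\<beta> z)) = \<beta> z" unfolding H_def using action_fibre[OF \<sigma>P[OF b(2)]] sec[OF b(2)] by simp
    then have "pr (H (\<beta> z)) = chart_inv d (fst z)" "sP (H (\<beta> z)) = snd z" by (simp_all add: pr_def sP_def \<beta>_def)
    moreover have "chart_inv ch (snd ch (H (\<beta> z))) = H (\<beta> z)" by (rule chart_inv_chart[OF Ps chP(1) b(3)])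
    ultimately show ?thesis
      using b(1) chart_chart_inv[of "fst z" d] unfolding h[OF z] by (auto simp: ZZ_def SS_def)
  qed
  have h0: "?h ?z0 = snd ch p" using h[OF O1(2)] \<beta>0 t by (simp add: H_def)
  have DZ: "(ZZ ch d has_derivative frechet_derivative (ZZ ch d) (at (snd ch p))) (at (?h ?z0))"
    unfolding h0 by (rule smooth_on_has_derivative[OF smooth_ZZ[OF chP(1) dM(1)] in_dom[OF ch d]])
  have "((\<lambda>z. z) has_derivative (\<lambda>w. frechet_derivative (ZZ ch d) (at (snd ch p)) (D2 (0, D1 w)))) (at ?z0)"
    by (rule has_derivative_transform_within_open[OF diff_chain_at[OF D DZ, unfolded o_def] O1]) (use ZZ in \<open>simp only: o_def\<close>)
  then have "(\<lambda>w. frechet_derivative (ZZ ch d) (at (snd ch p)) (D2 (0, D1 w))) = (\<lambda>w. w)"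
    by (rule has_derivative_unique[OF _ has_derivative_ident])
  then show ?thesis by metis
qed

text \<open>The chain rule along an orbit, for arbitrary \<open>f\<close>: with charts it gives the
  transformation law of \<open>generator\<close>, with the projection its verticality.\<close>

lemma generator_along:
  assumes ch: "ch \<in> charts_at P p" and F: "((\<lambda>x. f (chart_inv ch x)) has_derivative f') (at (snd ch p))"
  shows "((\<lambda>t. f (\<rho> (t *\<^sub>R axis j 1) p)) has_derivative (\<lambda>t. f' (t *\<^sub>R generator P \<rho> j p ch))) (at 0)"
proof -
  have chP: "ch \<in> P" "p \<in> fst ch" and p: "p \<in> points P" using charts_atD[OF ch] charts_at_points[OF ch] by auto
  let ?\<gamma> = "\<lambda>t. \<rho> (t *\<^sub>R axis j 1) p"
  have \<gamma>0: "?\<gamma> 0 = p" using torus_facts(3)[OF p] by simp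
  have "(\<lambda>(t, x). snd ch (\<rho> t (chart_inv ch x))) differentiable (at (0, snd ch p))"
    by (rule action_differentiable[OF ch]) (use ch torus_facts(3)[OF p] in simp)
  then obtain D2 where D2: "((\<lambda>(t, x). snd ch (\<rho> t (chart_inv ch x))) has_derivative D2) (at (0, snd ch p))"
    unfolding differentiable_def by blast
  have "((\<lambda>t::real. (t *\<^sub>R axis j 1 :: real ^ 'k, snd ch p)) has_derivative (\<lambda>t. (t *\<^sub>R axis j 1, 0))) (at 0)"
    by (intro has_derivative_Pair has_derivative_const has_derivative_scaleR_left has_derivative_ident)
  from diff_chain_at[OF this, of "\<lambda>(t, x). snd ch (\<rho> t (chart_inv ch x))" D2]
  have "((\<lambda>t. snd ch (?\<gamma> t)) has_derivative (\<lambda>t. D2 (t *\<^sub>R axis j 1, 0))) (at 0)"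
    using D2 by (simp add: o_def chart_inv_chart[OF Ps chP])
  then have "(snd ch \<circ> ?\<gamma>) differentiable (at 0)" unfolding differentiable_def o_def by blast
  then have "((snd ch \<circ> ?\<gamma>) has_vector_derivative generator P \<rho> j p ch) (at 0)"
    unfolding generator_def velocity_def using ch \<gamma>0 by (simp add: vector_derivative_works)
  then have \<gamma>': "((\<lambda>t. snd ch (?\<gamma> t)) has_derivative (\<lambda>t. t *\<^sub>R generator P \<rho> j p ch)) (at 0)"
    by (simp add: has_vector_derivative_def o_def)
  have "((\<lambda>x. f (chart_inv ch x)) has_derivative f') (at (snd ch (?\<gamma> 0)))" using F \<gamma>0 by simp
  from diff_chain_at[OF \<gamma>' this]
  have *: "((\<lambda>t. f (chart_inv ch (snd ch (?\<gamma> t)))) has_derivative (\<lambda>t. f' (t *\<^sub>R generator P \<rho> j p ch))) (at 0)"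
    by (simp add: o_def)
  have "continuous_on UNIV (\<lambda>t::real. (\<lambda>(t, p). \<rho> t p) (t *\<^sub>R axis j 1 :: real ^ 'k, p))"
    by (rule continuous_on_compose2[OF action_continuous]) (use p in \<open>auto intro!: continuous_intros\<close>)
  then have cont: "continuous_on UNIV ?\<gamma>" by simp
  show ?thesis
  proof (rule has_derivative_transform_within_open[OF *])
    show "open (UNIV \<inter> ?\<gamma> -` fst ch)" by (rule continuous_open_preimage[OF cont open_UNIV open_chart[OF Ps chP(1)]])
    show "0 \<in> UNIV \<inter> ?\<gamma> -` fst ch" using \<gamma>0 chP by simp
    show "f (chart_inv ch (snd ch (?\<gamma> t))) = f (?\<gamma> t)" if "t \<in> UNIV \<inter> ?\<gamma> -` fst ch" for t
      using chart_inv_chart[OF Ps chP(1)] that by simp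
  qed
qed

lemma generator_tangent:
  assumes p: "p \<in> points P"
  shows "generator P \<rho> j p \<in> tangent_space P p"
proof (rule tangent_spaceI)
  show "generator P \<rho> j p c = 0" if "c \<notin> charts_at P p" for c
    using that torus_facts(3)[OF p] by (simp add: generator_def velocity_def)
  fix c c' assume c: "c \<in> charts_at P p" "c' \<in> charts_at P p"
  have d: "((\<lambda>x. snd c' (chart_inv c x)) has_derivative frechet_derivative (transition c c') (at (snd c p))) (at (snd c p))"
    using transition_has_derivative[OF Ps c] by (simp add: transition_def o_def)
  have d': "((\<lambda>x. snd c' (chart_inv c' x)) has_derivative (\<lambda>w. w)) (at (snd c' p))"
    using transition_has_derivative[OF Ps c(2) c(2)] transition_self[OF Ps c(2)] by (simp add: transition_def o_def)
  show "generator P \<rho> j p c' = frechet_derivative (transition c c') (at (snd c p)) (generator P \<rho> j p c)"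
    using fun_cong[OF has_derivative_unique[OF generator_along[OF c(2) d', of j] generator_along[OF c(1) d, of j]], of 1] by simp
qed

lemma generator_vertical:
  assumes ch: "ch \<in> charts_at P p" and d: "d \<in> charts_at M (pr p)"
  shows "frechet_derivative (ZZ ch d) (at (snd ch p)) (generator P \<rho> j p ch) = 0"
proof -
  have chP: "ch \<in> P" and dM: "d \<in> M" and p: "p \<in> points P" using charts_atD[OF ch] charts_atD[OF d] charts_at_points[OF ch] by auto
  have "((\<lambda>x. (\<lambda>y. (snd d (pr y), sP y)) (chart_inv ch x)) has_derivative frechet_derivative (ZZ ch d) (at (snd ch p))) (at (snd ch p))"
    using smooth_on_has_derivative[OF smooth_ZZ[OF chP dM] in_dom[OF ch d]] by (simp add: ZZ_def SS_def o_def)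
  from generator_along[OF ch this, of j]
  have "((\<lambda>t::real. (snd d (pr p), sP p)) has_derivative (\<lambda>t. frechet_derivative (ZZ ch d) (at (snd ch p)) (t *\<^sub>R generator P \<rho> j p ch))) (at 0)"
    using action_fibre[OF p] by (simp add: pr_def sP_def)
  from fun_cong[OF has_derivative_unique[OF this has_derivative_const], of 1] show ?thesis by simp
qed

lemma linear_th:
  assumes ch: "ch \<in> charts_at P p"
  shows "linear (th ch j (snd ch p))"
proof -
  have p: "p \<in> points P" and i: "chart_inv ch (snd ch p) = p"
    using charts_at_points[OF ch] chart_inv_chart[OF Ps] charts_atD[OF ch] by auto
  show ?thesis
    by (rule linearI) (simp_all add: th_def i tangent_of_linear[OF Ps ch] theta_linear(1)[OF p] theta_linear(2)[OF p tangent_of_in[OF Ps ch] tangent_of_in[OF Ps ch, of 0]] tangent_of_in[OF Ps ch])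
qed

lemma th_generator:
  assumes ch: "ch \<in> charts_at P p"
  shows "th ch i (snd ch p) (generator P \<rho> j p ch) = (if j = i then 1 else 0)"
proof -
  have p: "p \<in> points P" using charts_at_points[OF ch] .
  have "\<theta> i p (\<lambda>_. generator P \<rho> j p) = th ch i (snd ch p) (generator P \<rho> j p ch)"
    by (rule theta_eval[OF ch]) (rule generator_tangent[OF p])
  then show ?thesis using connection[of i] p by (simp add: connection_form_def)
qed

text \<open>By \<open>submersion\<close>, and because the connection forms are dual to the
  generators, the base derivative together with the connection forms is onto. Source and target have
  equal dimension, so it is injective.\<close>

lemma coframe_injective:
  assumes ch: "ch \<in> charts_at P p" and d: "d \<in> charts_at M (pr p)"
    and w: "frechet_derivative (ZZ ch d) (at (snd ch p)) w = 0" "\<And>j. th ch j (snd ch p) w = 0"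
  shows "w = 0"
proof -
  let ?D = "frechet_derivative (ZZ ch d) (at (snd ch p))" and ?g = "\<lambda>j. generator P \<rho> j p ch"
  let ?L = "\<lambda>w. (?D w, \<chi> j. th ch j (snd ch p) w)"
  have chP: "ch \<in> P" and dM: "d \<in> M" using charts_atD[OF ch] charts_atD[OF d] by auto
  have lD: "linear ?D" using smooth_on_has_derivative[OF smooth_ZZ[OF chP dM] in_dom[OF ch d]] by (rule has_derivative_linear)
  note lt = linear_th[OF ch]
  have L: "linear ?L"
    by (rule linearI) (simp_all add: linear_add[OF lD] linear_scale[OF lD] linear_add[OF lt] linear_scale[OF lt] vec_eq_iff)
  have surj: "surj ?L"
    unfolding surj_def
  proof
    fix zt :: "((complex ^ 2) \<times> real) \<times> (real ^ 'k)"
    obtain w0 where w0: "?D w0 = fst zt" using submersion[OF ch d] by blast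
    \<comment> \<open>A lift of the base component, corrected by vertical vectors, which alter the
      connection forms but not the projection.\<close>
    let ?w = "w0 + (\<Sum>j\<in>UNIV. (snd zt $ j - th ch j (snd ch p) w0) *\<^sub>R ?g j)"
    have "?D ?w = fst zt"
      by (simp add: linear_add[OF lD] linear_sum[OF lD] linear_scale[OF lD] generator_vertical[OF ch d] w0)
    moreover have "th ch i (snd ch p) ?w = snd zt $ i" for i
      by (simp add: linear_add[OF lt] linear_sum[OF lt] linear_scale[OF lt] th_generator[OF ch] if_distrib sum.delta cong: if_cong)
    ultimately have "zt = ?L ?w" by (simp add: prod_eq_iff vec_eq_iff)
    then show "\<exists>x. zt = ?L x" by (rule exI[of _ ?w])
  qed
  have dim: "DIM('e) = DIM(((complex ^ 2) \<times> real) \<times> (real ^ 'k))" using torus_facts(1) by simp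
  \<comment> \<open>The two spaces are of different types. A linear right inverse is injective,
    hence onto by dimension, so every \<open>w\<close> can be written as \<open>g y\<close>.\<close>
  obtain g where g: "linear g" "?L \<circ> g = id" using linear_surjective_right_inverse[OF L surj] by blast
  have Lg: "?L (g y) = y" for y using fun_cong[OF g(2), of y] by (simp only: o_apply id_apply)
  have "inj g" by (rule inj_on_inverseI[of _ ?L]) (rule Lg)
  then have "dim (range g) = DIM(((complex ^ 2) \<times> real) \<times> (real ^ 'k))"
    using dim_image_eq[OF g(1), of UNIV] by simp
  then have "dim (range g) = DIM('e)" using dim by simp
  then have "span (range g) = UNIV" using dim_eq_full by blast
  then have "range g = UNIV" using linear_subspace_image[OF g(1) subspace_UNIV] by (simp add: span_eq_iff[THEN iffD2])
  then obtain y where y: "w = g y" by blast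
  have "y = 0" using Lg[of y] w unfolding y[symmetric] by (simp add: zero_prod_def vec_eq_iff prod_eq_iff)
  then show ?thesis using y linear_0[OF g(1)] by simp
qed

end

section \<open>Adapted coframes\<close>

text \<open>Grouping along dx1, dx2, dx3 displays the triple of self-dual 2-forms in dx4, ..., dx7
  that the SU(2)-structure of the base has to match.\<close>

lemma ev_phi0:
  "phi0 (\<lambda>i. F (v i)) = ev (one (\<lambda>w. F w $ 1) * (one (\<lambda>w. F w $ 2) * one (\<lambda>w. F w $ 3)
      + (one (\<lambda>w. F w $ 4) * one (\<lambda>w. F w $ 5) + one (\<lambda>w. F w $ 6) * one (\<lambda>w. F w $ 7)))
    + one (\<lambda>w. F w $ 2) * (one (\<lambda>w. F w $ 4) * one (\<lambda>w. F w $ 6) - one (\<lambda>w. F w $ 5) * one (\<lambda>w. F w $ 7))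
    - one (\<lambda>w. F w $ 3) * (one (\<lambda>w. F w $ 4) * one (\<lambda>w. F w $ 7) + one (\<lambda>w. F w $ 5) * one (\<lambda>w. F w $ 6))) [v 0, v 1, v 2]"
  unfolding phi0_cp phi0_expand ev_simps ev_one_mult_3 ev_one_one by algebra

lemma ev_psi0:
  "psi0 (\<lambda>i. F (v i)) = ev (one (\<lambda>w. F w $ 2) * (one (\<lambda>w. F w $ 3)
      * (one (\<lambda>w. F w $ 4) * one (\<lambda>w. F w $ 5) + one (\<lambda>w. F w $ 6) * one (\<lambda>w. F w $ 7)))
    + one (\<lambda>w. F w $ 4) * (one (\<lambda>w. F w $ 5) * (one (\<lambda>w. F w $ 6) * one (\<lambda>w. F w $ 7)))
    - one (\<lambda>w. F w $ 1) * (one (\<lambda>w. F w $ 2) * (one (\<lambda>w. F w $ 4) * one (\<lambda>w. F w $ 7) + one (\<lambda>w. F w $ 5) * one (\<lambda>w. F w $ 6)))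
    - one (\<lambda>w. F w $ 1) * (one (\<lambda>w. F w $ 3) * (one (\<lambda>w. F w $ 4) * one (\<lambda>w. F w $ 6) - one (\<lambda>w. F w $ 5) * one (\<lambda>w. F w $ 7))))
    [v 0, v 1, v 2, v 3]"
  unfolding psi0_def plus_fun_def fun_diff_def dx_4_pl pl_def ev_simps ev_one_mult_4 ev_one_mult_3 ev_one_one by algebra

lemma Phi0_split:
  "Phi0 v = v 0 $ 0 * phi0 (\<lambda>i. v (Suc i)) - v 1 $ 0 * phi0 (\<lambda>i. v (if i < 1 then i else Suc i))
    + v 2 $ 0 * phi0 (\<lambda>i. v (if i < 2 then i else Suc i)) - v 3 $ 0 * phi0 (\<lambda>i. v i) + psi0 v"
  unfolding phi0_cp phi0_expand Phi0_def psi0_def plus_fun_def fun_diff_def dx_4_pl pl_def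
  by (simp add: eval_nat_numeral) algebra

lemma phi0_scale: "phi0 (\<lambda>i. k *\<^sub>R v i) = k ^ 3 * phi0 v"
  unfolding phi0_cp phi0_expand vector_scaleR_component real_scaleR_def by algebra

lemma psi0_scale: "psi0 (\<lambda>i. k *\<^sub>R v i) = k ^ 4 * psi0 v"
  unfolding psi0_def plus_fun_def fun_diff_def dx_4_pl pl_def vector_scaleR_component real_scaleR_def by algebra

text \<open>With h = r + sqrt(-1) i, the factors are the real and imaginary parts of dz1 + (p +
  sqrt(-1) q) dz2 and of - sqrt(-1) h dz2. In their complex product \<open>p\<close> and
  \<open>q\<close> drop out because dz2 would occur twice.\<close>

lemma complete_square:
  "(one t1 + p *\<^sub>R one t3 - q *\<^sub>R one t4) * (one t2 + p *\<^sub>R one t4 + q *\<^sub>R one t3)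
    = kform 1 (p\<^sup>2 + q\<^sup>2) q p (one t1) (one t2) (one t3) (one t4)"
  "(i *\<^sub>R one t3 + r *\<^sub>R one t4) * (i *\<^sub>R one t4 - r *\<^sub>R one t3) = (i\<^sup>2 + r\<^sup>2) *\<^sub>R (one t3 * one t4)"
  "(one t1 + p *\<^sub>R one t3 - q *\<^sub>R one t4) * (i *\<^sub>R one t3 + r *\<^sub>R one t4)
    - (one t2 + p *\<^sub>R one t4 + q *\<^sub>R one t3) * (i *\<^sub>R one t4 - r *\<^sub>R one t3)
    = hform i (- r) (one t1) (one t2) (one t3) (one t4)"
  "(one t1 + p *\<^sub>R one t3 - q *\<^sub>R one t4) * (i *\<^sub>R one t4 - r *\<^sub>R one t3)
    + (one t2 + p *\<^sub>R one t4 + q *\<^sub>R one t3) * (i *\<^sub>R one t3 + r *\<^sub>R one t4)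
    = - hform r i (one t1) (one t2) (one t3) (one t4)"
  unfolding kform_def hform_def
  by (simp_all add: algebra_simps power2_eq_square
    one_square[of t1] one_square[of t2] one_square[of t3] one_square[of t4] one_square_left[of t1]
    one_square_left[of t2] one_square_left[of t3] one_square_left[of t4] one_anticommute[of t2 t1]
    one_anticommute_left[of t2 t1] one_anticommute[of t3 t1] one_anticommute_left[of t3 t1]
    one_anticommute[of t3 t2] one_anticommute_left[of t3 t2] one_anticommute[of t4 t1]
    one_anticommute_left[of t4 t1] one_anticommute[of t4 t2] one_anticommute_left[of t4 t2]
    one_anticommute[of t4 t3] one_anticommute_left[of t4 t3])

lemma square_of_sum:
  "(one f * one g + one h * one k) * (one f * one g + one h * one k) = 2 *\<^sub>R (one f * (one g * (one h * one k)))"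
  by (simp add: algebra_simps scaleR_2 one_square[of f] one_square[of g] one_square[of h] one_square[of k] one_square_left[of f]
    one_square_left[of g] one_square_left[of h] one_square_left[of k] one_anticommute[of g f]
    one_anticommute_left[of g f] one_anticommute[of h f] one_anticommute_left[of h f]
    one_anticommute[of h g] one_anticommute_left[of h g] one_anticommute[of k f]
    one_anticommute_left[of k f] one_anticommute[of k g] one_anticommute_left[of k g]
    one_anticommute[of k h] one_anticommute_left[of k h])

lemma linear_image_dim:
  fixes f :: "'a::euclidean_space \<Rightarrow> 'b::euclidean_space"
  assumes f: "linear f" "inj f" and T: "range f \<subseteq> T" "subspace T" "dim T = DIM('a)"
  shows "range f = T"
  using subspace_dim_equal[OF linear_subspace_image[OF f(1) subspace_UNIV] T(2,1)] dim_image_eq[OF f(1), of UNIV] f(2) T(3)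
  by simp

lemma R7_subspace: "subspace R7" "dim R7 = 7"
proof -
  have "R7 = {x. axis 0 1 \<bullet> x = 0}" by (simp add: R7_def inner_axis' )
  then show "subspace R7" "dim R7 = 7"
    using dim_hyperplane[of "axis 0 1 :: real ^ 8"] subspace_hyperplane[of "axis 0 1 :: real ^ 8"] by (simp_all add: axis_eq_0_iff)
qed

text \<open>Completing the square in the first complex variable leaves the Hermitian determinant
  over \<open>a\<close> in front of the second one; by \<open>ma\<close> this is what the components
  6 and 7 contribute. The unsimplified right-hand side is the shape in which
  \<open>kaehler_coordinates\<close> delivers the metric after J is applied.\<close>

lemma metric_algebra:
  fixes a e f k r hr hi u x y x' y' z w z' w' :: real
  assumes "a > 0" "r > 0" and ma: "u * (hr\<^sup>2 + hi\<^sup>2) = r * (a * k - e\<^sup>2 - f\<^sup>2)"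
    and mu: "mu\<^sup>2 = r * u" and nu: "nu\<^sup>2 = r * a"
  shows "(nu * (x + f / a * z - e / a * w)) * (nu * (x' + f / a * z' - e / a * w'))
      + (nu * (y + f / a * w + e / a * z)) * (nu * (y' + f / a * w' + e / a * z'))
      + (mu / nu * (hi * z + hr * w)) * (mu / nu * (hi * z' + hr * w'))
      + (mu / nu * (hi * w - hr * z)) * (mu / nu * (hi * w' - hr * z'))
    = r * (a * (x * x' + y * y') + k * (z * z' + w * w')
      + e * (- x * w' - z * (- y') + (y * z' - w * x')) + f * (x * z' - w * (- y') - (y * (- w') - z * x')))"
proof -
  have "(mu / nu * (hi * z + hr * w)) * (mu / nu * (hi * z' + hr * w')) + (mu / nu * (hi * w - hr * z)) * (mu / nu * (hi * w' - hr * z'))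
    = (mu\<^sup>2 / nu\<^sup>2) * ((hr\<^sup>2 + hi\<^sup>2) * (z * z' + w * w'))"
  proof -
    have "(k * (hi * z + hr * w)) * (k * (hi * z' + hr * w')) + (k * (hi * w - hr * z)) * (k * (hi * w' - hr * z'))
      = k\<^sup>2 * ((hr\<^sup>2 + hi\<^sup>2) * (z * z' + w * w'))" for k by algebra
    then show ?thesis by (simp only: power_divide)
  qed
  also have "\<dots> = (u * (hr\<^sup>2 + hi\<^sup>2)) / a * (z * z' + w * w')"
    using assms(1,2) by (simp add: mu nu field_simps)
  also have "\<dots> = r * (a * k - e\<^sup>2 - f\<^sup>2) / a * (z * z' + w * w')" unfolding ma ..
  finally have 1: "(mu / nu * (hi * z + hr * w)) * (mu / nu * (hi * z' + hr * w')) + (mu / nu * (hi * w - hr * z)) * (mu / nu * (hi * w' - hr * z'))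
    = r * (a * k - e\<^sup>2 - f\<^sup>2) / a * (z * z' + w * w')" .
  have 2: "(nu * (x + f / a * z - e / a * w)) * (nu * (x' + f / a * z' - e / a * w'))
      + (nu * (y + f / a * w + e / a * z)) * (nu * (y' + f / a * w' + e / a * z'))
    = nu\<^sup>2 * ((x + f / a * z - e / a * w) * (x' + f / a * z' - e / a * w') + (y + f / a * w + e / a * z) * (y' + f / a * w' + e / a * z'))"
    by algebra
  show ?thesis
    unfolding add.assoc 1 unfolding add.assoc[symmetric] 2 nu
    using assms(1) by (simp add: field_simps power2_eq_square)
qed

context chart_point
begin

abbreviation "ka0 \<equiv> ka d z0"
abbreviation "kd0 \<equiv> kd d z0"
abbreviation "ke0 \<equiv> ke d z0"
abbreviation "kf0 \<equiv> kf d z0"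
abbreviation "hr0 \<equiv> hr d (snd d m0)"
abbreviation "hi0 \<equiv> hi d (snd d m0)"
abbreviation "u0 \<equiv> u s0 m0"
definition "r0 = s0 * (s0 + c) / of_int A"
definition "mu = sqrt (r0 * u0)"
definition "nu = sqrt (r0 * ka0)"
abbreviation "gz \<equiv> frechet_derivative (GG ch d) (at X0)"

lemma positive: "s0 > 0" "(s0 + c) / of_int A > 0" "s0 + c \<noteq> 0" "of_int A \<noteq> (0::real)" "r0 > 0" "u0 > 0" "ka0 > 0" "mu > 0" "nu > 0"
  "mu\<^sup>2 = r0 * u0" "nu\<^sup>2 = r0 * ka0"
proof -
  show s: "s0 > 0" "(s0 + c) / of_int A > 0" "u0 > 0" using I(2,3) u(2) m0 by auto
  show A': "of_int A \<noteq> (0::real)" using A by simp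
  show "s0 + c \<noteq> 0" using s(2) by auto
  have "r0 = s0 * ((s0 + c) / of_int A)" by (simp add: r0_def)
  then show r: "r0 > 0" using s(1,2) by (simp only: mult_pos_pos)
  show k: "ka0 > 0" using coefficients_positive(1)[OF d(1) m0(2)] by (simp add: z0(1))
  show "mu > 0" "nu > 0" unfolding mu_def nu_def using r k s(3) by simp_all
  show "mu\<^sup>2 = r0 * u0" "nu\<^sup>2 = r0 * ka0" unfolding mu_def nu_def using r k s(3) by simp_all
qed

lemma ma0: "u0 * (hr0\<^sup>2 + hi0\<^sup>2) = r0 * (ka0 * kd0 - ke0\<^sup>2 - kf0\<^sup>2)"
  using monge_ampere[OF d(1) m0(2)] by (simp add: z0(1) r0_def)

text \<open>Positivity of the Kaehler form on the vector killed by the first unitary coframe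
  element, with second coordinate 1, makes the Hermitian determinant positive; \<open>ma0\<close>
  with positive \<open>u\<close> and \<open>r\<close> passes this on to |h|^2.\<close>

lemma h_nonzero: "hr0\<^sup>2 + hi0\<^sup>2 \<noteq> 0"
proof -
  define w :: "complex ^ 2" where "w = (\<chi> i. if i = 1 then Complex (- kf0 / ka0) (- ke0 / ka0) else 1)"
  have w: "w $ 1 = Complex (- kf0 / ka0) (- ke0 / ka0)" "w $ 2 = 1" by (simp_all add: w_def)
  have "tangent_of M d m0 w \<noteq> 0"
    using tangent_of_apply[OF Ms d(1), of w] w(2) by (metis zero_fun_apply zero_index zero_neq_one)
  then have "\<omega>1 s0 m0 (vec2 (tangent_of M d m0 w) (tangent_of M d m0 (\<i> *s w))) > 0"
    using kaehler(2) m0 tangent_of_in[OF Ms d(1)] J_tangent_of[OF d(1)]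
    unfolding kaehler_form_def by metis
  then have "ka0 * ((kf0 / ka0)\<^sup>2 + (ke0 / ka0)\<^sup>2) + kd0 - 2 * ke0 * (ke0 / ka0) - 2 * kf0 * (kf0 / ka0) > 0"
    unfolding kaehler_coordinates[OF d(1) m0(2)] by (simp add: w z0(1) power2_eq_square algebra_simps)
  then have "ka0 * (ka0 * ((kf0 / ka0)\<^sup>2 + (ke0 / ka0)\<^sup>2) + kd0 - 2 * ke0 * (ke0 / ka0) - 2 * kf0 * (kf0 / ka0)) > 0"
    using positive(7) by simp
  moreover have "ka0 * (ka0 * ((kf0 / ka0)\<^sup>2 + (ke0 / ka0)\<^sup>2) + kd0 - 2 * ke0 * (ke0 / ka0) - 2 * kf0 * (kf0 / ka0)) = ka0 * kd0 - ke0\<^sup>2 - kf0\<^sup>2"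
    using positive(7) by (simp add: field_simps power2_eq_square)
  ultimately have "r0 * (ka0 * kd0 - ke0\<^sup>2 - kf0\<^sup>2) > 0" using positive(5) by simp
  then show ?thesis using ma0 positive(6) by auto
qed

text \<open>The coframe in which \<open>s \<phi>\<close> takes the standard form. Its last four components are
  \<open>\<nu> (dz\<^sub>1 + (f + i e) / a dz\<^sub>2)\<close> and \<open>- i \<mu> h / \<nu> dz\<^sub>2\<close>, a unitary coframe for \<open>r \<omega>\<^sub>1\<close> whose
  complex volume form is \<open>- i \<mu> h dz\<^sub>1 dz\<^sub>2\<close>.\<close>
definition FR :: "('c \<Rightarrow> real) \<Rightarrow> 'c \<Rightarrow> real ^ 8" where
  "FR e w = (\<chi> i. if i = 0 then e w else if i = 1 then of_int A / (s0 + c) * th ch ix X0 w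
    else if i = 2 then mu / of_int A * frechet_derivative (SS ch) (at X0) w
    else if i = 3 then r0 / mu * th ch ia X0 w
    else if i = 4 then nu * (x1 (gz w) + kf0 / ka0 * x2 (gz w) - ke0 / ka0 * y2 (gz w))
    else if i = 5 then nu * (y1 (gz w) + kf0 / ka0 * y2 (gz w) + ke0 / ka0 * x2 (gz w))
    else if i = 6 then mu / nu * (hi0 * x2 (gz w) + hr0 * y2 (gz w))
    else mu / nu * (hi0 * y2 (gz w) - hr0 * x2 (gz w)))"

lemma FR_nth: "FR e w $ 0 = e w" "FR e w $ 1 = of_int A / (s0 + c) * th ch ix X0 w"
  "FR e w $ 2 = mu / of_int A * frechet_derivative (SS ch) (at X0) w" "FR e w $ 3 = r0 / mu * th ch ia X0 w"
  "FR e w $ 4 = nu * (x1 (gz w) + kf0 / ka0 * x2 (gz w) - ke0 / ka0 * y2 (gz w))"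
  "FR e w $ 5 = nu * (y1 (gz w) + kf0 / ka0 * y2 (gz w) + ke0 / ka0 * x2 (gz w))"
  "FR e w $ 6 = mu / nu * (hi0 * x2 (gz w) + hr0 * y2 (gz w))"
  "FR e w $ 7 = mu / nu * (hi0 * y2 (gz w) - hr0 * x2 (gz w))"
  by (simp_all add: FR_def)

lemma FR_one:
  "one (\<lambda>w. FR e w $ 1) = (of_int A / (s0 + c)) *\<^sub>R XI ch ix X0"
  "one (\<lambda>w. FR e w $ 2) = (mu / of_int A) *\<^sub>R DS ch X0" "one (\<lambda>w. FR e w $ 3) = (r0 / mu) *\<^sub>R XI ch ia X0"
  "one (\<lambda>w. FR e w $ 4) = nu *\<^sub>R (t1 ch d X0 + (kf0 / ka0) *\<^sub>R t3 ch d X0 - (ke0 / ka0) *\<^sub>R t4 ch d X0)"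
  "one (\<lambda>w. FR e w $ 5) = nu *\<^sub>R (t2 ch d X0 + (kf0 / ka0) *\<^sub>R t4 ch d X0 + (ke0 / ka0) *\<^sub>R t3 ch d X0)"
  "one (\<lambda>w. FR e w $ 6) = (mu / nu) *\<^sub>R (hi0 *\<^sub>R t3 ch d X0 + hr0 *\<^sub>R t4 ch d X0)"
  "one (\<lambda>w. FR e w $ 7) = (mu / nu) *\<^sub>R (hi0 *\<^sub>R t4 ch d X0 - hr0 *\<^sub>R t3 ch d X0)"
  unfolding FR_nth t_one[OF ch(2) d(2) X0] XI_def DS_def dfun_def one_add one_diff one_scale by (rule refl)+

text \<open>The coframe is built for these identities: r times the Kaehler form and mu times the two
  parts of the (2,0)-form take the places of the model triple displayed in \<open>ev_phi0\<close>,
  up to sign.\<close>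

lemma FR_two:
  "one (\<lambda>w. FR e w $ 4) * one (\<lambda>w. FR e w $ 5) + one (\<lambda>w. FR e w $ 6) * one (\<lambda>w. FR e w $ 7) = r0 *\<^sub>R W1 ch d X0"
  "one (\<lambda>w. FR e w $ 4) * one (\<lambda>w. FR e w $ 6) - one (\<lambda>w. FR e w $ 5) * one (\<lambda>w. FR e w $ 7) = mu *\<^sub>R W3 ch d X0"
  "one (\<lambda>w. FR e w $ 4) * one (\<lambda>w. FR e w $ 7) + one (\<lambda>w. FR e w $ 5) * one (\<lambda>w. FR e w $ 6) = - (mu *\<^sub>R W2 ch d X0)"
proof -
  obtain f1 f2 f3 f4 where f: "t1 ch d X0 = one f1" "t2 ch d X0 = one f2" "t3 ch d X0 = one f3" "t4 ch d X0 = one f4"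
    using t_dfun by meson
  have n: "nu * (mu / nu) = mu" "mu / nu * nu = mu" "nu * nu = r0 * ka0" using positive by (simp_all add: power2_eq_square)
  \<comment> \<open>The Monge-Ampere equation turns the coefficient from components 6 and 7 into the
    determinant term left over by completing the square.\<close>
  have m: "mu / nu * (mu / nu * (hi0\<^sup>2 + hr0\<^sup>2)) = r0 * ((ka0 * kd0 - ke0\<^sup>2 - kf0\<^sup>2) / ka0)"
  proof -
    have "mu / nu * (mu / nu * (hi0\<^sup>2 + hr0\<^sup>2)) = (mu\<^sup>2 / nu\<^sup>2) * (hr0\<^sup>2 + hi0\<^sup>2)"
      by (simp add: power2_eq_square add.commute)
    also have "\<dots> = u0 * (hr0\<^sup>2 + hi0\<^sup>2) / ka0"
      unfolding positive(10,11) using positive(5,7) by simp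
    finally show ?thesis unfolding ma0 by simp
  qed
  show "one (\<lambda>w. FR e w $ 4) * one (\<lambda>w. FR e w $ 5) + one (\<lambda>w. FR e w $ 6) * one (\<lambda>w. FR e w $ 7) = r0 *\<^sub>R W1 ch d X0"
  proof -
    have "one (\<lambda>w. FR e w $ 4) * one (\<lambda>w. FR e w $ 5) + one (\<lambda>w. FR e w $ 6) * one (\<lambda>w. FR e w $ 7)
      = (r0 * ka0) *\<^sub>R kform 1 ((kf0 / ka0)\<^sup>2 + (ke0 / ka0)\<^sup>2) (ke0 / ka0) (kf0 / ka0) (one f1) (one f2) (one f3) (one f4)
        + (r0 * ((ka0 * kd0 - ke0\<^sup>2 - kf0\<^sup>2) / ka0)) *\<^sub>R (one f3 * one f4)"
      unfolding FR_one f mult_scaleR_left mult_scaleR_right scaleR_scaleR complete_square n m ..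
    also have "\<dots> = r0 *\<^sub>R (ka0 *\<^sub>R kform 1 ((kf0 / ka0)\<^sup>2 + (ke0 / ka0)\<^sup>2) (ke0 / ka0) (kf0 / ka0) (one f1) (one f2) (one f3) (one f4)
        + ((ka0 * kd0 - ke0\<^sup>2 - kf0\<^sup>2) / ka0) *\<^sub>R (one f3 * one f4))"
      by (simp only: scaleR_right_distrib scaleR_scaleR)
    also have "ka0 *\<^sub>R kform 1 ((kf0 / ka0)\<^sup>2 + (ke0 / ka0)\<^sup>2) (ke0 / ka0) (kf0 / ka0) (one f1) (one f2) (one f3) (one f4)
        + ((ka0 * kd0 - ke0\<^sup>2 - kf0\<^sup>2) / ka0) *\<^sub>R (one f3 * one f4)
      = kform ka0 (ka0 * ((kf0 / ka0)\<^sup>2 + (ke0 / ka0)\<^sup>2) + (ka0 * kd0 - ke0\<^sup>2 - kf0\<^sup>2) / ka0) (ka0 * (ke0 / ka0)) (ka0 * (kf0 / ka0)) (one f1) (one f2) (one f3) (one f4)"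
      unfolding kform_def by (simp only: scaleR_right_distrib scaleR_left_distrib scaleR_scaleR mult_1_right distrib_left add_ac)
    also have "\<dots> = W1 ch d X0"
    proof -
      have "ka0 * ((kf0 / ka0)\<^sup>2 + (ke0 / ka0)\<^sup>2) + (ka0 * kd0 - ke0\<^sup>2 - kf0\<^sup>2) / ka0 = kd0"
        "ka0 * (ke0 / ka0) = ke0" "ka0 * (kf0 / ka0) = kf0"
        using positive(7) by (simp_all add: field_simps power2_eq_square)
      then show ?thesis unfolding W1_def f by (simp only:)
    qed
    finally show ?thesis .
  qed
  show "one (\<lambda>w. FR e w $ 4) * one (\<lambda>w. FR e w $ 6) - one (\<lambda>w. FR e w $ 5) * one (\<lambda>w. FR e w $ 7) = mu *\<^sub>R W3 ch d X0"
    unfolding FR_one f mult_scaleR_left mult_scaleR_right scaleR_scaleR n scaleR_right_diff_distrib[symmetric] complete_square W3_def z0(2) ..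
  show "one (\<lambda>w. FR e w $ 4) * one (\<lambda>w. FR e w $ 7) + one (\<lambda>w. FR e w $ 5) * one (\<lambda>w. FR e w $ 6) = - (mu *\<^sub>R W2 ch d X0)"
    unfolding FR_one f mult_scaleR_left mult_scaleR_right scaleR_scaleR n scaleR_right_distrib[symmetric] complete_square W2_def z0(2) by simp
qed

lemma coefficient_identities:
  "of_int A / (s0 + c) * r0 = s0" "mu / of_int A * (r0 / mu) = r0 / of_int A"
  "mu / of_int A * mu = s0 * (u0 * (s0 + c) / (of_int A)\<^sup>2)" "r0 / mu * mu = s0 * ((s0 + c) / of_int A)"
  "r0 / of_int A * r0 = s0\<^sup>2 * (s0 + c)\<^sup>2 / (of_int A) ^ 3" "r0 * r0 / 2 = s0\<^sup>2 * (s0 + c)\<^sup>2 / (2 * (of_int A)\<^sup>2)"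
  "of_int A / (s0 + c) * (mu / of_int A * mu) = s0 * u0 / of_int A" "of_int A / (s0 + c) * (r0 / mu * mu) = s0"
proof -
  have mm: "mu * mu = r0 * u0" using positive(10) by (simp add: power2_eq_square)
  have e: "mu / of_int A * mu = (mu * mu) / of_int A" by simp
  define S where "S = s0 + c"
  have r: "r0 = s0 * S / of_int A" and S: "S \<noteq> 0" using positive(3) by (simp_all add: r0_def S_def)
  show "of_int A / (s0 + c) * r0 = s0" "mu / of_int A * (r0 / mu) = r0 / of_int A"
    "mu / of_int A * mu = s0 * (u0 * (s0 + c) / (of_int A)\<^sup>2)" "r0 / mu * mu = s0 * ((s0 + c) / of_int A)"
    "r0 / of_int A * r0 = s0\<^sup>2 * (s0 + c)\<^sup>2 / (of_int A) ^ 3" "r0 * r0 / 2 = s0\<^sup>2 * (s0 + c)\<^sup>2 / (2 * (of_int A)\<^sup>2)"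
    "of_int A / (s0 + c) * (mu / of_int A * mu) = s0 * u0 / of_int A" "of_int A / (s0 + c) * (r0 / mu * mu) = s0"
    unfolding e mm S_def[symmetric] using positive(4,8) A S by (simp_all add: r field_simps power2_eq_square power3_eq_cube)
qed

lemma phi0_FR: "phi0 (\<lambda>i. FR e (v i)) = s0 * ev (PHI ch d X0) [v 0, v 1, v 2]"
proof -
  let ?X = "XI ch ix X0" and ?L = "XI ch ia X0" and ?T = "DS ch X0"
  note C = coefficient_identities
  have h1: "((of_int A / (s0 + c)) *\<^sub>R ?X) * (((mu / of_int A) *\<^sub>R ?T) * ((r0 / mu) *\<^sub>R ?L) + r0 *\<^sub>R W1 ch d X0)
      = (of_int A / (s0 + c) * r0) *\<^sub>R (?X * (W1 ch d X0 + (1 / of_int A) *\<^sub>R (?T * ?L)))"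
    unfolding mult_scaleR_left mult_scaleR_right scaleR_scaleR C(2) using positive(3,8) A by (simp add: distrib_left scaleR_right_distrib add.commute)
  have h2: "((mu / of_int A) *\<^sub>R ?T) * (mu *\<^sub>R W3 ch d X0) = (mu / of_int A * mu) *\<^sub>R (W3 ch d X0 * ?T)"
    unfolding mult_scaleR_left mult_scaleR_right scaleR_scaleR central_W(3)[of ?T] by (simp only: mult.commute)
  have h3: "((r0 / mu) *\<^sub>R ?L) * (- (mu *\<^sub>R W2 ch d X0)) = - ((r0 / mu * mu) *\<^sub>R (W2 ch d X0 * ?L))"
    unfolding mult_scaleR_left mult_minus_right mult_scaleR_right scaleR_scaleR central_W(2)[of ?L] by (simp only: scaleR_minus_right scaleR_scaleR mult.commute)
  show ?thesis
    unfolding ev_phi0 FR_two unfolding FR_one h1 h2 h3 PHI_def z0(3) uu_z0 C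
    by (simp only: ev_simps distrib_left diff_minus_eq_add mult.assoc add_ac)
qed

lemma psi0_FR: "psi0 (\<lambda>i. FR e (v i)) = ev (PSI ch d X0) [v 0, v 1, v 2, v 3]"
proof -
  let ?X = "XI ch ix X0" and ?L = "XI ch ia X0" and ?T = "DS ch X0"
  let ?E = "\<lambda>i. one (\<lambda>w. FR e w $ i)"
  note C = coefficient_identities
  have h1: "((mu / of_int A) *\<^sub>R ?T) * (((r0 / mu) *\<^sub>R ?L) * (r0 *\<^sub>R W1 ch d X0)) = (mu / of_int A * (r0 / mu) * r0) *\<^sub>R (?T * (?L * W1 ch d X0))"
    unfolding mult_scaleR_left mult_scaleR_right scaleR_scaleR by (simp only: mult_ac)
  \<comment> \<open>The square of the first 2-form of the triple is twice the volume form of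
    components 4 to 7, which is thereby expressed through the square of \<open>W1\<close>.\<close>
  have "2 *\<^sub>R (?E 4 * (?E 5 * (?E 6 * ?E 7))) = (r0 * r0) *\<^sub>R (W1 ch d X0 * W1 ch d X0)"
    unfolding square_of_sum[symmetric] FR_two mult_scaleR_left mult_scaleR_right scaleR_scaleR ..
  then have "(1 / 2) *\<^sub>R (2 *\<^sub>R (?E 4 * (?E 5 * (?E 6 * ?E 7)))) = (1 / 2) *\<^sub>R ((r0 * r0) *\<^sub>R (W1 ch d X0 * W1 ch d X0))" by (rule arg_cong)
  then have h2: "?E 4 * (?E 5 * (?E 6 * ?E 7)) = (r0 * r0 / 2) *\<^sub>R (W1 ch d X0 * W1 ch d X0)" by simp
  have h3: "((of_int A / (s0 + c)) *\<^sub>R ?X) * (((mu / of_int A) *\<^sub>R ?T) * (- (mu *\<^sub>R W2 ch d X0)))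
      = - ((of_int A / (s0 + c) * (mu / of_int A * mu)) *\<^sub>R (?X * (?T * W2 ch d X0)))"
    unfolding mult_scaleR_left mult_minus_right mult_scaleR_right scaleR_minus_right scaleR_scaleR by (simp only: mult_ac)
  have h4: "((of_int A / (s0 + c)) *\<^sub>R ?X) * (((r0 / mu) *\<^sub>R ?L) * (mu *\<^sub>R W3 ch d X0))
      = (of_int A / (s0 + c) * (r0 / mu * mu)) *\<^sub>R (?X * (?L * W3 ch d X0))"
    unfolding mult_scaleR_left mult_scaleR_right scaleR_scaleR by (simp only: mult_ac)
  show ?thesis
    unfolding ev_psi0 FR_two h2 unfolding FR_one(1-3) h1 h3 h4 PSI_def z0(3) uu_z0 C(7,8) unfolding C(2) unfolding C(5,6)
    by (simp only: ev_simps diff_minus_eq_add)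
qed

lemma FR_linear: "linear e \<Longrightarrow> linear (FR e)"
proof -
  assume e: "linear e"
  have g: "linear gz" "linear (frechet_derivative (SS ch) (at X0))"
    using smooth_on_has_derivative[OF smooth_GG[OF ch(2) d(2)] X0] smooth_on_has_derivative[OF smooth_SS[OF ch(2) d(2)] X0]
    by (auto intro: has_derivative_linear)
  note t = linear_th[OF ch(1), folded X0_def]
  show "linear (FR e)"
    by (rule linearI; rule vec_eq_8I)
      (simp_all add: FR_nth linear_add[OF e] linear_scale[OF e] linear_add[OF g(1)] linear_scale[OF g(1)] linear_add[OF g(2)] linear_scale[OF g(2)]
        linear_add[OF t] linear_scale[OF t] algebra_simps)
qed

text \<open>The vanishing of all connection forms is a hypothesis because it depends on the bundle:
  on L components 1 and 3 give it, on N component 0 supplies eta.\<close>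

lemma FR_inj:
  assumes e: "linear e" and j: "\<And>w j. FR e w = 0 \<Longrightarrow> th ch j X0 w = 0"
  shows "inj (FR e)"
  unfolding linear_injective_0[OF FR_linear[OF e]]
proof (intro allI impI)
  fix w assume w: "FR e w = 0"
  have n: "FR e w $ i = 0" for i using w by simp
  have p: "mu / of_int A \<noteq> 0" "nu \<noteq> 0" "mu / nu \<noteq> 0" using positive by auto
  have s: "frechet_derivative (SS ch) (at X0) w = 0" using n[of 2] p(1) by (simp only: FR_nth mult_eq_0_iff simp_thms)
  have 6: "hi0 * x2 (gz w) + hr0 * y2 (gz w) = 0" "hi0 * y2 (gz w) - hr0 * x2 (gz w) = 0"
    using n[of 6] n[of 7] p(3) by (simp_all only: FR_nth mult_eq_0_iff simp_thms)
  \<comment> \<open>The two equations are a linear system for the parts of the second coordinate,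
    with determinant |h|^2.\<close>
  have "(hr0\<^sup>2 + hi0\<^sup>2) * x2 (gz w) = 0" "(hr0\<^sup>2 + hi0\<^sup>2) * y2 (gz w) = 0" using 6 by algebra+
  then have z2: "x2 (gz w) = 0" "y2 (gz w) = 0" using h_nonzero by (simp_all only: mult_eq_0_iff simp_thms)
  have z1: "x1 (gz w) = 0" "y1 (gz w) = 0"
    using n[of 4] n[of 5] p(2) by (simp_all add: FR_nth z2)
  have "gz w = 0" using z1 z2 by (simp add: vec_eq_iff forall_2 complex_eq_iff)
  then have "frechet_derivative (ZZ ch d) (at X0) w = 0"
    unfolding ZZ_derivative[OF ch(2) d(2) X0] s by (simp add: zero_prod_def)
  then show "w = 0" using coframe_injective[OF ch(1) d(1)] j[OF w] by (simp only: X0_def)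
qed

lemma FR_metric:
  assumes v: "v \<in> tangent_space P p" "w \<in> tangent_space P p"
  shows "FR e (v ch) \<bullet> FR e (w ch) = e (v ch) * e (w ch)
    + (of_int A)\<^sup>2 / (s0 + c)\<^sup>2 * (\<theta> ix p (\<lambda>_. v) * \<theta> ix p (\<lambda>_. w))
    + s0 * (s0 + c) / (of_int A * u0) * (\<theta> ia p (\<lambda>_. v) * \<theta> ia p (\<lambda>_. w))
    + s0 * (s0 + c) * u0 / (of_int A) ^ 3 * (pullback P B \<pi> ds p (\<lambda>_. v) * pullback P B \<pi> ds p (\<lambda>_. w))
    + s0 * (s0 + c) / of_int A * kaehler_metric (\<omega>1 s0) m0 (\<tau> p v) (\<tau> p w)"
proof -
  have th: "\<theta> j p (\<lambda>_. v) = th ch j X0 (v ch)" if "v \<in> tangent_space P p" for j v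
    using theta_eval[OF ch(1), of "\<lambda>_. v"] that by (simp add: X0_def)
  have dse: "pullback P B \<pi> ds p (\<lambda>_. v) = frechet_derivative (SS ch) (at X0) (v ch)" if "v \<in> tangent_space P p" for v
    using ds_pi[OF ch(1) that, of "\<lambda>_. dmap P B \<pi> p v"] by (simp add: X0_def pullback_def)
  have t: "\<tau> p v = tangent_of M d m0 (gz (v ch))" if "v \<in> tangent_space P p" for v
    using tau_chart[OF ch(1) d(1) that] by (simp add: X0_def)
  have k: "kaehler_metric (\<omega>1 s0) m0 (\<tau> p v) (\<tau> p w) = ka0 * (x1 (gz (v ch)) * x1 (gz (w ch)) + y1 (gz (v ch)) * y1 (gz (w ch)))
      + kd0 * (x2 (gz (v ch)) * x2 (gz (w ch)) + y2 (gz (v ch)) * y2 (gz (w ch)))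
      + ke0 * (- x1 (gz (v ch)) * y2 (gz (w ch)) - x2 (gz (v ch)) * (- y1 (gz (w ch))) + (y1 (gz (v ch)) * x2 (gz (w ch)) - y2 (gz (v ch)) * x1 (gz (w ch))))
      + kf0 * (x1 (gz (v ch)) * x2 (gz (w ch)) - y2 (gz (v ch)) * (- y1 (gz (w ch))) - (y1 (gz (v ch)) * (- y2 (gz (w ch))) - x2 (gz (v ch)) * x1 (gz (w ch))))"
    unfolding kaehler_metric_def t[OF v(1)] t[OF v(2)] J_tangent_of[OF d(1)] kaehler_coordinates[OF d(1) m0(2)] z0(1)
    by simp
  note mm = metric_algebra[OF positive(7,5) ma0 positive(10,11)]
  have c: "(of_int A / (s0 + c) * a) * (of_int A / (s0 + c) * b) = (of_int A)\<^sup>2 / (s0 + c)\<^sup>2 * (a * b)"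
    "(mu / of_int A * a) * (mu / of_int A * b) = s0 * (s0 + c) * u0 / (of_int A) ^ 3 * (a * b)"
    "(r0 / mu * a) * (r0 / mu * b) = s0 * (s0 + c) / (of_int A * u0) * (a * b)" for a b
  proof -
    show "(of_int A / (s0 + c) * a) * (of_int A / (s0 + c) * b) = (of_int A)\<^sup>2 / (s0 + c)\<^sup>2 * (a * b)"
      by (simp add: power2_eq_square)
    have "(mu / of_int A * a) * (mu / of_int A * b) = mu\<^sup>2 / (of_int A)\<^sup>2 * (a * b)" by (simp add: power2_eq_square)
    also have "\<dots> = s0 * (s0 + c) * u0 / (of_int A) ^ 3 * (a * b)"
      unfolding positive(10) by (simp add: r0_def power2_eq_square power3_eq_cube)
    finally show "(mu / of_int A * a) * (mu / of_int A * b) = s0 * (s0 + c) * u0 / (of_int A) ^ 3 * (a * b)" .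
    have "(r0 / mu * a) * (r0 / mu * b) = r0\<^sup>2 / mu\<^sup>2 * (a * b)" by (simp add: power2_eq_square)
    also have "\<dots> = r0 / u0 * (a * b)" unfolding positive(10) using positive(5) by (simp add: power2_eq_square)
    finally show "(r0 / mu * a) * (r0 / mu * b) = s0 * (s0 + c) / (of_int A * u0) * (a * b)" by (simp add: r0_def)
  qed
  have reorder: "p' + q + r + s = K \<Longrightarrow> e' + a + b + g + p' + q + r + s = e' + a + g + b + K" for p' q r s K e' a b g :: real
    by linarith
  show ?thesis
    unfolding inner_8 FR_nth c th[OF v(1)] th[OF v(2)] dse[OF v(1)] dse[OF v(2)] r0_def[symmetric] k
    by (rule reorder) (rule mm)
qed

end

section \<open>The two structures\<close>

lemma dx_cong: "(\<And>i. i < length is \<Longrightarrow> v i = v' i) \<Longrightarrow> dx is v = dx is v'"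
  unfolding dx_def
proof (intro sum.cong refl arg_cong2[where f = "(*)"] prod.cong)
  fix \<sigma> j assume eq: "\<And>i. i < length is \<Longrightarrow> v i = v' i" and \<sigma>: "\<sigma> \<in> {\<sigma>. \<sigma> permutes {..<length is}}" and j: "j \<in> {..<length is}"
  have "\<sigma> j < length is" using permutes_in_image[of \<sigma> "{..<length is}" j] \<sigma> j by simp
  then show "v (\<sigma> j) $ (is ! j) = v' (\<sigma> j) $ (is ! j)" using eq by simp
qed

lemma alt_wedge_cong:
  assumes a: "\<And>w w'. (\<forall>i<k. w i = w' i) \<Longrightarrow> a w = a w'" and b: "\<And>w w'. (\<forall>i<l. w i = w' i) \<Longrightarrow> b w = b w'"
    and v: "\<forall>i<k + l. v i = v' i"
  shows "alt_wedge k l a b v = alt_wedge k l a b v'"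
  unfolding alt_wedge_def
proof (intro arg_cong2[where f = "(/)"] refl sum.cong arg_cong2[where f = "(*)"])
  fix \<sigma> assume "\<sigma> \<in> {\<sigma>. \<sigma> permutes {..<k + l}}"
  then have m: "\<sigma> j < k + l" if "j < k + l" for j using permutes_in_image[of \<sigma> "{..<k + l}" j] that by simp
  show "a (\<lambda>j. v (\<sigma> j)) = a (\<lambda>j. v' (\<sigma> j))" by (rule a) (use v m in simp)
  show "b (\<lambda>j. v (\<sigma> (k + j))) = b (\<lambda>j. v' (\<sigma> (k + j)))" by (rule b) (use v m in simp)
qed

lemma g2_star_cong:
  assumes "\<forall>i<4. v i = v' i"
  shows "g2_star T \<phi> 3 \<beta> v = g2_star T \<phi> 3 \<beta> v'"
  unfolding g2_star_def Let_def hodge_star_def vol7_def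
  by (intro arg_cong2[where f = "(/)"] refl sum.cong arg_cong2[where f = "(*)"] dx_cong) (use assms in auto)

text \<open>\<open>phi_eval\<close> speaks about tangent vectors, but
  \<open>alternating_form\<close> wants this for arbitrary sequences; it is therefore derived from
  the constituents of \<open>phi\<close>.\<close>

lemma (in torus_bundle) phi_cong:
  assumes p: "p \<in> points P" and v: "\<forall>i<3. v i = v' i"
  shows "phi p v = phi p v'"
proof -
  let ?W1 = "pullback P B \<pi> (family_form M I \<omega>1)" and ?W2 = "pullback P B \<pi> (pullback B M fst \<omega>2)"
    and ?W3 = "pullback P B \<pi> (pullback B M fst \<omega>3)" and ?T = "pullback P B \<pi> ds"
  let ?S = "\<lambda>w. ?W1 p w + (1 / of_int A) *\<^sub>R alt_wedge 1 1 (?T p) (\<theta> ia p) w"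
  have th: "\<theta> j p w = \<theta> j p w'" if "\<forall>i<1. w i = w' i" for j w w'
    by (rule theta_1[OF p]) (use that in simp)
  have T: "?T p w = ?T p w'" if "\<forall>i<1. w i = w' i" for w w'
    using that unfolding pullback_def ds ext_d_def Let_def fun_form_def by simp
  have W1: "?W1 p w = ?W1 p w'" if "\<forall>i<2. w i = w' i" for w w'
    unfolding pullback_def family_form_def proj_pi
    by (rule alternating_form_cong[OF alternating_kaehler[OF in_base[OF p]]]) (use that in simp)
  have W2: "?W2 p w = ?W2 p w'" if "\<forall>i<2. w i = w' i" for w w'
    unfolding pullback_def proj_pi
    by (rule alternating_form_cong[OF smooth_formD1[OF form23(1) in_base(2)[OF p]]]) (use that in simp)
  have W3: "?W3 p w = ?W3 p w'" if "\<forall>i<2. w i = w' i" for w w'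
    unfolding pullback_def proj_pi
    by (rule alternating_form_cong[OF smooth_formD1[OF form23(2) in_base(2)[OF p]]]) (use that in simp)
  have TA: "alt_wedge 1 1 (?T p) (\<theta> ia p) w = alt_wedge 1 1 (?T p) (\<theta> ia p) w'" if "\<forall>i<2. w i = w' i" for w w'
    by (rule alt_wedge_cong, erule T, erule th) (use that in simp)
  have S: "?S w = ?S w'" if "\<forall>i<2. w i = w' i" for w w'
    by (simp only: W1[OF that] TA[OF that])
  have e: "phi p v = alt_wedge 1 2 (\<theta> ix p) ?S v + ((sP p + c) / of_int A) *\<^sub>R alt_wedge 2 1 (?W2 p) (\<theta> ia p) v
      + (u (sP p) (pr p) * (sP p + c) / (of_int A)\<^sup>2) *\<^sub>R alt_wedge 2 1 (?W3 p) (?T p) v" for v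
    by (simp only: phi_def plus_fun_def fmult_def wedge_def scaleR_fun_def)
  have 1: "alt_wedge 1 2 (\<theta> ix p) ?S v = alt_wedge 1 2 (\<theta> ix p) ?S v'"
    by (rule alt_wedge_cong, erule th, erule S) (use v in simp)
  have 2: "alt_wedge 2 1 (?W2 p) (\<theta> ia p) v = alt_wedge 2 1 (?W2 p) (\<theta> ia p) v'"
    by (rule alt_wedge_cong, erule W2, erule th) (use v in simp)
  have 3: "alt_wedge 2 1 (?W3 p) (?T p) v = alt_wedge 2 1 (?W3 p) (?T p) v'"
    by (rule alt_wedge_cong, erule W3, erule T) (use v in simp)
  show ?thesis unfolding e 1 2 3 ..
qed

context chart_point
begin

lemma bij_frame:
  assumes "linear G" "inj G" "range G = R"
  shows "bij_betw (\<lambda>v. G (v ch)) (tangent_space P p) R"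
  using bij_betw_trans[OF bij_betw_tangent[OF Ps ch(1)], of G R] assms(2,3) by (simp add: bij_betw_def o_def)

lemma linear_frame: "linear G \<Longrightarrow> linear (\<lambda>v. G (v ch))"
  by (rule linearI) (simp_all add: linear_add linear_scale plus_fun_def)

text \<open>\<open>phi0\<close> is cubic, so the scaling by s^(-1/3) converts the frame of s phi
  into one of phi. Component 0 is set to 0 so that the image is \<open>R7\<close>.\<close>

lemma g2_frame_FR:
  assumes j: "\<And>j. j = ia \<or> j = ix" and k: "CARD('d) = 2"
  shows "g2_frame (tangent_space P p) (phi p) (\<lambda>v. (s0 powr (- 1 / 3)) *\<^sub>R FR (\<lambda>_. 0) (v ch))"
proof -
  let ?k = "s0 powr (- 1 / 3)"
  let ?G = "\<lambda>w. ?k *\<^sub>R FR (\<lambda>_. 0) w"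
  have k0: "?k \<noteq> 0" "?k ^ 3 = 1 / s0"
    using positive(1) by (simp_all add: powr_power powr_neg_one)
  have l0: "linear (\<lambda>_::'c. 0::real)" by (rule linearI) simp_all
  have lin: "linear ?G" using linear_compose_scale_right[OF FR_linear[OF l0]] .
  have z: "th ch j X0 w = 0" if "FR (\<lambda>_. 0) w = 0" for w j
  proof -
    have "FR (\<lambda>_. 0) w $ 1 = 0" "FR (\<lambda>_. 0) w $ 3 = 0" using that by simp_all
    then show ?thesis using j[of j] positive by (auto simp: FR_nth)
  qed
  have inj: "inj ?G" using FR_inj[OF l0 z] k0(1) by (simp add: inj_on_def)
  have "DIM('c) = 7" using torus_facts(1) k by simp
  then have ran: "range ?G = R7"
    by (intro linear_image_dim[OF lin inj _ R7_subspace(1)]) (auto simp: R7_def FR_nth R7_subspace(2)[unfolded R7_def])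
  have eq: "phi p v = phi0 ((\<lambda>v. ?k *\<^sub>R FR (\<lambda>_. 0) (v ch)) \<circ> v)" if v: "\<forall>i. v i \<in> tangent_space P p" for v
    unfolding o_def phi0_scale phi0_FR k0(2) phi_eval[OF ch(1) d(1) v] X0_def using positive(1) by simp
  show ?thesis
    unfolding g2_frame_def
    by (rule conjI[OF linear_frame[OF lin] conjI[OF bij_frame[OF lin inj ran]]], intro allI impI, erule eq)
qed

text \<open>\<open>psi0\<close> is quartic, so the scaled frame contributes s^(-4/3), which the
  prefactor cancels. As \<open>psi0\<close> does not see component 0, any \<open>e\<close> may be
  put there.\<close>

lemma g2_hodge_FR:
  assumes j: "\<And>j. j = ia \<or> j = ix" and k: "CARD('d) = 2" and v: "\<And>i. v i \<in> tangent_space P p"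
  shows "s0 powr (4 / 3) * g2_hodge P phi 3 phi p v = psi0 (\<lambda>i. FR e (v i ch))"
proof -
  have k: "s0 powr (4 / 3) * (s0 powr (- 1 / 3)) ^ 4 = 1"
    using positive(1) by (simp add: powr_power flip: powr_add)
  have "g2_hodge P phi 3 phi p v = (s0 powr (- 1 / 3)) ^ 4 * psi0 (\<lambda>i. FR (\<lambda>_. 0) (v i ch))"
    unfolding g2_hodge_def g2_star_frame[OF subspace_tangent_space[OF Ps] g2_frame_FR[OF j assms(2)] v]
    by (simp add: o_def psi0_scale)
  also have "psi0 (\<lambda>i. FR (\<lambda>_. 0) (v i ch)) = psi0 (\<lambda>i. FR e (v i ch))"
    unfolding psi0_FR ..
  finally show ?thesis using k by (simp add: mult.assoc[symmetric])
qed

text \<open>Along dx0 the model form contributes component 0 wedge s phi, so component 0 has to be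
  eta divided by s.\<close>

lemma spin7_frame_FR:
  assumes j: "\<And>j. j = ia \<or> j = ix \<or> j = ie" and k: "CARD('d) = 3"
    and r: "represents 4 \<Phi> (\<lambda>ch d x. XI ch ie x * PHI ch d x + PSI ch d x)"
  shows "spin7_frame (tangent_space P p) (\<Phi> p) (\<lambda>v. FR (\<lambda>w. 1 / s0 * th ch ie X0 w) (v ch))"
proof -
  let ?e = "\<lambda>w. 1 / s0 * th ch ie X0 w"
  note t = linear_th[OF ch(1), folded X0_def]
  have le: "linear ?e" by (rule linearI) (simp_all add: linear_add[OF t] linear_scale[OF t] distrib_left add_divide_distrib)
  note lin = FR_linear[OF le]
  have z: "th ch j X0 w = 0" if "FR ?e w = 0" for w j
  proof -
    have "FR ?e w $ 0 = 0" "FR ?e w $ 1 = 0" "FR ?e w $ 3 = 0" using that by simp_all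
    then show ?thesis using j[of j] positive by (auto simp: FR_nth)
  qed
  have inj: "inj (FR ?e)" using FR_inj[OF le z] .
  have "DIM('c) = 8" using torus_facts(1) k by simp
  then have ran: "range (FR ?e) = UNIV"
    by (intro linear_image_dim[OF lin inj]) auto
  have eq: "\<Phi> p v = Phi0 ((\<lambda>v. FR ?e (v ch)) \<circ> v)" if v: "\<forall>i. v i \<in> tangent_space P p" for v
  proof -
    have "\<Phi> p v = ev (one (th ch ie X0) * PHI ch d X0 + PSI ch d X0) [v 0 ch, v 1 ch, v 2 ch, v 3 ch]"
      using r ch(1) d(1) v unfolding represents_def map_upt_small XI_def X0_def by blast
    also have "\<dots> = Phi0 (\<lambda>i. FR ?e (v i ch))"
      unfolding Phi0_split phi0_FR psi0_FR FR_nth ev_simps ev_one_mult_4 using positive(1)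
      by (simp add: eval_nat_numeral)
    finally show ?thesis by (simp add: o_def)
  qed
  show ?thesis
    unfolding spin7_frame_def
    by (rule conjI[OF linear_frame[OF lin] conjI[OF bij_frame[OF lin inj ran]]], intro allI impI, erule eq)
qed

end

context torus_bundle
begin

lemma chart_point_at: "p \<in> points P \<Longrightarrow> chart_point M \<omega>2 \<omega>3 A c I \<omega>1 u B ds F P \<pi> \<rho> \<theta> ia ix p (some_chart P p) (some_chart M (pr p))"
  using some_chart[of p P] some_chart[of "pr p" M] in_base(2)[of p] by unfold_locales auto

lemma closed_g2_phi:
  assumes j: "\<And>j. j = ia \<or> j = ix" and k: "CARD('k) = 2"
  shows "closed_g2_structure P phi"
proof -
  have fr: "\<exists>f. g2_frame (tangent_space P p) (phi p) f" if "p \<in> points P" for p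
    by (rule exI, rule chart_point.g2_frame_FR[OF chart_point_at[OF that] j k])
  have al: "alternating_form (tangent_space P p) 3 (phi p)" if p: "p \<in> points P" for p
  proof -
    obtain f where "g2_frame (tangent_space P p) (phi p) f" using fr[OF p] by blast
    then have f: "linear f" "\<And>v. \<forall>i. v i \<in> tangent_space P p \<Longrightarrow> phi p v = phi0 (f \<circ> v)" by (simp_all add: g2_frame_def)
    show ?thesis by (rule alternating_form_phi0[OF f(1) phi_cong[OF p] subspace_tangent_space[OF Ps] f(2)])
  qed
  have "smooth_form P 3 phi"
    by (rule represents_smooth[OF represents_phi]) (erule gsmooth_PHI, assumption, erule al)
  then show ?thesis using fr closed_phi by (simp add: closed_g2_structure_def g2_structure_def)
qed

lemma torsion_free_Phi:
  assumes j: "\<And>j. j = ia \<or> j = ix \<or> j = ie" and k: "CARD('k) = 3"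
    and r: "represents 4 \<Phi> (\<lambda>ch d x. XI ch ie x * PHI ch d x + PSI ch d x)"
    and eta: "form_eq P (ext_d P 1 (\<theta> ie)) (pullback P B \<pi> (- of_int A *\<^sub>R pullback B M fst \<omega>3))"
    and cong: "\<And>p v v'. p \<in> points P \<Longrightarrow> (\<forall>i<4. v i = v' i) \<Longrightarrow> \<Phi> p v = \<Phi> p v'"
  shows "torsion_free_spin7_structure P \<Phi>"
proof -
  have fr: "\<exists>f. spin7_frame (tangent_space P p) (\<Phi> p) f" if "p \<in> points P" for p
    by (rule exI, rule chart_point.spin7_frame_FR[OF chart_point_at[OF that] j k r])
  have al: "alternating_form (tangent_space P p) 4 (\<Phi> p)" if p: "p \<in> points P" for p
  proof -
    obtain f where "spin7_frame (tangent_space P p) (\<Phi> p) f" using fr[OF p] by blast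
    then have f: "linear f" "\<And>v. \<forall>i. v i \<in> tangent_space P p \<Longrightarrow> \<Phi> p v = Phi0 (f \<circ> v)" by (simp_all add: spin7_frame_def)
    show ?thesis by (rule alternating_form_Phi0[OF f(1) cong[OF p] subspace_tangent_space[OF Ps] f(2)])
  qed
  have "smooth_form P 4 \<Phi>"
  proof (rule represents_smooth[OF r])
    fix ch d assume "ch \<in> P" "d \<in> M"
    then show "gsmooth (dom ch d) (\<lambda>x. XI ch ie x * PHI ch d x + PSI ch d x)"
      by (intro gsmooth_linear(1) gsmooth_mult gsmooth_basic(6) gsmooth_PHI gsmooth_PSI open_dom)
  qed (rule al)
  then show ?thesis using fr closed_Phi[OF r eta] by (simp add: torsion_free_spin7_structure_def spin7_structure_def)
qed

lemma spin7_metric_Phi: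
  assumes j: "\<And>j. j = ia \<or> j = ix \<or> j = ie" and k: "CARD('k) = 3"
    and r: "represents 4 \<Phi> (\<lambda>ch d x. XI ch ie x * PHI ch d x + PSI ch d x)"
    and p: "p \<in> points P" and v: "v \<in> tangent_space P p" "w \<in> tangent_space P p"
  shows "spin7_metric (tangent_space P p) (\<Phi> p) v w = 1 / (sP p)\<^sup>2 * (\<theta> ie p (\<lambda>_. v) * \<theta> ie p (\<lambda>_. w))
    + (of_int A)\<^sup>2 / (sP p + c)\<^sup>2 * (\<theta> ix p (\<lambda>_. v) * \<theta> ix p (\<lambda>_. w))
    + sP p * (sP p + c) / (of_int A * u (sP p) (pr p)) * (\<theta> ia p (\<lambda>_. v) * \<theta> ia p (\<lambda>_. w))
    + sP p * (sP p + c) * u (sP p) (pr p) / (of_int A) ^ 3 * (pullback P B \<pi> ds p (\<lambda>_. v) * pullback P B \<pi> ds p (\<lambda>_. w))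
    + sP p * (sP p + c) / of_int A * kaehler_metric (\<omega>1 (sP p)) (pr p) (\<tau> p v) (\<tau> p w)"
proof -
  interpret cp: chart_point M \<omega>2 \<omega>3 A c I \<omega>1 u B ds F P \<pi> \<rho> \<theta> ia ix p "some_chart P p" "some_chart M (pr p)"
    by (rule chart_point_at[OF p])
  have e: "\<theta> ie p (\<lambda>_. v) = th (some_chart P p) ie cp.X0 (v (some_chart P p))" if "v \<in> tangent_space P p" for v
    using theta_eval[OF cp.ch(1), of "\<lambda>_. v" ie] that by (simp add: cp.X0_def)
  have sq: "1 / s * a * (1 / s * b) = 1 / s\<^sup>2 * (a * b)" for s a b :: real by (simp add: power2_eq_square)
  show ?thesis
    unfolding spin7_metric_frame[OF subspace_tangent_space[OF Ps] cp.spin7_frame_FR[OF j k r] v] cp.FR_metric[OF v] e[OF v(1)] e[OF v(2)] sq ..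
qed

end

theorem corollary4p4:
  fixes M :: "('m::{t2_space,second_countable_topology}, complex ^ 2) chart set"
    and \<omega>2 \<omega>3 :: "('m, complex ^ 2, real) form"
    and A :: int and c :: real and I :: "real set"
    and \<omega>1 :: "real \<Rightarrow> ('m, complex ^ 2, real) form"
    and u :: "real \<Rightarrow> 'm \<Rightarrow> real"
    and B :: "('m \<times> real, (complex ^ 2) \<times> real) chart set"
    and ds F :: "('m \<times> real, (complex ^ 2) \<times> real, real) form"
    and N :: "('n::{t2_space,second_countable_topology}, real ^ 8) chart set"
    and \<pi>N :: "'n \<Rightarrow> 'm \<times> real" and \<rho>N :: "real ^ 3 \<Rightarrow> 'n \<Rightarrow> 'n"
    and \<alpha> \<xi> \<eta> :: "('n, real ^ 8, real) form"
    and L :: "('l::{t2_space,second_countable_topology}, real ^ 7) chart set"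
    and \<pi>L :: "'l \<Rightarrow> 'm \<times> real" and \<rho>L :: "real ^ 2 \<Rightarrow> 'l \<Rightarrow> 'l"
    and \<alpha>L \<xi>L :: "('l, real ^ 7, real) form"
    and q :: "'n \<Rightarrow> 'l"
    and sL uL :: "'l \<Rightarrow> real" and sN uN :: "'n \<Rightarrow> real"
    and W1 W2 W3 dsL \<phi> :: "('l, real ^ 7, real) form"
    and dsN \<Phi> :: "('n, real ^ 8, real) form"
  assumes M: "complex_surface M"
    and form23: "smooth_form M 2 \<omega>2" "smooth_form M 2 \<omega>3"
      "holomorphic_2_0_form M (complex_form \<omega>2 \<omega>3)"
      "\<forall>p\<in>points M. \<forall>v\<in>tangent_space M p. \<forall>w\<in>tangent_space M p.
         \<omega>2 p (vec2 v w) = \<omega>3 p (vec2 (J v) w)"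
    and A: "A \<noteq> 0"
    and I: "open I" "is_interval I" "I \<subseteq> {0<..}" "\<forall>s\<in>I. (s + c) / of_int A > 0"
    and B: "B = prod_atlas M (open_atlas I)"
    and kaehler: "smooth_form B 2 (family_form M I \<omega>1)" "\<forall>s\<in>I. kaehler_form M (\<omega>1 s)"
    and u: "smooth_form B 0 (fun_form (\<lambda>x. u (snd x) (fst x)))"
      "\<forall>s\<in>I. \<forall>p\<in>points M. u s p > 0"
    and eq1: "\<forall>s\<in>I. form_eq M
        ((\<lambda>p. 1 / 2 * u s p) \<cdot> (complex_form \<omega>2 \<omega>3 \<and>\<^bsub>2,2\<^esub> complex_form \<omega>2 (- \<omega>3)))
        (complex_form ((s * (s + c) / of_int A) *\<^sub>R (\<omega>1 s \<and>\<^bsub>2,2\<^esub> \<omega>1 s)) 0)"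
    and eq2: "\<forall>s\<in>I. form_eq M
        (ext_d M 1 (dc M (u s)))
        ((of_int A)\<^sup>2 *\<^sub>R family_deriv (family_deriv \<omega>1) s)"
    and ds: "ds = ext_d B 0 (fun_form snd)"
    and F: "F = - (1 / of_int A) *\<^sub>R (family_form M I (\<lambda>s. dc M (u s)) \<and>\<^bsub>1,1\<^esub> ds)
                + of_int A *\<^sub>R family_form M I (family_deriv \<omega>1)"
    and N: "principal_torus_bundle N B \<pi>N \<rho>N"
      "connection_form N \<rho>N 1 \<alpha>" "connection_form N \<rho>N 2 \<xi>" "connection_form N \<rho>N 3 \<eta>"
    and curvN: "form_eq N (ext_d N 1 \<xi>) (pullback N B \<pi>N (- pullback B M fst \<omega>2))"
      "form_eq N (ext_d N 1 \<eta>) (pullback N B \<pi>N (- of_int A *\<^sub>R pullback B M fst \<omega>3))"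
      "form_eq N (ext_d N 1 \<alpha>) (pullback N B \<pi>N F)"
    and L: "principal_torus_bundle L B \<pi>L \<rho>L"
      "connection_form L \<rho>L 1 \<alpha>L" "connection_form L \<rho>L 2 \<xi>L"
    and curvL: "form_eq L (ext_d L 1 \<xi>L) (pullback L B \<pi>L (- pullback B M fst \<omega>2))"
      "form_eq L (ext_d L 1 \<alpha>L) (pullback L B \<pi>L F)"
    and q: "smooth_map N L q" "\<forall>p\<in>points N. \<pi>L (q p) = \<pi>N p"
      "\<forall>p\<in>points N. \<forall>t. q (\<rho>N t p) = \<rho>L (vector [t $ 1, t $ 2]) (q p)"
      "form_eq N \<alpha> (pullback N L q \<alpha>L)" "form_eq N \<xi> (pullback N L q \<xi>L)"
    and sL: "sL = (\<lambda>p. snd (\<pi>L p))" and uL: "uL = (\<lambda>p. u (sL p) (fst (\<pi>L p)))"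
    and W: "W1 = pullback L B \<pi>L (family_form M I \<omega>1)"
      "W2 = pullback L B \<pi>L (pullback B M fst \<omega>2)"
      "W3 = pullback L B \<pi>L (pullback B M fst \<omega>3)"
      "dsL = pullback L B \<pi>L ds"
    and \<phi>: "\<phi> = \<xi>L \<and>\<^bsub>1,2\<^esub> (W1 + (1 / of_int A) *\<^sub>R (dsL \<and>\<^bsub>1,1\<^esub> \<alpha>L))
               + (\<lambda>p. (sL p + c) / of_int A) \<cdot> (W2 \<and>\<^bsub>2,1\<^esub> \<alpha>L)
               + (\<lambda>p. uL p * (sL p + c) / (of_int A)\<^sup>2) \<cdot> (W3 \<and>\<^bsub>2,1\<^esub> dsL)"
    and sN: "sN = (\<lambda>p. snd (\<pi>N p))" and uN: "uN = (\<lambda>p. u (sN p) (fst (\<pi>N p)))"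
    and dsN: "dsN = pullback N B \<pi>N ds"
    and \<Phi>: "\<Phi> = \<eta> \<and>\<^bsub>1,3\<^esub> pullback N L q \<phi>
               + (\<lambda>p. sN p powr (4 / 3)) \<cdot> pullback N L q (g2_hodge L \<phi> 3 \<phi>)"
  shows "closed_g2_structure L \<phi> \<and> torsion_free_spin7_structure N \<Phi> \<and>
    (\<forall>p\<in>points N. \<forall>v\<in>tangent_space N p. \<forall>w\<in>tangent_space N p.
       spin7_metric (tangent_space N p) (\<Phi> p) v w =
         1 / (sN p)\<^sup>2 * (\<eta> p (\<lambda>_. v) * \<eta> p (\<lambda>_. w))
         + (of_int A)\<^sup>2 / (sN p + c)\<^sup>2 * (\<xi> p (\<lambda>_. v) * \<xi> p (\<lambda>_. w))
         + sN p * (sN p + c) / (of_int A * uN p) * (\<alpha> p (\<lambda>_. v) * \<alpha> p (\<lambda>_. w))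
         + sN p * (sN p + c) * uN p / (of_int A) ^ 3 * (dsN p (\<lambda>_. v) * dsN p (\<lambda>_. w))
         + sN p * (sN p + c) / of_int A *
             kaehler_metric (\<omega>1 (sN p)) (fst (\<pi>N p))
               (dmap B M fst (\<pi>N p) (dmap N B \<pi>N p v))
               (dmap B M fst (\<pi>N p) (dmap N B \<pi>N p w)))"
proof -
  have E: "surface_data M \<omega>2 \<omega>3 A c I \<omega>1 u B ds F"
    by unfold_locales (fact M form23 A I B kaehler u eq1 ds F)+
  \<comment> \<open>In the index type \<open>2\<close> the numeral 2 equals 0, and in
    \<open>3\<close> the numeral 3 does; the final branches take care of these indices.\<close>
  define \<theta>L :: "2 \<Rightarrow> ('l, real ^ 7, real) form" where "\<theta>L = (\<lambda>j. if j = 1 then \<alpha>L else \<xi>L)"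
  define \<theta>N :: "3 \<Rightarrow> ('n, real ^ 8, real) form" where "\<theta>N = (\<lambda>j. if j = 1 then \<alpha> else if j = 2 then \<xi> else \<eta>)"
  have \<theta>L: "\<theta>L 1 = \<alpha>L" "\<theta>L 2 = \<xi>L" by (simp_all add: \<theta>L_def)
  have \<theta>N: "\<theta>N 1 = \<alpha>" "\<theta>N 2 = \<xi>" "\<theta>N 3 = \<eta>" by (simp_all add: \<theta>N_def)
  interpret Lb: torus_bundle M \<omega>2 \<omega>3 A c I \<omega>1 u B ds F L \<pi>L \<rho>L \<theta>L 1 2
  proof (intro torus_bundle.intro[OF E] torus_bundle_axioms.intro)
    show "connection_form L \<rho>L j (\<theta>L j)" for j
      using L(2,3) exhaust_2[of j] \<theta>L by metis
  qed (simp_all only: \<theta>L L curvL)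
  interpret Nb: torus_bundle M \<omega>2 \<omega>3 A c I \<omega>1 u B ds F N \<pi>N \<rho>N \<theta>N 1 2
  proof (intro torus_bundle.intro[OF E] torus_bundle_axioms.intro)
    show "connection_form N \<rho>N j (\<theta>N j)" for j
      using N(2-4) exhaust_3[of j] \<theta>N by metis
  qed (simp_all only: \<theta>N N curvN)
  have j2: "j = 1 \<or> j = 2" for j :: 2 by (rule exhaust_2)
  have j3: "j = 1 \<or> j = 2 \<or> j = 3" for j :: 3 by (rule exhaust_3)
  have k: "CARD(2) = 2" "CARD(3) = 3" by simp_all
  have \<phi>': "\<phi> = Lb.phi"
    unfolding \<phi> Lb.phi_def W uL sL Lb.sP_def Lb.pr_def \<theta>L ..
  have \<Phi>': "\<Phi> p v = alt_wedge 1 3 (\<eta> p) (pullback N L q Lb.phi p) v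
      + Nb.sP p powr (4 / 3) * g2_hodge L Lb.phi 3 Lb.phi (q p) (\<lambda>i. dmap N L q p (v i))" for p v
    unfolding \<Phi> \<phi>' by (simp add: wedge_def fmult_def pullback_def sN Nb.sP_def)
  \<comment> \<open>Since \<open>q\<close> covers the identity of the base and pulls back alpha and
    xi, dq carries the coframe of L to that of N (\<open>FR\<close> below). Thus phi and its Hodge
    dual, although taken on L, are given by the fields \<open>PHI\<close> and \<open>PSI\<close> of
    N.\<close>
  have rep: "Nb.represents 4 \<Phi> (\<lambda>ch d x. Nb.XI ch 3 x * Nb.PHI ch d x + Nb.PSI ch d x)"
    unfolding Nb.represents_def map_upt_small
  proof (intro allI impI)
    fix y ch d and v :: "nat \<Rightarrow> ('n, real ^ 8) tangent"
    assume ch: "ch \<in> charts_at N y" and d: "d \<in> charts_at M (Nb.pr y)" and v: "\<forall>i. v i \<in> tangent_space N y"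
    have y: "y \<in> points N" using charts_at_points[OF ch] .
    have prs: "Lb.pr (q y) = Nb.pr y" "Lb.sP (q y) = Nb.sP y"
      using q(2) y by (simp_all add: Lb.pr_def Nb.pr_def Lb.sP_def Nb.sP_def)
    let ?cL = "some_chart L (q y)"
    have cL: "?cL \<in> charts_at L (q y)" by (rule some_chart[OF smooth_map_point[OF q(1) y]])
    have dL: "d \<in> charts_at M (Lb.pr (q y))" unfolding prs by (rule d)
    \<comment> \<open>Both points use the same chart \<open>d\<close> of M, so the coefficients of
      the two coframes that come from the base coincide.\<close>
    interpret np: chart_point M \<omega>2 \<omega>3 A c I \<omega>1 u B ds F N \<pi>N \<rho>N \<theta>N 1 2 y ch d
      by unfold_locales (rule ch, rule d)
    interpret lp: chart_point M \<omega>2 \<omega>3 A c I \<omega>1 u B ds F L \<pi>L \<rho>L \<theta>L 1 2 "q y" ?cL d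
      by unfold_locales (rule cL, rule dL)
    let ?V = "\<lambda>w. dmap N L q y w"
    have V: "?V w \<in> tangent_space L (q y)" if "w \<in> tangent_space N y" for w
      by (rule dmap_tangent[OF Nb.Ps Lb.Ps q(1) y that])
    have z: "lp.z0 = np.z0" by (simp only: lp.z0(1) np.z0(1) prs)
    have r: "lp.r0 = np.r0" by (simp only: lp.r0_def np.r0_def prs)
    have mu: "lp.mu = np.mu" by (simp only: lp.mu_def np.mu_def r prs)
    have nu: "lp.nu = np.nu" by (simp only: lp.nu_def np.nu_def r z)
    have th1: "Lb.th ?cL 1 lp.X0 (?V w ?cL) = Nb.th ch 1 np.X0 (w ch)"
      and th2: "Lb.th ?cL 2 lp.X0 (?V w ?cL) = Nb.th ch 2 np.X0 (w ch)" if w: "w \<in> tangent_space N y" for w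
    proof -
      have "\<alpha> y (\<lambda>_. w) = \<alpha>L (q y) (\<lambda>_. ?V w)" "\<xi> y (\<lambda>_. w) = \<xi>L (q y) (\<lambda>_. ?V w)"
        using q(4,5)[unfolded form_eq_def pullback_def, rule_format, OF y, of "\<lambda>_. w"] w by simp_all
      then show "Lb.th ?cL 1 lp.X0 (?V w ?cL) = Nb.th ch 1 np.X0 (w ch)" "Lb.th ?cL 2 lp.X0 (?V w ?cL) = Nb.th ch 2 np.X0 (w ch)"
        using Lb.theta_eval[OF cL V[OF w], of 1] Lb.theta_eval[OF cL V[OF w], of 2]
          Nb.theta_eval[OF ch w, of 1] Nb.theta_eval[OF ch w, of 2]
        unfolding \<theta>L \<theta>N lp.X0_def np.X0_def by simp_all
    qed
    \<comment> \<open>\<open>ZZ\<close> on L composed with \<open>q\<close> is \<open>ZZ\<close> on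
      N, as the projections are compatible; the chain rule then relates the derivatives.\<close>
    have DZ: "frechet_derivative (Lb.ZZ ?cL d) (at lp.X0) (?V w ?cL) = frechet_derivative (Nb.ZZ ch d) (at np.X0) (w ch)"
      if w: "w \<in> tangent_space N y" for w
    proof -
      let ?l = "lrep ch ?cL q" and ?O = "snd ch ` (fst ch \<inter> q -` fst ?cL)"
      have O: "open ?O" by (rule open_lrep_domain[OF Nb.Ps q(1) np.ch(2) open_chart[OF Lb.Ps lp.ch(2)]])
      have XO: "np.X0 \<in> ?O" unfolding np.X0_def using np.ch(3) lp.ch(3) by blast
      have l0: "?l np.X0 = lp.X0" by (simp add: np.inv_X0 lp.X0_def)
      have dl: "(?l has_derivative frechet_derivative ?l (at np.X0)) (at np.X0)"
        by (rule smooth_on_has_derivative[OF smooth_map_lrep[OF q(1) np.ch(2) lp.ch(2)] XO])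
      have dZ: "(Lb.ZZ ?cL d has_derivative frechet_derivative (Lb.ZZ ?cL d) (at lp.X0)) (at (?l np.X0))"
        unfolding l0 by (rule smooth_on_has_derivative[OF Lb.smooth_ZZ[OF lp.ch(2) lp.d(2)] lp.X0])
      have "(Nb.ZZ ch d has_derivative (frechet_derivative (Lb.ZZ ?cL d) (at lp.X0) \<circ> frechet_derivative ?l (at np.X0))) (at np.X0)"
      proof (rule has_derivative_transform_within_open[OF diff_chain_at[OF dl dZ] O XO])
        fix x assume "x \<in> ?O"
        then obtain y' where y': "x = snd ch y'" "y' \<in> fst ch" "q y' \<in> fst ?cL" by blast
        have "chart_inv ch x = y'" "chart_inv ?cL (snd ?cL (q y')) = q y'"
          unfolding y'(1) by (rule chart_inv_chart[OF Nb.Ps np.ch(2) y'(2)] chart_inv_chart[OF Lb.Ps lp.ch(2) y'(3)])+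
        moreover have "\<pi>L (q y') = \<pi>N y'" using q(2) Nb.in_points[OF np.ch(2) y'(2)] by blast
        ultimately show "(Lb.ZZ ?cL d \<circ> ?l) x = Nb.ZZ ch d x"
          by (simp add: Lb.ZZ_def Nb.ZZ_def Lb.SS_def Nb.SS_def Lb.pr_def Nb.pr_def Lb.sP_def Nb.sP_def)
      qed
      from frechet_derivative_eqI[OF this] show ?thesis
        using smooth_map_dmap[OF Nb.Ps q(1) ch cL w] by (simp only: np.X0_def o_apply)
    qed
    have g: "lp.gz (?V w ?cL) = np.gz (w ch)"
      and sg: "frechet_derivative (Lb.SS ?cL) (at lp.X0) (?V w ?cL) = frechet_derivative (Nb.SS ch) (at np.X0) (w ch)"
      if w: "w \<in> tangent_space N y" for w
      using DZ[OF w] unfolding Lb.ZZ_derivative[OF lp.ch(2) lp.d(2) lp.X0] Nb.ZZ_derivative[OF np.ch(2) np.d(2) np.X0] prod.inject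
      by blast+
    have FR: "lp.FR (\<lambda>_. 0) (?V w ?cL) = np.FR (\<lambda>_. 0) (w ch)" if w: "w \<in> tangent_space N y" for w
      by (rule vec_eq_8I; simp only: lp.FR_nth np.FR_nth g[OF w] sg[OF w] th1[OF w] th2[OF w] r mu nu z prs)
    have b: "pullback N L q Lb.phi y w = ev (Nb.PHI ch d np.X0) [w 0 ch, w 1 ch, w 2 ch]" if w: "\<forall>i. w i \<in> tangent_space N y" for w
    proof -
      have "\<forall>i. ?V (w i) \<in> tangent_space L (q y)" using V w by blast
      from Lb.phi_eval[OF cL dL this]
      \<comment> \<open>It is s phi that has the standard form, so the comparison runs through
        \<open>phi0\<close> with a factor s, cancelled at the end because s is positive.\<close>
      have "Nb.sP y * Lb.phi (q y) (\<lambda>i. ?V (w i)) = phi0 (\<lambda>i. lp.FR (\<lambda>_. 0) (?V (w i) ?cL))"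
        unfolding lp.phi0_FR lp.X0_def prs by simp
      also have "\<dots> = phi0 (\<lambda>i. np.FR (\<lambda>_. 0) (w i ch))"
        using FR w by simp
      also have "\<dots> = Nb.sP y * ev (Nb.PHI ch d np.X0) [w 0 ch, w 1 ch, w 2 ch]" by (rule np.phi0_FR)
      finally show ?thesis using np.positive(1) by (simp add: pullback_def)
    qed
    have "Nb.sP y powr (4 / 3) * g2_hodge L Lb.phi 3 Lb.phi (q y) (\<lambda>i. ?V (v i)) = psi0 (\<lambda>i. lp.FR (\<lambda>_. 0) (?V (v i) ?cL))"
      using lp.g2_hodge_FR[OF j2 k(1), of "\<lambda>i. ?V (v i)" "\<lambda>_. 0"] V v unfolding prs by blast
    also have "\<dots> = psi0 (\<lambda>i. np.FR (\<lambda>_. 0) (v i ch))" using FR v by simp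
    also have "\<dots> = ev (Nb.PSI ch d np.X0) [v 0 ch, v 1 ch, v 2 ch, v 3 ch]" by (rule np.psi0_FR)
    finally have star: "Nb.sP y powr (4 / 3) * g2_hodge L Lb.phi 3 Lb.phi (q y) (\<lambda>i. ?V (v i))
      = ev (Nb.PSI ch d np.X0) [v 0 ch, v 1 ch, v 2 ch, v 3 ch]" .
    have e: "\<eta> y w = Nb.th ch 3 np.X0 (w 0 ch)" if "\<forall>i. w i \<in> tangent_space N y" for w
      using Nb.theta_eval[OF ch, of w 3] that unfolding \<theta>N np.X0_def by blast
    have sk: "skew (Nb.PHI ch d np.X0)"
      unfolding Nb.PHI_def by (intro skew_linear skew_mult Nb.skew_W)
    have "alt_wedge 1 3 (\<eta> y) (pullback N L q Lb.phi y) v = ev (one (Nb.th ch 3 np.X0) * Nb.PHI ch d np.X0) [v 0 ch, v 1 ch, v 2 ch, v 3 ch]"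
      unfolding ev_one_mult_4
      by (rule alt_wedge_1_3[where T = "tangent_space N y" and a = "\<eta> y" and b = "pullback N L q Lb.phi y"
            and f = "\<lambda>v. Nb.th ch 3 np.X0 (v ch)" and g = "\<lambda>x y z. ev (Nb.PHI ch d np.X0) [x ch, y ch, z ch]",
            OF e b skew3(1)[OF sk] skew3(2)[OF sk] v])
    then show "\<Phi> y v = ev (Nb.XI ch 3 (snd ch y) * Nb.PHI ch d (snd ch y) + Nb.PSI ch d (snd ch y)) [v 0 ch, v 1 ch, v 2 ch, v 3 ch]"
      unfolding \<Phi>' star Nb.XI_def ev_simps np.X0_def by simp
  qed
  \<comment> \<open>This too covers sequences outside the tangent spaces, for the first clause of
    \<open>alternating_form\<close>.\<close>
  have cong: "\<Phi> p v = \<Phi> p v'" if p: "p \<in> points N" and eq: "\<forall>i<4. v i = v' i" for p v v'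
  proof -
    have "alt_wedge 1 3 (\<eta> p) (pullback N L q Lb.phi p) v = alt_wedge 1 3 (\<eta> p) (pullback N L q Lb.phi p) v'"
    proof (rule alt_wedge_cong)
      show "\<eta> p w = \<eta> p w'" if "\<forall>i<1. w i = w' i" for w w'
        using Nb.theta_1[OF p, of w w' 3] that by (simp add: \<theta>N)
      show "pullback N L q Lb.phi p w = pullback N L q Lb.phi p w'" if "\<forall>i<3. w i = w' i" for w w'
        unfolding pullback_def by (rule Lb.phi_cong[OF smooth_map_point[OF q(1) p]]) (use that in simp)
    qed (use eq in simp)
    moreover have "g2_hodge L Lb.phi 3 Lb.phi (q p) (\<lambda>i. dmap N L q p (v i)) = g2_hodge L Lb.phi 3 Lb.phi (q p) (\<lambda>i. dmap N L q p (v' i))"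
      unfolding g2_hodge_def by (rule g2_star_cong) (use eq in simp)
    ultimately show ?thesis unfolding \<Phi>' by simp
  qed
  have "closed_g2_structure L \<phi>"
    unfolding \<phi>' by (rule Lb.closed_g2_phi[OF j2 k(1)])
  moreover have "torsion_free_spin7_structure N \<Phi>"
    by (rule Nb.torsion_free_Phi[OF j3 k(2) rep _ cong]) (unfold \<theta>N, fact curvN(2))
  moreover have "spin7_metric (tangent_space N p) (\<Phi> p) v w =
         1 / (sN p)\<^sup>2 * (\<eta> p (\<lambda>_. v) * \<eta> p (\<lambda>_. w))
         + (of_int A)\<^sup>2 / (sN p + c)\<^sup>2 * (\<xi> p (\<lambda>_. v) * \<xi> p (\<lambda>_. w))
         + sN p * (sN p + c) / (of_int A * uN p) * (\<alpha> p (\<lambda>_. v) * \<alpha> p (\<lambda>_. w))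
         + sN p * (sN p + c) * uN p / (of_int A) ^ 3 * (dsN p (\<lambda>_. v) * dsN p (\<lambda>_. w))
         + sN p * (sN p + c) / of_int A *
             kaehler_metric (\<omega>1 (sN p)) (fst (\<pi>N p))
               (dmap B M fst (\<pi>N p) (dmap N B \<pi>N p v))
               (dmap B M fst (\<pi>N p) (dmap N B \<pi>N p w))"
    if p: "p \<in> points N" and v: "v \<in> tangent_space N p" "w \<in> tangent_space N p" for p v w
    using Nb.spin7_metric_Phi[OF j3 k(2) rep p v]
    unfolding Nb.dmap_pr[OF p v(1)] Nb.dmap_pr[OF p v(2)] \<theta>N uN sN dsN Nb.sP_def Nb.pr_def .
  ultimately show ?thesis by blast
qed

end
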